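(* Let $r\ge 2$ be an integer and let $J$ satisfy $J_{uniq}(r)<J<J_{rec}(r)$, where $J_{uniq}(r)=\operatorname{arctanh}\frac1{2r-1}$ and $J_{rec}(r)=\operatorname{arctanh}\frac{1}{\sqrt{2r-1}}$. Consider the Ising model on $\mathbb{F}_r$ with interaction strength $J$ and zero external field. Then there is a sequence of sets of homomorphisms $S_n\subset\operatorname{Hom}(\mathbb{F}_r,\operatorname{Sym}(n))$, $n\ge1$, with $\mathbb{P}(S_n)\to1$ as $n\to\infty$ (with respect to the uniform distribution on $\operatorname{Hom}(\mathbb{F}_r,\operatorname{Sym}(n))$), such that if $\Sigma=\{\sigma_n\}_{n=1}^\infty$ is a sequence of maps with $\sigma_n\in S_{m_n}$ for some $m_n\to\infty$, then 1. $\Sigma$ is a sofic approximation to $\mathbb{F}_r$; 2. $\mathrm{p}_\Sigma(\mu^{\mathrm{FB}})=\mathrm{p}_{\mathrm{f}}(\mu^{\mathrm{FB}})<\mathrm{p}_{\mathrm{f}}(\mu^+)=\mathrm{p}_\Sigma(\mu^+)$. In particular, the free boundary state $\mu^{\mathrm{FB}}$ has finite $\Sigma$-entropy $\mathrm{h}_\Sigma(\mu^{\mathrm{FB}})>-\infty$ but is not $\Sigma$-equilibrium.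
   Context: Let $\mathbb{F}_r=\langle s_1,\dots,s_r\rangle$ be the free group of rank $r$; its Cayley graph (edges $\{\gamma,s_i\gamma\}$) is the $2r$-regular tree. $\mathbb{F}_r$ acts on $\{-1,+1\}^{\mathbb{F}_r}$ by the shift $(g\cdot \mathbf{x})(h)=\mathbf{x}(hg)$. Ising model with interaction strength $J>0$ and no external field: $u(\mathbf{x})=-\frac{J}{2}\sum_{i=1}^r\big(\mathbf{x}(e)\mathbf{x}(s_i)+\mathbf{x}(e)\mathbf{x}(s_i^{-1})\big)$, and $u(\mu)=\int u\,d\mu$. Low temperature means large $J$. For $t\in\mathbb{R}$ let $\alpha(t)=\frac{e^{-2J}+e^{-2t}}{2e^{-2J}+2\cosh(2t)}$ and $\beta(t)=\frac{1}{e^{2(J+t)}+1}$. Let $\mu_t$ be the tree-indexed Markov chain on $\{-1,+1\}^{\mathbb{F}_r}$, invariant under all automorphisms of the Cayley tree, with single-site marginal $\mathbb{P}\{-1\}=\alpha(t)$, $\mathbb{P}\{+1\}=1-\alpha(t)$, and with transition probabilities across each edge $\mathbb{P}\{-1\to+1\}=\beta(-t)$, $\mathbb{P}\{-1\to-1\}=1-\beta(-t)$, $\mathbb{P}\{+1\to-1\}=\beta(t)$, $\mathbb{P}\{+1\to+1\}=1-\beta(t)$. The free boundary state is $\mu^{\mathrm{FB}}=\mu_0$. For $J>J_{uniq}(r)$ the equation $t=\frac{2r-1}{2}\log\frac{\cosh(t+J)}{\cosh(t-J)}$ has exactly three solutions $0$, $t_+>0$ and $t_-=-t_+$; the plus state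 is $\mu^+=\mu_{t_+}$. For a finite set $V$, a map $\sigma:\mathbb{F}_r\to\operatorname{Sym}(V)$ and $\mathbf{x}\in\{-1,+1\}^V$, let $\Pi_v^\sigma\mathbf{x}(\gamma)=\mathbf{x}(\sigma(\gamma)(v))$ and $P^\sigma_{\mathbf{x}}=\frac1{|V|}\sum_{v\in V}\delta_{\Pi_v^\sigma\mathbf{x}}$. For a set $\mathcal{O}$ of Borel probability measures on $\{-1,+1\}^{\mathbb{F}_r}$ let $\Omega(\sigma,\mathcal{O})=\{\mathbf{x}: P^\sigma_{\mathbf{x}}\in\mathcal{O}\}$. For finite $F\subset\mathbb{F}_r$ and $\delta>0$, $\sigma$ is $(F,\delta)$-sofic if $\frac1{|V|}|\{v:\sigma(\gamma)(v)\ne v\ \forall\gamma\in F\setminus\{e\}\}|>1-\delta$ and $\frac1{|V|}|\{v:\sigma(\gamma_1\gamma_2)(v)=\sigma(\gamma_1)(\sigma(\gamma_2)(v))\ \forall\gamma_1,\gamma_2\in F\}|>1-\delta$. A sequence $\Sigma=\{\sigma_n:\mathbb{F}_r\to\operatorname{Sym}(V_n)\}$ is a sofic approximation if $|V_n|\to\infty$ and for all $F,\delta$ the map $\sigma_n$ is $(F,\delta)$-sofic for all large $n$. Sofic entropy: $\mathrm{h}_\Sigma(\mu)=\inf_{\mathcal{O}\ni\mu}\limsup_{n\to\infty}\frac1{|V_n|}\log|\Omega(\sigma_n,\mathcal{O})|$, and $\mathrm{f}$-entropy: $\mathrm{f}(\mu)=\mathrm{h}_{\mathrm{f}}(\mu)=\inf_{\mathcal{O}\ni\mu}\limsup_{n\to\infty}\frac1n\log\mathbb{E}|\Omega(\sigma_n,\mathcal{O})|$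 with $\sigma_n$ uniformly random in $\operatorname{Hom}(\mathbb{F}_r,\operatorname{Sym}(n))$; $\mathcal{O}$ ranges over weak*-open neighborhoods of $\mu$. Pressures: $\mathrm{p}_\Sigma(\mu)=\mathrm{h}_\Sigma(\mu)-u(\mu)$ and $\mathrm{p}_{\mathrm{f}}(\mu)=\mathrm{f}(\mu)-u(\mu)$. A shift-invariant $\mu$ is $\Sigma$-equilibrium if it maximizes $\mathrm{p}_\Sigma$ over all shift-invariant Borel probability measures on $\{-1,+1\}^{\mathbb{F}_r}$. *)

theory Defs
  imports "HOL-Probability.Probability" "HOL-Algebra.Sym_Groups"
begin

section \<open>The free group\<close>

text \<open>
  A letter \<^term>\<open>(i, True)\<close> stands for the generator \<open>s\<^sub>i\<close> and \<^term>\<open>(i, False)\<close> for its inverse.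
  The free group on \<open>'a\<close> is the set of reduced words with concatenation followed by reduction.
  Its rank is the cardinality of \<open>'a\<close>. Making it a type lets configurations be total functions,
  which then carry the library's product topology and Borel \<open>\<sigma>\<close>-algebra.
\<close>

type_synonym 'a letter = "'a \<times> bool"

definition flip :: "'a letter \<Rightarrow> 'a letter" where
  "flip a = (fst a, \<not> snd a)"

definition reduced :: "'a letter list \<Rightarrow> bool" where
  "reduced w \<longleftrightarrow> successively (\<lambda>a b. b \<noteq> flip a) w"

typedef 'a fgroup = "{w :: 'a letter list. reduced w}"
  by (rule exI[of _ "[]"]) (simp add: reduced_def)

setup_lifting type_definition_fgroup

definition push :: "'a letter \<Rightarrow> 'a letter list \<Rightarrow> 'a letter list" where
  "push a w = (if w \<noteq> [] \<and> hd w = flip a then tl w else a # w)"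

lemma flip_flip [simp]: "flip (flip a) = a"
  by (simp add: flip_def)

lemma flip_neq [simp]: "flip a \<noteq> a" "a \<noteq> flip a"
  by (auto simp: flip_def prod_eq_iff)

lemma reduced_Nil [simp]: "reduced []"
  by (simp add: reduced_def)

lemma reduced_Cons: "reduced (a # w) \<longleftrightarrow> (w = [] \<or> hd w \<noteq> flip a) \<and> reduced w"
  by (auto simp: reduced_def successively_Cons)

lemma reduced_push: "reduced w \<Longrightarrow> reduced (push a w)"
  by (cases w) (auto simp: push_def reduced_Cons)

lemma push_flip: "reduced w \<Longrightarrow> push a (push (flip a) w) = w"
  by (cases w) (auto simp: push_def reduced_Cons)

lemma push_flip': "reduced w \<Longrightarrow> push (flip a) (push a w) = w"
  using push_flip[of w "flip a"] by simp

lemma reduced_foldr_push: "reduced w \<Longrightarrow> reduced (foldr push v w)"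
  by (induction v) (auto intro: reduced_push)

lemma foldr_push_push:
  assumes "reduced w"
  shows "foldr push (push a v) w = push a (foldr push v w)"
proof (cases v)
  case Nil
  then show ?thesis by (simp add: push_def)
next
  case (Cons b v')
  then show ?thesis
    using assms push_flip[OF reduced_foldr_push[OF assms], of a v'] by (auto simp: push_def)
qed

lemma foldr_push_assoc:
  "reduced w \<Longrightarrow> foldr push (foldr push u v) w = foldr push u (foldr push v w)"
  by (induction u) (auto simp: foldr_push_push)

lemma foldr_push_Nil: "reduced v \<Longrightarrow> foldr push v [] = v"
  by (induction v) (auto simp: push_def reduced_Cons)

lemma foldr_push_inverse:
  "reduced w \<Longrightarrow> foldr push (rev (map flip v)) (foldr push v w) = w"
  by (induction v arbitrary: w) (auto simp: push_flip' reduced_foldr_push)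

lift_definition fg_mult :: "'a fgroup \<Rightarrow> 'a fgroup \<Rightarrow> 'a fgroup" is "\<lambda>v w. foldr push v w"
  by (rule reduced_foldr_push)

lift_definition fg_one :: "'a fgroup" is "[]"
  by simp

lift_definition fg_gen :: "'a \<Rightarrow> 'a fgroup" is "\<lambda>i. [(i, True)]"
  by (simp add: reduced_Cons)

definition FG :: "'a fgroup monoid" where
  "FG = \<lparr>carrier = UNIV, mult = fg_mult, one = fg_one\<rparr>"

lemma group_FG: "group (FG :: 'a fgroup monoid)"
proof (rule groupI)
  fix g h k :: "'a fgroup"
  show "(g \<otimes>\<^bsub>FG\<^esub> h) \<otimes>\<^bsub>FG\<^esub> k = g \<otimes>\<^bsub>FG\<^esub> (h \<otimes>\<^bsub>FG\<^esub> k)"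
    unfolding FG_def by simp (transfer, simp add: foldr_push_assoc)
  show "\<one>\<^bsub>FG\<^esub> \<otimes>\<^bsub>FG\<^esub> g = g"
    unfolding FG_def by simp (transfer, simp)
  have "\<exists>h. fg_mult h g = fg_one"
  proof transfer
    fix w :: "'a letter list"
    assume w: "reduced w"
    let ?v = "foldr push (rev (map flip w)) []"
    have "foldr push ?v w = foldr push (rev (map flip w)) (foldr push w [])"
      using w by (simp add: foldr_push_assoc foldr_push_Nil)
    also have "\<dots> = []"
      by (rule foldr_push_inverse) simp
    finally show "\<exists>h\<in>Collect reduced. foldr push h w = []"
      by (intro bexI[of _ ?v]) (simp_all add: reduced_foldr_push)
  qed
  then show "\<exists>h\<in>carrier FG. h \<otimes>\<^bsub>FG\<^esub> g = \<one>\<^bsub>FG\<^esub>"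
    by (simp add: FG_def)
qed (simp_all add: FG_def)

instance fgroup :: (countable) countable
  by (rule countable_classI[of "\<lambda>g. to_nat (Rep_fgroup g)"]) (simp add: Rep_fgroup_inject)

section \<open>Configurations\<close>

datatype spin = Minus | Plus

primrec val :: "spin \<Rightarrow> real" where
  "val Minus = -1"
| "val Plus = 1"

instance spin :: finite
proof
  have "(UNIV :: spin set) = {Minus, Plus}"
    using spin.exhaust by blast
  then show "finite (UNIV :: spin set)"
    by (metis finite.simps)
qed

instantiation spin :: discrete_topology
begin
definition open_spin :: "spin set \<Rightarrow> bool" where "open_spin A = True"
instance
  by standard (simp_all add: open_spin_def)
end

instance spin :: second_countable_topology
proof
  show "\<exists>B::spin set set. countable B \<and> open = generate_topology B"
    by (rule exI[of _ UNIV])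
       (auto simp: open_spin_def fun_eq_iff intro: generate_topology.Basis)
qed

type_synonym 'a config = "'a fgroup \<Rightarrow> spin"

definition shift :: "'a fgroup \<Rightarrow> 'a config \<Rightarrow> 'a config" where
  "shift g x = (\<lambda>h. x (h \<otimes>\<^bsub>FG\<^esub> g))"

definition borel_prob :: "'x::topological_space measure set" where
  "borel_prob = {\<mu>. prob_space \<mu> \<and> sets \<mu> = sets borel}"

definition shift_invariant :: "'a config measure \<Rightarrow> bool" where
  "shift_invariant \<mu> \<longleftrightarrow> (\<forall>g. distr \<mu> borel (shift g) = \<mu>)"

text \<open>
  The test functions are all continuous real functions. This is the usual weak* topology only over
  a compact space, such as the space of configurations, where these are bounded.
\<close>

definition weak_star :: "'x::topological_space measure topology" where
  "weak_star = topology_generated_by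
     {{\<mu> \<in> borel_prob. (\<integral>x. f x \<partial>\<mu>) \<in> U} | (f :: 'x \<Rightarrow> real) U.
        continuous_on UNIV f \<and> open U}"

section \<open>Sofic approximations\<close>

definition sofic_map :: "'v set \<Rightarrow> ('a fgroup \<Rightarrow> 'v \<Rightarrow> 'v) \<Rightarrow> 'a fgroup set \<Rightarrow> real \<Rightarrow> bool" where
  "sofic_map V \<sigma> F \<delta> \<longleftrightarrow>
     real (card {v \<in> V. \<forall>\<gamma>\<in>F - {\<one>\<^bsub>FG\<^esub>}. \<sigma> \<gamma> v \<noteq> v}) / real (card V) > 1 - \<delta> \<and>
     real (card {v \<in> V. \<forall>\<gamma>\<^sub>1\<in>F. \<forall>\<gamma>\<^sub>2\<in>F. \<sigma> (\<gamma>\<^sub>1 \<otimes>\<^bsub>FG\<^esub> \<gamma>\<^sub>2) v = \<sigma> \<gamma>\<^sub>1 (\<sigma> \<gamma>\<^sub>2 v)}) / real (card V) > 1 - \<delta>"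

definition sofic_approximation ::
    "(nat \<Rightarrow> 'v set) \<Rightarrow> (nat \<Rightarrow> 'a fgroup \<Rightarrow> 'v \<Rightarrow> 'v) \<Rightarrow> bool" where
  "sofic_approximation V \<sigma> \<longleftrightarrow>
     (\<forall>n. finite (V n) \<and> (\<forall>\<gamma>. \<sigma> n \<gamma> permutes V n)) \<and>
     filterlim (\<lambda>n. card (V n)) at_top sequentially \<and>
     (\<forall>F \<delta>. finite F \<and> \<delta> > 0 \<longrightarrow> (\<forall>\<^sub>F n in sequentially. sofic_map (V n) (\<sigma> n) F \<delta>))"

section \<open>Entropies and pressures\<close>

definition pullback :: "('a fgroup \<Rightarrow> 'v \<Rightarrow> 'v) \<Rightarrow> ('v \<Rightarrow> spin) \<Rightarrow> 'v \<Rightarrow> 'a config" where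
  "pullback \<sigma> x v = (\<lambda>\<gamma>. x (\<sigma> \<gamma> v))"

text \<open>
  The average of the point masses at \<^term>\<open>pullback \<sigma> x v\<close>, \<^term>\<open>v \<in> V\<close>, as the image of the uniform
  distribution on \<open>V\<close>.
\<close>

definition empirical ::
    "'v set \<Rightarrow> ('a fgroup \<Rightarrow> 'v \<Rightarrow> 'v) \<Rightarrow> ('v \<Rightarrow> spin) \<Rightarrow> 'a config measure" where
  "empirical V \<sigma> x = distr (uniform_count_measure V) borel (pullback \<sigma> x)"

definition microstates ::
    "'v set \<Rightarrow> ('a fgroup \<Rightarrow> 'v \<Rightarrow> 'v) \<Rightarrow> 'a config measure set \<Rightarrow> ('v \<Rightarrow> spin) set" where
  "microstates V \<sigma> \<O> = {x \<in> V \<rightarrow>\<^sub>E UNIV. empirical V \<sigma> x \<in> \<O>}"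

definition elog :: "real \<Rightarrow> ereal" where
  "elog a = (if a = 0 then -\<infinity> else ereal (ln a))"

definition sofic_entropy ::
    "(nat \<Rightarrow> 'v set) \<Rightarrow> (nat \<Rightarrow> 'a fgroup \<Rightarrow> 'v \<Rightarrow> 'v) \<Rightarrow> 'a config measure \<Rightarrow> ereal" where
  "sofic_entropy V \<sigma> \<mu> = (INF \<O>\<in>{\<O>. openin weak_star \<O> \<and> \<mu> \<in> \<O>}.
     limsup (\<lambda>n. ereal (1 / real (card (V n))) * elog (real (card (microstates (V n) (\<sigma> n) \<O>)))))"

definition uniform_hom :: "nat \<Rightarrow> ('a fgroup \<Rightarrow> nat \<Rightarrow> nat) pmf" where
  "uniform_hom n = pmf_of_set (hom FG (sym_group n))"

definition f_entropy :: "'a config measure \<Rightarrow> ereal" where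
  "f_entropy \<mu> = (INF \<O>\<in>{\<O>. openin weak_star \<O> \<and> \<mu> \<in> \<O>}.
     limsup (\<lambda>n. ereal (1 / real n) *
       elog (measure_pmf.expectation (uniform_hom n) (\<lambda>\<sigma>. real (card (microstates {1..n} \<sigma> \<O>))))))"

definition site_energy :: "real \<Rightarrow> 'a::finite config \<Rightarrow> real" where
  "site_energy J x = - (J / 2) * (\<Sum>i\<in>UNIV.
     val (x \<one>\<^bsub>FG\<^esub>) * val (x (fg_gen i)) + val (x \<one>\<^bsub>FG\<^esub>) * val (x (inv\<^bsub>FG\<^esub> (fg_gen i))))"

definition energy :: "real \<Rightarrow> 'a::finite config measure \<Rightarrow> real" where
  "energy J \<mu> = (\<integral>x. site_energy J x \<partial>\<mu>)"

definition sofic_pressure ::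
    "(nat \<Rightarrow> 'v set) \<Rightarrow> (nat \<Rightarrow> 'a::finite fgroup \<Rightarrow> 'v \<Rightarrow> 'v) \<Rightarrow> real \<Rightarrow> 'a config measure \<Rightarrow> ereal"
  where "sofic_pressure V \<sigma> J \<mu> = sofic_entropy V \<sigma> \<mu> - ereal (energy J \<mu>)"

definition f_pressure :: "real \<Rightarrow> 'a::finite config measure \<Rightarrow> ereal" where
  "f_pressure J \<mu> = f_entropy \<mu> - ereal (energy J \<mu>)"

definition sofic_equilibrium ::
    "(nat \<Rightarrow> 'v set) \<Rightarrow> (nat \<Rightarrow> 'a::finite fgroup \<Rightarrow> 'v \<Rightarrow> 'v) \<Rightarrow> real \<Rightarrow> 'a config measure \<Rightarrow> bool"
  where "sofic_equilibrium V \<sigma> J \<mu> \<longleftrightarrow>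
     \<mu> \<in> borel_prob \<and> shift_invariant \<mu> \<and>
     (\<forall>\<nu>\<in>borel_prob. shift_invariant \<nu> \<longrightarrow> sofic_pressure V \<sigma> J \<nu> \<le> sofic_pressure V \<sigma> J \<mu>)"

section \<open>Tree-indexed Markov chains and the Ising states\<close>

definition cayley_edge :: "'a fgroup \<Rightarrow> 'a fgroup \<Rightarrow> bool" where
  "cayley_edge g h \<longleftrightarrow> (\<exists>i. h = fg_gen i \<otimes>\<^bsub>FG\<^esub> g \<or> g = fg_gen i \<otimes>\<^bsub>FG\<^esub> h)"

definition tree_automorphism :: "('a fgroup \<Rightarrow> 'a fgroup) \<Rightarrow> bool" where
  "tree_automorphism \<phi> \<longleftrightarrow>
     bij \<phi> \<and> (\<forall>g h. cayley_edge (\<phi> g) (\<phi> h) \<longleftrightarrow> cayley_edge g h)"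

text \<open>The component of \<open>g\<close> in the tree after the edge between \<open>g\<close> and \<open>h\<close> has been deleted.\<close>

definition past :: "'a fgroup \<Rightarrow> 'a fgroup \<Rightarrow> 'a fgroup set" where
  "past g h = {k. (g, k) \<in> {(a, b). cayley_edge a b \<and> {a, b} \<noteq> {g, h}}\<^sup>*}"

text \<open>
  The last condition is the Markov property: given the spins on any finite part \<open>F\<close> of the past of an
  edge from \<open>g\<close> to \<open>h\<close> with \<^term>\<open>g \<in> F\<close>, the spin at \<open>h\<close> has law \<^term>\<open>P (\<eta> g)\<close>. It is multiplied
  out so that conditioning events of probability zero are allowed.
\<close>

definition tree_markov_chain ::
    "(spin \<Rightarrow> real) \<Rightarrow> (spin \<Rightarrow> spin \<Rightarrow> real) \<Rightarrow> 'a config measure \<Rightarrow> bool" where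
  "tree_markov_chain \<pi> P \<mu> \<longleftrightarrow>
     \<mu> \<in> borel_prob \<and>
     (\<forall>g a. measure \<mu> {x. x g = a} = \<pi> a) \<and>
     (\<forall>g h F \<eta> b. cayley_edge g h \<and> finite F \<and> g \<in> F \<and> F \<subseteq> past g h \<longrightarrow>
        measure \<mu> {x. (\<forall>k\<in>F. x k = \<eta> k) \<and> x h = b} =
        measure \<mu> {x. \<forall>k\<in>F. x k = \<eta> k} * P (\<eta> g) b)"

definition ising_alpha :: "real \<Rightarrow> real \<Rightarrow> real" where
  "ising_alpha J t = (exp (-2 * J) + exp (-2 * t)) / (2 * exp (-2 * J) + 2 * cosh (2 * t))"

definition ising_beta :: "real \<Rightarrow> real \<Rightarrow> real" where
  "ising_beta J t = 1 / (exp (2 * (J + t)) + 1)"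

primrec ising_marginal :: "real \<Rightarrow> real \<Rightarrow> spin \<Rightarrow> real" where
  "ising_marginal J t Minus = ising_alpha J t"
| "ising_marginal J t Plus = 1 - ising_alpha J t"

fun ising_transition :: "real \<Rightarrow> real \<Rightarrow> spin \<Rightarrow> spin \<Rightarrow> real" where
  "ising_transition J t Minus Plus = ising_beta J (- t)"
| "ising_transition J t Minus Minus = 1 - ising_beta J (- t)"
| "ising_transition J t Plus Minus = ising_beta J t"
| "ising_transition J t Plus Plus = 1 - ising_beta J t"

definition ising_chain :: "real \<Rightarrow> real \<Rightarrow> 'a config measure" where
  "ising_chain J t = (THE \<mu>.
     tree_markov_chain (ising_marginal J t) (ising_transition J t) \<mu> \<and>
     (\<forall>\<phi>. tree_automorphism \<phi> \<longrightarrow> distr \<mu> borel (\<lambda>x. x \<circ> \<phi>) = \<mu>))"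

definition J_uniq :: "nat \<Rightarrow> real" where
  "J_uniq r = artanh (1 / (2 * real r - 1))"

definition J_rec :: "nat \<Rightarrow> real" where
  "J_rec r = artanh (1 / sqrt (2 * real r - 1))"

text \<open>The positive solution is unique for \<open>r \<ge> 2\<close> and \<^term>\<open>J > J_uniq r\<close>.\<close>

definition t_plus :: "nat \<Rightarrow> real \<Rightarrow> real" where
  "t_plus r J = (THE t. t > 0 \<and>
     t = (2 * real r - 1) / 2 * ln (cosh (t + J) / cosh (t - J)))"

definition free_boundary_state :: "real \<Rightarrow> 'a config measure" where
  "free_boundary_state J = ising_chain J 0"

definition plus_state :: "real \<Rightarrow> 'a::finite config measure" where
  "plus_state J = ising_chain J (t_plus CARD('a) J)"

end

theory Submission
  imports Defs "HOL-Combinatorics.Multiset_Permutations" "HOL-Real_Asymp.Real_Asymp"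
begin

text \<open>
  The expected number of labellings with a prescribed edge type over a random homomorphism is explicit. At the
  edge law of an Ising chain its exponential rate is the f-entropy, and rate plus interaction energy is the
  Bethe functional, which has its strict maximum at the plus state. Markov's inequality yields the upper bounds
  for typical homomorphisms; the lower bounds need the second moment, a count of pairs of labellings. For the
  plus state the quadratic form of a pair is the tensor square of that of a single labelling, whose norm is
  multiplicative. For the free boundary state the pairs have uniform marginals, only their overlap is
  free, and independence dominates as long as \<open>(2 r - 1) (tanh J)\<^sup>2 \<le> 1\<close>, the reconstruction bound.
  Switchings show that in the model conditioned on a given labelling the local statistics are those of the chain.
  Finally, a concentration inequality for the logarithm of a soft count of good labellings upgrades the
  exponentially small probability given by the second moment to a probability close to 1.
\<close>

text \<open>Every count is sharp only up to factors subexponential in \<open>n\<close>. The second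
  moment therefore shows that many good labellings exist with probability at least
  \<open>exp (-\<epsilon> n)\<close> for each \<open>\<epsilon> > 0\<close>, and no better.
  Concentration fails with probability \<open>exp (-\<gamma> n)\<close> for a fixed
  \<open>\<gamma>\<close>, and that difference carries the argument. The two states need different
  second moments because the bound through the quadratic form takes a supremum over all boundary
  fields. It is sharp at the plus state, where \<open>bethe\<close> is maximal, but too large at the
  free state. There the balance of the two spins is kept as a constraint, and one parameter remains,
  the overlap of the pair. Labellings are counted with exact edge types rather than types in a
  window. All counted labellings then carry the same interaction weight, so this weight can be
  inserted into a count and divided out again. An upper bound may use a neighbourhood that sees
  edges only. A lower bound has to serve every neighbourhood, which is why local statistics of
  larger balls are needed there, and why the sets of good tuples are glued by a diagonal
  argument.\<close>

declare One_nat_def [simp del]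

section \<open>Homomorphisms as tuples of permutations\<close>

type_synonym 'a perms = "'a \<Rightarrow> nat \<Rightarrow> nat"

definition perm_tuples :: "nat \<Rightarrow> 'a perms set" where
  "perm_tuples n = {p. \<forall>i. p i permutes {1..n}}"

fun letter_perm :: "'a perms \<Rightarrow> 'a letter \<Rightarrow> nat \<Rightarrow> nat" where
  "letter_perm p (i, True) = p i"
| "letter_perm p (i, False) = inv_into UNIV (p i)"

primrec word_perm :: "'a perms \<Rightarrow> 'a letter list \<Rightarrow> nat \<Rightarrow> nat" where
  "word_perm p [] = id"
| "word_perm p (a # w) = letter_perm p a \<circ> word_perm p w"

definition tuple_hom :: "'a perms \<Rightarrow> 'a fgroup \<Rightarrow> nat \<Rightarrow> nat" where
  "tuple_hom p g = word_perm p (Rep_fgroup g)"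

lemma letter_perm_permutes: "p \<in> perm_tuples n \<Longrightarrow> letter_perm p a permutes {1..n}"
  by (cases a; cases "snd a") (auto simp: perm_tuples_def intro: permutes_inv)

lemma word_perm_permutes: "p \<in> perm_tuples n \<Longrightarrow> word_perm p w permutes {1..n}"
  by (induction w)
     (auto simp del: letter_perm.simps simp: permutes_id intro!: permutes_compose letter_perm_permutes)

lemma letter_perm_flip: "p \<in> perm_tuples n \<Longrightarrow> letter_perm p (flip a) \<circ> letter_perm p a = id"
proof (cases a)
  case (Pair i b)
  assume "p \<in> perm_tuples n"
  then have "p i permutes {1..n}" by (auto simp: perm_tuples_def)
  then show ?thesis using Pair
    by (cases b) (auto simp: flip_def permutes_inv_o)
qed

text \<open>Cancellation in \<open>push\<close> is matched by \<open>letter_perm_flip\<close>, so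
  words may be reduced before or after they act. This is what makes \<open>tuple_hom\<close> a
  homomorphism.\<close>

lemma word_perm_push:
  assumes "p \<in> perm_tuples n"
  shows "word_perm p (push a w) = letter_perm p a \<circ> word_perm p w"
proof (cases "w \<noteq> [] \<and> hd w = flip a")
  case True
  then obtain w' where w: "w = flip a # w'" by (cases w) auto
  have "letter_perm p a \<circ> (letter_perm p (flip a) \<circ> word_perm p w') = word_perm p w'"
    using letter_perm_flip[OF assms, of "flip a"] by (simp add: o_assoc)
  then show ?thesis using w by (simp add: push_def)
qed (auto simp: push_def)

lemma word_perm_foldr_push:
  assumes "p \<in> perm_tuples n"
  shows "word_perm p (foldr push v w) = word_perm p v \<circ> word_perm p w"
  by (induction v) (auto simp: word_perm_push[OF assms] o_assoc)

lemma tuple_hom_in_hom: "p \<in> perm_tuples n \<Longrightarrow> tuple_hom p \<in> hom FG (sym_group n)"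
  unfolding hom_def tuple_hom_def FG_def sym_group_def
  by (auto simp: word_perm_permutes fg_mult.rep_eq word_perm_foldr_push)

lemma tuple_hom_gen: "tuple_hom p (fg_gen i) = p i"
  by (simp add: tuple_hom_def fg_gen.rep_eq)

lemma inj_tuple_hom: "inj tuple_hom"
proof (rule injI)
  fix p q :: "'a perms" assume "tuple_hom p = tuple_hom q"
  then have "p i = q i" for i using tuple_hom_gen[of p i] tuple_hom_gen[of q i] by simp
  then show "p = q" by auto
qed

definition letter_elt :: "'a letter \<Rightarrow> 'a fgroup" where
  "letter_elt a = Abs_fgroup [a]"

lemma Rep_letter_elt: "Rep_fgroup (letter_elt a) = [a]"
  by (simp add: letter_elt_def Abs_fgroup_inverse reduced_Cons)

lemma fg_gen_letter: "fg_gen i = letter_elt (i, True)"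
  by (simp add: letter_elt_def fg_gen_def)

lemma Abs_fgroup_Cons:
  assumes "reduced (a # w)"
  shows "Abs_fgroup (a # w) = letter_elt a \<otimes>\<^bsub>FG\<^esub> Abs_fgroup w"
proof -
  have "push a w = a # w" using assms by (auto simp: push_def reduced_Cons)
  then show ?thesis using assms
    by (intro Rep_fgroup_inject[THEN iffD1])
       (simp add: FG_def fg_mult.rep_eq Rep_letter_elt Abs_fgroup_inverse reduced_Cons)
qed

lemma FG_simps: "carrier FG = UNIV" "mult FG = fg_mult" "one FG = fg_one"
  by (auto simp: FG_def)

lemma Rep_fg_one: "Rep_fgroup fg_one = []"
  by (simp add: fg_one.rep_eq)

lemma letter_elt_False: "letter_elt (i, False) = inv\<^bsub>FG\<^esub> (fg_gen i)"
proof -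
  have "letter_elt (i, False) \<otimes>\<^bsub>FG\<^esub> fg_gen i = \<one>\<^bsub>FG\<^esub>"
    by (intro Rep_fgroup_inject[THEN iffD1])
       (simp add: FG_def fg_mult.rep_eq fg_gen_letter Rep_letter_elt push_def flip_def Rep_fg_one)
  then show ?thesis
    using group.inv_equality[OF group_FG, of "letter_elt (i, False)" "fg_gen i"] by (simp add: FG_simps)
qed

text \<open>Values on generators determine those on inverse generators and then, letter by letter,
  on reduced words. A uniform homomorphism thus is a tuple of independent uniform
  permutations.\<close>

lemma hom_eq_tuple_hom:
  assumes h: "h \<in> hom FG (sym_group n)"
  defines "p \<equiv> \<lambda>i. h (fg_gen i)"
  shows "p \<in> perm_tuples n" "h = tuple_hom p"
proof -
  have gh: "group_hom FG (sym_group n) h"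
    by (simp add: group_hom_def group_hom_axioms_def group_FG sym_group_is_group h)
  show p: "p \<in> perm_tuples n"
    using h by (auto simp: p_def perm_tuples_def hom_def sym_group_def FG_simps)
  have gt: "group_hom FG (sym_group n) (tuple_hom p)"
    by (simp add: group_hom_def group_hom_axioms_def group_FG sym_group_is_group tuple_hom_in_hom p)
  have gen: "h (fg_gen i) = tuple_hom p (fg_gen i)" for i
    by (simp add: tuple_hom_gen p_def)
  have letter: "h (letter_elt a) = tuple_hom p (letter_elt a)" for a
  proof (cases a)
    case (Pair i b)
    show ?thesis
    proof (cases b)
      case False
      then have "h (letter_elt a) = inv\<^bsub>sym_group n\<^esub> (h (fg_gen i))"
        using Pair by (simp add: letter_elt_False group_hom.hom_inv[OF gh] FG_simps)
      also have "\<dots> = tuple_hom p (letter_elt a)"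
        using Pair False by (simp add: letter_elt_False group_hom.hom_inv[OF gt] FG_simps gen)
      finally show ?thesis .
    qed (use Pair in \<open>simp add: fg_gen_letter[symmetric] gen\<close>)
  qed
  have "reduced w \<Longrightarrow> h (Abs_fgroup w) = tuple_hom p (Abs_fgroup w)" for w
  proof (induction w)
    case Nil
    then show ?case
      using group_hom.hom_one[OF gh] group_hom.hom_one[OF gt] by (simp add: FG_simps fg_one_def)
  next
    case (Cons a w)
    then have "reduced w" by (simp add: reduced_Cons)
    then show ?case
      using Cons group_hom.hom_mult[OF gh] group_hom.hom_mult[OF gt]
      by (simp add: Abs_fgroup_Cons letter FG_simps)
  qed
  then have "h (Abs_fgroup (Rep_fgroup g)) = tuple_hom p (Abs_fgroup (Rep_fgroup g))" for g
    using Rep_fgroup by blast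
  then show "h = tuple_hom p" by (auto simp: Rep_fgroup_inverse)
qed

lemma hom_sym_group_eq: "hom FG (sym_group n) = tuple_hom ` perm_tuples n"
  using hom_eq_tuple_hom tuple_hom_in_hom by blast

lemma perm_tuples_PiE: "perm_tuples n = (UNIV \<rightarrow>\<^sub>E {p. p permutes {1..n}})"
  by (auto simp: perm_tuples_def PiE_def)

lemma finite_perm_tuples [simp]: "finite (perm_tuples n :: ('a::finite \<Rightarrow> _) set)"
  unfolding perm_tuples_PiE by (intro finite_PiE) (auto simp: finite_permutations)

lemma perm_tuples_nonempty [simp]: "perm_tuples n \<noteq> {}"
  by (auto simp: perm_tuples_def intro!: exI[of _ "\<lambda>_. id"] permutes_id)

lemma card_perm_tuples: "card (perm_tuples n :: ('a::finite \<Rightarrow> _) set) = fact n ^ CARD('a)"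
  unfolding perm_tuples_PiE by (simp add: card_PiE card_permutations)

lemma card_perm_tuples_pos [simp]: "card (perm_tuples n :: ('a::finite \<Rightarrow> _) set) > 0"
  by (simp add: card_gt_0_iff)

definition tuple_avg :: "nat \<Rightarrow> ('a::finite perms \<Rightarrow> real) \<Rightarrow> real" where
  "tuple_avg n f = (\<Sum>p\<in>perm_tuples n. f p) / real (card (perm_tuples n :: 'a perms set))"

lemma prob_uniform_hom:
  assumes "G \<subseteq> (perm_tuples n :: 'a::finite perms set)"
  shows "measure_pmf.prob (uniform_hom n) (tuple_hom ` G) = real (card G) / real (card (perm_tuples n :: 'a perms set))"
proof -
  have "hom FG (sym_group n) \<inter> tuple_hom ` G = tuple_hom ` G"
    using assms by (auto simp: hom_sym_group_eq)
  then show ?thesis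
    unfolding uniform_hom_def hom_sym_group_eq
    by (subst measure_pmf_of_set)
       (auto simp: card_image inj_on_subset[OF inj_tuple_hom] hom_sym_group_eq)
qed

lemma expectation_uniform_hom:
  fixes f :: "('a::finite fgroup \<Rightarrow> nat \<Rightarrow> nat) \<Rightarrow> real"
  shows "measure_pmf.expectation (uniform_hom n) f = tuple_avg n (\<lambda>p. f (tuple_hom p))"
  unfolding uniform_hom_def hom_sym_group_eq tuple_avg_def
  by (subst integral_pmf_of_set)
     (auto simp: card_image inj_on_subset[OF inj_tuple_hom] sum.reindex)

section \<open>Type classes\<close>

definition confs :: "nat \<Rightarrow> (nat \<Rightarrow> 'c) set" where
  "confs n = ({1..n} \<rightarrow>\<^sub>E UNIV)"

definition vcount :: "nat \<Rightarrow> (nat \<Rightarrow> 'c) \<Rightarrow> 'c \<Rightarrow> nat" where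
  "vcount n z a = card {v \<in> {1..n}. z v = a}"

definition ecount :: "nat \<Rightarrow> (nat \<Rightarrow> 'c) \<Rightarrow> (nat \<Rightarrow> 'c) \<Rightarrow> 'c \<Rightarrow> 'c \<Rightarrow> nat" where
  "ecount n z y a b = card {v \<in> {1..n}. z v = a \<and> y v = b}"

lemma finite_confs [simp]: "finite (confs n :: (nat \<Rightarrow> 'c::finite) set)"
  unfolding confs_def by (intro finite_PiE) auto

lemma card_confs: "card (confs n :: (nat \<Rightarrow> 'c::finite) set) = CARD('c) ^ n"
  unfolding confs_def by (simp add: card_PiE)

lemma vcount_restrict [simp]: "vcount n (restrict z {1..n}) = vcount n z"
  by (auto simp: vcount_def fun_eq_iff intro!: arg_cong[where f = card])

lemma ecount_restrict [simp]: "ecount n z (restrict y {1..n}) = ecount n z y"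
  by (auto simp: ecount_def fun_eq_iff intro!: arg_cong[where f = card])

lemma sum_vcount: "(\<Sum>a\<in>UNIV. vcount n (z :: nat \<Rightarrow> 'c::finite) a) = n"
proof -
  have "(\<Sum>a\<in>UNIV. vcount n z a) = card (\<Union>a\<in>UNIV. {v \<in> {1..n}. z v = a})"
    unfolding vcount_def by (subst card_UN_disjoint) auto
  also have "(\<Union>a\<in>UNIV. {v \<in> {1..n}. z v = a}) = {1..n}" by auto
  finally show ?thesis by simp
qed

lemma sum_ecount_right: "(\<Sum>b\<in>UNIV. ecount n z (y :: nat \<Rightarrow> 'c::finite) a b) = vcount n z a"
proof -
  have "(\<Sum>b\<in>UNIV. ecount n z y a b) = card (\<Union>b\<in>UNIV. {v \<in> {1..n}. z v = a \<and> y v = b})"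
    unfolding ecount_def by (subst card_UN_disjoint) auto
  also have "(\<Union>b\<in>UNIV. {v \<in> {1..n}. z v = a \<and> y v = b}) = {v \<in> {1..n}. z v = a}" by auto
  finally show ?thesis by (simp add: vcount_def)
qed

lemma sum_ecount_left: "(\<Sum>a\<in>UNIV. ecount n (z :: nat \<Rightarrow> 'c::finite) y a b) = vcount n y b"
proof -
  have "(\<Sum>a\<in>UNIV. ecount n z y a b) = card (\<Union>a\<in>UNIV. {v \<in> {1..n}. z v = a \<and> y v = b})"
    unfolding ecount_def by (subst card_UN_disjoint) auto
  also have "(\<Union>a\<in>UNIV. {v \<in> {1..n}. z v = a \<and> y v = b}) = {v \<in> {1..n}. y v = b}" by auto
  finally show ?thesis by (simp add: vcount_def)
qed

lemma vcount_permute: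
  assumes "q permutes {1..n}"
  shows "vcount n (z \<circ> q) = vcount n z"
proof
  fix a
  have "bij_betw q {v \<in> {1..n}. (z \<circ> q) v = a} {v \<in> {1..n}. z v = a}"
  proof (rule bij_betw_imageI)
    show "inj_on q {v \<in> {1..n}. (z \<circ> q) v = a}"
      using permutes_inj[OF assms] by (rule inj_on_subset) simp
    show "q ` {v \<in> {1..n}. (z \<circ> q) v = a} = {v \<in> {1..n}. z v = a}"
    proof (intro equalityI subsetI)
      fix v assume v: "v \<in> {v \<in> {1..n}. z v = a}"
      then have "v \<in> q ` {1..n}" using permutes_image[OF assms] by simp
      then obtain u where "u \<in> {1..n}" "v = q u" by blast
      then show "v \<in> q ` {v \<in> {1..n}. (z \<circ> q) v = a}" using v by auto
    qed (use permutes_in_image[OF assms] in auto)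
  qed
  then show "vcount n (z \<circ> q) a = vcount n z a"
    unfolding vcount_def by (rule bij_betw_same_card)
qed

lemma ecount_permute:
  assumes "q permutes {1..n}"
  shows "ecount n (z \<circ> q) (y \<circ> q) = ecount n z y"
proof (intro ext)
  fix a b
  have "vcount n ((\<lambda>v. (z v, y v)) \<circ> q) (a, b) = vcount n (\<lambda>v. (z v, y v)) (a, b)"
    by (simp add: vcount_permute[OF assms])
  then show "ecount n (z \<circ> q) (y \<circ> q) a b = ecount n z y a b"
    by (simp add: vcount_def ecount_def)
qed

text \<open>Equal letter counts mean that the two labellings have the same multiset of
  values.\<close>

lemma vcount_eq_imp_permutes:
  assumes "vcount n z = vcount n y"
  obtains q where "q permutes {1..n}" "\<And>v. v \<in> {1..n} \<Longrightarrow> y v = z (q v)"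
proof -
  have c: "count (image_mset f (mset_set {1..n})) a = vcount n f a" for f and a :: 'a
  proof -
    have "count (image_mset f (mset_set {1..n})) a = (\<Sum>v\<in>f -` {a} \<inter> {1..n}. 1)"
      unfolding count_image_mset by (rule sum.cong) auto
    also have "\<dots> = card {v \<in> {1..n}. f v = a}"
      by (auto intro!: arg_cong[where f = card])
    finally show ?thesis by (simp add: vcount_def)
  qed
  have "image_mset y (mset_set {1..n}) = image_mset z (mset_set {1..n})"
    by (rule multiset_eqI) (simp add: c assms)
  then show thesis
    using image_mset_eq_implies_permutes[of "{1..n}" y z] that by (metis finite_atLeastAtMost)
qed

text \<open>The type class of \<open>c\<close> in the sense of the method of types.\<close>

definition vclass :: "nat \<Rightarrow> ('c \<Rightarrow> nat) \<Rightarrow> (nat \<Rightarrow> 'c) set" where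
  "vclass n c = {z \<in> confs n. vcount n z = c}"

lemma finite_vclass [simp]: "finite (vclass n (c :: 'c::finite \<Rightarrow> nat))"
  by (simp add: vclass_def)

text \<open>The order of the stabilizer of \<open>z\<close>, a Young subgroup.\<close>

definition stab_size :: "nat \<Rightarrow> (nat \<Rightarrow> 'c) \<Rightarrow> nat" where
  "stab_size n z = card {q. q permutes {1..n} \<and> (\<forall>v\<in>{1..n}. z (q v) = z v)}"

text \<open>The permutations that pull \<open>z\<close> back to \<open>y\<close> form a coset of the
  stabilizer of \<open>z\<close>.\<close>

lemma card_fibre:
  assumes "vcount n z = vcount n y"
  shows "card {q. q permutes {1..n} \<and> (\<forall>v\<in>{1..n}. z (q v) = y v)} = stab_size n z"
proof -
  obtain q0 where q0: "q0 permutes {1..n}" "\<And>v. v \<in> {1..n} \<Longrightarrow> y v = z (q0 v)"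
    using vcount_eq_imp_permutes[OF assms] by blast
  let ?A = "{q. q permutes {1..n} \<and> (\<forall>v\<in>{1..n}. z (q v) = z v)}"
  let ?B = "{q. q permutes {1..n} \<and> (\<forall>v\<in>{1..n}. z (q v) = y v)}"
  have "bij_betw (\<lambda>q. q \<circ> q0) ?A ?B"
  proof (rule bij_betw_byWitness[where f' = "\<lambda>q. q \<circ> inv_into UNIV q0"])
    show "\<forall>q\<in>?A. q \<circ> q0 \<circ> inv_into UNIV q0 = q" "\<forall>q\<in>?B. q \<circ> inv_into UNIV q0 \<circ> q0 = q"
      using permutes_inv_o[OF q0(1)] by (auto simp: o_assoc[symmetric])
    show "(\<lambda>q. q \<circ> q0) ` ?A \<subseteq> ?B"
      using q0 permutes_in_image[OF q0(1)] by (auto intro!: permutes_compose)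
    show "(\<lambda>q. q \<circ> inv_into UNIV q0) ` ?B \<subseteq> ?A"
      using q0 permutes_inv[OF q0(1)] permutes_in_image[OF permutes_inv[OF q0(1)]] permutes_inverses[OF q0(1)]
      by (auto intro!: permutes_compose)
  qed
  then show ?thesis using bij_betw_same_card unfolding stab_size_def by force
qed

text \<open>Orbit-stabilizer: for a uniform permutation \<open>q\<close> the labelling
  \<open>z \<circ> q\<close> is uniform on the type class of \<open>z\<close>. The predicate
  \<open>P\<close> is left free so that it can be an edge type relative to \<open>z\<close>.\<close>

lemma card_perms_with_pullback:
  fixes z :: "nat \<Rightarrow> 'c::finite"
  shows "card {q. q permutes {1..n} \<and> P (restrict (z \<circ> q) {1..n})}
       = stab_size n z * card {y \<in> vclass n (vcount n z). P y}"
proof -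
  let ?S = "{q. q permutes {1..n} \<and> P (restrict (z \<circ> q) {1..n})}"
  let ?T = "{y \<in> vclass n (vcount n z). P y}"
  let ?g = "\<lambda>q. restrict (z \<circ> q) {1..n}"
  have fin: "finite ?S" "finite ?T"
    by (auto intro: finite_subset[OF _ finite_permutations[of "{1..n}"]])
  have sub: "?g ` ?S \<subseteq> ?T"
    by (auto simp: vclass_def confs_def vcount_permute)
  have "card ?S = (\<Sum>y\<in>?T. sum (\<lambda>_. 1) {q \<in> ?S. ?g q = y})"
    by (subst sum.group[OF fin sub]) simp
  also have "\<dots> = (\<Sum>y\<in>?T. stab_size n z)"
  proof (rule sum.cong)
    fix y assume y: "y \<in> ?T"
    then have ye: "y \<in> {1..n} \<rightarrow>\<^sub>E UNIV" by (simp add: vclass_def confs_def)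
    have eq: "?g q = y \<longleftrightarrow> (\<forall>v\<in>{1..n}. z (q v) = y v)" for q
    proof
      assume "\<forall>v\<in>{1..n}. z (q v) = y v"
      then show "?g q = y" using ye by (intro PiE_ext[of _ "{1..n}" "\<lambda>_. UNIV"]) auto
    qed auto
    have "{q \<in> ?S. ?g q = y} = {q. q permutes {1..n} \<and> (\<forall>v\<in>{1..n}. z (q v) = y v)}"
      using y by (auto simp: eq) (metis eq)
    then show "sum (\<lambda>_. 1) {q \<in> ?S. ?g q = y} = stab_size n z"
      using card_fibre[of n z y] y by (simp add: vclass_def)
  qed simp
  finally show ?thesis by simp
qed

lemma fact_eq_stab_size: "fact n = stab_size n z * card (vclass n (vcount n (z :: nat \<Rightarrow> 'c::finite)))"
  using card_perms_with_pullback[of n "\<lambda>_. True" z] by (simp add: card_permutations)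

text \<open>A pair of labellings is one labelling by pairs, so joint types are types over a larger
  alphabet and inherit all size estimates.\<close>

definition eclass :: "nat \<Rightarrow> ('c \<Rightarrow> 'c \<Rightarrow> nat) \<Rightarrow> (nat \<Rightarrow> 'c \<times> 'c) set" where
  "eclass n N = vclass n (\<lambda>(a, b). N a b)"

lemma finite_eclass [simp]: "finite (eclass n (N :: 'c::finite \<Rightarrow> _))"
  by (simp add: eclass_def)

text \<open>Relabelling the vertices carries the partners \<open>y\<close> of one labelling
  \<open>z\<close> bijectively to those of any other labelling of the same type. All fibres of the
  projection to the first component therefore have the same size.\<close>

lemma card_eclass_fibre:
  fixes N :: "'c::finite \<Rightarrow> 'c \<Rightarrow> nat"
  assumes "\<And>a. (\<Sum>b\<in>UNIV. N a b) = c a" and z: "z \<in> vclass n c"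
  shows "card (eclass n N) = card (vclass n c) * card {y \<in> confs n. ecount n z y = N}"
proof -
  let ?Y = "\<lambda>z. {y \<in> confs n. ecount n z y = N}"
  have const: "card (?Y z') = card (?Y z)" if z': "z' \<in> vclass n c" for z'
  proof -
    obtain q where q: "q permutes {1..n}" "\<And>v. v \<in> {1..n} \<Longrightarrow> z' v = z (q v)"
      using vcount_eq_imp_permutes[of n z z'] z z' by (auto simp: vclass_def)
    let ?f = "\<lambda>y :: nat \<Rightarrow> 'c. restrict (y \<circ> q) {1..n}"
    let ?h = "\<lambda>y :: nat \<Rightarrow> 'c. restrict (y \<circ> inv_into UNIV q) {1..n}"
    have qi: "inv_into UNIV q permutes {1..n}" using q(1) by (rule permutes_inv)
    have e: "ecount n z' y = ecount n (z \<circ> q) y" for y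
      by (auto simp: ecount_def fun_eq_iff q(2) intro!: arg_cong[where f = card])
    have "bij_betw ?f (?Y z) (?Y z')"
    proof (rule bij_betw_byWitness[where f' = ?h])
      show "\<forall>y\<in>?Y z. ?h (?f y) = y"
        using permutes_in_image[OF qi] permutes_inverses[OF q(1)]
        by (auto simp: confs_def fun_eq_iff PiE_def extensional_def restrict_def)
      show "\<forall>y\<in>?Y z'. ?f (?h y) = y"
        using permutes_in_image[OF q(1)] permutes_inverses[OF q(1)]
        by (auto simp: confs_def fun_eq_iff PiE_def extensional_def restrict_def)
      show "?f ` ?Y z \<subseteq> ?Y z'"
        by (auto simp: confs_def e ecount_permute[OF q(1)])
      show "?h ` ?Y z' \<subseteq> ?Y z"
      proof (rule image_subsetI)
        fix y assume y: "y \<in> ?Y z'"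
        have "ecount n z (y \<circ> inv_into UNIV q) = ecount n ((z \<circ> q) \<circ> inv_into UNIV q) (y \<circ> inv_into UNIV q)"
          using permutes_inv_o[OF q(1)] by (simp add: o_assoc[symmetric])
        also have "\<dots> = N" using y by (simp add: ecount_permute[OF qi] e)
        finally show "?h y \<in> ?Y z" by (simp add: confs_def)
      qed
    qed
    then show ?thesis by (rule bij_betw_same_card[symmetric])
  qed
  let ?P = "Sigma (vclass n c) ?Y"
  have "bij_betw (\<lambda>w. (restrict (fst \<circ> w) {1..n}, restrict (snd \<circ> w) {1..n})) (eclass n N) ?P"
  proof (rule bij_betw_byWitness[where f' = "\<lambda>(z, y). restrict (\<lambda>v. (z v, y v)) {1..n}"])
    have split: "vcount n w (a, b) = ecount n (fst \<circ> w) (snd \<circ> w) a b" for w :: "nat \<Rightarrow> 'c \<times> 'c" and a b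
      by (auto simp: vcount_def ecount_def prod_eq_iff intro!: arg_cong[where f = card])
    have rl: "ecount n (restrict z {1..n}) y = ecount n z y" for z y :: "nat \<Rightarrow> 'c"
      by (auto simp: ecount_def fun_eq_iff intro!: arg_cong[where f = card])
    show "(\<lambda>w. (restrict (fst \<circ> w) {1..n}, restrict (snd \<circ> w) {1..n})) ` eclass n N \<subseteq> ?P"
    proof (rule image_subsetI)
      fix w assume "w \<in> eclass n N"
      then have "vcount n w = (\<lambda>(a, b). N a b)" by (simp add: eclass_def vclass_def)
      then have eN: "ecount n (fst \<circ> w) (snd \<circ> w) = N" using split[of w] by (metis case_prod_conv ext)
      then have "vcount n (fst \<circ> w) a = c a" for a
        using sum_ecount_right[of n "fst \<circ> w" "snd \<circ> w" a] assms(1) by simp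
      then show "(restrict (fst \<circ> w) {1..n}, restrict (snd \<circ> w) {1..n}) \<in> ?P"
        using eN by (auto simp: vclass_def confs_def rl)
    qed
    show "(\<lambda>(z, y). restrict (\<lambda>v. (z v, y v)) {1..n}) ` ?P \<subseteq> eclass n N"
      by (auto simp: eclass_def vclass_def confs_def fun_eq_iff) (simp add: vcount_def ecount_def)
  qed (auto simp: eclass_def vclass_def confs_def fun_eq_iff PiE_def extensional_def restrict_def)
  then have "card (eclass n N) = card ?P" by (rule bij_betw_same_card)
  also have "\<dots> = (\<Sum>z'\<in>vclass n c. card (?Y z'))" by simp
  also have "\<dots> = card (vclass n c) * card (?Y z)" by (simp add: const)
  finally show ?thesis .
qed

section \<open>Sizes of type classes\<close>

lemma sum_prod_confs:
  fixes q :: "'c::finite \<Rightarrow> real"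
  shows "(\<Sum>z\<in>confs n. \<Prod>v\<in>{1..n}. q (z v)) = (\<Sum>a\<in>UNIV. q a) ^ n"
  unfolding confs_def by (subst prod_sum_PiE[symmetric]) auto

lemma prod_power_vcount:
  fixes q :: "'c::finite \<Rightarrow> real"
  shows "(\<Prod>v\<in>{1..n}. q (z v)) = (\<Prod>a\<in>UNIV. q a ^ vcount n z a)"
proof -
  have "(\<Prod>a\<in>UNIV. prod (\<lambda>v. q (z v)) {v \<in> {1..n}. z v = a}) = (\<Prod>v\<in>{1..n}. q (z v))"
    by (rule prod.group) auto
  moreover have "prod (\<lambda>v. q (z v)) {v \<in> {1..n}. z v = a} = q a ^ vcount n z a" for a
    unfolding vcount_def by (subst prod_constant[symmetric], rule prod.cong) auto
  ultimately show ?thesis by simp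
qed

text \<open>The terms of one type in the multinomial expansion of the power on the right. The
  weights stay free and are optimized only where the bound is applied.\<close>

lemma card_vclass_le:
  fixes q :: "'c::finite \<Rightarrow> real"
  assumes "\<And>a. q a \<ge> 0"
  shows "real (card (vclass n c)) * (\<Prod>a\<in>UNIV. q a ^ c a) \<le> (\<Sum>a\<in>UNIV. q a) ^ n"
proof -
  have "real (card (vclass n c)) * (\<Prod>a\<in>UNIV. q a ^ c a) = (\<Sum>z\<in>vclass n c. \<Prod>v\<in>{1..n}. q (z v))"
    by (simp add: prod_power_vcount vclass_def)
  also have "\<dots> \<le> (\<Sum>z\<in>confs n. \<Prod>v\<in>{1..n}. q (z v))"
    by (rule sum_mono2) (auto simp: vclass_def intro!: prod_nonneg assms)
  finally show ?thesis by (simp add: sum_prod_confs)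
qed

lemma card_eclass_le:
  fixes q :: "'c::finite \<Rightarrow> 'c \<Rightarrow> real"
  assumes "\<And>a b. q a b \<ge> 0"
  shows "real (card (eclass n N)) * (\<Prod>a\<in>UNIV. \<Prod>b\<in>UNIV. q a b ^ N a b) \<le> (\<Sum>a\<in>UNIV. \<Sum>b\<in>UNIV. q a b) ^ n"
  using card_vclass_le[of "\<lambda>(a, b). q a b" n "\<lambda>(a, b). N a b"] assms
  by (simp add: eclass_def sum.cartesian_product prod.cartesian_product UNIV_Times_UNIV[symmetric] case_prod_unfold del: UNIV_Times_UNIV)

text \<open>The multinomial coefficient, transported from permutations of a multiset.\<close>

lemma card_vclass_fact:
  fixes c :: "'c::finite \<Rightarrow> nat"
  assumes "(\<Sum>a\<in>UNIV. c a) = n"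
  shows "card (vclass n c) * (\<Prod>a\<in>UNIV. fact (c a)) = (fact n :: nat)"
proof -
  define A where "A = (\<Sum>a\<in>(UNIV :: 'c set). replicate_mset (c a) a)"
  have cA: "count A a = c a" for a
    by (simp add: A_def count_sum)
  have szA: "size A = n" proof -
    have "size (\<Sum>a\<in>B. replicate_mset (c a) a) = (\<Sum>a\<in>B. c a)" for B :: "'c set"
      by (induction B rule: infinite_finite_induct) auto
    then show ?thesis using assms by (simp add: A_def)
  qed
  have cm: "count (mset (map z [1..<Suc n])) a = vcount n z a" for z :: "nat \<Rightarrow> 'c" and a
  proof -
    have "mset [1..<Suc n] = mset_set {1..n}"
      by (metis atLeastLessThanSuc_atLeastAtMost mset_upt)
    then have "count (mset (map z [1..<Suc n])) a = count (image_mset z (mset_set {1..n})) a"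
      by (metis mset_map)
    also have "\<dots> = (\<Sum>v\<in>z -` {a} \<inter> {1..n}. 1)"
      unfolding count_image_mset by (rule sum.cong) auto
    also have "\<dots> = card {v \<in> {1..n}. z v = a}"
      by (auto intro!: arg_cong[where f = card])
    finally show ?thesis by (simp add: vcount_def)
  qed
  \<comment> \<open>Vertices are numbered from 1 and list positions from 0, hence the index
    \<open>v - 1\<close> in the inverse map.\<close>
  have "bij_betw (\<lambda>z. map z [1..<Suc n]) (vclass n c) (permutations_of_multiset A)"
  proof (rule bij_betw_byWitness[where f' = "\<lambda>xs. restrict (\<lambda>v. xs ! (v - 1)) {1..n}"])
    show "\<forall>z\<in>vclass n c. restrict (\<lambda>v. map z [1..<Suc n] ! (v - 1)) {1..n} = z"
      by (auto simp: vclass_def confs_def fun_eq_iff PiE_def extensional_def restrict_def nth_append simp del: upt_Suc)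
    have len: "length xs = n" if "xs \<in> permutations_of_multiset A" for xs
      using that szA by (auto simp: permutations_of_multiset_def)
    show inv: "\<forall>xs\<in>permutations_of_multiset A. map (restrict (\<lambda>v. xs ! (v - 1)) {1..n}) [1..<Suc n] = xs"
      by (auto intro!: nth_equalityI simp: len simp del: upt_Suc)
    show "(\<lambda>z. map z [1..<Suc n]) ` vclass n c \<subseteq> permutations_of_multiset A"
      by (auto simp del: upt_Suc mset_map simp: permutations_of_multiset_def vclass_def cA cm intro!: multiset_eqI)
    show "(\<lambda>xs. restrict (\<lambda>v. xs ! (v - 1)) {1..n}) ` permutations_of_multiset A \<subseteq> vclass n c"
    proof (rule image_subsetI)
      fix xs assume xs: "xs \<in> permutations_of_multiset A"
      let ?z = "restrict (\<lambda>v. xs ! (v - 1)) {1..n}"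
      have "vcount n ?z a = c a" for a
        using cm[of ?z a] inv xs cA by (simp add: permutations_of_multiset_def del: upt_Suc mset_map vcount_restrict)
      then show "?z \<in> vclass n c" by (auto simp: vclass_def confs_def)
    qed
  qed
  then have "card (vclass n c) = card (permutations_of_multiset A)" by (rule bij_betw_same_card)
  moreover have "(\<Prod>x\<in>set_mset A. fact (count A x)) = (\<Prod>a\<in>UNIV. fact (c a) :: nat)"
    by (rule prod.mono_neutral_cong_left) (auto simp: cA not_in_iff)
  ultimately show ?thesis
    using card_permutations_of_multiset_aux[of A] szA by simp
qed

text \<open>A single term of the exponential series at \<open>real n\<close>.\<close>

lemma fact_lower: "(real n / exp 1) ^ n \<le> fact n"
proof -
  have "(\<lambda>k. real n ^ k /\<^sub>R fact k) sums exp (real n)" by (rule exp_converges)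
  then have "(\<Sum>k\<in>{n}. real n ^ k /\<^sub>R fact k) \<le> exp (real n)"
    using sum_le_suminf[of "\<lambda>k. real n ^ k /\<^sub>R fact k" "{n}"] by (auto simp: sums_iff)
  then have "real n ^ n / fact n \<le> exp 1 ^ n"
    by (simp add: exp_of_nat_mult[symmetric] divide_inverse mult.commute)
  then show ?thesis by (simp add: power_divide field_simps)
qed

text \<open>The induction rests on \<open>exp 1 \<le> ((k + 1) / k) ^ (k + 1)\<close>. The factor
  \<open>real k + 1\<close> in place of \<open>real k\<close> admits \<open>k = 0\<close>.\<close>

lemma fact_upper: "fact k \<le> exp 1 * (real k + 1) * (real k / exp 1) ^ k"
proof (cases "k = 0")
  case False
  then have "k \<ge> 1" by simp
  then have "fact k \<le> exp 1 * real k * (real k / exp 1) ^ k"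
  proof (induction k rule: dec_induct)
    case (step k)
    then have k: "real k > 0" by simp
    have "ln (real k / (real k + 1)) \<le> real k / (real k + 1) - 1"
      by (rule ln_le_minus_one) (use k in simp)
    also have "\<dots> = - 1 / (real k + 1)" using k by (simp add: field_simps)
    finally have "1 / (real k + 1) \<le> ln ((real k + 1) / real k)"
      using k by (simp add: ln_div)
    then have "1 \<le> real (k + 1) * ln ((real k + 1) / real k)"
      using k by (simp add: field_simps)
    then have "exp 1 \<le> exp (real (k + 1) * ln ((real k + 1) / real k))" by simp
    also have "\<dots> = ((real k + 1) / real k) ^ (k + 1)"
      using k by (subst exp_of_nat_mult) simp
    finally have "exp 1 \<le> (real k + 1) ^ (k + 1) / real k ^ (k + 1)"
      by (simp only: power_divide)
    then have e: "exp 1 * real k ^ (k + 1) \<le> (real k + 1) ^ (k + 1)"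
      using k by (subst (asm) pos_le_divide_eq) auto
    have "fact (Suc k) = (real k + 1) * fact k" by (simp add: algebra_simps)
    also have "\<dots> \<le> (real k + 1) * (exp 1 * real k * (real k / exp 1) ^ k)"
      using step.IH by (intro mult_left_mono) auto
    also have "\<dots> = (real k + 1) * (exp 1 * real k ^ (k + 1)) / exp 1 ^ k"
      by (simp add: power_divide power_add)
    also have "\<dots> \<le> (real k + 1) * (real k + 1) ^ (k + 1) / exp 1 ^ k"
      using e by (intro divide_right_mono mult_left_mono) auto
    also have "\<dots> = exp 1 * real (Suc k) * (real (Suc k) / exp 1) ^ Suc k"
      by (simp add: power_divide power_add mult_ac add.commute)
    finally show ?case .
  qed (simp add: One_nat_def)
  also have "\<dots> \<le> exp 1 * (real k + 1) * (real k / exp 1) ^ k"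
    by (intro mult_right_mono) auto
  finally show ?thesis .
qed simp

lemma card_vclass_ge:
  fixes c :: "'c::finite \<Rightarrow> nat"
  assumes "(\<Sum>a\<in>UNIV. c a) = n"
  shows "real n ^ n \<le> (exp 1 * (real n + 1)) ^ CARD('c) * real (card (vclass n c)) * (\<Prod>a\<in>UNIV. real (c a) ^ c a)"
proof -
  have cn: "c a \<le> n" for a using assms member_le_sum[of a UNIV c] by simp
  have "(\<Prod>a\<in>UNIV. fact (c a) :: real) \<le> (\<Prod>a\<in>UNIV. exp 1 * (real n + 1) * (real (c a) / exp 1) ^ c a)"
  proof (rule prod_mono, safe)
    fix a
    have "fact (c a) \<le> exp 1 * (real (c a) + 1) * (real (c a) / exp 1) ^ c a" by (rule fact_upper)
    also have "\<dots> \<le> exp 1 * (real n + 1) * (real (c a) / exp 1) ^ c a"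
      using cn[of a] by (intro mult_right_mono mult_left_mono) auto
    finally show "(fact (c a) :: real) \<le> exp 1 * (real n + 1) * (real (c a) / exp 1) ^ c a" .
  qed simp
  also have "\<dots> = (exp 1 * (real n + 1)) ^ CARD('c) * (\<Prod>a\<in>UNIV. real (c a) ^ c a) / exp 1 ^ n"
    by (simp only: prod.distrib prod_constant power_divide prod_dividef power_sum[symmetric] assms times_divide_eq_right power_mult_distrib)
  finally have F: "(\<Prod>a\<in>UNIV. fact (c a) :: real) \<le> (exp 1 * (real n + 1)) ^ CARD('c) * (\<Prod>a\<in>UNIV. real (c a) ^ c a) / exp 1 ^ n" .
  have "real n ^ n / exp 1 ^ n \<le> fact n" using fact_lower[of n] by (simp only: power_divide)
  also have "\<dots> = real (card (vclass n c)) * (\<Prod>a\<in>UNIV. fact (c a))"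
    using arg_cong[OF card_vclass_fact[OF assms], of real] by (simp only: of_nat_mult of_nat_prod of_nat_fact)
  also have "\<dots> \<le> real (card (vclass n c)) * ((exp 1 * (real n + 1)) ^ CARD('c) * (\<Prod>a\<in>UNIV. real (c a) ^ c a) / exp 1 ^ n)"
    by (intro mult_left_mono F) auto
  finally have main: "real n ^ n / exp 1 ^ n \<le> real (card (vclass n c)) * ((exp 1 * (real n + 1)) ^ CARD('c) * (\<Prod>a\<in>UNIV. real (c a) ^ c a) / exp 1 ^ n)" .
  have cancel: "x \<le> k * p * y" if "x / E \<le> k' * (k'' * y / E)" "E > 0" "k * p = k'' * k'" for x k k' k'' p y E :: real
  proof -
    have "x / E \<le> k * p * y / E" using that(1,3) by (simp add: mult_ac)
    then show ?thesis using that(2) by (simp add: divide_le_cancel)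
  qed
  show ?thesis by (rule cancel[OF main]) (simp_all only: exp_gt_zero zero_less_power mult.commute)
qed

text \<open>A random permutation produces the edge type \<open>N\<close> with probability
  \<open>|eclass| / |vclass|^2\<close>: the pulled-back labelling is uniform on its type class, and
  the admissible ones form one fibre of \<open>eclass\<close>.\<close>

lemma card_perms_ecount:
  fixes N :: "'c::finite \<Rightarrow> 'c \<Rightarrow> nat"
  assumes row: "\<And>a. (\<Sum>b\<in>UNIV. N a b) = c a" and col: "\<And>b. (\<Sum>a\<in>UNIV. N a b) = c b"
    and z: "z \<in> vclass n c"
  shows "real (card {q. q permutes {1..n} \<and> ecount n z (z \<circ> q) = N}) * real (card (vclass n c)) ^ 2
       = fact n * real (card (eclass n N))"
proof -
  have vz: "vcount n z = c" using z by (simp add: vclass_def)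
  have "vcount n y = c" if "ecount n z y = N" for y
    using sum_ecount_left[of n z y] col that by (auto simp: fun_eq_iff)
  then have Y: "{y \<in> vclass n c. ecount n z y = N} = {y \<in> confs n. ecount n z y = N}"
    by (auto simp: vclass_def)
  have 1: "card {q. q permutes {1..n} \<and> ecount n z (z \<circ> q) = N} = stab_size n z * card {y \<in> confs n. ecount n z y = N}"
    using card_perms_with_pullback[of n "\<lambda>y. ecount n z y = N" z] by (simp add: vz Y)
  have 2: "card (eclass n N) = card (vclass n c) * card {y \<in> confs n. ecount n z y = N}"
    by (rule card_eclass_fibre[OF row z])
  have 3: "fact n = stab_size n z * card (vclass n c)" using fact_eq_stab_size[of n z] by (simp add: vz)
  have "card {q. q permutes {1..n} \<and> ecount n z (z \<circ> q) = N} * card (vclass n c) ^ 2 = fact n * card (eclass n N)"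
    unfolding 1 2 3 by (simp add: power2_eq_square)
  from arg_cong[OF this, of real] show ?thesis by (simp only: of_nat_mult of_nat_power of_nat_fact)
qed

text \<open>Independence of the generators, in counting form.\<close>

lemma card_tuples_PiE:
  "card {p \<in> (perm_tuples n :: ('a::finite \<Rightarrow> _) set). \<forall>i. Q i (p i)} = (\<Prod>i\<in>UNIV. card {q. q permutes {1..n} \<and> Q i q})"
proof -
  have "{p \<in> (perm_tuples n :: ('a \<Rightarrow> _) set). \<forall>i. Q i (p i)} = (UNIV \<rightarrow>\<^sub>E UNIV) \<inter> (\<Pi>\<^sub>E i\<in>UNIV. {q. q permutes {1..n} \<and> Q i q})"
    by (auto simp: perm_tuples_def PiE_def)
  also have "\<dots> = (\<Pi>\<^sub>E i\<in>UNIV. {q. q permutes {1..n} \<and> Q i q})" by auto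
  finally show ?thesis by (simp add: card_PiE)
qed

definition typed :: "nat \<Rightarrow> ('a \<Rightarrow> 'c \<Rightarrow> 'c \<Rightarrow> nat) \<Rightarrow> 'a perms \<Rightarrow> (nat \<Rightarrow> 'c) \<Rightarrow> bool" where
  "typed n N p z \<longleftrightarrow> (\<forall>i. ecount n z (z \<circ> p i) = N i)"

lemma typed_vclass:
  fixes N :: "'a::finite \<Rightarrow> 'c::finite \<Rightarrow> 'c \<Rightarrow> nat"
  assumes row: "\<And>i a. (\<Sum>b\<in>UNIV. N i a b) = c a" and "z \<in> confs n" "typed n N p z"
  shows "z \<in> vclass n c"
proof -
  \<comment> \<open>Types are nonempty, so there is a generator, and the edge type of one generator
    already fixes the vertex type.\<close>
  obtain i :: 'a where True by auto
  have "ecount n z (z \<circ> p i) = N i" using assms by (simp add: typed_def)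
  then have "vcount n z a = c a" for a
    using sum_ecount_right[of n z "z \<circ> p i" a] row[of i a] by simp
  then show ?thesis using assms by (auto simp: vclass_def)
qed

text \<open>Double counting of pairs of a tuple and a labelling. The extra condition
  \<open>Q\<close> later carries local statistics from planted tuples back to averages over all
  tuples.\<close>

lemma sum_typed:
  fixes N :: "'a::finite \<Rightarrow> 'c::finite \<Rightarrow> 'c \<Rightarrow> nat"
  assumes row: "\<And>i a. (\<Sum>b\<in>UNIV. N i a b) = c a"
  shows "(\<Sum>p\<in>perm_tuples n. card {z \<in> confs n. typed n N p z \<and> Q p z})
       = (\<Sum>z\<in>vclass n c. card {p \<in> perm_tuples n. typed n N p z \<and> Q p z})"
proof -
  have "{z \<in> confs n. typed n N p z \<and> Q p z} = {z \<in> vclass n c. typed n N p z \<and> Q p z}" for p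
    using typed_vclass[where N = N and c = c and n = n, OF row] by (auto simp: vclass_def)
  then have "(\<Sum>p\<in>perm_tuples n. card {z \<in> confs n. typed n N p z \<and> Q p z})
      = (\<Sum>p\<in>perm_tuples n. \<Sum>z\<in>vclass n c. if typed n N p z \<and> Q p z then 1 else 0)"
    by (simp add: sum.If_cases Int_def)
  also have "\<dots> = (\<Sum>z\<in>vclass n c. \<Sum>p\<in>perm_tuples n. if typed n N p z \<and> Q p z then 1 else 0)"
    by (rule sum.swap)
  finally show ?thesis by (simp add: sum.If_cases Int_def)
qed

text \<open>The choice of the labelling gives one factor \<open>|vclass|\<close>, and each generator
  puts two into the denominator by \<open>card_perms_ecount\<close>. Denominators are
  cleared.\<close>

lemma tuple_avg_typed:
  fixes N :: "'a::finite \<Rightarrow> 'c::finite \<Rightarrow> 'c \<Rightarrow> nat"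
  assumes row: "\<And>i a. (\<Sum>b\<in>UNIV. N i a b) = c a" and col: "\<And>i b. (\<Sum>a\<in>UNIV. N i a b) = c b"
  shows "tuple_avg n (\<lambda>p. real (card {z \<in> confs n. typed n N p z})) * real (card (vclass n c)) ^ (2 * CARD('a))
       = real (card (vclass n c)) * (\<Prod>i\<in>UNIV. real (card (eclass n (N i))))"
proof -
  let ?M = "real (card (vclass n c))"
  let ?P = "perm_tuples n :: 'a perms set"
  have z: "real (card {p \<in> ?P. typed n N p z}) * ?M ^ (2 * CARD('a)) = real (card ?P) * (\<Prod>i\<in>UNIV. real (card (eclass n (N i))))"
    if "z \<in> vclass n c" for z
  proof -
    have "real (card {p \<in> ?P. typed n N p z}) * ?M ^ (2 * CARD('a))
        = (\<Prod>i\<in>UNIV. real (card {q. q permutes {1..n} \<and> ecount n z (z \<circ> q) = N i}) * ?M ^ 2)"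
      unfolding typed_def by (subst card_tuples_PiE) (simp add: prod.distrib power_mult)
    also have "\<dots> = (\<Prod>i\<in>UNIV. fact n * real (card (eclass n (N i))))"
      by (intro prod.cong refl card_perms_ecount[OF row col that])
    finally show ?thesis by (simp add: prod.distrib card_perm_tuples)
  qed
  have "(\<Sum>p\<in>?P. real (card {z \<in> confs n. typed n N p z})) * ?M ^ (2 * CARD('a))
      = real (\<Sum>z\<in>vclass n c. card {p \<in> ?P. typed n N p z}) * ?M ^ (2 * CARD('a))"
    using sum_typed[where N = N and c = c and n = n and Q = "\<lambda>_ _. True", OF row] by (simp flip: of_nat_sum)
  also have "\<dots> = (\<Sum>z\<in>vclass n c. real (card {p \<in> ?P. typed n N p z}) * ?M ^ (2 * CARD('a)))"
    by (simp add: sum_distrib_right)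
  also have "\<dots> = real (card ?P) * (?M * (\<Prod>i\<in>UNIV. real (card (eclass n (N i)))))"
    by (simp add: z)
  finally have "(\<Sum>p\<in>?P. real (card {z \<in> confs n. typed n N p z})) * ?M ^ (2 * CARD('a)) = real (card ?P) * (?M * (\<Prod>i\<in>UNIV. real (card (eclass n (N i)))))" .
  then show ?thesis unfolding tuple_avg_def by (simp add: divide_eq_eq mult.commute)
qed

text \<open>Edge classes are bounded from above with free weights \<open>q\<close>, and the
  \<open>2 r - 1\<close> vertex classes that remain in the denominator from below. The later upper
  bounds are choices of \<open>q\<close>.\<close>

lemma tuple_avg_typed_le:
  fixes N :: "'a::finite \<Rightarrow> 'c::finite \<Rightarrow> 'c \<Rightarrow> nat"
  assumes row: "\<And>i a. (\<Sum>b\<in>UNIV. N i a b) = c a" and col: "\<And>i b. (\<Sum>a\<in>UNIV. N i a b) = c b"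
    and cn: "(\<Sum>a\<in>UNIV. c a) = n" and q: "\<And>i a b. q i a b \<ge> 0"
  shows "tuple_avg n (\<lambda>p. real (card {z \<in> confs n. typed n N p z})) * (real n ^ n) ^ (2 * CARD('a) - 1)
           * (\<Prod>i\<in>UNIV. \<Prod>a\<in>UNIV. \<Prod>b\<in>UNIV. q i a b ^ N i a b)
      \<le> ((exp 1 * (real n + 1)) ^ CARD('c)) ^ (2 * CARD('a) - 1) * (\<Prod>a\<in>UNIV. real (c a) ^ c a) ^ (2 * CARD('a) - 1)
           * (\<Prod>i\<in>UNIV. (\<Sum>a\<in>UNIV. \<Sum>b\<in>UNIV. q i a b) ^ n)"
proof -
  define M where "M = real (card (vclass n c))"
  define A where "A = tuple_avg n (\<lambda>p. real (card {z \<in> confs n. typed n N p z}))"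
  define e where "e = 2 * CARD('a) - 1"
  define T where "T = (\<Prod>i\<in>UNIV. real (card (eclass n (N i))))"
  define Q where "Q = (\<Prod>i\<in>UNIV. \<Prod>a\<in>UNIV. \<Prod>b\<in>UNIV. q i a b ^ N i a b)"
  define X where "X = (exp 1 * (real n + 1)) ^ CARD('c)"
  define Y where "Y = (\<Prod>a\<in>UNIV. real (c a) ^ c a)"
  have M: "M > 0"
    using card_vclass_fact[OF cn] by (auto simp: M_def intro!: gr0I)
  have card: "2 * CARD('a) = Suc e" by (simp add: e_def)
  have A0: "A \<ge> 0" by (simp add: A_def tuple_avg_def sum_nonneg)
  have Q0: "Q \<ge> 0" by (simp add: Q_def prod_nonneg q)
  have "A * M ^ Suc e = M * T"
    using tuple_avg_typed[where N = N and c = c and n = n, OF row col] unfolding card A_def M_def T_def .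
  then have AM: "A * M ^ e = T" using M by simp
  have TQ: "T * Q \<le> (\<Prod>i\<in>UNIV. (\<Sum>a\<in>UNIV. \<Sum>b\<in>UNIV. q i a b) ^ n)"
    unfolding T_def Q_def prod.distrib[symmetric]
    by (intro prod_mono conjI card_eclass_le mult_nonneg_nonneg prod_nonneg zero_le_power q ballI) simp_all
  have "A * (real n ^ n) ^ e * Q \<le> A * (X * M * Y) ^ e * Q"
    using card_vclass_ge[OF cn] unfolding X_def M_def Y_def
    by (intro mult_right_mono mult_left_mono power_mono A0 Q0) auto
  also have "\<dots> = X ^ e * Y ^ e * (A * M ^ e * Q)" by (simp add: power_mult_distrib)
  also have "\<dots> \<le> X ^ e * Y ^ e * (\<Prod>i\<in>UNIV. (\<Sum>a\<in>UNIV. \<Sum>b\<in>UNIV. q i a b) ^ n)"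
    unfolding AM by (intro mult_left_mono TQ) (auto simp: X_def Y_def intro!: mult_nonneg_nonneg prod_nonneg zero_le_power)
  finally show ?thesis unfolding A_def e_def Q_def X_def Y_def .
qed

text \<open>The two size estimates exchange roles: vertex classes are bounded from above with the
  weights \<open>\<pi>\<close>, edge classes from below by \<open>card_vclass_ge\<close>.\<close>

lemma tuple_avg_typed_ge:
  fixes N :: "'c::finite \<Rightarrow> 'c \<Rightarrow> nat" and \<pi> :: "'c \<Rightarrow> real"
  assumes row: "\<And>a. (\<Sum>b\<in>UNIV. N a b) = c a" and col: "\<And>b. (\<Sum>a\<in>UNIV. N a b) = c b"
    and cn: "(\<Sum>a\<in>UNIV. c a) = n" and \<pi>: "\<And>a. \<pi> a \<ge> 0" "(\<Sum>a\<in>UNIV. \<pi> a) = 1"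
  shows "(\<Prod>a\<in>UNIV. \<pi> a ^ c a) ^ (2 * CARD('a::finite) - 1) * (real n ^ n) ^ CARD('a)
      \<le> tuple_avg n (\<lambda>p :: 'a perms. real (card {z \<in> confs n. typed n (\<lambda>_. N) p z}))
         * ((exp 1 * (real n + 1)) ^ (CARD('c) * CARD('c)) * (\<Prod>a\<in>UNIV. \<Prod>b\<in>UNIV. real (N a b) ^ N a b)) ^ CARD('a)"
proof -
  define M where "M = real (card (vclass n c))"
  define A where "A = tuple_avg n (\<lambda>p :: 'a perms. real (card {z \<in> confs n. typed n (\<lambda>_. N) p z}))"
  define e where "e = 2 * CARD('a) - 1"
  define T where "T = real (card (eclass n N))"
  define Q where "Q = (\<Prod>a\<in>UNIV. \<pi> a ^ c a)"
  define X where "X = (exp 1 * (real n + 1)) ^ (CARD('c) * CARD('c)) * (\<Prod>a\<in>UNIV. \<Prod>b\<in>UNIV. real (N a b) ^ N a b)"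
  have M: "M > 0"
    using card_vclass_fact[OF cn] by (auto simp: M_def intro!: gr0I)
  have card: "2 * CARD('a) = Suc e" by (simp add: e_def)
  have A0: "A \<ge> 0" by (simp add: A_def tuple_avg_def sum_nonneg)
  have Q0: "Q \<ge> 0" by (simp add: Q_def prod_nonneg \<pi>)
  have X0: "X \<ge> 0" by (simp add: X_def prod_nonneg)
  have "A * M ^ Suc e = M * T ^ CARD('a)"
    using tuple_avg_typed[where N = "\<lambda>_::'a. N" and c = c and n = n, OF row col] unfolding card A_def M_def T_def by simp
  then have AM: "A * M ^ e = T ^ CARD('a)" using M by simp
  have MQ: "M * Q \<le> 1"
    using card_vclass_le[where q = \<pi> and c = c and n = n, OF \<pi>(1)] \<pi>(2) by (simp add: M_def Q_def)
  have "(\<Sum>p\<in>UNIV. case p of (a, b) \<Rightarrow> N a b) = n"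
    using row cn by (simp add: UNIV_Times_UNIV[symmetric] sum.cartesian_product[symmetric] del: UNIV_Times_UNIV)
  from card_vclass_ge[OF this] have nT: "real n ^ n \<le> T * X"
    by (simp add: T_def X_def eclass_def prod.cartesian_product UNIV_Times_UNIV[symmetric] case_prod_unfold mult_ac card_cartesian_product del: UNIV_Times_UNIV)
  have "Q ^ e * (real n ^ n) ^ CARD('a) \<le> Q ^ e * (T * X) ^ CARD('a)"
    by (intro mult_left_mono power_mono nT) (auto simp: Q0)
  also have "\<dots> = A * (M * Q) ^ e * X ^ CARD('a)"
    by (simp add: power_mult_distrib AM[symmetric])
  also have "\<dots> \<le> A * 1 ^ e * X ^ CARD('a)"
    using M Q0 MQ by (intro mult_right_mono mult_left_mono power_mono) (auto simp: A0 X0)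
  finally show ?thesis unfolding A_def e_def Q_def X_def by simp
qed

section \<open>Switchings in the planted model\<close>

text \<open>The switching that exchanges the targets of \<open>u\<close> and \<open>u'\<close> under
  the letter \<open>a\<close>. For an inverse letter this means composing the generator with the
  transposition on the other side.\<close>

definition swap_at :: "'a perms \<Rightarrow> 'a letter \<Rightarrow> nat \<Rightarrow> nat \<Rightarrow> 'a \<Rightarrow> nat \<Rightarrow> nat" where
  "swap_at p a u u' = p(fst a := (if snd a then p (fst a) \<circ> Transposition.transpose u u' else Transposition.transpose u u' \<circ> p (fst a)))"

lemma perm_tuples_bij: "p \<in> perm_tuples n \<Longrightarrow> bij (p i)"
  by (auto simp: perm_tuples_def intro: permutes_bij)

lemma letter_perm_swap:
  assumes "p \<in> perm_tuples n"
  shows "letter_perm (swap_at p a u u') a = letter_perm p a \<circ> Transposition.transpose u u'"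
  by (cases a; cases "snd a")
     (auto simp: swap_at_def o_inv_distrib perm_tuples_bij[OF assms])

lemma letter_perm_swap_flip:
  assumes "p \<in> perm_tuples n"
  shows "letter_perm (swap_at p a u u') (flip a) = Transposition.transpose u u' \<circ> letter_perm p (flip a)"
  by (cases a; cases "snd a")
     (auto simp: swap_at_def flip_def o_inv_distrib perm_tuples_bij[OF assms])

lemma letter_perm_swap_other: "fst b \<noteq> fst a \<Longrightarrow> letter_perm (swap_at p a u u') b = letter_perm p b"
  by (cases b; cases "snd b") (auto simp: swap_at_def)

lemma swap_at_twice: "swap_at (swap_at p a u u') a u u' = p"
  by (auto simp: swap_at_def fun_eq_iff)

lemma swap_at_perm_tuples:
  assumes "p \<in> perm_tuples n" "u \<in> {1..n}" "u' \<in> {1..n}"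
  shows "swap_at p a u u' \<in> perm_tuples n"
proof -
  have "Transposition.transpose u u' permutes {1..n}" using assms(2,3) by (rule permutes_swap_id)
  then show ?thesis using assms(1) by (auto simp: perm_tuples_def swap_at_def intro!: permutes_compose)
qed

definition point :: "'a perms \<Rightarrow> ('k \<Rightarrow> nat) \<Rightarrow> 'k \<times> 'a letter list \<Rightarrow> nat" where
  "point p v k = word_perm p (snd k) (v (fst k))"

text \<open>Words act from right to left, so suffixes are initial segments of paths.
  \<open>K\<close> describes explored trees whose roots are indexed by the first component.\<close>

definition suffix_closed :: "('k \<times> 'a letter list) set \<Rightarrow> bool" where
  "suffix_closed K \<longleftrightarrow> (\<forall>j w. (j, w) \<in> K \<longrightarrow> reduced w \<and> (\<forall>a w'. w = a # w' \<longrightarrow> (j, w') \<in> K))"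

lemma suffix_closedD:
  assumes "suffix_closed K" "(j, a # w) \<in> K"
  shows "(j, w) \<in> K" "reduced (a # w)"
  using assms unfolding suffix_closed_def by blast+

text \<open>The explored forest crosses no altered edge: it does not meet \<open>u'\<close>, and at
  the vertex \<open>(j, w)\<close> the step by \<open>a\<close> has not been explored yet.\<close>

lemma point_swap:
  assumes p: "p \<in> perm_tuples n" and K: "suffix_closed K"
    and jw: "(j, w) \<in> K" "(j, a # w) \<notin> K" "reduced (a # w)"
    and inj: "inj_on (point p v) K" and u': "u' \<notin> point p v ` K"
    and k: "k \<in> K"
  shows "point (swap_at p a (point p v (j, w)) u') v k = point p v k"
proof -
  let ?p = "swap_at p a (point p v (j, w)) u'"
  have "(j', w') \<in> K \<Longrightarrow> word_perm ?p w' (v j') = word_perm p w' (v j')" for j' w'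
  proof (induction w')
    case (Cons b w'')
    let ?s = "word_perm p w'' (v j')"
    have K': "(j', w'') \<in> K" using suffix_closedD[OF K Cons.prems] by blast
    then have IH: "word_perm ?p w'' (v j') = ?s" by (rule Cons.IH)
    have s: "?s = point p v (j', w'')" and t: "letter_perm p b ?s = point p v (j', b # w'')"
      by (simp_all add: point_def)
    have su': "?s \<noteq> u'" unfolding s using u' K' by blast
    have tu': "letter_perm p b ?s \<noteq> u'" unfolding t using u' Cons.prems by blast
    consider "fst b \<noteq> fst a" | "b = a" | "b = flip a" by (auto simp: flip_def prod_eq_iff)
    then have "letter_perm ?p b ?s = letter_perm p b ?s"
    proof cases
      case 1
      then show ?thesis by (simp add: letter_perm_swap_other)
    next
      case 2
      \<comment> \<open>Otherwise injectivity would make this step the unexplored one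
        \<open>(j, a # w)\<close>.\<close>
      have "?s \<noteq> point p v (j, w)"
      proof
        assume "?s = point p v (j, w)"
        then have "(j', w'') = (j, w)" unfolding s using inj K' jw(1) by (auto dest: inj_onD)
        then show False using Cons.prems jw(2) 2 by simp
      qed
      then show ?thesis using 2 su' by (simp add: letter_perm_swap[OF p] transpose_apply_other)
    next
      case 3
      \<comment> \<open>Reaching \<open>(j, w)\<close> by \<open>flip a\<close> would make
        \<open>w\<close> begin with \<open>flip a\<close>, against reducedness of
        \<open>a # w\<close>.\<close>
      have "letter_perm p b ?s \<noteq> point p v (j, w)"
      proof
        assume "letter_perm p b ?s = point p v (j, w)"
        then have "(j', b # w'') = (j, w)" unfolding t using inj Cons.prems jw(1) by (auto dest: inj_onD)
        then show False using jw(3) 3 by (auto simp: reduced_Cons)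
      qed
      then show ?thesis using 3 tu' by (simp add: letter_perm_swap_flip[OF p] transpose_apply_other)
    qed
    then show ?case by (simp add: IH)
  qed simp
  then show ?thesis using k by (cases k) (simp add: point_def)
qed

definition planted :: "nat \<Rightarrow> ('c \<Rightarrow> 'c \<Rightarrow> nat) \<Rightarrow> (nat \<Rightarrow> 'c) \<Rightarrow> 'a perms set" where
  "planted n N x = {p \<in> perm_tuples n. \<forall>i. ecount n x (x \<circ> p i) = N}"

lemma finite_planted [simp]: "finite (planted n N x :: ('a::finite \<Rightarrow> _) set)"
  by (simp add: planted_def)

text \<open>Exchanging two vertices with equal labels does not change \<open>x\<close>, so composing
  with the transposition on either side keeps all edge counts.\<close>

lemma swap_at_planted:
  assumes "p \<in> planted n N x" "u \<in> {1..n}" "u' \<in> {1..n}" "x u = x u'"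
  shows "swap_at p a u u' \<in> planted n N x"
proof -
  have xt: "x \<circ> Transposition.transpose u u' = x" using assms(4) by (auto simp: fun_eq_iff Transposition.transpose_def)
  have t: "Transposition.transpose u u' permutes {1..n}" using assms(2,3) by (rule permutes_swap_id)
  have "ecount n x (x \<circ> (p i \<circ> Transposition.transpose u u')) = ecount n x (x \<circ> p i)" for i
    using ecount_permute[OF t, of x "x \<circ> p i"] by (simp add: xt o_assoc)
  moreover have "x \<circ> (Transposition.transpose u u' \<circ> p i) = x \<circ> p i" for i
    by (simp add: o_assoc xt)
  ultimately show ?thesis
    using assms swap_at_perm_tuples[of p n u u' a] by (auto simp: planted_def swap_at_def)
qed

text \<open>Symmetry of \<open>N\<close> makes inverse letters behave like generators.\<close>

lemma card_letter_edges:
  assumes "p \<in> planted n N x" and sym: "\<And>s s'. N s s' = N s' s"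
  shows "card {v \<in> {1..n}. x v = s \<and> x (letter_perm p a v) = s'} = N s s'"
proof (cases a)
  case (Pair i b)
  have pi: "p i permutes {1..n}" and N: "ecount n x (x \<circ> p i) = N"
    using assms(1) by (auto simp: planted_def perm_tuples_def)
  have "ecount n x (x \<circ> inv_into UNIV (p i)) s s' = ecount n (x \<circ> p i) (x \<circ> inv_into UNIV (p i) \<circ> p i) s s'"
    by (simp add: ecount_permute[OF pi])
  also have "x \<circ> inv_into UNIV (p i) \<circ> p i = x"
    using permutes_inv_o[OF pi] by (simp add: o_assoc[symmetric])
  also have "ecount n (x \<circ> p i) x s s' = ecount n x (x \<circ> p i) s' s"
    by (auto simp: ecount_def intro!: arg_cong[where f = card])
  also have "\<dots> = N s s'" using N sym by metis
  finally have "ecount n x (x \<circ> inv_into UNIV (p i)) s s' = N s s'" .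
  then show ?thesis using Pair N by (cases b) (auto simp: ecount_def fun_eq_iff)
qed

definition seen :: "nat \<Rightarrow> ('c \<Rightarrow> 'c \<Rightarrow> nat) \<Rightarrow> (nat \<Rightarrow> 'c) \<Rightarrow> ('k \<Rightarrow> nat) \<Rightarrow> ('k \<times> 'a letter list \<Rightarrow> 'c) \<Rightarrow>
    ('k \<times> 'a letter list) set \<Rightarrow> 'a perms set" where
  "seen n N x v \<theta> K = {p \<in> planted n N x. inj_on (point p v) K \<and> (\<forall>k\<in>K. x (point p v k) = \<theta> k)}"

lemma finite_seen [simp]: "finite (seen n N x v \<theta> K :: ('a::finite \<Rightarrow> _) set)"
  by (simp add: seen_def)

text \<open>The switching \<open>(p, u') \<mapsto> (swap_at p a u u', u')\<close> with
  \<open>u\<close> the parent vertex is an involution, so it is injective on the pairs for which the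
  target of \<open>u'\<close> is a fresh vertex with the wanted label. Each \<open>p\<close> has at
  least \<open>N s s' - 2 |K|\<close> such \<open>u'\<close>, and each resulting tuple arises from
  at most as many as there are vertices with the label of the parent.\<close>

lemma card_seen_step:
  fixes K :: "('k \<times> 'a::finite letter list) set"
  assumes sym: "\<And>s s'. N s s' = N s' s" and K: "suffix_closed K" "finite K"
    and jw: "(j, w) \<in> K" "(j, a # w) \<notin> K" "reduced (a # w)" and v: "\<And>j. v j \<in> {1..n}"
  shows "real (card (seen n N x v \<theta> K)) * (real (N (\<theta> (j, w)) (\<theta> (j, a # w))) - 2 * real (card K))
     \<le> real (card (seen n N x v \<theta> (insert (j, a # w) K))) * real (vcount n x (\<theta> (j, w)))"
proof -
  define s where "s = \<theta> (j, w)"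
  define s' where "s' = \<theta> (j, a # w)"
  let ?E = "seen n N x v \<theta> K"
  let ?u = "\<lambda>p. point p v (j, w)"
  let ?X = "{u' \<in> {1..n}. x u' = s}"
  \<comment> \<open>\<open>A\<close> is the domain on which the switching is an involution, and
    \<open>A2\<close> the part on which the new leaf receives the prescribed label.\<close>
  define A where "A = Sigma ?E (\<lambda>p. ?X - point p v ` K)"
  define A2 where "A2 = Sigma ?E (\<lambda>p. {u' \<in> ?X - point p v ` K. letter_perm p a u' \<notin> point p v ` K \<and> x (letter_perm p a u') = s'})"
  define \<Phi> where "\<Phi> = (\<lambda>(p, u'). (swap_at p a (?u p) u', u'))"
  have pt: "p \<in> perm_tuples n" if "p \<in> ?E" for p
    using that by (auto simp: seen_def planted_def)
  have uin: "?u p \<in> {1..n}" if "p \<in> ?E" for p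
    using permutes_in_image[OF word_perm_permutes[OF pt[OF that]]] v by (simp add: point_def)
  have keep: "point (swap_at p a (?u p) u') v k = point p v k" if "(p, u') \<in> A" "k \<in> K" for p u' k
    using that by (intro point_swap[OF pt K(1) jw]) (auto simp: A_def seen_def)
  have keep_img: "point (swap_at p a (?u p) u') v ` K = point p v ` K" if "(p, u') \<in> A" for p u'
    using keep[OF that] by (rule image_cong[OF refl])
  have \<Phi>A: "\<Phi> z \<in> A" if "z \<in> A" for z
  proof -
    obtain p u' where z: "z = (p, u')" by force
    have p: "p \<in> ?E" and u': "u' \<in> ?X" using that z by (auto simp: A_def)
    have "swap_at p a (?u p) u' \<in> planted n N x"
      using p u' uin[OF p] jw(1) by (intro swap_at_planted) (auto simp: seen_def s_def)
    moreover have "inj_on (point (swap_at p a (?u p) u') v) K"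
      using p keep that z by (auto simp: seen_def cong: inj_on_cong)
    ultimately have "swap_at p a (?u p) u' \<in> ?E"
      using p keep that z by (auto simp: seen_def)
    then show ?thesis using that keep_img[of p u'] unfolding z by (auto simp: A_def \<Phi>_def)
  qed
  have \<Phi>\<Phi>: "\<Phi> (\<Phi> z) = z" if "z \<in> A" for z
  proof -
    obtain p u' where z: "z = (p, u')" by force
    show ?thesis using keep[of p u' "(j, w)"] that jw(1) by (simp add: z \<Phi>_def swap_at_twice)
  qed
  have A2A: "A2 \<subseteq> A" by (auto simp: A_def A2_def)
  have inj: "inj_on \<Phi> A2" using \<Phi>\<Phi> A2A by (metis inj_onI subsetD)
  have img: "\<Phi> ` A2 \<subseteq> seen n N x v \<theta> (insert (j, a # w) K) \<times> ?X"
  proof (rule image_subsetI)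
    fix z assume "z \<in> A2"
    then obtain p u' where z: "z = (p, u')" "(p, u') \<in> A" and p: "p \<in> ?E" and u': "u' \<in> ?X"
      and l: "letter_perm p a u' \<notin> point p v ` K" "x (letter_perm p a u') = s'"
      by (auto simp: A2_def A_def)
    let ?p = "swap_at p a (?u p) u'"
    have pE: "?p \<in> ?E" using \<Phi>A[OF z(2)] by (auto simp: \<Phi>_def A_def)
    have "point ?p v (j, a # w) = letter_perm ?p a (point ?p v (j, w))" by (simp add: point_def)
    also have "\<dots> = letter_perm p a u'"
      using keep[OF z(2) jw(1)] by (simp add: letter_perm_swap[OF pt[OF p]])
    finally have new: "point ?p v (j, a # w) = letter_perm p a u'" .
    have "inj_on (point ?p v) (insert (j, a # w) K)"
      using pE l(1) new keep_img[OF z(2)] by (auto simp: seen_def inj_on_insert)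
    then have "?p \<in> seen n N x v \<theta> (insert (j, a # w) K)"
      using pE new l(2) by (auto simp: seen_def s'_def)
    then show "\<Phi> z \<in> seen n N x v \<theta> (insert (j, a # w) K) \<times> ?X"
      using u' z by (auto simp: \<Phi>_def)
  qed
  have up: "card A2 \<le> card (seen n N x v \<theta> (insert (j, a # w) K)) * vcount n x s"
    using card_inj_on_le[OF inj img] by (simp add: card_cartesian_product vcount_def)
  have low: "real (N s s') - 2 * real (card K)
     \<le> real (card {u' \<in> ?X - point p v ` K. letter_perm p a u' \<notin> point p v ` K \<and> x (letter_perm p a u') = s'})"
    (is "_ \<le> real (card ?S)") if p: "p \<in> ?E" for p
  proof -
    let ?B = "{u' \<in> {1..n}. x u' = s \<and> x (letter_perm p a u') = s'}"
    let ?C = "letter_perm p a -` (point p v ` K)"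
    have B: "card ?B = N s s'" using p by (intro card_letter_edges sym) (auto simp: seen_def)
    have bij: "bij (letter_perm p a)" using letter_perm_permutes[OF pt[OF p]] by (rule permutes_bij)
    have C: "finite ?C" "card ?C \<le> card K"
      using bij K(2) by (auto simp: bij_def finite_vimageI card_vimage_inj card_image_le intro: order_trans[OF card_vimage_inj_on_le])
    \<comment> \<open>Edges of the right type are lost only if their source or their target is
      explored, at most \<open>card K\<close> of either kind.\<close>
    have "?B \<subseteq> ?S \<union> (point p v ` K \<union> ?C)" by auto
    then have "card ?B \<le> card (?S \<union> (point p v ` K \<union> ?C))"
      using C K(2) by (intro card_mono) auto
    also have "\<dots> \<le> card ?S + (card (point p v ` K) + card ?C)"
      by (meson card_Un_le add_left_mono order_trans)
    also have "\<dots> \<le> card ?S + (card K + card K)"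
      using C(2) card_image_le[OF K(2)] by (intro add_mono) auto
    finally show ?thesis using B by linarith
  qed
  have "real (card ?E) * (real (N s s') - 2 * real (card K)) = (\<Sum>p\<in>?E. real (N s s') - 2 * real (card K))"
    by simp
  also have "\<dots> \<le> (\<Sum>p\<in>?E. real (card {u' \<in> ?X - point p v ` K. letter_perm p a u' \<notin> point p v ` K \<and> x (letter_perm p a u') = s'}))"
    by (intro sum_mono low)
  also have "\<dots> = real (card A2)" unfolding A2_def by (subst card_SigmaI) auto
  also have "\<dots> \<le> real (card (seen n N x v \<theta> (insert (j, a # w) K))) * real (vcount n x s)"
    using up by (metis of_nat_le_iff of_nat_mult)
  finally show ?thesis unfolding s_def s'_def .
qed

text \<open>A lower bound for the conditional probability that a new child of a vertex labelled
  \<open>s\<close> is labelled \<open>s'\<close>. A uniform \<open>m\<close> replaces the current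
  size of the forest, and the cut at 0 keeps products of such bounds monotone.\<close>

definition step_ratio :: "('c \<Rightarrow> 'c \<Rightarrow> nat) \<Rightarrow> ('c \<Rightarrow> nat) \<Rightarrow> nat \<Rightarrow> 'c \<Rightarrow> 'c \<Rightarrow> real" where
  "step_ratio N c m s s' = max 0 ((real (N s s') - 2 * real m) / real (c s))"

text \<open>The forest is grown leaf by leaf from its roots, one switching step for each
  leaf.\<close>

lemma card_seen_ge:
  fixes K :: "('k::finite \<times> 'a::finite letter list) set"
  assumes sym: "\<And>s s'. N s s' = N s' s" and K: "suffix_closed K" "finite K" "card K \<le> m"
    and R: "range (\<lambda>j. (j, [])) \<subseteq> K"
    and v: "\<And>j. v j \<in> {1..n}" "inj v" "\<And>j. x (v j) = \<theta> (j, [])"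
  shows "real (card (seen n N x v \<theta> K)) \<ge>
     real (card (planted n N x :: 'a perms set)) *
     (\<Prod>k\<in>{k \<in> K. snd k \<noteq> []}. step_ratio N (vcount n x) m (\<theta> (fst k, tl (snd k))) (\<theta> k))"
  using K R
proof (induction "card K" arbitrary: K rule: less_induct)
  case less
  show ?case
  proof (cases "\<exists>k\<in>K. snd k \<noteq> []")
    case False
    then have "K \<subseteq> range (\<lambda>j. (j, []))" by (metis prod.collapse rangeI subsetI)
    then have KR: "K = range (\<lambda>j. (j, []))" using less.prems by auto
    have "seen n N x v \<theta> K = planted n N x"
      using v by (auto simp: seen_def KR point_def inj_on_def)
    moreover have "{k \<in> K. snd k \<noteq> []} = {}" using False by auto
    ultimately show ?thesis by (metis (no_types, lifting) mult.right_neutral order_refl prod.empty)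
  next
    case True
    \<comment> \<open>A longest word is a leaf, so its removal leaves a suffix-closed set.\<close>
    let ?L = "(\<lambda>k. length (snd k)) ` K"
    have "Max ?L \<in> ?L" using less.prems(2) True by (intro Max_in) auto
    then obtain h where h: "h \<in> K" "length (snd h) = Max ?L" by auto
    have hmax: "length (snd k) \<le> length (snd h)" if "k \<in> K" for k
      using that less.prems(2) h(2) by simp
    have "snd h \<noteq> []" using True hmax by fastforce
    then obtain j a w where hj: "h = (j, a # w)" by (metis list.exhaust prod.collapse)
    let ?K = "K - {h}"
    have jw: "(j, w) \<in> ?K" and red: "reduced (a # w)"
      using suffix_closedD[OF less.prems(1)] h(1) hj by auto
    have cl: "suffix_closed ?K"
      using less.prems(1) hmax hj unfolding suffix_closed_def by fastforce
    have cK: "card ?K < card K" using h(1) less.prems(2) by (meson card_Diff1_less)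
    have RK: "range (\<lambda>j. (j, [])) \<subseteq> ?K" using less.prems(4) hj by auto
    have IH: "real (card (planted n N x :: 'a perms set)) *
       (\<Prod>k\<in>{k \<in> ?K. snd k \<noteq> []}. step_ratio N (vcount n x) m (\<theta> (fst k, tl (snd k))) (\<theta> k)) \<le> real (card (seen n N x v \<theta> ?K))"
      using less.hyps[OF cK cl _ _ RK] less.prems(2,3) cK by auto
    have step: "real (card (seen n N x v \<theta> ?K)) * (real (N (\<theta> (j, w)) (\<theta> h)) - 2 * real (card ?K))
      \<le> real (card (seen n N x v \<theta> K)) * real (vcount n x (\<theta> (j, w)))"
      using card_seen_step[OF sym cl _ jw _ red v(1), where x = x and \<theta> = \<theta>] less.prems(2) hj h(1)
      by (auto simp: insert_absorb)
    let ?r = "step_ratio N (vcount n x) m (\<theta> (j, w)) (\<theta> h)"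
    have r: "real (card (seen n N x v \<theta> ?K)) * ?r \<le> real (card (seen n N x v \<theta> K))"
    proof (cases "real (N (\<theta> (j, w)) (\<theta> h)) - 2 * real m > 0 \<and> vcount n x (\<theta> (j, w)) > 0")
      case False
      then consider "real (N (\<theta> (j, w)) (\<theta> h)) - 2 * real m \<le> 0" | "vcount n x (\<theta> (j, w)) = 0" by linarith
      then have "?r = 0"
      proof cases
        case 1
        then have "(real (N (\<theta> (j, w)) (\<theta> h)) - 2 * real m) / real (vcount n x (\<theta> (j, w))) \<le> 0"
          by (rule divide_nonpos_nonneg) simp
        then show ?thesis unfolding step_ratio_def by (rule max_absorb1)
      qed (simp add: step_ratio_def)
      then show ?thesis by simp
    next
      case True
      then have "?r = (real (N (\<theta> (j, w)) (\<theta> h)) - 2 * real m) / real (vcount n x (\<theta> (j, w)))"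
        by (auto simp: step_ratio_def max_def)
      moreover have "real (card (seen n N x v \<theta> ?K)) * (real (N (\<theta> (j, w)) (\<theta> h)) - 2 * real m)
         \<le> real (card (seen n N x v \<theta> ?K)) * (real (N (\<theta> (j, w)) (\<theta> h)) - 2 * real (card ?K))"
        using cK less.prems(3) by (intro mult_left_mono) auto
      ultimately show ?thesis using step True by (simp add: divide_le_eq)
    qed
    have set: "{k \<in> K. snd k \<noteq> []} = insert h {k \<in> ?K. snd k \<noteq> []}" using h(1) hj by auto
    have "(\<Prod>k\<in>{k \<in> K. snd k \<noteq> []}. step_ratio N (vcount n x) m (\<theta> (fst k, tl (snd k))) (\<theta> k))
      = ?r * (\<Prod>k\<in>{k \<in> ?K. snd k \<noteq> []}. step_ratio N (vcount n x) m (\<theta> (fst k, tl (snd k))) (\<theta> k))"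
      unfolding set using less.prems(2) by (subst prod.insert) (auto simp: hj)
    then have "real (card (planted n N x :: 'a perms set)) * (\<Prod>k\<in>{k \<in> K. snd k \<noteq> []}. step_ratio N (vcount n x) m (\<theta> (fst k, tl (snd k))) (\<theta> k))
      \<le> real (card (seen n N x v \<theta> ?K)) * ?r"
      using mult_right_mono[OF IH, of ?r] by (simp add: step_ratio_def mult_ac)
    also note r
    finally show ?thesis .
  qed
qed

section \<open>Concentration for tuples of permutations\<close>

text \<open>Meant for centred variables: the linear term averages out and a Gaussian factor remains,
  with no restriction on the size of \<open>x\<close>.\<close>

lemma exp_le_add_exp_square: "exp x \<le> x + exp (x\<^sup>2)" for x :: real
proof -
  have sq: "1 + x\<^sup>2 \<le> exp (x\<^sup>2)" by (rule exp_ge_add_one_self)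
  consider "x \<ge> 1" | "0 \<le> x" "x \<le> 1" | "-1 \<le> x" "x \<le> 0" | "x \<le> -1" by linarith
  then show ?thesis
  proof cases
    case 1
    then have "x \<le> x\<^sup>2" by (simp add: power2_eq_square)
    then have "exp x \<le> exp (x\<^sup>2)" by simp
    then show ?thesis using 1 by linarith
  next
    case 2
    then show ?thesis using exp_bound[of x] sq by linarith
  next
    case 3
    \<comment> \<open>Multiplying this bound by \<open>1 + x + x\<^sup>2\<close> yields
      \<open>exp x \<le> 1 + x + x\<^sup>2\<close> on the interval from -1 to 0.\<close>
    have "1 + (-x) + (-x)\<^sup>2 / 2 \<le> exp (-x)" using 3 by (intro exp_lower_Taylor_quadratic) auto
    moreover have "1 + x + x\<^sup>2 = (x + 1 / 2)\<^sup>2 + 3 / 4" by (simp add: power2_eq_square algebra_simps)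
    then have "1 + x + x\<^sup>2 \<ge> 0" by simp
    ultimately have "(1 + x + x\<^sup>2) * (1 + (-x) + (-x)\<^sup>2 / 2) \<le> (1 + x + x\<^sup>2) * exp (-x)"
      by (intro mult_left_mono)
    moreover have "(1 + x + x\<^sup>2) * (1 + (-x) + (-x)\<^sup>2 / 2) = 1 + x\<^sup>2 / 2 + (-x) * x\<^sup>2 / 2 + x ^ 4 / 2"
      by (simp add: algebra_simps power2_eq_square power4_eq_xxxx add_divide_distrib diff_divide_distrib)
    moreover have "(-x) * x\<^sup>2 \<ge> 0" using 3 by (intro mult_nonneg_nonneg) auto
    moreover have "x\<^sup>2 \<ge> 0" "x ^ 4 \<ge> 0" by auto
    ultimately have "1 \<le> (1 + x + x\<^sup>2) * exp (-x)" by linarith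
    then have "exp x \<le> 1 + x + x\<^sup>2" by (simp add: exp_minus field_simps)
    then show ?thesis using sq by linarith
  next
    case 4
    then have "x * (x + 1) \<ge> 0" by (intro mult_nonpos_nonpos) auto
    then have "x\<^sup>2 + x \<ge> 0" by (simp add: power2_eq_square algebra_simps)
    moreover have "exp x \<le> 1" using 4 by simp
    ultimately show ?thesis using sq by linarith
  qed
qed

definition perm_avg :: "'v set \<Rightarrow> (('v \<Rightarrow> 'v) \<Rightarrow> real) \<Rightarrow> real" where
  "perm_avg S f = (\<Sum>p | p permutes S. f p) / fact (card S)"

lemma perm_avg_mono: "finite S \<Longrightarrow> (\<And>p. p permutes S \<Longrightarrow> f p \<le> g p) \<Longrightarrow> perm_avg S f \<le> perm_avg S g"
  unfolding perm_avg_def by (intro divide_right_mono sum_mono) auto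

lemma perm_avg_const: "finite S \<Longrightarrow> perm_avg S (\<lambda>_. c) = c"
  by (simp add: perm_avg_def card_permutations)

lemma perm_avg_diff: "perm_avg S (\<lambda>p. f p - g p) = perm_avg S f - perm_avg S g"
  by (simp add: perm_avg_def sum_subtractf diff_divide_distrib)

lemma perm_avg_cmult: "perm_avg S (\<lambda>p. c * f p) = c * perm_avg S f"
  by (simp add: perm_avg_def sum_distrib_left)

lemma perm_avg_abs_diff:
  assumes "finite S" "\<And>p. p permutes S \<Longrightarrow> \<bar>f p - g p\<bar> \<le> c"
  shows "\<bar>perm_avg S f - perm_avg S g\<bar> \<le> c"
proof -
  have "perm_avg S (\<lambda>p. f p - g p) \<le> perm_avg S (\<lambda>_. c)" "perm_avg S (\<lambda>_. - c) \<le> perm_avg S (\<lambda>p. f p - g p)"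
    using assms(2) by (intro perm_avg_mono[OF assms(1)]; force simp: abs_le_iff)+
  then show ?thesis by (simp add: perm_avg_diff perm_avg_const assms(1) abs_le_iff)
qed

text \<open>A uniform permutation of \<open>insert a S\<close> is a uniform permutation of
  \<open>S\<close> followed by the transposition of \<open>a\<close> with a uniform element. This is
  the exposure step of the martingale argument.\<close>

lemma perm_avg_insert:
  assumes "finite S" "a \<notin> S"
  shows "perm_avg (insert a S) f = (\<Sum>b\<in>insert a S. perm_avg S (\<lambda>q. f (Transposition.transpose a b \<circ> q))) / real (card (insert a S))"
  unfolding perm_avg_def sum_over_permutations_insert[OF assms]
  using assms by (simp add: sum_divide_distrib[symmetric] mult.commute)

lemma transpose_commute_swap:
  "Transposition.transpose a b (Transposition.transpose x y z)
   = Transposition.transpose (Transposition.transpose a b x) (Transposition.transpose a b y) (Transposition.transpose a b z)"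
  by (auto simp: Transposition.transpose_def)

text \<open>Azuma's inequality as an induction: exposing one choice \<open>b\<close> moves the
  conditional mean \<open>A b\<close> by at most \<open>2 c\<close> from the overall mean, and
  squaring gives the factor 4 in the exponent.\<close>

lemma perm_avg_mgf:
  assumes "finite S" "c \<ge> 0"
    and "\<And>p x y. p permutes S \<Longrightarrow> x \<in> S \<Longrightarrow> y \<in> S \<Longrightarrow> \<bar>f (Transposition.transpose x y \<circ> p) - f p\<bar> \<le> c"
  shows "perm_avg S (\<lambda>p. exp (l * (f p - perm_avg S f))) \<le> exp (4 * l\<^sup>2 * c\<^sup>2 * real (card S))"
  using assms(1,3)
proof (induction S arbitrary: f rule: finite_induct)
  case empty
  then show ?case by (simp add: perm_avg_def)
next
  case (insert a S)
  let ?fb = "\<lambda>b q. f (Transposition.transpose a b \<circ> q)"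
  define A where "A b = perm_avg S (?fb b)" for b
  define B where "B = perm_avg (insert a S) f"
  let ?m = "real (card (insert a S))"
  have m: "?m > 0" using insert by simp
  have BA: "B = (\<Sum>b\<in>insert a S. A b) / ?m"
    unfolding B_def A_def by (rule perm_avg_insert) (use insert in auto)
  have perm_in: "q permutes insert a S" if "q permutes S" for q
    using that by (rule permutes_subset) auto
  have lip: "\<bar>?fb b (Transposition.transpose x y \<circ> q) - ?fb b q\<bar> \<le> c"
    if "b \<in> insert a S" "q permutes S" "x \<in> S" "y \<in> S" for b q x y
  proof -
    let ?t = "Transposition.transpose a b"
    have t: "?t permutes insert a S" using that(1) by (intro permutes_swap_id) auto
    \<comment> \<open>Moving the inner transposition past the outer one conjugates it into a
      transposition of elements of \<open>insert a S\<close>, to which the Lipschitz hypothesis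
      applies.\<close>
    have eq: "?t \<circ> (Transposition.transpose x y \<circ> q) = Transposition.transpose (?t x) (?t y) \<circ> (?t \<circ> q)"
      by (auto simp: fun_eq_iff intro: transpose_commute_swap)
    have p: "?t \<circ> q permutes insert a S" using perm_in[OF that(2)] t by (rule permutes_compose)
    have m: "?t x \<in> insert a S" "?t y \<in> insert a S"
      using permutes_in_image[OF t] that(3,4) by auto
    show ?thesis unfolding eq by (rule insert.prems[OF p m])
  qed
  have IH: "perm_avg S (\<lambda>q. exp (l * (?fb b q - A b))) \<le> exp (4 * l\<^sup>2 * c\<^sup>2 * real (card S))"
    if "b \<in> insert a S" for b
    unfolding A_def by (rule insert.IH) (rule lip[OF that])
  \<comment> \<open>Here the Lipschitz hypothesis is applied to the transposition of
    \<open>a\<close> and \<open>b\<close> itself.\<close>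
  have near: "\<bar>A b - perm_avg S f\<bar> \<le> c" if "b \<in> insert a S" for b
    unfolding A_def by (rule perm_avg_abs_diff[OF insert.hyps(1)]) (rule insert.prems[OF perm_in insertI1 that])
  have AB: "\<bar>A b - B\<bar> \<le> 2 * c" if "b \<in> insert a S" for b
  proof -
    have "\<bar>B - perm_avg S f\<bar> = \<bar>\<Sum>b\<in>insert a S. A b - perm_avg S f\<bar> / ?m"
      using m by (simp add: BA sum_subtractf divide_simps mult.commute)
    also have "\<dots> \<le> (\<Sum>b\<in>insert a S. c) / ?m"
      by (intro divide_right_mono order_trans[OF sum_abs] sum_mono near) auto
    also have "\<dots> = c" using m by simp
    finally show ?thesis using near[OF that] by linarith
  qed
  have split: "exp (l * (?fb b q - B)) = exp (l * (A b - B)) * exp (l * (?fb b q - A b))" for b q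
    by (simp add: exp_add[symmetric] algebra_simps)
  have avgA: "(\<Sum>b\<in>insert a S. exp (l * (A b - B))) / ?m \<le> exp (4 * l\<^sup>2 * c\<^sup>2)"
  proof -
    have "(\<Sum>b\<in>insert a S. exp (l * (A b - B))) \<le> (\<Sum>b\<in>insert a S. l * (A b - B) + exp (4 * l\<^sup>2 * c\<^sup>2))"
    proof (rule sum_mono)
      fix b assume b: "b \<in> insert a S"
      have "(A b - B)\<^sup>2 \<le> (2 * c)\<^sup>2" using AB[OF b] assms(2) by (metis abs_le_square_iff abs_of_nonneg mult_nonneg_nonneg zero_le_numeral)
      then have "l\<^sup>2 * (A b - B)\<^sup>2 \<le> l\<^sup>2 * (2 * c)\<^sup>2" by (rule mult_left_mono) simp
      then have "exp ((l * (A b - B))\<^sup>2) \<le> exp (4 * l\<^sup>2 * c\<^sup>2)" by (simp add: power_mult_distrib mult_ac)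
      then show "exp (l * (A b - B)) \<le> l * (A b - B) + exp (4 * l\<^sup>2 * c\<^sup>2)"
        using exp_le_add_exp_square[of "l * (A b - B)"] by linarith
    qed
    also have "\<dots> = l * ((\<Sum>b\<in>insert a S. A b) - ?m * B) + ?m * exp (4 * l\<^sup>2 * c\<^sup>2)"
      by (simp only: sum.distrib sum_distrib_left[symmetric] sum_subtractf sum_constant)
    also have "\<dots> = ?m * exp (4 * l\<^sup>2 * c\<^sup>2)" using m by (simp add: BA)
    finally show ?thesis using m by (simp add: divide_le_eq mult.commute)
  qed
  have "perm_avg (insert a S) (\<lambda>p. exp (l * (f p - B)))
      = (\<Sum>b\<in>insert a S. exp (l * (A b - B)) * perm_avg S (\<lambda>q. exp (l * (?fb b q - A b)))) / ?m"
    by (simp only: perm_avg_insert[OF insert.hyps] split perm_avg_cmult)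
  also have "\<dots> \<le> (\<Sum>b\<in>insert a S. exp (l * (A b - B)) * exp (4 * l\<^sup>2 * c\<^sup>2 * real (card S))) / ?m"
    by (intro divide_right_mono sum_mono mult_left_mono IH) auto
  also have "\<dots> = (\<Sum>b\<in>insert a S. exp (l * (A b - B))) / ?m * exp (4 * l\<^sup>2 * c\<^sup>2 * real (card S))"
    by (simp add: sum_distrib_right)
  also have "\<dots> \<le> exp (4 * l\<^sup>2 * c\<^sup>2) * exp (4 * l\<^sup>2 * c\<^sup>2 * real (card S))"
    by (intro mult_right_mono avgA) auto
  also have "\<dots> = exp (4 * l\<^sup>2 * c\<^sup>2 * real (card (insert a S)))"
    using insert.hyps by (simp add: exp_add[symmetric] algebra_simps)
  finally show ?case unfolding B_def .
qed

text \<open>Averages over tuples indexed by a subset \<open>I\<close>, so that coordinates can be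
  exposed one at a time.\<close>

definition PiE_avg :: "nat \<Rightarrow> 'a set \<Rightarrow> ('a perms \<Rightarrow> real) \<Rightarrow> real" where
  "PiE_avg n I f = (\<Sum>p\<in>(I \<rightarrow>\<^sub>E {q. q permutes {1..n}}). f p) / fact n ^ card I"

lemma PiE_avg_insert:
  assumes "finite I" "i \<notin> I"
  shows "PiE_avg n (insert i I) f = PiE_avg n I (\<lambda>p. perm_avg {1..n} (\<lambda>q. f (p(i := q))))"
proof -
  let ?P = "{q. q permutes {1..n}}"
  have "(\<Sum>p\<in>(insert i I \<rightarrow>\<^sub>E ?P). f p) = (\<Sum>(q, p)\<in>?P \<times> (I \<rightarrow>\<^sub>E ?P). f (p(i := q)))"
    unfolding PiE_insert_eq using assms(2)
    by (subst sum.reindex[OF inj_combinator]) (auto simp: case_prod_unfold)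
  also have "\<dots> = (\<Sum>p\<in>(I \<rightarrow>\<^sub>E ?P). \<Sum>q\<in>?P. f (p(i := q)))"
    by (subst sum.cartesian_product[symmetric], rule sum.swap)
  finally show ?thesis using assms by (simp add: PiE_avg_def perm_avg_def sum_divide_distrib[symmetric])
qed

lemma PiE_avg_mono: "(\<And>p. p \<in> (I \<rightarrow>\<^sub>E {q. q permutes {1..n}}) \<Longrightarrow> f p \<le> g p) \<Longrightarrow> PiE_avg n I f \<le> PiE_avg n I g"
  unfolding PiE_avg_def by (intro divide_right_mono sum_mono) auto

lemma PiE_avg_cmult: "PiE_avg n I (\<lambda>p. f p * c) = PiE_avg n I f * c"
  by (simp add: PiE_avg_def sum_distrib_right)

text \<open>Averaging out one coordinate costs the factor of \<open>perm_avg_mgf\<close> and leaves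
  a function of the other coordinates with the same Lipschitz constant.\<close>

lemma PiE_avg_mgf:
  assumes "finite I" "c \<ge> 0"
    and "\<And>p i x y. p \<in> (I \<rightarrow>\<^sub>E {q. q permutes {1..n}}) \<Longrightarrow> i \<in> I \<Longrightarrow> x \<in> {1..n} \<Longrightarrow> y \<in> {1..n} \<Longrightarrow>
      \<bar>f (p(i := Transposition.transpose x y \<circ> p i)) - f p\<bar> \<le> c"
  shows "PiE_avg n I (\<lambda>p. exp (l * (f p - PiE_avg n I f))) \<le> exp (4 * l\<^sup>2 * c\<^sup>2 * real n * real (card I))"
  using assms(1,3)
proof (induction I arbitrary: f rule: finite_induct)
  case empty
  then show ?case by (simp add: PiE_avg_def)
next
  case (insert i I)
  let ?P = "{q. q permutes {1..n}}"
  define g where "g p = perm_avg {1..n} (\<lambda>q. f (p(i := q)))" for p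
  have B: "PiE_avg n (insert i I) f = PiE_avg n I g"
    unfolding g_def by (rule PiE_avg_insert) (use insert in auto)
  have upd: "p(i := q) \<in> (insert i I \<rightarrow>\<^sub>E ?P)" if "p \<in> (I \<rightarrow>\<^sub>E ?P)" "q permutes {1..n}" for p q
    using that by (auto simp: PiE_insert_eq)
  have lip1: "\<bar>f (p(i := Transposition.transpose x y \<circ> q)) - f (p(i := q))\<bar> \<le> c"
    if "p \<in> (I \<rightarrow>\<^sub>E ?P)" "q permutes {1..n}" "x \<in> {1..n}" "y \<in> {1..n}" for p q x y
    using insert.prems[OF upd[OF that(1,2)] insertI1 that(3,4)] by (simp only: fun_upd_same fun_upd_upd)
  have inner: "perm_avg {1..n} (\<lambda>q. exp (l * (f (p(i := q)) - g p))) \<le> exp (4 * l\<^sup>2 * c\<^sup>2 * real n)"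
    if "p \<in> (I \<rightarrow>\<^sub>E ?P)" for p
    using perm_avg_mgf[of "{1..n}" c "\<lambda>q. f (p(i := q))" l] lip1[OF that] assms(2) by (simp add: g_def)
  have lipg: "\<bar>g (p(j := Transposition.transpose x y \<circ> p j)) - g p\<bar> \<le> c"
    if p: "p \<in> (I \<rightarrow>\<^sub>E ?P)" and j: "j \<in> I" "x \<in> {1..n}" "y \<in> {1..n}" for p j x y
    unfolding g_def
  proof (rule perm_avg_abs_diff)
    fix q assume q: "q permutes {1..n}"
    have "i \<noteq> j" using j insert.hyps by auto
    then have eq: "(p(j := Transposition.transpose x y \<circ> p j))(i := q) = (p(i := q))(j := Transposition.transpose x y \<circ> (p(i := q)) j)"
      by (auto simp: fun_eq_iff)
    show "\<bar>f ((p(j := Transposition.transpose x y \<circ> p j))(i := q)) - f (p(i := q))\<bar> \<le> c"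
      unfolding eq by (rule insert.prems[OF upd[OF p q] insertI2[OF j(1)] j(2,3)])
  qed simp
  have split: "exp (l * (f (p(i := q)) - PiE_avg n I g)) = exp (l * (g p - PiE_avg n I g)) * exp (l * (f (p(i := q)) - g p))" for p q
    by (simp add: exp_add[symmetric] algebra_simps)
  have "PiE_avg n (insert i I) (\<lambda>p. exp (l * (f p - PiE_avg n I g)))
      = PiE_avg n I (\<lambda>p. exp (l * (g p - PiE_avg n I g)) * perm_avg {1..n} (\<lambda>q. exp (l * (f (p(i := q)) - g p))))"
    by (simp only: PiE_avg_insert[OF insert.hyps] split perm_avg_cmult)
  also have "\<dots> \<le> PiE_avg n I (\<lambda>p. exp (l * (g p - PiE_avg n I g)) * exp (4 * l\<^sup>2 * c\<^sup>2 * real n))"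
    by (intro PiE_avg_mono mult_left_mono inner) auto
  also have "\<dots> \<le> exp (4 * l\<^sup>2 * c\<^sup>2 * real n * real (card I)) * exp (4 * l\<^sup>2 * c\<^sup>2 * real n)"
    unfolding PiE_avg_cmult by (intro mult_right_mono insert.IH lipg) auto
  also have "\<dots> = exp (4 * l\<^sup>2 * c\<^sup>2 * real n * real (card (insert i I)))"
    using insert.hyps by (simp add: exp_add[symmetric] algebra_simps)
  finally show ?case unfolding B .
qed

lemma tuple_concentration:
  fixes f :: "'a::finite perms \<Rightarrow> real"
  assumes "c > 0" "s > 0"
    and lip: "\<And>p i x y. p \<in> perm_tuples n \<Longrightarrow> x \<in> {1..n} \<Longrightarrow> y \<in> {1..n} \<Longrightarrow>
      \<bar>f (p(i := Transposition.transpose x y \<circ> p i)) - f p\<bar> \<le> c"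
  shows "real (card {p \<in> perm_tuples n. f p \<ge> tuple_avg n f + s * real n})
     \<le> real (card (perm_tuples n :: 'a perms set)) * exp (- (s\<^sup>2 / (16 * c\<^sup>2 * real CARD('a))) * real n)"
proof -
  let ?P = "perm_tuples n :: 'a perms set"
  let ?r = "real CARD('a)"
  \<comment> \<open>The minimizer of \<open>4 * l\<^sup>2 * c\<^sup>2 * ?r - l * s\<close>.\<close>
  define l where "l = s / (8 * c\<^sup>2 * ?r)"
  have l: "l > 0" using assms by (simp add: l_def)
  have avg: "PiE_avg n UNIV g = tuple_avg n g" for g :: "'a perms \<Rightarrow> real"
    by (simp add: PiE_avg_def tuple_avg_def card_perm_tuples perm_tuples_PiE[symmetric])
  have "real (card {p \<in> ?P. f p \<ge> tuple_avg n f + s * real n}) * exp (l * (s * real n))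
      = (\<Sum>p\<in>{p \<in> ?P. f p \<ge> tuple_avg n f + s * real n}. exp (l * (s * real n)))" by simp
  also have "\<dots> \<le> (\<Sum>p\<in>{p \<in> ?P. f p \<ge> tuple_avg n f + s * real n}. exp (l * (f p - tuple_avg n f)))"
    using l by (intro sum_mono) (auto intro!: mult_left_mono)
  also have "\<dots> \<le> (\<Sum>p\<in>?P. exp (l * (f p - tuple_avg n f)))"
    by (intro sum_mono2) auto
  also have "\<dots> = real (card ?P) * tuple_avg n (\<lambda>p. exp (l * (f p - tuple_avg n f)))"
    using card_perm_tuples_pos[of n, where 'a = 'a] by (simp add: tuple_avg_def)
  also have "\<dots> \<le> real (card ?P) * exp (4 * l\<^sup>2 * c\<^sup>2 * real n * ?r)"
    using PiE_avg_mgf[of UNIV c n f l] lip assms(1) unfolding avg perm_tuples_PiE[symmetric]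
    by (intro mult_left_mono) auto
  finally have "real (card {p \<in> ?P. f p \<ge> tuple_avg n f + s * real n}) \<le> real (card ?P) * exp (4 * l\<^sup>2 * c\<^sup>2 * real n * ?r) / exp (l * (s * real n))"
    by (simp add: pos_le_divide_eq)
  also have "\<dots> = real (card ?P) * exp (4 * l\<^sup>2 * c\<^sup>2 * real n * ?r - l * (s * real n))"
    by (simp add: exp_diff)
  also have "4 * l\<^sup>2 * c\<^sup>2 * real n * ?r - l * (s * real n) = - (s\<^sup>2 / (16 * c\<^sup>2 * ?r)) * real n"
    using assms(1) by (simp add: l_def field_simps power2_eq_square)
  finally show ?thesis .
qed

section \<open>Local statistics of planted tuples\<close>

definition word_tree :: "'a letter list set \<Rightarrow> bool" where
  "word_tree T \<longleftrightarrow> finite T \<and> [] \<in> T \<and> (\<forall>w\<in>T. reduced w) \<and> (\<forall>a w. a # w \<in> T \<longrightarrow> w \<in> T)"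

definition hits :: "nat \<Rightarrow> 'a perms \<Rightarrow> (nat \<Rightarrow> 'c) \<Rightarrow> 'a letter list set \<Rightarrow> ('a letter list \<Rightarrow> 'c) \<Rightarrow> nat" where
  "hits n p x T \<eta> = card {v \<in> {1..n}. \<forall>w\<in>T. x (word_perm p w v) = \<eta> w}"

definition tree_ratio :: "('c \<Rightarrow> 'c \<Rightarrow> nat) \<Rightarrow> ('c \<Rightarrow> nat) \<Rightarrow> nat \<Rightarrow> 'a letter list set \<Rightarrow> ('a letter list \<Rightarrow> 'c) \<Rightarrow> real" where
  "tree_ratio N c m T \<eta> = (\<Prod>w\<in>T - {[]}. step_ratio N c m (\<eta> (tl w)) (\<eta> w))"

lemma step_ratio_nonneg [simp]: "step_ratio N c m s s' \<ge> 0"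
  by (simp add: step_ratio_def)

lemma tree_ratio_nonneg [simp]: "tree_ratio N c m T \<eta> \<ge> 0"
  by (simp add: tree_ratio_def prod_nonneg)

lemma suffix_closed_tree: "word_tree T \<Longrightarrow> suffix_closed (UNIV \<times> T)"
  unfolding suffix_closed_def word_tree_def by blast

lemma sum_hits:
  fixes T :: "'a letter list set" and x :: "nat \<Rightarrow> 'c::finite"
  assumes "finite T"
  shows "(\<Sum>\<eta>\<in>(T \<rightarrow>\<^sub>E UNIV). hits n p x T \<eta>) = n"
proof -
  have "(\<Sum>\<eta>\<in>(T \<rightarrow>\<^sub>E UNIV). hits n p x T \<eta>)
      = card (\<Union>\<eta>\<in>(T \<rightarrow>\<^sub>E UNIV). {v \<in> {1..n}. \<forall>w\<in>T. x (word_perm p w v) = \<eta> w})"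
    unfolding hits_def
  proof (subst card_UN_disjoint)
    show "finite (T \<rightarrow>\<^sub>E (UNIV :: 'c set))" using assms by (intro finite_PiE) auto
    show "\<forall>\<eta>\<in>T \<rightarrow>\<^sub>E UNIV. \<forall>\<eta>'\<in>T \<rightarrow>\<^sub>E UNIV. \<eta> \<noteq> \<eta>' \<longrightarrow>
      {v \<in> {1..n}. \<forall>w\<in>T. x (word_perm p w v) = \<eta> w} \<inter> {v \<in> {1..n}. \<forall>w\<in>T. x (word_perm p w v) = \<eta>' w} = {}"
    proof (intro ballI impI)
      fix \<eta> \<eta>' :: "'a letter list \<Rightarrow> 'c" assume "\<eta> \<in> T \<rightarrow>\<^sub>E UNIV" "\<eta>' \<in> T \<rightarrow>\<^sub>E UNIV" "\<eta> \<noteq> \<eta>'"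
      then obtain w where "w \<in> T" "\<eta> w \<noteq> \<eta>' w" by (meson PiE_ext)
      then show "{v \<in> {1..n}. \<forall>w\<in>T. x (word_perm p w v) = \<eta> w} \<inter> {v \<in> {1..n}. \<forall>w\<in>T. x (word_perm p w v) = \<eta>' w} = {}"
        by auto
    qed
  qed auto
  also have "(\<Union>\<eta>\<in>(T \<rightarrow>\<^sub>E UNIV). {v \<in> {1..n}. \<forall>w\<in>T. x (word_perm p w v) = \<eta> w}) = {1..n}"
  proof (intro equalityI subsetI)
    fix v assume "v \<in> {1..n}"
    then show "v \<in> (\<Union>\<eta>\<in>(T \<rightarrow>\<^sub>E UNIV). {v \<in> {1..n}. \<forall>w\<in>T. x (word_perm p w v) = \<eta> w})"
      by (intro UN_I[of "restrict (\<lambda>w. x (word_perm p w v)) T"]) auto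
  qed auto
  finally show ?thesis by simp
qed

text \<open>Two trees are explored simultaneously, as one forest with roots indexed by
  \<open>bool\<close>, so the joint probability is nearly a product. Subtracting
  \<open>real n\<close> removes the pairs with equal roots.\<close>

lemma sum_hits_product_ge:
  fixes N :: "'c \<Rightarrow> 'c \<Rightarrow> nat" and T :: "'a::finite letter list set" and x :: "nat \<Rightarrow> 'c" and n :: nat
  assumes sym: "\<And>s s'. N s s' = N s' s" and T: "word_tree T"
  defines "c \<equiv> vcount n x" and "P \<equiv> planted n N x :: 'a perms set"
  shows "(\<Sum>p\<in>P. real (hits n p x T \<eta>) * real (hits n p x T \<eta>'))
     \<ge> real (card P) * ((real (c (\<eta> [])) * real (c (\<eta>' [])) - real n) * (tree_ratio N c (2 * card T) T \<eta> * tree_ratio N c (2 * card T) T \<eta>'))"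
proof -
  let ?H = "\<lambda>p \<eta>. {v \<in> {1..n}. \<forall>w\<in>T. x (word_perm p w v) = \<eta> w}"
  let ?\<theta> = "\<lambda>k :: bool \<times> 'a letter list. if fst k then \<eta> (snd k) else \<eta>' (snd k)"
  let ?v = "\<lambda>v v' j. if j then v else v' :: nat"
  let ?K = "UNIV \<times> T :: (bool \<times> 'a letter list) set"
  let ?Q = "{(v, v'). v \<in> {1..n} \<and> v' \<in> {1..n} \<and> x v = \<eta> [] \<and> x v' = \<eta>' [] \<and> v \<noteq> v'}"
  let ?S = "\<lambda>(v, v'). seen n N x (?v v v') ?\<theta> ?K :: 'a perms set"
  let ?R = "tree_ratio N c (2 * card T) T \<eta> * tree_ratio N c (2 * card T) T \<eta>'"
  have finT: "finite T" and T0: "[] \<in> T" using T by (auto simp: word_tree_def)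
  have finQ: "finite ?Q" by (rule finite_subset[of _ "{1..n} \<times> {1..n}"]) auto
  have cardK: "card ?K = 2 * card T" by (simp add: card_cartesian_product UNIV_bool)
  have prod: "(\<Prod>k\<in>{k \<in> ?K. snd k \<noteq> []}. step_ratio N c (2 * card T) (?\<theta> (fst k, tl (snd k))) (?\<theta> k)) = ?R"
  proof -
    have "{k \<in> ?K. snd k \<noteq> []} = UNIV \<times> (T - {[]})" by auto
    then have "(\<Prod>k\<in>{k \<in> ?K. snd k \<noteq> []}. step_ratio N c (2 * card T) (?\<theta> (fst k, tl (snd k))) (?\<theta> k))
      = (\<Prod>j\<in>UNIV. \<Prod>w\<in>T - {[]}. step_ratio N c (2 * card T) (?\<theta> (j, tl w)) (?\<theta> (j, w)))"
      by (simp add: prod.cartesian_product case_prod_unfold cong: if_cong)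
    then show ?thesis by (simp add: UNIV_bool tree_ratio_def mult.commute)
  qed
  have S: "real (card (?S q)) \<ge> real (card P) * ?R" if q: "q \<in> ?Q" for q
  proof -
    obtain v v' where vv: "q = (v, v')" by force
    have "real (card (planted n N x :: 'a perms set)) *
        (\<Prod>k\<in>{k \<in> ?K. snd k \<noteq> []}. step_ratio N (vcount n x) (2 * card T) (?\<theta> (fst k, tl (snd k))) (?\<theta> k))
        \<le> real (card (seen n N x (?v v v') ?\<theta> ?K :: 'a perms set))"
    proof (rule card_seen_ge[OF sym suffix_closed_tree[OF T]])
      show "finite ?K" using finT by simp
      show "card ?K \<le> 2 * card T" by (simp add: cardK)
      show "range (\<lambda>j. (j, [])) \<subseteq> ?K" using T0 by auto
      show "inj (?v v v')" using q by (auto simp: vv inj_def)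
    qed (use q in \<open>auto simp: vv\<close>)
    then show ?thesis unfolding P_def[symmetric] c_def[symmetric] prod by (simp add: vv)
  qed
  have sub: "{q \<in> ?Q. p \<in> ?S q} \<subseteq> ?H p \<eta> \<times> ?H p \<eta>'" for p
  proof
    fix q assume q: "q \<in> {q \<in> ?Q. p \<in> ?S q}"
    obtain v v' where vv: "q = (v, v')" by force
    have "\<forall>k\<in>?K. x (point p (?v v v') k) = ?\<theta> k" using q by (simp add: vv seen_def)
    then have "x (point p (?v v v') (True, w)) = ?\<theta> (True, w)" "x (point p (?v v v') (False, w)) = ?\<theta> (False, w)"
      if "w \<in> T" for w using that by blast+
    then show "q \<in> ?H p \<eta> \<times> ?H p \<eta>'" using q by (simp add: vv point_def)
  qed
  have finP: "finite P" by (simp add: P_def)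
  have Q: "real (card ?Q) \<ge> real (c (\<eta> [])) * real (c (\<eta>' [])) - real n"
  proof -
    let ?A = "{v \<in> {1..n}. x v = \<eta> []} \<times> {v \<in> {1..n}. x v = \<eta>' []}"
    have "?A \<subseteq> ?Q \<union> (\<lambda>v. (v, v)) ` {1..n}" by auto
    then have "card ?A \<le> card (?Q \<union> (\<lambda>v. (v, v)) ` {1..n})"
      using finQ by (intro card_mono) auto
    also have "\<dots> \<le> card ?Q + n"
      by (rule order_trans[OF card_Un_le]) (use card_image_le[of "{1..n}" "\<lambda>v. (v, v)"] in auto)
    finally have "c (\<eta> []) * c (\<eta>' []) \<le> card ?Q + n"
      by (simp add: card_cartesian_product c_def vcount_def)
    then have "real (c (\<eta> []) * c (\<eta>' [])) \<le> real (card ?Q + n)" by (simp only: of_nat_le_iff)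
    then show ?thesis by simp
  qed
  have "real (card P) * ((real (c (\<eta> [])) * real (c (\<eta>' [])) - real n) * ?R)
      \<le> real (card P) * (real (card ?Q) * ?R)"
    by (intro mult_left_mono mult_right_mono Q) auto
  also have "\<dots> = (\<Sum>q\<in>?Q. real (card P) * ?R)" by simp
  also have "\<dots> \<le> (\<Sum>q\<in>?Q. real (card (?S q)))" by (intro sum_mono S)
  also have "\<dots> = (\<Sum>q\<in>?Q. \<Sum>p\<in>P. if p \<in> ?S q then 1 else 0)"
  proof (rule sum.cong)
    fix q assume "q \<in> ?Q"
    have "?S q \<subseteq> P" by (auto simp: seen_def P_def)
    then show "real (card (?S q)) = (\<Sum>p\<in>P. if p \<in> ?S q then 1 else 0)"
      using finP by (simp add: sum.If_cases Int_absorb1 Int_def[symmetric])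
  qed simp
  also have "\<dots> = (\<Sum>p\<in>P. real (card {q \<in> ?Q. p \<in> ?S q}))"
    using finQ by (subst sum.swap) (simp add: sum.If_cases Int_def)
  also have "\<dots> \<le> (\<Sum>p\<in>P. real (card (?H p \<eta> \<times> ?H p \<eta>')))"
  proof (rule sum_mono)
    fix p assume "p \<in> P"
    show "real (card {q \<in> ?Q. p \<in> ?S q}) \<le> real (card (?H p \<eta> \<times> ?H p \<eta>'))"
      by (intro of_nat_mono card_mono sub) auto
  qed
  finally show ?thesis by (simp add: hits_def card_cartesian_product)
qed

text \<open>With a single label every tuple is planted, and \<open>card_seen_ge\<close> then counts
  only the injectivity of the exploration.\<close>

lemma sum_free_ge:
  fixes T :: "'a::finite letter list set"
  assumes T: "word_tree T" and n: "n > 0"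
  shows "(\<Sum>p\<in>perm_tuples n. real (card {v \<in> {1..n}. inj_on (\<lambda>w. word_perm p w v) T}))
     \<ge> real (card (perm_tuples n :: 'a perms set)) * (real n * (max 0 ((real n - 2 * real (card T)) / real n)) ^ card (T - {[]}))"
proof -
  let ?N = "\<lambda>_ _ :: unit. n"
  let ?x = "\<lambda>_ :: nat. ()"
  let ?K = "UNIV \<times> T :: (unit \<times> 'a letter list) set"
  let ?P = "perm_tuples n :: 'a perms set"
  have pl: "planted n ?N ?x = ?P" by (simp add: planted_def ecount_def fun_eq_iff del: atLeastAtMost_iff)
  have seen: "seen n ?N ?x (\<lambda>_. v) (\<lambda>_. ()) ?K = {p \<in> ?P. inj_on (\<lambda>w. word_perm p w v) T}" for v
    by (auto simp: seen_def pl point_def inj_on_def)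
  have c: "vcount n ?x = (\<lambda>_. n)" by (simp add: vcount_def fun_eq_iff del: atLeastAtMost_iff)
  have K: "{k \<in> ?K. snd k \<noteq> []} = UNIV \<times> (T - {[]})" by auto
  have low: "real (card {p \<in> ?P. inj_on (\<lambda>w. word_perm p w v) T}) \<ge> real (card ?P) * (max 0 ((real n - 2 * real (card T)) / real n)) ^ card (T - {[]})"
    if "v \<in> {1..n}" for v
  proof -
    have fT: "finite T" and T0: "[] \<in> T" using T by (auto simp: word_tree_def)
    have "real (card (planted n ?N ?x :: 'a perms set)) *
        (\<Prod>k\<in>{k \<in> ?K. snd k \<noteq> []}. step_ratio ?N (vcount n ?x) (card T) () ())
        \<le> real (card (seen n ?N ?x (\<lambda>_. v) (\<lambda>_. ()) ?K :: 'a perms set))"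
    proof (rule card_seen_ge[OF refl suffix_closed_tree[OF T]])
      show "finite ?K" using fT by simp
      show "card ?K \<le> card T" by (simp add: card_cartesian_product)
      show "range (\<lambda>j. (j, [])) \<subseteq> ?K" using T0 by auto
    qed (use that in \<open>auto simp: inj_def\<close>)
    moreover have "(\<Prod>k\<in>{k \<in> ?K. snd k \<noteq> []}. step_ratio ?N (vcount n ?x) (card T) () ())
        = (max 0 ((real n - 2 * real (card T)) / real n)) ^ card (T - {[]})"
      unfolding K c by (simp only: prod_constant card_cartesian_product step_ratio_def) simp
    ultimately show ?thesis unfolding seen pl by simp
  qed
  have "real (card ?P) * (real n * (max 0 ((real n - 2 * real (card T)) / real n)) ^ card (T - {[]}))
     = (\<Sum>v\<in>{1..n}. real (card ?P) * (max 0 ((real n - 2 * real (card T)) / real n)) ^ card (T - {[]}))" by simp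
  also have "\<dots> \<le> (\<Sum>v\<in>{1..n}. real (card {p \<in> ?P. inj_on (\<lambda>w. word_perm p w v) T}))"
    by (intro sum_mono low)
  also have "\<dots> = (\<Sum>v\<in>{1..n}. \<Sum>p\<in>?P. if inj_on (\<lambda>w. word_perm p w v) T then 1 else 0)"
    by (simp add: sum.If_cases Int_def)
  also have "\<dots> = (\<Sum>p\<in>?P. \<Sum>v\<in>{1..n}. if inj_on (\<lambda>w. word_perm p w v) T then 1 else 0)"
    by (rule sum.swap)
  also have "\<dots> = (\<Sum>p\<in>?P. real (card {v \<in> {1..n}. inj_on (\<lambda>w. word_perm p w v) T}))"
    by (simp add: sum.If_cases Int_def)
  finally show ?thesis .
qed

text \<open>Chebyshev's inequality from lower bounds alone. The frequencies and the weights both sum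
  to 1, so lower bounds for all mixed moments give upper bounds for means and second moments by
  subtraction. Switchings supply exactly such lower bounds.\<close>

lemma second_moment_concentration:
  fixes f :: "'o \<Rightarrow> 'e \<Rightarrow> real"
  assumes fin: "finite \<Omega>" "finite E"
    and f: "\<And>\<omega> e. \<omega> \<in> \<Omega> \<Longrightarrow> e \<in> E \<Longrightarrow> f \<omega> e \<ge> 0" "\<And>\<omega>. \<omega> \<in> \<Omega> \<Longrightarrow> (\<Sum>e\<in>E. f \<omega> e) = 1"
    and w: "\<And>e. e \<in> E \<Longrightarrow> w e \<ge> 0" "(\<Sum>e\<in>E. w e) = 1"
    and \<delta>: "\<delta> \<ge> 0" "\<And>e e'. e \<in> E \<Longrightarrow> e' \<in> E \<Longrightarrow> (\<Sum>\<omega>\<in>\<Omega>. f \<omega> e * f \<omega> e') \<ge> real (card \<Omega>) * (w e * w e' - \<delta>)"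
    and \<epsilon>: "\<epsilon> > 0"
  shows "real (card {\<omega> \<in> \<Omega>. (\<Sum>e\<in>E. \<bar>f \<omega> e - w e\<bar>) > \<epsilon>})
    \<le> real (card \<Omega>) * (real (card E) * (real (card E) ^ 2 + 3 * real (card E)) * real (card E) ^ 2 / \<epsilon>\<^sup>2 * \<delta>)"
proof -
  let ?k = "real (card E)" and ?O = "real (card \<Omega>)"
  let ?m = "\<lambda>e. \<Sum>\<omega>\<in>\<Omega>. f \<omega> e"
  have k: "?k > 0" using w(2) fin(2) by (auto simp: card_gt_0_iff)
  have k1: "?k \<ge> 1" using k by simp
  have wE: "(\<Sum>e'\<in>E - {e}. w e') = 1 - w e" if "e \<in> E" for e
    using fin(2) w(2) that by (simp add: sum_diff1)
  have cE: "real (card (E - {e})) = ?k - 1" if "e \<in> E" for e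
    using fin(2) k1 that by (simp add: of_nat_diff)
  have m_split: "?m e = (\<Sum>e'\<in>E. \<Sum>\<omega>\<in>\<Omega>. f \<omega> e * f \<omega> e')" for e
    by (subst sum.swap) (simp add: sum_distrib_left[symmetric] f(2))
  have m_ge: "?m e \<ge> ?O * (w e - ?k * \<delta>)" if "e \<in> E" for e
  proof -
    have "?O * (w e - ?k * \<delta>) = (\<Sum>e'\<in>E. ?O * (w e * w e' - \<delta>))"
      by (simp add: sum_distrib_left[symmetric] sum_subtractf w(2))
    also have "\<dots> \<le> ?m e" unfolding m_split by (intro sum_mono \<delta>(2) that)
    finally show ?thesis .
  qed
  have m_sum: "(\<Sum>e\<in>E. ?m e) = ?O" by (subst sum.swap) (simp add: f(2))
  have m_le: "?m e \<le> ?O * (w e + ?k\<^sup>2 * \<delta>)" if e: "e \<in> E" for e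
  proof -
    have "?O * (1 - w e) - ?O * (?k * (?k * \<delta>)) \<le> ?O * (1 - w e) - ?O * ((?k - 1) * (?k * \<delta>))"
      using k \<delta>(1) by (simp add: mult_left_mono mult_right_mono)
    also have "\<dots> = (\<Sum>e'\<in>E - {e}. ?O * (w e' - ?k * \<delta>))"
      unfolding sum_distrib_left[symmetric] sum_subtractf sum_constant wE[OF e] cE[OF e] by (simp add: algebra_simps)
    also have "\<dots> \<le> (\<Sum>e'\<in>E - {e}. ?m e')" by (intro sum_mono m_ge) auto
    also have "\<dots> = ?O - ?m e" using m_sum fin(2) e by (simp add: sum_diff1)
    finally show ?thesis by (simp add: algebra_simps power2_eq_square)
  qed
  have sq: "(\<Sum>\<omega>\<in>\<Omega>. f \<omega> e * f \<omega> e) \<le> ?O * ((w e)\<^sup>2 + (?k\<^sup>2 + ?k) * \<delta>)" if e: "e \<in> E" for e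
  proof -
    have "(\<Sum>\<omega>\<in>\<Omega>. f \<omega> e * f \<omega> e) = ?m e - (\<Sum>e'\<in>E - {e}. \<Sum>\<omega>\<in>\<Omega>. f \<omega> e * f \<omega> e')"
      using m_split[of e] fin(2) e by (simp add: sum_diff1)
    also have "\<dots> \<le> ?O * (w e + ?k\<^sup>2 * \<delta>) - (\<Sum>e'\<in>E - {e}. ?O * (w e * w e' - \<delta>))"
      by (intro diff_mono m_le sum_mono \<delta>(2)) (use e in auto)
    also have "(\<Sum>e'\<in>E - {e}. ?O * (w e * w e' - \<delta>)) = ?O * (w e * (1 - w e) - (?k - 1) * \<delta>)"
      unfolding sum_distrib_left[symmetric] sum_subtractf sum_constant wE[OF e] cE[OF e] ..
    also have "?O * (w e + ?k\<^sup>2 * \<delta>) - ?O * (w e * (1 - w e) - (?k - 1) * \<delta>) \<le> ?O * ((w e)\<^sup>2 + (?k\<^sup>2 + ?k) * \<delta>)"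
      using \<delta>(1) by (simp add: algebra_simps power2_eq_square)
    finally show ?thesis .
  qed
  have var: "(\<Sum>\<omega>\<in>\<Omega>. (f \<omega> e - w e)\<^sup>2) \<le> ?O * ((?k\<^sup>2 + 3 * ?k) * \<delta>)" if e: "e \<in> E" for e
  proof -
    have w1: "w e \<le> 1" using member_le_sum[of e E w] w e fin by auto
    have "(\<Sum>\<omega>\<in>\<Omega>. (f \<omega> e - w e)\<^sup>2) = (\<Sum>\<omega>\<in>\<Omega>. f \<omega> e * f \<omega> e) - 2 * w e * ?m e + ?O * (w e)\<^sup>2"
      by (simp add: power2_eq_square algebra_simps sum.distrib sum_subtractf sum_distrib_left)
    also have "\<dots> \<le> ?O * ((w e)\<^sup>2 + (?k\<^sup>2 + ?k) * \<delta>) - 2 * w e * (?O * (w e - ?k * \<delta>)) + ?O * (w e)\<^sup>2"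
      using w(1)[OF e] by (intro add_right_mono diff_mono sq e mult_left_mono m_ge) auto
    also have "\<dots> = ?O * ((?k\<^sup>2 + ?k + 2 * w e * ?k) * \<delta>)"
      by (simp add: power2_eq_square algebra_simps)
    also have "\<dots> \<le> ?O * ((?k\<^sup>2 + ?k + 2 * 1 * ?k) * \<delta>)"
      using w1 k \<delta>(1) by (intro mult_left_mono mult_right_mono add_left_mono) auto
    finally show ?thesis by (simp add: add.commute)
  qed
  let ?B = "\<lambda>e. {\<omega> \<in> \<Omega>. \<bar>f \<omega> e - w e\<bar> > \<epsilon> / ?k}"
  have bad: "real (card (?B e)) \<le> ?O * ((?k\<^sup>2 + 3 * ?k) * \<delta>) * ?k\<^sup>2 / \<epsilon>\<^sup>2" if e: "e \<in> E" for e
  proof -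
    have "real (card (?B e)) * (\<epsilon> / ?k)\<^sup>2 = (\<Sum>\<omega>\<in>?B e. (\<epsilon> / ?k)\<^sup>2)" by simp
    also have "\<dots> \<le> (\<Sum>\<omega>\<in>?B e. (f \<omega> e - w e)\<^sup>2)"
      using \<epsilon> k by (intro sum_mono) (auto intro!: abs_le_square_iff[THEN iffD1])
    also have "\<dots> \<le> (\<Sum>\<omega>\<in>\<Omega>. (f \<omega> e - w e)\<^sup>2)" by (intro sum_mono2 fin) auto
    also have "\<dots> \<le> ?O * ((?k\<^sup>2 + 3 * ?k) * \<delta>)" by (rule var[OF e])
    finally show ?thesis using k \<epsilon> by (simp add: power_divide field_simps)
  qed
  have "{\<omega> \<in> \<Omega>. (\<Sum>e\<in>E. \<bar>f \<omega> e - w e\<bar>) > \<epsilon>} \<subseteq> (\<Union>e\<in>E. ?B e)"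
  proof (rule subsetI, rule ccontr)
    fix \<omega> assume \<omega>: "\<omega> \<in> {\<omega> \<in> \<Omega>. (\<Sum>e\<in>E. \<bar>f \<omega> e - w e\<bar>) > \<epsilon>}" "\<omega> \<notin> (\<Union>e\<in>E. ?B e)"
    then have "(\<Sum>e\<in>E. \<bar>f \<omega> e - w e\<bar>) \<le> (\<Sum>e\<in>E. \<epsilon> / ?k)" by (intro sum_mono) auto
    then show False using \<omega> k by auto
  qed
  then have "card {\<omega> \<in> \<Omega>. (\<Sum>e\<in>E. \<bar>f \<omega> e - w e\<bar>) > \<epsilon>} \<le> card (\<Union>e\<in>E. ?B e)"
    using fin by (intro card_mono) auto
  also have "\<dots> \<le> (\<Sum>e\<in>E. card (?B e))" by (rule card_UN_le[OF fin(2)])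
  finally have "real (card {\<omega> \<in> \<Omega>. (\<Sum>e\<in>E. \<bar>f \<omega> e - w e\<bar>) > \<epsilon>}) \<le> real (\<Sum>e\<in>E. card (?B e))"
    by (rule of_nat_mono)
  also have "\<dots> = (\<Sum>e\<in>E. real (card (?B e)))" by (rule of_nat_sum)
  also have "\<dots> \<le> (\<Sum>e\<in>E. ?O * ((?k\<^sup>2 + 3 * ?k) * \<delta>) * ?k\<^sup>2 / \<epsilon>\<^sup>2)" by (intro sum_mono bad)
  finally show ?thesis by (simp add: mult_ac)
qed

text \<open>Letters are added at the front, so \<open>tl w\<close> is the parent of
  \<open>w\<close>.\<close>

definition tree_weight :: "('c \<Rightarrow> 'c \<Rightarrow> real) \<Rightarrow> ('c \<Rightarrow> real) \<Rightarrow> 'a letter list set \<Rightarrow> ('a letter list \<Rightarrow> 'c) \<Rightarrow> real" where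
  "tree_weight P \<pi> T \<eta> = \<pi> (\<eta> []) * (\<Prod>w\<in>T - {[]}. P (\<eta> (tl w)) (\<eta> w))"

lemma step_ratio_tendsto:
  assumes "(\<lambda>n. real (N n s s') / real n) \<longlonglongrightarrow> W" "(\<lambda>n. real (c n s) / real n) \<longlonglongrightarrow> \<pi>" "\<pi> > 0" "W \<ge> 0"
  shows "(\<lambda>n. step_ratio (N n) (c n) m s s') \<longlonglongrightarrow> W / \<pi>"
proof -
  have "(\<lambda>n. max 0 ((real (N n s s') / real n - 2 * real m / real n) / (real (c n s) / real n))) \<longlonglongrightarrow> max 0 ((W - 0) / \<pi>)"
    using assms(3) by (intro tendsto_intros assms lim_const_over_n) auto
  moreover have "\<forall>\<^sub>F n in sequentially. max 0 ((real (N n s s') / real n - 2 * real m / real n) / (real (c n s) / real n)) = step_ratio (N n) (c n) m s s'"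
    using eventually_gt_at_top[of 0]
  proof eventually_elim
    case (elim n)
    have "(real (N n s s') / real n - 2 * real m / real n) / (real (c n s) / real n) = (real (N n s s') - 2 * real m) / real (c n s)"
      using elim by (simp add: diff_divide_distrib[symmetric])
    then show ?case by (simp only: step_ratio_def)
  qed
  ultimately have "(\<lambda>n. step_ratio (N n) (c n) m s s') \<longlonglongrightarrow> max 0 ((W - 0) / \<pi>)"
    by (rule Lim_transform_eventually)
  then show ?thesis using assms(3,4) by (simp add: max_absorb2)
qed

text \<open>The switching bounds for pairs of patterns converge to products of tree weights. They
  depend on \<open>x\<close> only through its type, which makes the statement uniform over the type
  class.\<close>

lemma planted_limit:
  fixes N :: "nat \<Rightarrow> 'c::finite \<Rightarrow> 'c \<Rightarrow> nat" and T :: "'a::finite letter list set" and P :: "'c \<Rightarrow> 'c \<Rightarrow> real"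
  assumes sym: "\<And>n s s'. N n s s' = N n s' s"
    and N: "\<And>s s'. (\<lambda>n. real (N n s s') / real n) \<longlonglongrightarrow> \<pi> s * P s s'"
    and c: "\<And>s. (\<lambda>n. real (c n s) / real n) \<longlonglongrightarrow> \<pi> s"
    and pos: "\<And>s. \<pi> s > 0" "\<And>s s'. P s s' \<ge> 0"
    and T: "word_tree T" and one: "(\<Sum>\<eta>\<in>(T \<rightarrow>\<^sub>E UNIV). tree_weight P \<pi> T \<eta>) = 1" and \<epsilon>: "\<epsilon> > 0"
  shows "\<forall>\<^sub>F n in sequentially. \<forall>x\<in>vclass n (c n).
    real (card {p \<in> planted n (N n) x. (\<Sum>\<eta>\<in>(T \<rightarrow>\<^sub>E UNIV). \<bar>real (hits n p x T \<eta>) / real n - tree_weight P \<pi> T \<eta>\<bar>) > \<epsilon>})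
      \<le> real (card (planted n (N n) x :: 'a perms set)) / 2"
proof -
  let ?E = "T \<rightarrow>\<^sub>E (UNIV :: 'c set)"
  let ?w = "tree_weight P \<pi> T"
  define C where "C = real (card ?E) * (real (card ?E) ^ 2 + 3 * real (card ?E)) * real (card ?E) ^ 2 / \<epsilon>\<^sup>2"
  \<comment> \<open>\<open>C\<close> is the factor in \<open>second_moment_concentration\<close>;
    this choice makes the exceptional fraction \<open>C * \<delta>\<close> at most one half.\<close>
  define \<delta> where "\<delta> = 1 / (2 * (C + 1))"
  have C: "C \<ge> 0" by (simp add: C_def)
  have \<delta>: "\<delta> > 0" and C\<delta>: "C * \<delta> \<le> 1 / 2" using C by (simp_all add: \<delta>_def field_simps)
  have finT: "finite T" using T by (simp add: word_tree_def)
  have finE: "finite ?E" using finT by (intro finite_PiE) auto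
  define R where "R n \<eta> = tree_ratio (N n) (c n) (2 * card T) T \<eta>" for n and \<eta> :: "'a letter list \<Rightarrow> 'c"
  define a where "a n \<eta> \<eta>' = (real (c n (\<eta> [])) / real n * (real (c n (\<eta>' [])) / real n) - 1 / real n) * (R n \<eta> * R n \<eta>')"
    for n and \<eta> \<eta>' :: "'a letter list \<Rightarrow> 'c"
  have step: "(\<lambda>n. step_ratio (N n) (c n) m s s') \<longlonglongrightarrow> P s s'" for m s s'
    using step_ratio_tendsto[of N s s' "\<pi> s * P s s'" c "\<pi> s" m] N c pos by (simp add: less_imp_le order_less_imp_not_eq2)
  have alim0: "(\<lambda>n. a n \<eta> \<eta>') \<longlonglongrightarrow> (\<pi> (\<eta> []) * \<pi> (\<eta>' []) - 0) *
      ((\<Prod>w\<in>T - {[]}. P (\<eta> (tl w)) (\<eta> w)) * (\<Prod>w\<in>T - {[]}. P (\<eta>' (tl w)) (\<eta>' w)))" for \<eta> \<eta>'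
    unfolding a_def R_def tree_ratio_def by (intro tendsto_intros c step lim_const_over_n)
  have alim: "(\<lambda>n. a n \<eta> \<eta>') \<longlonglongrightarrow> ?w \<eta> * ?w \<eta>'" for \<eta> \<eta>'
    using alim0[of \<eta> \<eta>'] by (simp add: tree_weight_def mult_ac)
  have "\<forall>\<^sub>F n in sequentially. a n \<eta> \<eta>' > ?w \<eta> * ?w \<eta>' - \<delta>" for \<eta> \<eta>'
    by (rule order_tendstoD(1)[OF alim]) (use \<delta> in simp)
  then have "\<forall>\<^sub>F n in sequentially. \<forall>\<eta>\<in>?E. \<forall>\<eta>'\<in>?E. a n \<eta> \<eta>' > ?w \<eta> * ?w \<eta>' - \<delta>"
    by (intro eventually_ball_finite[OF finE] ballI)
  then show ?thesis using eventually_gt_at_top[of 0]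
  proof eventually_elim
    case (elim n)
    show ?case
    proof
      fix x assume x: "x \<in> vclass n (c n)"
      let ?\<Omega> = "planted n (N n) x :: 'a perms set"
      let ?f = "\<lambda>p \<eta>. real (hits n p x T \<eta>) / real n"
      have cx: "vcount n x = c n" using x by (simp add: vclass_def)
      have "real (card {p \<in> ?\<Omega>. (\<Sum>\<eta>\<in>?E. \<bar>?f p \<eta> - ?w \<eta>\<bar>) > \<epsilon>}) \<le> real (card ?\<Omega>) * (C * \<delta>)"
        unfolding C_def
      proof (rule second_moment_concentration[OF _ finE])
        show "(\<Sum>\<eta>\<in>?E. ?f p \<eta>) = 1" for p
          using sum_hits[OF finT, of n p x] elim(2) by (simp add: sum_divide_distrib[symmetric] flip: of_nat_sum)
        show "?w \<eta> \<ge> 0" for \<eta>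
          using pos by (auto simp: tree_weight_def less_imp_le intro!: mult_nonneg_nonneg prod_nonneg)
        fix \<eta> \<eta>' assume \<eta>: "\<eta> \<in> ?E" "\<eta>' \<in> ?E"
        have "real (card ?\<Omega>) * (?w \<eta> * ?w \<eta>' - \<delta>) \<le> real (card ?\<Omega>) * a n \<eta> \<eta>'"
          using elim(1) \<eta> by (intro mult_left_mono) (auto intro: less_imp_le)
        also have "\<dots> = real (card ?\<Omega>) * ((real (c n (\<eta> [])) * real (c n (\<eta>' [])) - real n) * (R n \<eta> * R n \<eta>')) / (real n * real n)"
          using elim(2) by (simp add: a_def field_simps)
        also have "\<dots> \<le> (\<Sum>p\<in>?\<Omega>. real (hits n p x T \<eta>) * real (hits n p x T \<eta>')) / (real n * real n)"
          using sum_hits_product_ge[OF sym T, where n = n and x = x and \<eta> = \<eta> and \<eta>' = \<eta>'] unfolding cx R_def by (intro divide_right_mono) auto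
        finally show "real (card ?\<Omega>) * (?w \<eta> * ?w \<eta>' - \<delta>) \<le> (\<Sum>p\<in>?\<Omega>. ?f p \<eta> * ?f p \<eta>')"
          by (simp add: sum_divide_distrib)
      qed (use \<delta> \<epsilon> one in auto)
      also have "\<dots> \<le> real (card ?\<Omega>) * (1 / 2)" by (intro mult_left_mono C\<delta>) auto
      finally show "real (card {p \<in> ?\<Omega>. (\<Sum>\<eta>\<in>?E. \<bar>?f p \<eta> - ?w \<eta>\<bar>) > \<epsilon>}) \<le> real (card ?\<Omega>) / 2" by simp
    qed
  qed
qed

lemma free_limit:
  fixes T :: "'a::finite letter list set"
  assumes T: "word_tree T" and \<delta>: "\<delta> > 0"
  shows "\<forall>\<^sub>F n in sequentially. (\<Sum>p\<in>perm_tuples n. real (card {v \<in> {1..n}. inj_on (\<lambda>w. word_perm p w v) T}))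
     \<ge> real (card (perm_tuples n :: 'a perms set)) * (real n * (1 - \<delta>))"
proof -
  have "(\<lambda>n. (max 0 (1 - 2 * real (card T) / real n)) ^ card (T - {[]})) \<longlonglongrightarrow> (max 0 (1 - 0)) ^ card (T - {[]})"
    by (intro tendsto_intros lim_const_over_n)
  then have "\<forall>\<^sub>F n in sequentially. (max 0 (1 - 2 * real (card T) / real n)) ^ card (T - {[]}) > 1 - \<delta>"
    by (rule order_tendstoD(1)) (use \<delta> in simp)
  then show ?thesis using eventually_gt_at_top[of 0]
  proof eventually_elim
    case (elim n)
    have "(real n - 2 * real (card T)) / real n = 1 - 2 * real (card T) / real n"
      using elim(2) by (simp add: diff_divide_distrib)
    then have "real (card (perm_tuples n :: 'a perms set)) * (real n * (1 - \<delta>))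
      \<le> real (card (perm_tuples n :: 'a perms set)) * (real n * (max 0 ((real n - 2 * real (card T)) / real n)) ^ card (T - {[]}))"
      using elim(1) by (intro mult_left_mono) auto
    also note sum_free_ge[OF T elim(2)]
    finally show ?case .
  qed
qed

section \<open>Tree-indexed Markov chains\<close>

lemma sets_borel_spin: "sets (borel :: spin measure) = UNIV"
  by (auto simp: open_spin_def intro: borel_open)

lemma sets_borel_config: "sets (borel :: ('a::finite config) measure) = sets (PiM UNIV (\<lambda>_. borel :: spin measure))"
  by (rule sets_PiM_equal_borel[symmetric])

lemma space_borel_prob: "\<mu> \<in> borel_prob \<Longrightarrow> space \<mu> = UNIV"
  by (auto simp: borel_prob_def dest: sets_eq_imp_space_eq)

lemma coordinate_measurable: "(\<lambda>x :: 'a::finite config. x g) \<in> borel \<rightarrow>\<^sub>M (borel :: spin measure)"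
proof -
  have "(\<lambda>x :: 'a config. x g) \<in> PiM UNIV (\<lambda>_. borel) \<rightarrow>\<^sub>M (borel :: spin measure)"
    by (rule measurable_component_singleton) auto
  then show ?thesis by (simp cong: measurable_cong_sets add: sets_borel_config)
qed

lemma config_set_borel:
  "finite F \<Longrightarrow> {x :: 'a::finite config. \<forall>k\<in>F. x k = \<eta> k} \<in> sets borel"
proof -
  assume F: "finite F"
  have "{x :: 'a config. x k = s} \<in> sets borel" for k s
    using measurable_sets[OF coordinate_measurable[of k], of "{s}"] by (simp add: sets_borel_spin vimage_def)
  then have one: "{x :: 'a config. x k = s} \<inter> X \<in> sets borel" if "X \<in> sets borel" for k s X
    using that by (intro sets.Int)
  show ?thesis using F
  proof (induction F rule: finite_induct)
    case (insert k F)
    have "{x. \<forall>k\<in>insert k F. x k = \<eta> k} = {x. x k = \<eta> k} \<inter> {x. \<forall>k\<in>F. x k = \<eta> k}" by auto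
    then show ?case using one[OF insert.IH] by simp
  qed simp
qed

lemma measurable_into_config:
  assumes "\<And>g. (\<lambda>y. f y g) \<in> M \<rightarrow>\<^sub>M (borel :: spin measure)"
  shows "f \<in> M \<rightarrow>\<^sub>M (borel :: 'a::finite config measure)"
proof -
  have "f \<in> M \<rightarrow>\<^sub>M PiM UNIV (\<lambda>_. borel)"
    using assms by (intro measurable_PiM_single') auto
  then show ?thesis by (simp cong: measurable_cong_sets add: sets_borel_config)
qed

lemma config_event_split:
  fixes \<mu> :: "'a::finite config measure"
  assumes \<mu>: "\<mu> \<in> borel_prob" and S: "finite S" "F \<subseteq> S" and A: "A \<in> sets borel"
  shows "measure \<mu> {x. (\<forall>k\<in>F. x k = \<eta> k) \<and> x \<in> A}
    = (\<Sum>\<theta>\<in>{\<theta> \<in> S \<rightarrow>\<^sub>E UNIV. \<forall>k\<in>F. \<theta> k = \<eta> k}. measure \<mu> {x. (\<forall>k\<in>S. x k = \<theta> k) \<and> x \<in> A})"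
proof -
  interpret prob_space \<mu> using \<mu> by (simp add: borel_prob_def)
  let ?I = "{\<theta> \<in> S \<rightarrow>\<^sub>E UNIV. \<forall>k\<in>F. \<theta> k = \<eta> k}"
  let ?B = "\<lambda>\<theta>. {x. (\<forall>k\<in>S. x k = \<theta> k) \<and> x \<in> A}"
  have sets: "sets \<mu> = sets borel" using \<mu> by (simp add: borel_prob_def)
  have fin: "finite ?I" using S by (intro finite_subset[OF _ finite_PiE[OF S(1), of "\<lambda>_. UNIV"]]) auto
  have meas: "?B \<theta> \<in> sets \<mu>" for \<theta>
    using config_set_borel[OF S(1), of \<theta>] A unfolding sets Collect_conj_eq by (simp add: sets.Int)
  have disj: "disjoint_family_on ?B ?I"
    unfolding disjoint_family_on_def
  proof (intro ballI impI)
    fix \<theta> \<theta>' assume a: "\<theta> \<in> ?I" "\<theta>' \<in> ?I" "\<theta> \<noteq> \<theta>'"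
    then obtain k where "k \<in> S" "\<theta> k \<noteq> \<theta>' k" by (metis (mono_tags, lifting) PiE_ext mem_Collect_eq)
    then show "?B \<theta> \<inter> ?B \<theta>' = {}" by auto
  qed
  have eq: "{x. (\<forall>k\<in>F. x k = \<eta> k) \<and> x \<in> A} = (\<Union>\<theta>\<in>?I. ?B \<theta>)"
  proof (intro equalityI subsetI)
    fix x assume "x \<in> {x. (\<forall>k\<in>F. x k = \<eta> k) \<and> x \<in> A}"
    then show "x \<in> (\<Union>\<theta>\<in>?I. ?B \<theta>)" using S(2) by (intro UN_I[of "restrict x S"]) auto
  qed (use S(2) in auto)
  show ?thesis unfolding eq by (rule finite_measure_finite_Union[OF fin _ disj]) (use meas in blast)
qed

lemma config_event_split':
  fixes \<mu> :: "'a::finite config measure"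
  assumes \<mu>: "\<mu> \<in> borel_prob" and S: "finite S" "F \<subseteq> S"
  shows "measure \<mu> {x. \<forall>k\<in>F. x k = \<eta> k}
    = (\<Sum>\<theta>\<in>{\<theta> \<in> S \<rightarrow>\<^sub>E UNIV. \<forall>k\<in>F. \<theta> k = \<eta> k}. measure \<mu> {x. \<forall>k\<in>S. x k = \<theta> k})"
  using config_event_split[OF assms, of UNIV \<eta>] by simp

text \<open>Cylinders over finitely many coordinates determine the measure, and each is a finite
  disjoint union of events that prescribe single spins.\<close>

lemma borel_prob_eqI:
  fixes \<mu> \<nu> :: "'a::finite config measure"
  assumes "\<mu> \<in> borel_prob" "\<nu> \<in> borel_prob"
    and eq: "\<And>F \<eta>. finite F \<Longrightarrow> measure \<mu> {x. \<forall>k\<in>F. x k = \<eta> k} = measure \<nu> {x. \<forall>k\<in>F. x k = \<eta> k}"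
  shows "\<mu> = \<nu>"
proof -
  interpret M: prob_space \<mu> using assms by (simp add: borel_prob_def)
  interpret N: prob_space \<nu> using assms by (simp add: borel_prob_def)
  have cyl: "measure \<rho> {x. \<forall>k\<in>J. x k \<in> A k} = (\<Sum>\<theta>\<in>Pi\<^sub>E J A. measure \<rho> {x. \<forall>k\<in>J. x k = \<theta> k})"
    if \<rho>: "\<rho> \<in> borel_prob" and J: "finite J" for \<rho> :: "'a config measure" and J :: "'a fgroup set" and A :: "'a fgroup \<Rightarrow> spin set"
  proof -
    interpret R: prob_space \<rho> using \<rho> by (simp add: borel_prob_def)
    have sets: "sets \<rho> = sets borel" using \<rho> by (simp add: borel_prob_def)
    have eq: "{x. \<forall>k\<in>J. x k \<in> A k} = (\<Union>\<theta>\<in>Pi\<^sub>E J A. {x. \<forall>k\<in>J. x k = \<theta> k})"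
    proof (intro equalityI subsetI)
      fix x assume "x \<in> {x. \<forall>k\<in>J. x k \<in> A k}"
      then show "x \<in> (\<Union>\<theta>\<in>Pi\<^sub>E J A. {x. \<forall>k\<in>J. x k = \<theta> k})" by (intro UN_I[of "restrict x J"]) auto
    qed (auto simp: PiE_def)
    have disj: "disjoint_family_on (\<lambda>\<theta>. {x. \<forall>k\<in>J. x k = \<theta> k}) (Pi\<^sub>E J A)"
      unfolding disjoint_family_on_def
    proof (intro ballI impI)
      fix \<theta> \<theta>' assume "\<theta> \<in> Pi\<^sub>E J A" "\<theta>' \<in> Pi\<^sub>E J A" "\<theta> \<noteq> \<theta>'"
      then obtain k where "k \<in> J" "\<theta> k \<noteq> \<theta>' k" by (meson PiE_ext)
      then show "{x. \<forall>k\<in>J. x k = \<theta> k} \<inter> {x. \<forall>k\<in>J. x k = \<theta>' k} = {}" by auto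
    qed
    have fin: "finite (Pi\<^sub>E J A)" using J by (intro finite_PiE) auto
    show ?thesis unfolding eq
      by (rule R.finite_measure_finite_Union[OF fin _ disj]) (use config_set_borel[OF J] sets in blast)
  qed
  have sets: "sets \<mu> = sets (PiM UNIV (\<lambda>_. borel))" "sets \<nu> = sets (PiM UNIV (\<lambda>_. borel))"
    using assms by (simp_all add: borel_prob_def sets_borel_config)
  show ?thesis
  proof (rule measure_eqI_PiM_infinite[OF sets])
    fix A :: "'a fgroup \<Rightarrow> spin set" and J :: "'a fgroup set" assume J: "finite J"
    have "prod_emb UNIV (\<lambda>_. borel) J (Pi\<^sub>E J A) = {x. \<forall>k\<in>J. x k \<in> A k}"
      by (auto simp: prod_emb_def restrict_PiE_iff vimage_def Pi_def)
    then show "emeasure \<mu> (prod_emb UNIV (\<lambda>_. borel) J (Pi\<^sub>E J A)) = emeasure \<nu> (prod_emb UNIV (\<lambda>_. borel) J (Pi\<^sub>E J A))"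
      using cyl[OF assms(1) J] cyl[OF assms(2) J] eq[OF J]
      by (simp add: M.emeasure_eq_measure N.emeasure_eq_measure)
  qed (rule M.finite_measure_axioms)
qed

section \<open>The Cayley tree in terms of reduced words\<close>

lemma Rep_gen_mult: "Rep_fgroup (fg_gen i \<otimes>\<^bsub>FG\<^esub> g) = push (i, True) (Rep_fgroup g)"
  by (simp add: FG_def fg_mult.rep_eq fg_gen.rep_eq)

text \<open>Left multiplication by a generator either adds a front letter or cancels one. The tree
  is thereby rooted at the empty word, and every edge has a parent and a child.\<close>

lemma cayley_edge_iff:
  fixes g h :: "'a fgroup"
  shows "cayley_edge g h \<longleftrightarrow> (\<exists>a. Rep_fgroup h = a # Rep_fgroup g) \<or> (\<exists>a. Rep_fgroup g = a # Rep_fgroup h)"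
proof -
  have one: "(\<exists>i. h = fg_gen i \<otimes>\<^bsub>FG\<^esub> g) \<longleftrightarrow> (\<exists>i. Rep_fgroup h = (i, True) # Rep_fgroup g) \<or> (\<exists>i. Rep_fgroup g = (i, False) # Rep_fgroup h)" for g h :: "'a fgroup"
  proof -
    have A: "h = fg_gen i \<otimes>\<^bsub>FG\<^esub> g \<longleftrightarrow> Rep_fgroup h = push (i, True) (Rep_fgroup g)" for i
      by (simp add: Rep_fgroup_inject[symmetric] Rep_gen_mult)
    have B: "H = push (i, True) G \<longleftrightarrow> H = (i, True) # G \<or> G = (i, False) # H"
      if "reduced G" "reduced H" for i and G H :: "'a letter list"
      using that by (cases G) (auto simp: push_def flip_def reduced_Cons)
    have "h = fg_gen i \<otimes>\<^bsub>FG\<^esub> g \<longleftrightarrow> Rep_fgroup h = (i, True) # Rep_fgroup g \<or> Rep_fgroup g = (i, False) # Rep_fgroup h" for i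
      unfolding A by (rule B) (use Rep_fgroup[of g] Rep_fgroup[of h] in auto)
    then show ?thesis by auto
  qed
  have "cayley_edge g h \<longleftrightarrow> (\<exists>i. h = fg_gen i \<otimes>\<^bsub>FG\<^esub> g) \<or> (\<exists>i. g = fg_gen i \<otimes>\<^bsub>FG\<^esub> h)"
    by (auto simp: cayley_edge_def)
  also have "\<dots> \<longleftrightarrow> (\<exists>a. Rep_fgroup h = a # Rep_fgroup g) \<or> (\<exists>a. Rep_fgroup g = a # Rep_fgroup h)"
    unfolding one by (metis (full_types) surj_pair)
  finally show ?thesis .
qed

lemma cayley_edge_sym: "cayley_edge g h \<longleftrightarrow> cayley_edge h g"
  by (auto simp: cayley_edge_def)

definition descendants :: "'a letter list \<Rightarrow> 'a fgroup set" where
  "descendants H = {k. \<exists>u. Rep_fgroup k = u @ H}"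

text \<open>The deleted edge is the only one between the subtree below \<open>h\<close> and its
  complement.\<close>

lemma past_invariant:
  assumes e: "Rep_fgroup h = a # Rep_fgroup g" and k: "(x, k) \<in> {(a, b). cayley_edge a b \<and> {a, b} \<noteq> {g, h}}\<^sup>*"
  shows "k \<in> descendants (Rep_fgroup h) \<longleftrightarrow> x \<in> descendants (Rep_fgroup h)"
  using k
proof (induction rule: rtrancl_induct)
  case (step y z)
  let ?H = "Rep_fgroup h"
  have up: "v \<in> descendants ?H \<longleftrightarrow> u \<in> descendants ?H" if vu: "Rep_fgroup v = b # Rep_fgroup u" "{u, v} \<noteq> {g, h}" for u v b
  proof
    assume "v \<in> descendants ?H"
    then obtain t where t: "b # Rep_fgroup u = t @ ?H" using vu(1) unfolding descendants_def mem_Collect_eq by auto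
    show "u \<in> descendants ?H"
    proof (cases t)
      case Nil
      then have "Rep_fgroup v = Rep_fgroup h" "Rep_fgroup u = Rep_fgroup g" using t e vu(1) by auto
      then have "v = h" "u = g" by (simp_all add: Rep_fgroup_inject)
      then show ?thesis using vu(2) by auto
    qed (use t in \<open>auto simp: descendants_def\<close>)
  next
    assume "u \<in> descendants ?H"
    then show "v \<in> descendants ?H" using vu(1) by (auto simp: descendants_def intro: exI[of _ "b # _"])
  qed
  from step.hyps(2) have "cayley_edge y z" "{y, z} \<noteq> {g, h}" by auto
  then show ?case using step.IH up[of z _ y] up[of y _ z] unfolding cayley_edge_iff by (metis insert_commute)
qed simp

text \<open>A word outside the subtree reaches the root by dropping front letters and never meets
  \<open>h\<close> on the way.\<close>

lemma past_down:
  assumes "Rep_fgroup h = a # Rep_fgroup g"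
  shows "past g h = - descendants (Rep_fgroup h)"
proof (intro equalityI subsetI)
  have "g \<notin> descendants (Rep_fgroup h)"
    using assms by (auto simp: descendants_def dest: arg_cong[of _ _ length])
  then show "k \<in> - descendants (Rep_fgroup h)" if "k \<in> past g h" for k
    using past_invariant[OF assms, of g k] that by (simp add: past_def)
  let ?R = "{(a, b). cayley_edge a b \<and> {a, b} \<noteq> {g, h}}"
  have sym: "sym (?R\<^sup>*)" by (intro sym_rtrancl) (auto simp: sym_def cayley_edge_sym insert_commute)
  have root: "reduced w \<Longrightarrow> \<not> (\<exists>u. w = u @ Rep_fgroup h) \<Longrightarrow> (Abs_fgroup w, Abs_fgroup []) \<in> ?R\<^sup>*" for w
  proof (induction w)
    case (Cons b w)
    have w: "reduced w" using Cons.prems by (simp add: reduced_Cons)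
    have n: "\<not> (\<exists>u. w = u @ Rep_fgroup h)" using Cons.prems(2) by (metis append_Cons)
    have R: "Rep_fgroup (Abs_fgroup (b # w)) = b # w" "Rep_fgroup (Abs_fgroup w) = w"
      using Cons.prems w by (simp_all add: Abs_fgroup_inverse)
    have "Abs_fgroup (b # w) \<noteq> h" using Cons.prems(2) R(1) by (metis append_Nil)
    moreover have "Abs_fgroup w \<noteq> h" using n R(2) by (metis append_Nil)
    ultimately have "(Abs_fgroup (b # w), Abs_fgroup w) \<in> ?R" using R by (auto simp: cayley_edge_iff doubleton_eq_iff)
    then show ?case using Cons.IH[OF w n] by (rule converse_rtrancl_into_rtrancl)
  qed simp
  fix k assume k: "k \<in> - descendants (Rep_fgroup h)"
  have "(k, Abs_fgroup []) \<in> ?R\<^sup>*"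
    using root[of "Rep_fgroup k"] k Rep_fgroup[of k] by (auto simp: descendants_def Rep_fgroup_inverse)
  moreover have "(g, Abs_fgroup []) \<in> ?R\<^sup>*"
    using root[of "Rep_fgroup g"] \<open>g \<notin> descendants _\<close> Rep_fgroup[of g] by (auto simp: descendants_def Rep_fgroup_inverse)
  ultimately show "k \<in> past g h" unfolding past_def using sym by (auto dest: symD intro: rtrancl_trans)
qed

lemma past_up:
  assumes "Rep_fgroup g = a # Rep_fgroup h"
  shows "past g h \<subseteq> descendants (Rep_fgroup g)"
proof
  fix k assume "k \<in> past g h"
  then have "(g, k) \<in> {(a, b). cayley_edge a b \<and> {a, b} \<noteq> {h, g}}\<^sup>*" by (simp add: past_def insert_commute)
  from past_invariant[OF assms this] show "k \<in> descendants (Rep_fgroup g)"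
    by (auto simp: descendants_def)
qed

lemma word_tree_reduced: "word_tree T \<Longrightarrow> w \<in> T \<Longrightarrow> Rep_fgroup (Abs_fgroup w) = w"
  by (simp add: word_tree_def Abs_fgroup_inverse)

text \<open>The leaf for inductions over trees. The last clause puts the remaining vertices into the
  past of the edge that leads to this leaf.\<close>

lemma word_tree_remove_longest:
  assumes T: "word_tree T" and ne: "T \<noteq> {[]}"
  obtains a w where "a # w \<in> T" "word_tree (T - {a # w})" "w \<in> T" "w \<noteq> a # w"
    "\<And>u. u \<in> T - {a # w} \<Longrightarrow> \<not> (\<exists>v. u = v @ a # w)"
proof -
  have fin: "finite T" and T0: "[] \<in> T" using T by (auto simp: word_tree_def)
  have "Max (length ` T) \<in> length ` T" using fin T0 by (intro Max_in) auto
  then obtain h where h: "h \<in> T" "length h = Max (length ` T)" by auto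
  have hmax: "length k \<le> length h" if "k \<in> T" for k using that fin h(2) by simp
  have "h \<noteq> []"
  proof
    assume "h = []"
    then have "T \<subseteq> {[]}" using hmax by auto
    then show False using T0 ne by auto
  qed
  then obtain a w where aw: "h = a # w" by (cases h) auto
  show thesis
  proof (rule that[of a w])
    show "a # w \<in> T" using h aw by simp
    then show "w \<in> T" using T unfolding word_tree_def by blast
    show "word_tree (T - {a # w})"
      unfolding word_tree_def
    proof (intro conjI ballI allI impI)
      fix b u assume bu: "b # u \<in> T - {a # w}"
      then have "u \<in> T" using T unfolding word_tree_def by blast
      moreover have "u \<noteq> a # w" using hmax[of "b # u"] bu aw by auto
      ultimately show "u \<in> T - {a # w}" by simp
    qed (use T in \<open>auto simp: word_tree_def\<close>)
    show "\<not> (\<exists>v. u = v @ a # w)" if "u \<in> T - {a # w}" for u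
    proof
      assume "\<exists>v. u = v @ a # w"
      then obtain v where v: "u = v @ a # w" by blast
      then have "length u \<le> length (a # w)" using hmax[of u] that aw by simp
      then have "v = []" using v by simp
      then show False using v that by simp
    qed
  qed auto
qed

lemma tree_markov_chain_step:
  assumes "tree_markov_chain \<pi> P \<mu>" "cayley_edge g h" "finite F" "g \<in> F" "F \<subseteq> past g h"
  shows "measure \<mu> {x. (\<forall>k\<in>F. x k = \<eta> k) \<and> x h = b} = measure \<mu> {x. \<forall>k\<in>F. x k = \<eta> k} * P (\<eta> g) b"
  using assms unfolding tree_markov_chain_def by blast

lemma tree_markov_chain_cylinder:
  fixes \<mu> :: "'a::finite config measure"
  assumes M: "tree_markov_chain \<pi> P \<mu>" and T: "word_tree T"
  shows "measure \<mu> {x. \<forall>w\<in>T. x (Abs_fgroup w) = \<eta> w} = tree_weight P \<pi> T \<eta>"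
  using T
proof (induction "card T" arbitrary: T rule: less_induct)
  case less
  show ?case
  proof (cases "T = {[]}")
    case True
    then show ?thesis using M by (simp add: tree_weight_def tree_markov_chain_def)
  next
    case False
    obtain a w where aw: "a # w \<in> T" "word_tree (T - {a # w})" "w \<in> T" "w \<noteq> a # w"
      "\<And>u. u \<in> T - {a # w} \<Longrightarrow> \<not> (\<exists>v. u = v @ a # w)"
      using word_tree_remove_longest[OF less.prems False] by blast
    let ?T = "T - {a # w}" and ?g = "Abs_fgroup w" and ?h = "Abs_fgroup (a # w)"
    have fin: "finite T" using less.prems by (simp add: word_tree_def)
    have Rep: "Rep_fgroup (Abs_fgroup u) = u" if "u \<in> T" for u
      using word_tree_reduced[OF less.prems that] .
    have e: "Rep_fgroup ?h = a # Rep_fgroup ?g" using Rep aw(1,3) by simp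
    have "Abs_fgroup ` ?T \<subseteq> past ?g ?h"
      unfolding past_down[OF e] descendants_def using aw(5) Rep aw(1) by fastforce
    note past = this
    have ce: "cayley_edge ?g ?h" using e by (auto simp: cayley_edge_iff)
    have g: "?g \<in> Abs_fgroup ` ?T" using aw(3,4) by auto
    have "measure \<mu> {x. (\<forall>k\<in>Abs_fgroup ` ?T. x k = \<eta> (Rep_fgroup k)) \<and> x ?h = \<eta> (a # w)} =
        measure \<mu> {x. \<forall>k\<in>Abs_fgroup ` ?T. x k = \<eta> (Rep_fgroup k)} * P (\<eta> (Rep_fgroup ?g)) (\<eta> (a # w))"
      using tree_markov_chain_step[OF M ce _ g past, where \<eta> = "\<lambda>k. \<eta> (Rep_fgroup k)" and b = "\<eta> (a # w)"] fin by blast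
    also have "{x. \<forall>k\<in>Abs_fgroup ` ?T. x k = \<eta> (Rep_fgroup k)} = {x. \<forall>u\<in>?T. x (Abs_fgroup u) = \<eta> u}"
      using Rep by auto
    also have "{x. (\<forall>k\<in>Abs_fgroup ` ?T. x k = \<eta> (Rep_fgroup k)) \<and> x ?h = \<eta> (a # w)} = {x. \<forall>u\<in>T. x (Abs_fgroup u) = \<eta> u}"
      using Rep aw(1) by auto
    also have "measure \<mu> {x. \<forall>u\<in>?T. x (Abs_fgroup u) = \<eta> u} = tree_weight P \<pi> ?T \<eta>"
      by (intro less.hyps card_Diff1_less fin aw(1,2))
    also have "tree_weight P \<pi> ?T \<eta> * P (\<eta> (Rep_fgroup ?g)) (\<eta> (a # w)) = tree_weight P \<pi> T \<eta>"
    proof -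
      have "T - {[]} = insert (a # w) (?T - {[]})" using aw(1) by auto
      then show ?thesis using fin Rep aw(3) by (simp add: tree_weight_def)
    qed
    finally show ?thesis .
  qed
qed

text \<open>The tree spanned by \<open>F\<close> and the root; the root is added explicitly to cover
  empty \<open>F\<close>.\<close>

definition suffixes_of :: "'a fgroup set \<Rightarrow> 'a letter list set" where
  "suffixes_of F = {w. \<exists>k\<in>F. \<exists>u. Rep_fgroup k = u @ w} \<union> {[]}"

lemma reduced_suffix: "reduced (u @ w) \<Longrightarrow> reduced w"
  by (induction u) (auto simp: reduced_Cons)

lemma finite_suffixes_of: "finite F \<Longrightarrow> finite (suffixes_of F)"
proof -
  assume F: "finite F"
  have "suffixes_of F \<subseteq> (\<Union>k\<in>F. (\<lambda>n. drop n (Rep_fgroup k)) ` {..length (Rep_fgroup k)}) \<union> {[]}"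
  proof
    fix w assume "w \<in> suffixes_of F"
    then consider "w = []" | k u where "k \<in> F" "Rep_fgroup k = u @ w" by (auto simp: suffixes_of_def)
    then show "w \<in> (\<Union>k\<in>F. (\<lambda>n. drop n (Rep_fgroup k)) ` {..length (Rep_fgroup k)}) \<union> {[]}"
    proof cases
      case 2
      then have "w = drop (length u) (Rep_fgroup k)" "length u \<le> length (Rep_fgroup k)" by auto
      then show ?thesis using 2(1) by blast
    qed simp
  qed
  then show ?thesis by (rule finite_subset) (use F in auto)
qed

lemma word_tree_suffixes_of: "finite F \<Longrightarrow> word_tree (suffixes_of F)"
  unfolding word_tree_def
proof (intro conjI ballI allI impI)
  show "finite F \<Longrightarrow> finite (suffixes_of F)" by (rule finite_suffixes_of)
  show "[] \<in> suffixes_of F" by (simp add: suffixes_of_def)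
next
  fix w assume "w \<in> suffixes_of F"
  then consider "w = []" | k u where "k \<in> F" "Rep_fgroup k = u @ w" by (auto simp: suffixes_of_def)
  then show "reduced w"
  proof cases
    case 2
    then show ?thesis using Rep_fgroup[of k] reduced_suffix[of u w] by simp
  qed simp
next
  fix a w assume "a # w \<in> suffixes_of F"
  then obtain k u where "k \<in> F" "Rep_fgroup k = (u @ [a]) @ w" by (auto simp: suffixes_of_def)
  then show "w \<in> suffixes_of F" unfolding suffixes_of_def by blast
qed

lemma suffixes_of_superset: "k \<in> F \<Longrightarrow> Rep_fgroup k \<in> suffixes_of F"
  unfolding suffixes_of_def by blast

lemma borel_prob_eq_of_cylinders:
  fixes \<mu> \<nu> :: "'a::finite config measure"
  assumes "\<mu> \<in> borel_prob" "\<nu> \<in> borel_prob"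
    and eq: "\<And>T \<eta>. word_tree T \<Longrightarrow> measure \<mu> {x. \<forall>w\<in>T. x (Abs_fgroup w) = \<eta> w} = measure \<nu> {x. \<forall>w\<in>T. x (Abs_fgroup w) = \<eta> w}"
  shows "\<mu> = \<nu>"
proof (rule borel_prob_eqI[OF assms(1,2)])
  fix F :: "'a fgroup set" and \<eta> assume F: "finite F"
  let ?T = "suffixes_of F" and ?S = "Abs_fgroup ` suffixes_of F"
  have T: "word_tree ?T" by (rule word_tree_suffixes_of[OF F])
  have S: "finite ?S" "F \<subseteq> ?S"
    using finite_suffixes_of[OF F] suffixes_of_superset[of _ F]
    by (auto intro!: image_eqI[of _ Abs_fgroup "Rep_fgroup _"] simp: Rep_fgroup_inverse)
  have "{x. \<forall>k\<in>?S. x k = \<theta> k} = {x. \<forall>w\<in>?T. x (Abs_fgroup w) = (\<theta> \<circ> Abs_fgroup) w}" for \<theta> :: "'a fgroup \<Rightarrow> spin" by auto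
  then show "measure \<mu> {x. \<forall>k\<in>F. x k = \<eta> k} = measure \<nu> {x. \<forall>k\<in>F. x k = \<eta> k}"
    using config_event_split'[OF assms(1) S, of \<eta>] config_event_split'[OF assms(2) S, of \<eta>] eq[OF T] by simp
qed

lemma tree_markov_chain_unique:
  fixes \<mu> \<nu> :: "'a::finite config measure"
  assumes "tree_markov_chain \<pi> P \<mu>" "tree_markov_chain \<pi> P \<nu>"
  shows "\<mu> = \<nu>"
proof (rule borel_prob_eq_of_cylinders)
  show "\<mu> \<in> borel_prob" "\<nu> \<in> borel_prob" using assms by (auto simp: tree_markov_chain_def)
  fix T :: "'a letter list set" and \<eta> assume "word_tree T"
  then show "measure \<mu> {x. \<forall>w\<in>T. x (Abs_fgroup w) = \<eta> w} = measure \<nu> {x. \<forall>w\<in>T. x (Abs_fgroup w) = \<eta> w}"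
    by (simp add: tree_markov_chain_cylinder[OF assms(1)] tree_markov_chain_cylinder[OF assms(2)])
qed

section \<open>Existence of the chain\<close>

lemma UNIV_spin: "(UNIV :: spin set) = {Minus, Plus}"
  using spin.exhaust by blast

lemma pmf_embed_spin:
  fixes f :: "spin \<Rightarrow> real"
  assumes "\<And>s. f s \<ge> 0" "f Minus + f Plus = 1"
  shows "pmf (embed_pmf f) s = f s"
proof (rule pmf_embed_pmf)
  have "(\<integral>\<^sup>+ x. ennreal (f x) \<partial>count_space UNIV) = ennreal (f Minus) + ennreal (f Plus)"
    by (subst nn_integral_count_space_finite) (auto simp: UNIV_spin)
  also have "\<dots> = ennreal (f Minus + f Plus)" by (rule ennreal_plus[symmetric]) (rule assms)+
  also have "\<dots> = 1" unfolding assms(2) by (rule ennreal_1)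
  finally show "(\<integral>\<^sup>+ x. ennreal (f x) \<partial>count_space UNIV) = 1" .
qed (rule assms)

primrec spin_at :: "('a fgroup \<Rightarrow> spin \<times> spin) \<Rightarrow> 'a letter list \<Rightarrow> spin" where
  "spin_at \<xi> [] = fst (\<xi> (Abs_fgroup []))"
| "spin_at \<xi> (a # w) = (case spin_at \<xi> w of Minus \<Rightarrow> fst (\<xi> (Abs_fgroup (a # w))) | Plus \<Rightarrow> snd (\<xi> (Abs_fgroup (a # w))))"

text \<open>
  The noise at a vertex lists the spin it will receive for each spin of its parent, so the spins at the
  reduced words are computed from independent noise by recursion along the tree.
\<close>

lemma exists_tree_measure:
  assumes \<pi>: "\<And>s. \<pi> s \<ge> 0" "\<pi> Minus + \<pi> Plus = 1" and tr: "\<And>s s'. P s s' \<ge> 0" "\<And>s. P s Minus + P s Plus = 1"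
  shows "\<exists>\<mu> :: 'a::finite config measure. \<mu> \<in> borel_prob \<and>
    (\<forall>T \<eta>. word_tree T \<longrightarrow> measure \<mu> {x. \<forall>w\<in>T. x (Abs_fgroup w) = \<eta> w} = tree_weight P \<pi> T \<eta>)"
proof -
  \<comment> \<open>The root has no parent, so both entries of its noise are the initial
    spin.\<close>
  define D :: "'a fgroup \<Rightarrow> (spin \<times> spin) pmf" where
    "D g = (if g = Abs_fgroup [] then map_pmf (\<lambda>s. (s, s)) (embed_pmf \<pi>)
            else pair_pmf (embed_pmf (P Minus)) (embed_pmf (P Plus)))" for g
  interpret product_prob_space "\<lambda>g. measure_pmf (D g)" UNIV
    by (unfold_locales)
  let ?\<Omega> = "PiM UNIV (\<lambda>g. measure_pmf (D g))"
  define X where "X \<xi> g = spin_at \<xi> (Rep_fgroup g)" for \<xi> and g :: "'a fgroup"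
  have meas: "(\<lambda>\<xi>. spin_at \<xi> w) \<in> ?\<Omega> \<rightarrow>\<^sub>M count_space UNIV" for w :: "'a letter list"
  proof (induction w)
    case Nil
    have "(\<lambda>\<xi>. fst (\<xi> (Abs_fgroup []))) \<in> ?\<Omega> \<rightarrow>\<^sub>M count_space UNIV"
      by (rule measurable_compose[OF measurable_component_singleton]) auto
    then show ?case by simp
  next
    case (Cons a w)
    have "(\<lambda>\<xi>. case i of Minus \<Rightarrow> fst (\<xi> (Abs_fgroup (a # w))) | Plus \<Rightarrow> snd (\<xi> (Abs_fgroup (a # w)))) \<in> ?\<Omega> \<rightarrow>\<^sub>M count_space UNIV" for i
    proof (cases i)
      case Minus
      have "(\<lambda>\<xi>. fst (\<xi> (Abs_fgroup (a # w)))) \<in> ?\<Omega> \<rightarrow>\<^sub>M count_space UNIV"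
        by (rule measurable_compose[OF measurable_component_singleton]) auto
      then show ?thesis using Minus by simp
    next
      case Plus
      have "(\<lambda>\<xi>. snd (\<xi> (Abs_fgroup (a # w)))) \<in> ?\<Omega> \<rightarrow>\<^sub>M count_space UNIV"
        by (rule measurable_compose[OF measurable_component_singleton]) auto
      then show ?thesis using Plus by simp
    qed
    then have "(\<lambda>\<xi>. case spin_at \<xi> w of Minus \<Rightarrow> fst (\<xi> (Abs_fgroup (a # w))) | Plus \<Rightarrow> snd (\<xi> (Abs_fgroup (a # w)))) \<in> ?\<Omega> \<rightarrow>\<^sub>M count_space UNIV"
      by (rule measurable_compose_countable'[OF _ Cons.IH]) (auto simp: UNIV_spin)
    then show ?case by simp
  qed
  have Xm: "X \<in> ?\<Omega> \<rightarrow>\<^sub>M borel"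
  proof (rule measurable_into_config)
    fix g
    have "(\<lambda>y. X y g) \<in> ?\<Omega> \<rightarrow>\<^sub>M count_space UNIV" using meas by (simp add: X_def)
    then show "(\<lambda>y. X y g) \<in> ?\<Omega> \<rightarrow>\<^sub>M borel" by (simp add: measurable_cong_sets[OF refl, of borel "count_space UNIV :: spin measure"] sets_borel_spin)
  qed
  define \<mu> where "\<mu> = distr ?\<Omega> borel X"
  have \<mu>: "\<mu> \<in> borel_prob" using prob_space_distr[OF Xm] by (simp add: \<mu>_def borel_prob_def)
  have "measure \<mu> {x. \<forall>w\<in>T. x (Abs_fgroup w) = \<eta> w} = tree_weight P \<pi> T \<eta>" if T: "word_tree T" for T :: "'a letter list set" and \<eta>
  proof -
    have fin: "finite T" and T0: "[] \<in> T" using T by (auto simp: word_tree_def)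
    \<comment> \<open>The noise values that continue the pattern \<open>\<eta>\<close> when the
      parent already shows it. They turn a cylinder event into a product event for the
      noise.\<close>
    define Y where "Y g = (if g = Abs_fgroup [] then {y. fst y = \<eta> []}
        else {y. (case \<eta> (tl (Rep_fgroup g)) of Minus \<Rightarrow> fst y | Plus \<Rightarrow> snd y) = \<eta> (Rep_fgroup g)})" for g :: "'a fgroup"
    have Rep: "Rep_fgroup (Abs_fgroup u) = u" if "u \<in> T" for u
      using word_tree_reduced[OF T that] .
    have inj: "inj_on Abs_fgroup T" by (rule inj_on_inverseI[of _ Rep_fgroup]) (rule Rep)
    have set: "{x. \<forall>w\<in>T. x (Abs_fgroup w) = \<eta> w} \<in> sets borel"
    proof -
      have "{x. \<forall>w\<in>T. x (Abs_fgroup w) = \<eta> w} = {x. \<forall>k\<in>Abs_fgroup ` T. x k = (\<eta> \<circ> Rep_fgroup) k}" using Rep by auto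
      then show ?thesis using config_set_borel[of "Abs_fgroup ` T" "\<eta> \<circ> Rep_fgroup"] fin by simp
    qed
    have ev: "X -` {x. \<forall>w\<in>T. x (Abs_fgroup w) = \<eta> w} \<inter> space ?\<Omega> = prod_emb UNIV (\<lambda>g. measure_pmf (D g)) (Abs_fgroup ` T) (Pi\<^sub>E (Abs_fgroup ` T) Y)"
    proof -
      have one: "(\<forall>w\<in>T. spin_at \<xi> w = \<eta> w) \<longleftrightarrow> (\<forall>w\<in>T. \<xi> (Abs_fgroup w) \<in> Y (Abs_fgroup w))" for \<xi>
      proof -
        have ne: "Abs_fgroup (a # w) \<noteq> Abs_fgroup []" if "a # w \<in> T" for a w
          using Rep[OF that] Rep[OF T0] by auto
        have Yc: "Y (Abs_fgroup (a # w)) = {y. (case \<eta> w of Minus \<Rightarrow> fst y | Plus \<Rightarrow> snd y) = \<eta> (a # w)}" if "a # w \<in> T" for a w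
          using ne[OF that] Rep[OF that] by (simp add: Y_def)
        have closed: "w \<in> T" if "a # w \<in> T" for a w using T that unfolding word_tree_def by blast
        show ?thesis
        proof
          assume L: "\<forall>w\<in>T. spin_at \<xi> w = \<eta> w"
          show "\<forall>w\<in>T. \<xi> (Abs_fgroup w) \<in> Y (Abs_fgroup w)"
          proof
            fix w assume w: "w \<in> T"
            show "\<xi> (Abs_fgroup w) \<in> Y (Abs_fgroup w)"
            proof (cases w)
              case Nil
              then show ?thesis using L T0 by (auto simp: Y_def)
            next
              case (Cons a w')
              have "w' \<in> T" using closed[of a w'] w Cons by simp
              then have A: "spin_at \<xi> w' = \<eta> w'" using L by blast
              have "spin_at \<xi> (a # w') = \<eta> (a # w')" using L w Cons by blast
              then show ?thesis using Yc[of a w'] w Cons A by simp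
            qed
          qed
        next
          assume R: "\<forall>w\<in>T. \<xi> (Abs_fgroup w) \<in> Y (Abs_fgroup w)"
          have "w \<in> T \<Longrightarrow> spin_at \<xi> w = \<eta> w" for w
          proof (induction w)
            case Nil
            then show ?case using R by (auto simp: Y_def)
          next
            case (Cons a w)
            then have "spin_at \<xi> w = \<eta> w" using closed by blast
            moreover have "\<xi> (Abs_fgroup (a # w)) \<in> Y (Abs_fgroup (a # w))" using R Cons.prems by blast
            ultimately show ?case using Yc[OF Cons.prems] by simp
          qed
          then show "\<forall>w\<in>T. spin_at \<xi> w = \<eta> w" by blast
        qed
      qed
      have "(\<forall>w\<in>T. X \<xi> (Abs_fgroup w) = \<eta> w) \<longleftrightarrow> (\<forall>w\<in>T. spin_at \<xi> w = \<eta> w)" for \<xi>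
        using Rep by (simp add: X_def)
      then show ?thesis using one by (simp add: prod_emb_def restrict_PiE_iff vimage_def space_PiM) (auto simp: Pi_def)
    qed
    have mY: "measure (measure_pmf (D (Abs_fgroup w))) (Y (Abs_fgroup w)) = (if w = [] then \<pi> (\<eta> []) else P (\<eta> (tl w)) (\<eta> w))" if w: "w \<in> T" for w
    proof (cases "w = []")
      case True
      have "measure (measure_pmf (map_pmf (\<lambda>s. (s, s)) (embed_pmf \<pi>))) {y. fst y = \<eta> []} = measure (measure_pmf (embed_pmf \<pi>)) {\<eta> []}"
        by (simp add: measure_map_pmf vimage_def)
      then show ?thesis using True by (simp add: D_def Y_def measure_pmf_single pmf_embed_spin[OF \<pi>])
    next
      case False
      then have ne: "Abs_fgroup w \<noteq> Abs_fgroup []" using Rep[OF w] Rep[OF T0] by auto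
      let ?p = "pair_pmf (embed_pmf (P Minus)) (embed_pmf (P Plus))"
      have "measure (measure_pmf ?p) {y. fst y = s} = P Minus s" "measure (measure_pmf ?p) {y. snd y = s} = P Plus s" for s
        using measure_map_pmf[of fst ?p "{s}"] measure_map_pmf[of snd ?p "{s}"]
        by (simp_all add: map_fst_pair_pmf map_snd_pair_pmf measure_pmf_single pmf_embed_spin[OF tr] vimage_def)
      then show ?thesis using False ne Rep[OF w] by (cases "\<eta> (tl w)") (simp_all add: D_def Y_def)
    qed
    have "measure \<mu> {x. \<forall>w\<in>T. x (Abs_fgroup w) = \<eta> w} = measure ?\<Omega> (prod_emb UNIV (\<lambda>g. measure_pmf (D g)) (Abs_fgroup ` T) (Pi\<^sub>E (Abs_fgroup ` T) Y))"
      unfolding \<mu>_def ev[symmetric] by (rule measure_distr[OF Xm set])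
    also have "\<dots> = (\<Prod>g\<in>Abs_fgroup ` T. measure (measure_pmf (D g)) (Y g))"
      using fin by (intro measure_PiM_emb) auto
    also have "\<dots> = (\<Prod>w\<in>T. if w = [] then \<pi> (\<eta> []) else P (\<eta> (tl w)) (\<eta> w))"
      by (subst prod.reindex[OF inj]) (simp add: mY)
    also have "\<dots> = tree_weight P \<pi> T \<eta>"
      using prod.remove[OF fin T0, of "\<lambda>w. if w = [] then \<pi> (\<eta> []) else P (\<eta> (tl w)) (\<eta> w)"]
      by (simp add: tree_weight_def)
    finally show ?thesis .
  qed
  then show ?thesis using \<mu> by blast
qed

lemma config_split_spin:
  fixes \<mu> :: "'a::finite config measure"
  assumes \<mu>: "\<mu> \<in> borel_prob" and A: "A \<in> sets borel"
  shows "measure \<mu> A = measure \<mu> {x \<in> A. x g = Minus} + measure \<mu> {x \<in> A. x g = Plus}"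
proof -
  interpret prob_space \<mu> using \<mu> by (simp add: borel_prob_def)
  have sets: "sets \<mu> = sets borel" using \<mu> by (simp add: borel_prob_def)
  have m: "{x \<in> A. x g = s} \<in> sets \<mu>" for s
    using config_set_borel[of "{g}" "\<lambda>_. s"] A unfolding sets Collect_conj_eq by (simp add: sets.Int)
  have "A = {x \<in> A. x g = Minus} \<union> {x \<in> A. x g = Plus}"
    by (auto intro: spin.exhaust)
  then have "measure \<mu> A = measure \<mu> ({x \<in> A. x g = Minus} \<union> {x \<in> A. x g = Plus})" by simp
  also have "\<dots> = measure \<mu> {x \<in> A. x g = Minus} + measure \<mu> {x \<in> A. x g = Plus}"
    by (rule finite_measure_Union[OF m m]) auto
  finally show ?thesis .
qed

context
  fixes \<mu> :: "'a::finite config measure" and P :: "spin \<Rightarrow> spin \<Rightarrow> real" and \<pi> :: "spin \<Rightarrow> real"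
  assumes \<mu>: "\<mu> \<in> borel_prob"
    and cyl: "\<And>T \<eta>. word_tree T \<Longrightarrow> measure \<mu> {x. \<forall>w\<in>T. x (Abs_fgroup w) = \<eta> w} = tree_weight P \<pi> T \<eta>"
    and P: "\<And>s. P s Minus + P s Plus = 1" and rev: "\<And>s s'. \<pi> s * P s s' = \<pi> s' * P s' s"
begin

text \<open>\<open>F\<close> is completed to a tree that avoids \<open>h\<close>. Adding
  \<open>h\<close> to this tree multiplies its weight by one transition probability, and summation
  over the completions returns to \<open>F\<close>.\<close>

lemma chain_step_down:
  assumes e: "Rep_fgroup h = a # Rep_fgroup g" and F: "finite F" "g \<in> F" "F \<inter> descendants (Rep_fgroup h) = {}"
  shows "measure \<mu> {x. (\<forall>k\<in>F. x k = \<eta> k) \<and> x h = b} = measure \<mu> {x. \<forall>k\<in>F. x k = \<eta> k} * P (\<eta> g) b"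
proof -
  let ?H = "Rep_fgroup h"
  define T where "T = suffixes_of F"
  let ?S = "Abs_fgroup ` T"
  have T: "word_tree T" unfolding T_def by (rule word_tree_suffixes_of[OF F(1)])
  have fin: "finite T" using T by (simp add: word_tree_def)
  have FS: "F \<subseteq> ?S"
    using suffixes_of_superset[of _ F] by (auto intro!: image_eqI[of _ Abs_fgroup "Rep_fgroup _"] simp: Rep_fgroup_inverse T_def)
  have G: "Rep_fgroup g \<in> T" using suffixes_of_superset[OF F(2)] by (simp add: T_def)
  have HT: "?H \<notin> T"
    using F(3) e by (auto simp: T_def suffixes_of_def descendants_def)
  have T': "word_tree (insert ?H T)"
    unfolding word_tree_def
  proof (intro conjI ballI allI impI)
    fix b w assume "b # w \<in> insert ?H T"
    then consider "b # w = ?H" | "b # w \<in> T" by blast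
    then show "w \<in> insert ?H T"
    proof cases
      case 1 then show ?thesis using e G by auto
    next
      case 2 then show ?thesis using T unfolding word_tree_def by blast
    qed
  qed (use T Rep_fgroup[of h] in \<open>auto simp: word_tree_def\<close>)
  have RepA: "Rep_fgroup (Abs_fgroup u) = u" if "u \<in> T" for u using word_tree_reduced[OF T that] .
  have ext: "measure \<mu> {x. (\<forall>k\<in>?S. x k = \<theta> k) \<and> x \<in> {x. x h = b}} = measure \<mu> {x. \<forall>k\<in>?S. x k = \<theta> k} * P (\<theta> g) b" for \<theta>
  proof -
    let ?\<theta> = "\<lambda>w. if w = ?H then b else \<theta> (Abs_fgroup w)"
    have "{x. (\<forall>k\<in>?S. x k = \<theta> k) \<and> x \<in> {x. x h = b}} = {x. \<forall>w\<in>insert ?H T. x (Abs_fgroup w) = ?\<theta> w}"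
      using HT by (auto simp: Rep_fgroup_inverse)
    then have "measure \<mu> {x. (\<forall>k\<in>?S. x k = \<theta> k) \<and> x \<in> {x. x h = b}} = tree_weight P \<pi> (insert ?H T) ?\<theta>"
      by (simp only: cyl[OF T'])
    also have "\<dots> = tree_weight P \<pi> T ?\<theta> * P (\<theta> g) b"
    proof -
      have "insert ?H T - {[]} = insert ?H (T - {[]})" using e by auto
      moreover have "Rep_fgroup g \<noteq> ?H" using HT G by auto
      ultimately show ?thesis using HT fin e by (simp add: tree_weight_def Rep_fgroup_inverse)
    qed
    also have "tree_weight P \<pi> T ?\<theta> = measure \<mu> {x. \<forall>w\<in>T. x (Abs_fgroup w) = ?\<theta> w}"
      by (rule cyl[OF T, symmetric])
    also have "{x. \<forall>w\<in>T. x (Abs_fgroup w) = ?\<theta> w} = {x. \<forall>k\<in>?S. x k = \<theta> k}" using HT by auto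
    finally show ?thesis .
  qed
  have hb: "{x. x h = b} \<in> sets borel" using config_set_borel[of "{h}" "\<lambda>_. b"] by simp
  have "measure \<mu> {x. (\<forall>k\<in>F. x k = \<eta> k) \<and> x h = b} = measure \<mu> {x. (\<forall>k\<in>F. x k = \<eta> k) \<and> x \<in> {x. x h = b}}" by simp
  also have "\<dots> = (\<Sum>\<theta>\<in>{\<theta> \<in> ?S \<rightarrow>\<^sub>E UNIV. \<forall>k\<in>F. \<theta> k = \<eta> k}. measure \<mu> {x. \<forall>k\<in>?S. x k = \<theta> k} * P (\<theta> g) b)"
    using fin by (subst config_event_split[OF \<mu> _ FS hb]) (simp_all only: ext finite_imageI)
  also have "\<dots> = (\<Sum>\<theta>\<in>{\<theta> \<in> ?S \<rightarrow>\<^sub>E UNIV. \<forall>k\<in>F. \<theta> k = \<eta> k}. measure \<mu> {x. \<forall>k\<in>?S. x k = \<theta> k} * P (\<eta> g) b)"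
    using F(2) by (intro sum.cong) auto
  also have "\<dots> = measure \<mu> {x. \<forall>k\<in>F. x k = \<eta> k} * P (\<eta> g) b"
    using fin by (simp add: config_event_split'[OF \<mu> _ FS] sum_distrib_right)
  finally show ?thesis .
qed

lemma not_own_descendant:
  "Rep_fgroup h = a # Rep_fgroup g \<Longrightarrow> g \<notin> descendants (Rep_fgroup h)"
  by (auto simp: descendants_def dest: arg_cong[of _ _ length])

text \<open>Reversibility makes \<open>\<pi>\<close> stationary, so the law at the root is passed on
  along every word.\<close>

lemma chain_marginal: "measure \<mu> {x. x g = b} = \<pi> b"
proof -
  have "reduced w \<Longrightarrow> measure \<mu> {x. x (Abs_fgroup w) = b} = \<pi> b" for w b
  proof (induction w arbitrary: b)
    case Nil
    then show ?case using cyl[of "{[]}" "\<lambda>_. b"] by (simp add: word_tree_def tree_weight_def)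
  next
    case (Cons a w)
    let ?g = "Abs_fgroup w" and ?h = "Abs_fgroup (a # w)"
    have e: "Rep_fgroup ?h = a # Rep_fgroup ?g" using Cons.prems by (simp add: Abs_fgroup_inverse reduced_Cons)
    have hb: "{x. x ?h = b} \<in> sets borel" using config_set_borel[of "{?h}" "\<lambda>_. b"] by simp
    have "measure \<mu> {x \<in> {x. x ?h = b}. x ?g = s} = \<pi> b * P b s" for s
    proof -
      have "measure \<mu> {x. (\<forall>k\<in>{?g}. x k = s) \<and> x ?h = b} = measure \<mu> {x. \<forall>k\<in>{?g}. x k = s} * P s b"
        using not_own_descendant[OF e] by (intro chain_step_down[OF e]) auto
      then show ?thesis using Cons by (simp add: reduced_Cons rev conj_commute)
    qed
    then have "measure \<mu> {x. x ?h = b} = \<pi> b * (P b Minus + P b Plus)"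
      using config_split_spin[OF \<mu> hb, of ?g] by (simp add: distrib_left)
    then show ?case using P by simp
  qed
  then show ?thesis using Rep_fgroup[of g] by (metis Rep_fgroup_inverse mem_Collect_eq)
qed

text \<open>The subtree below \<open>g\<close> is read from the parent \<open>h\<close>: start with
  the marginal at \<open>h\<close>, step to \<open>g\<close>, then descend. The spin
  \<open>b\<close> at \<open>h\<close> occurs only in the first two factors.\<close>

lemma chain_descendants:
  assumes e: "Rep_fgroup g = a # Rep_fgroup h"
    and S: "finite S" "g \<in> S" "S \<subseteq> descendants (Rep_fgroup g)"
      "\<And>k. k \<in> S \<Longrightarrow> k \<noteq> g \<Longrightarrow> Abs_fgroup (tl (Rep_fgroup k)) \<in> S"
  shows "measure \<mu> {x. (\<forall>k\<in>S. x k = \<theta> k) \<and> x h = b}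
    = \<pi> b * P b (\<theta> g) * (\<Prod>k\<in>S - {g}. P (\<theta> (Abs_fgroup (tl (Rep_fgroup k)))) (\<theta> k))"
  using S
proof (induction "card S" arbitrary: S rule: less_induct)
  case less
  show ?case
  proof (cases "S = {g}")
    case True
    have "measure \<mu> {x. (\<forall>k\<in>{h}. x k = b) \<and> x g = \<theta> g} = measure \<mu> {x. \<forall>k\<in>{h}. x k = b} * P b (\<theta> g)"
      using not_own_descendant[OF e] by (intro chain_step_down[OF e]) auto
    then show ?thesis using True by (simp add: chain_marginal conj_commute)
  next
    case False
    let ?L = "(\<lambda>k. length (Rep_fgroup k)) ` S"
    have "Max ?L \<in> ?L" using less.prems(1,2) by (intro Max_in) auto
    then obtain k where k: "k \<in> S" "length (Rep_fgroup k) = Max ?L" by auto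
    have kmax: "length (Rep_fgroup k') \<le> length (Rep_fgroup k)" if "k' \<in> S" for k'
      using that less.prems(1) k(2) by simp
    have desc: "length (Rep_fgroup k') > length (Rep_fgroup g)" if k': "k' \<in> S" "k' \<noteq> g" for k'
    proof -
      obtain u where u: "Rep_fgroup k' = u @ Rep_fgroup g" using less.prems(3) k' by (auto simp: descendants_def)
      then have "u \<noteq> []" using k'(2) by (auto simp: Rep_fgroup_inject)
      then show ?thesis using u by simp
    qed
    obtain k' where "k' \<in> S" "k' \<noteq> g" using False less.prems(2) by blast
    then have kg: "k \<noteq> g" using desc kmax by fastforce
    then have "Rep_fgroup k \<noteq> []" using desc[OF k(1)] by auto
    then obtain c w where cw: "Rep_fgroup k = c # w" by (cases "Rep_fgroup k") auto
    let ?p = "Abs_fgroup w"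
    have pS: "?p \<in> S" using less.prems(4)[OF k(1) kg] cw by simp
    have redw: "reduced w" using Rep_fgroup[of k] cw by (simp add: reduced_Cons)
    have ek: "Rep_fgroup k = c # Rep_fgroup ?p" using cw redw by (simp add: Abs_fgroup_inverse)
    have hS: "h \<notin> S" using not_own_descendant[OF e] less.prems(3) by auto
    let ?S = "S - {k}" and ?\<theta> = "\<lambda>k. if k = h then b else \<theta> k"
    have pk: "?p \<noteq> k" using ek by (metis not_Cons_self2)
    have disj: "insert h ?S \<inter> descendants (Rep_fgroup k) = {}"
    proof -
      have "False" if "k' \<in> ?S" "Rep_fgroup k' = u @ Rep_fgroup k" for k' u
        using kmax[of k'] that by (auto simp: Rep_fgroup_inject)
      moreover have "False" if "Rep_fgroup h = u @ Rep_fgroup k" for u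
        using desc[OF k(1) kg] e arg_cong[OF that, of length] by simp
      ultimately show ?thesis by (auto simp: descendants_def)
    qed
    have "measure \<mu> {x. (\<forall>j\<in>insert h ?S. x j = ?\<theta> j) \<and> x k = \<theta> k} = measure \<mu> {x. \<forall>j\<in>insert h ?S. x j = ?\<theta> j} * P (?\<theta> ?p) (\<theta> k)"
      by (rule chain_step_down[OF ek _ _ disj]) (use pS pk less.prems(1) in auto)
    also have "{x. (\<forall>j\<in>insert h ?S. x j = ?\<theta> j) \<and> x k = \<theta> k} = {x. (\<forall>j\<in>S. x j = \<theta> j) \<and> x h = b}"
      using k(1) hS by auto
    also have "{x. \<forall>j\<in>insert h ?S. x j = ?\<theta> j} = {x. (\<forall>j\<in>?S. x j = \<theta> j) \<and> x h = b}" using hS by auto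
    also have "?\<theta> ?p = \<theta> ?p" using pS hS by auto
    also have "measure \<mu> {x. (\<forall>j\<in>?S. x j = \<theta> j) \<and> x h = b}
        = \<pi> b * P b (\<theta> g) * (\<Prod>k\<in>?S - {g}. P (\<theta> (Abs_fgroup (tl (Rep_fgroup k)))) (\<theta> k))"
    proof (rule less.hyps)
      show "card ?S < card S" using less.prems(1) k(1) by (rule card_Diff1_less)
      fix j assume j: "j \<in> ?S" "j \<noteq> g"
      have len: "length (Rep_fgroup j) > 0" using desc[of j] j by auto
      have "Abs_fgroup (tl (Rep_fgroup j)) \<noteq> k"
      proof
        assume eq: "Abs_fgroup (tl (Rep_fgroup j)) = k"
        have "reduced (Rep_fgroup j)" using Rep_fgroup[of j] unfolding mem_Collect_eq .
        then have "reduced (tl (Rep_fgroup j))" by (cases "Rep_fgroup j") (simp_all add: reduced_Cons)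
        then have "Rep_fgroup k = tl (Rep_fgroup j)" using eq Abs_fgroup_inverse by blast
        then have "length (Rep_fgroup k) = length (Rep_fgroup j) - 1" by simp
        moreover have "length (Rep_fgroup j) \<le> length (Rep_fgroup k)" using kmax j by blast
        ultimately show False using len by linarith
      qed
      then show "Abs_fgroup (tl (Rep_fgroup j)) \<in> ?S" using less.prems(4)[of j] j by simp
    qed (use less.prems kg in auto)
    also have "S - {g} = insert k (?S - {g})" using k(1) kg by auto
    ultimately show ?thesis
      using less.prems(1) cw by (simp add: mult_ac)
  qed
qed

text \<open>Detailed balance turns \<open>\<pi> b * P b (\<theta> g)\<close> into
  \<open>\<pi> (\<theta> g) * P (\<theta> g) b\<close>, so the dependence on \<open>b\<close> splits
  off from the sum over the subtree.\<close>

lemma chain_step_up: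
  assumes e: "Rep_fgroup g = a # Rep_fgroup h" and F: "finite F" "g \<in> F" "F \<subseteq> descendants (Rep_fgroup g)"
  shows "measure \<mu> {x. (\<forall>k\<in>F. x k = \<eta> k) \<and> x h = b} = measure \<mu> {x. \<forall>k\<in>F. x k = \<eta> k} * P (\<eta> g) b"
proof -
  let ?G = "Rep_fgroup g"
  define T where "T = {w \<in> suffixes_of F. \<exists>u. w = u @ ?G}"
  let ?S = "Abs_fgroup ` T"
  have wt: "word_tree (suffixes_of F)" by (rule word_tree_suffixes_of[OF F(1)])
  have RepA: "Rep_fgroup (Abs_fgroup u) = u" if "u \<in> T" for u
    using word_tree_reduced[OF wt, of u] that by (auto simp: T_def)
  have fin: "finite ?S" using finite_suffixes_of[OF F(1)] by (simp add: T_def)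
  have FS: "F \<subseteq> ?S"
  proof
    fix k assume "k \<in> F"
    then have "Rep_fgroup k \<in> T" using suffixes_of_superset F(3) by (auto simp: T_def descendants_def)
    then show "k \<in> ?S" by (metis Rep_fgroup_inverse image_eqI)
  qed
  have gS: "g \<in> ?S" using FS F(2) by blast
  have Sd: "?S \<subseteq> descendants ?G"
  proof
    fix k assume "k \<in> ?S"
    then obtain w where w: "w \<in> T" "k = Abs_fgroup w" by blast
    then show "k \<in> descendants ?G" using RepA[OF w(1)] by (auto simp: descendants_def T_def)
  qed
  have Sc: "Abs_fgroup (tl (Rep_fgroup k)) \<in> ?S" if k: "k \<in> ?S" "k \<noteq> g" for k
  proof -
    obtain w where w: "w \<in> T" "k = Abs_fgroup w" using k by blast
    obtain u where u: "w = u @ ?G" using w(1) by (auto simp: T_def)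
    have "u \<noteq> []" using u w(2) k(2) by (auto simp: Rep_fgroup_inverse)
    then obtain c u' where "u = c # u'" by (cases u) auto
    then have cw: "w = c # (u' @ ?G)" using u by simp
    have "u' @ ?G \<in> suffixes_of F" using wt w(1) unfolding cw T_def word_tree_def by blast
    then have "u' @ ?G \<in> T" by (auto simp: T_def)
    moreover have "tl (Rep_fgroup k) = u' @ ?G" using RepA[OF w(1)] w(2) cw by simp
    ultimately show ?thesis by simp
  qed
  let ?I = "{\<theta> \<in> ?S \<rightarrow>\<^sub>E UNIV. \<forall>k\<in>F. \<theta> k = \<eta> k}"
  define Q where "Q \<theta> = (\<Prod>k\<in>?S - {g}. P (\<theta> (Abs_fgroup (tl (Rep_fgroup k)))) (\<theta> k))" for \<theta>
  have hb: "{x. x h = b} \<in> sets borel" for b :: spin using config_set_borel[of "{h}" "\<lambda>_. b"] by simp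
  have main: "measure \<mu> {x. (\<forall>k\<in>F. x k = \<eta> k) \<and> x h = b} = \<pi> (\<eta> g) * P (\<eta> g) b * (\<Sum>\<theta>\<in>?I. Q \<theta>)" for b
  proof -
    have "measure \<mu> {x. (\<forall>k\<in>F. x k = \<eta> k) \<and> x h = b} = (\<Sum>\<theta>\<in>?I. measure \<mu> {x. (\<forall>k\<in>?S. x k = \<theta> k) \<and> x h = b})"
      using config_event_split[OF \<mu> fin FS hb[of b], of \<eta>] by simp
    also have "\<dots> = (\<Sum>\<theta>\<in>?I. \<pi> b * P b (\<theta> g) * Q \<theta>)"
      unfolding Q_def by (intro sum.cong refl chain_descendants[OF e fin gS Sd Sc])
    also have "\<dots> = (\<Sum>\<theta>\<in>?I. \<pi> (\<eta> g) * P (\<eta> g) b * Q \<theta>)"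
      using F(2) by (intro sum.cong) (auto simp: rev)
    finally show ?thesis by (simp add: sum_distrib_left)
  qed
  have FB: "{x. \<forall>k\<in>F. x k = \<eta> k} \<in> sets borel" by (rule config_set_borel[OF F(1)])
  have "measure \<mu> {x. \<forall>k\<in>F. x k = \<eta> k} = \<pi> (\<eta> g) * (P (\<eta> g) Minus + P (\<eta> g) Plus) * (\<Sum>\<theta>\<in>?I. Q \<theta>)"
    using config_split_spin[OF \<mu> FB, of h] main[of Minus] main[of Plus] by (simp add: algebra_simps)
  then show ?thesis using main[of b] P by simp
qed

lemma chain_is_markov: "tree_markov_chain \<pi> P \<mu>"
  unfolding tree_markov_chain_def
proof (intro conjI allI impI)
  fix g h :: "'a fgroup" and F and \<eta> :: "'a fgroup \<Rightarrow> spin" and b :: spin assume a: "cayley_edge g h \<and> finite F \<and> g \<in> F \<and> F \<subseteq> past g h"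
  then consider a where "Rep_fgroup h = a # Rep_fgroup g" | a where "Rep_fgroup g = a # Rep_fgroup h"
    by (auto simp: cayley_edge_iff)
  then show "measure \<mu> {x. (\<forall>k\<in>F. x k = \<eta> k) \<and> x h = b} = measure \<mu> {x. \<forall>k\<in>F. x k = \<eta> k} * P (\<eta> g) b"
  proof cases
    case 1
    then show ?thesis using chain_step_down[OF 1] past_down[OF 1] a by blast
  next
    case 2
    then show ?thesis using chain_step_up[OF 2] past_up[OF 2] a by blast
  qed
qed (use \<mu> chain_marginal in auto)

end

section \<open>Automorphisms of the tree\<close>

lemma automorphism_past:
  assumes "tree_automorphism \<phi>"
  shows "\<phi> ` past g h \<subseteq> past (\<phi> g) (\<phi> h)"
proof -
  have b: "bij \<phi>" and e: "\<And>g h. cayley_edge (\<phi> g) (\<phi> h) \<longleftrightarrow> cayley_edge g h"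
    using assms by (auto simp: tree_automorphism_def)
  have "(\<phi> g, \<phi> k) \<in> {(a, b). cayley_edge a b \<and> {a, b} \<noteq> {\<phi> g, \<phi> h}}\<^sup>*"
    if "(g, k) \<in> {(a, b). cayley_edge a b \<and> {a, b} \<noteq> {g, h}}\<^sup>*" for k
    using that
  proof (induction rule: rtrancl_induct)
    case (step y z)
    have "{\<phi> y, \<phi> z} = {\<phi> g, \<phi> h} \<longleftrightarrow> {y, z} = {g, h}"
      using inj_image_eq_iff[OF bij_is_inj[OF b], of "{y, z}" "{g, h}"] by simp
    then have "(\<phi> y, \<phi> z) \<in> {(a, b). cayley_edge a b \<and> {a, b} \<noteq> {\<phi> g, \<phi> h}}" using step.hyps(2) e by auto
    then show ?case using step.IH by (rule rtrancl_into_rtrancl[rotated])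
  qed simp
  then show ?thesis by (auto simp: past_def)
qed

lemma reindex_measurable: "(\<lambda>x :: 'a::finite config. x \<circ> \<phi>) \<in> borel \<rightarrow>\<^sub>M (borel :: 'a config measure)"
  by (rule measurable_into_config) (simp add: coordinate_measurable)

lemma measure_reindex:
  fixes \<mu> :: "'a::finite config measure" and \<phi> :: "'a fgroup \<Rightarrow> 'a fgroup"
  assumes \<mu>: "\<mu> \<in> borel_prob" and A: "A \<in> sets borel"
  shows "measure (distr \<mu> borel (\<lambda>x. x \<circ> \<phi>)) A = measure \<mu> {x. x \<circ> \<phi> \<in> A}"
proof -
  have m: "(\<lambda>x. x \<circ> \<phi>) \<in> \<mu> \<rightarrow>\<^sub>M (borel :: 'a config measure)"
    using reindex_measurable \<mu> by (simp add: borel_prob_def cong: measurable_cong_sets)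
  show ?thesis using measure_distr[OF m A] space_borel_prob[OF \<mu>] by (simp add: vimage_def)
qed

lemma tree_markov_chain_reindex:
  fixes \<mu> :: "'a::finite config measure"
  assumes M: "tree_markov_chain \<pi> P \<mu>" and \<phi>: "tree_automorphism \<phi>"
  shows "tree_markov_chain \<pi> P (distr \<mu> borel (\<lambda>x. x \<circ> \<phi>))"
proof -
  let ?\<nu> = "distr \<mu> borel (\<lambda>x. x \<circ> \<phi>)"
  have \<mu>: "\<mu> \<in> borel_prob" using M by (simp add: tree_markov_chain_def)
  interpret prob_space \<mu> using \<mu> by (simp add: borel_prob_def)
  have b: "bij \<phi>" and e: "\<And>g h. cayley_edge (\<phi> g) (\<phi> h) \<longleftrightarrow> cayley_edge g h"
    using \<phi> by (auto simp: tree_automorphism_def)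
  have m: "(\<lambda>x. x \<circ> \<phi>) \<in> \<mu> \<rightarrow>\<^sub>M (borel :: 'a config measure)"
    using reindex_measurable \<mu> by (simp add: borel_prob_def cong: measurable_cong_sets)
  show ?thesis
    unfolding tree_markov_chain_def
  proof (intro conjI allI impI)
    show "?\<nu> \<in> borel_prob" using prob_space_distr[OF m] by (simp add: borel_prob_def)
    fix g a
    show "measure ?\<nu> {x. x g = a} = \<pi> a"
      using measure_reindex[OF \<mu>, of "{x. x g = a}" \<phi>] config_set_borel[of "{g}" "\<lambda>_. a"] M
      by (simp add: tree_markov_chain_def)
  next
    fix g h :: "'a fgroup" and F and \<eta> :: "'a fgroup \<Rightarrow> spin" and b :: spin assume a: "cayley_edge g h \<and> finite F \<and> g \<in> F \<and> F \<subseteq> past g h"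
    let ?\<eta> = "\<lambda>k. \<eta> (inv_into UNIV \<phi> k)"
    have inv: "inv_into UNIV \<phi> (\<phi> k) = k" for k using b by (simp add: bij_is_inj)
    have fF: "{x. \<forall>k\<in>F. x k = \<eta> k} \<in> sets borel" using a by (intro config_set_borel) auto
    have hb: "{x. x h = b} \<in> sets borel" using config_set_borel[of "{h}" "\<lambda>_. b"] by simp
    have "measure \<mu> {x. (\<forall>k\<in>\<phi> ` F. x k = ?\<eta> k) \<and> x (\<phi> h) = b} = measure \<mu> {x. \<forall>k\<in>\<phi> ` F. x k = ?\<eta> k} * P (?\<eta> (\<phi> g)) b"
    proof (rule tree_markov_chain_step[OF M])
      show "\<phi> ` F \<subseteq> past (\<phi> g) (\<phi> h)" using a automorphism_past[OF \<phi>, of g h] by blast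
    qed (use a e in auto)
    then show "measure ?\<nu> {x. (\<forall>k\<in>F. x k = \<eta> k) \<and> x h = b} = measure ?\<nu> {x. \<forall>k\<in>F. x k = \<eta> k} * P (\<eta> g) b"
      using measure_reindex[OF \<mu> fF, of \<phi>] measure_reindex[OF \<mu> sets.Int[OF fF hb], of \<phi>]
      by (simp add: inv Int_def)
  qed
qed

section \<open>The Ising chains\<close>

definition ising_norm :: "real \<Rightarrow> real \<Rightarrow> real" where
  "ising_norm J t = 2 * exp (-2 * J) + 2 * cosh (2 * t)"

text \<open>The Gibbs law of a single edge with coupling \<open>J\<close> and boundary field
  \<open>t\<close> at both ends, scaled by \<open>exp (- J)\<close>. It is the joint law of
  neighbouring spins in the chain.\<close>

definition ising_edge :: "real \<Rightarrow> real \<Rightarrow> spin \<Rightarrow> spin \<Rightarrow> real" where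
  "ising_edge J t s s' = exp (J * (val s * val s' - 1) + t * (val s + val s')) / ising_norm J t"

lemma ising_norm_pos [simp]: "ising_norm J t > 0"
  by (simp add: ising_norm_def add_pos_pos)

lemma ising_edge_pos [simp]: "ising_edge J t s s' > 0"
  by (simp add: ising_edge_def)

lemma ising_edge_sym: "ising_edge J t s s' = ising_edge J t s' s"
  by (simp add: ising_edge_def mult.commute add.commute)

lemma ising_norm_alt: "ising_norm J t = 2 * exp (-2 * J) + exp (2 * t) + exp (- 2 * t)"
  by (simp add: ising_norm_def cosh_field_def field_simps)

lemma ising_edge_simps:
  "ising_edge J t Plus Plus = exp (2 * t) / ising_norm J t"
  "ising_edge J t Minus Minus = exp (- 2 * t) / ising_norm J t"
  "ising_edge J t Plus Minus = exp (- 2 * J) / ising_norm J t"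
  "ising_edge J t Minus Plus = exp (- 2 * J) / ising_norm J t"
  by (simp_all add: ising_edge_def)

lemma sum_spin: "(\<Sum>s\<in>UNIV. f s) = f Minus + f Plus" for f :: "spin \<Rightarrow> 'b::comm_monoid_add"
  by (simp add: UNIV_spin)

lemma prod_spin: "(\<Prod>s\<in>UNIV. f s) = f Minus * f Plus" for f :: "spin \<Rightarrow> 'b::comm_monoid_mult"
  by (simp add: UNIV_spin)

lemma ising_marginal_edge: "ising_marginal J t s = ising_edge J t s Minus + ising_edge J t s Plus"
proof -
  have n: "ising_norm J t \<noteq> 0" by (rule less_imp_neq[OF ising_norm_pos, symmetric])
  have a: "ising_alpha J t = (exp (- 2 * J) + exp (- 2 * t)) / ising_norm J t"
    by (simp add: ising_alpha_def ising_norm_def)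
  show ?thesis
  proof (cases s)
    case Minus
    then show ?thesis by (simp add: a ising_edge_simps add_divide_distrib)
  next
    case Plus
    have "1 - ising_alpha J t = (ising_norm J t - (exp (- 2 * J) + exp (- 2 * t))) / ising_norm J t"
      using n by (simp add: a diff_divide_distrib)
    also have "\<dots> = ising_edge J t Plus Minus + ising_edge J t Plus Plus"
      by (simp add: ising_edge_simps ising_norm_alt add_divide_distrib[symmetric])
    finally show ?thesis using Plus by simp
  qed
qed

lemma ising_marginal_pos [simp]: "ising_marginal J t s > 0"
  unfolding ising_marginal_edge by (intro add_pos_pos) simp_all

lemma ising_marginal_sum: "ising_marginal J t Minus + ising_marginal J t Plus = 1"
  by simp

text \<open>\<open>ising_alpha\<close> and \<open>ising_beta\<close> are the marginal and the
  conditional probabilities of the symmetric law \<open>ising_edge\<close>, which makes the chain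
  reversible.\<close>

lemma ising_transition_edge: "ising_marginal J t s * ising_transition J t s s' = ising_edge J t s s'"
proof -
  have off: "ising_marginal J t Minus * ising_beta J (- t) = ising_edge J t Minus Plus"
    "ising_marginal J t Plus * ising_beta J t = ising_edge J t Plus Minus"
  proof -
    have frac: "A / N * (1 / B) = e / N" if "A / B = e" for A N B e :: real
      using that by (auto simp: mult.commute)
    have "(exp (- 2 * J) + exp (- 2 * t)) / (exp (2 * (J + - t)) + 1) = exp (- 2 * J)"
    proof -
      have "exp (- 2 * J) * (exp (2 * (J + - t)) + 1) = exp (- 2 * J) + exp (- 2 * t)"
        by (simp add: distrib_left exp_add[symmetric] algebra_simps)
      then show ?thesis by (simp add: nonzero_divide_eq_eq add_pos_pos less_imp_neq[symmetric])
    qed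
    moreover have "ising_marginal J t Minus = (exp (- 2 * J) + exp (- 2 * t)) / ising_norm J t"
      by (simp add: ising_alpha_def ising_norm_def)
    ultimately show "ising_marginal J t Minus * ising_beta J (- t) = ising_edge J t Minus Plus"
      unfolding ising_beta_def ising_edge_simps by (simp only: frac)
    have "(exp (- 2 * J) + exp (2 * t)) / (exp (2 * (J + t)) + 1) = exp (- 2 * J)"
    proof -
      have "exp (- 2 * J) * (exp (2 * (J + t)) + 1) = exp (- 2 * J) + exp (2 * t)"
        by (simp add: distrib_left exp_add[symmetric] algebra_simps)
      then show ?thesis by (simp add: nonzero_divide_eq_eq add_pos_pos less_imp_neq[symmetric])
    qed
    moreover have "ising_marginal J t Plus = (exp (- 2 * J) + exp (2 * t)) / ising_norm J t"
      by (simp only: ising_marginal_edge ising_edge_simps add_divide_distrib)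
    ultimately show "ising_marginal J t Plus * ising_beta J t = ising_edge J t Plus Minus"
      unfolding ising_beta_def ising_edge_simps by (simp only: frac)
  qed
  have "ising_marginal J t Minus * (1 - ising_beta J (- t)) = ising_edge J t Minus Minus"
    "ising_marginal J t Plus * (1 - ising_beta J t) = ising_edge J t Plus Plus"
    unfolding right_diff_distrib off by (simp_all only: ising_marginal_edge) auto
  then show ?thesis using off by (cases s; cases s') (simp_all del: ising_marginal.simps)
qed

lemma ising_transition_eq: "ising_transition J t s s' = ising_edge J t s s' / ising_marginal J t s"
  by (subst nonzero_eq_divide_eq)
     (simp_all only: less_imp_neq[OF ising_marginal_pos, symmetric] ising_transition_edge[symmetric] mult.commute not_False_eq_True)

lemma ising_transition_pos [simp]: "ising_transition J t s s' > 0"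
  by (simp add: ising_transition_eq del: ising_marginal.simps)

lemma ising_transition_sum: "ising_transition J t s Minus + ising_transition J t s Plus = 1"
  by (cases s) simp_all

text \<open>Invariance under automorphisms comes for free: the image of the chain is a chain with
  the same data, and such a chain is unique.\<close>

lemma ising_chain_ex1:
  "\<exists>!\<mu> :: 'a::finite config measure. tree_markov_chain (ising_marginal J t) (ising_transition J t) \<mu> \<and>
     (\<forall>\<phi>. tree_automorphism \<phi> \<longrightarrow> distr \<mu> borel (\<lambda>x. x \<circ> \<phi>) = \<mu>)"
proof -
  obtain \<mu> :: "'a config measure" where \<mu>: "\<mu> \<in> borel_prob"
    "\<And>T \<eta>. word_tree T \<Longrightarrow> measure \<mu> {x. \<forall>w\<in>T. x (Abs_fgroup w) = \<eta> w} = tree_weight (ising_transition J t) (ising_marginal J t) T \<eta>"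
    using exists_tree_measure[of "ising_marginal J t" "ising_transition J t", OF less_imp_le[OF ising_marginal_pos]
      ising_marginal_sum less_imp_le[OF ising_transition_pos] ising_transition_sum] by blast
  have M: "tree_markov_chain (ising_marginal J t) (ising_transition J t) \<mu>"
    by (rule chain_is_markov[OF \<mu>]) (auto simp: ising_transition_sum ising_transition_edge ising_edge_sym simp del: ising_marginal.simps)
  show ?thesis
  proof (rule ex1I[of _ \<mu>])
    show "tree_markov_chain (ising_marginal J t) (ising_transition J t) \<mu> \<and>
      (\<forall>\<phi>. tree_automorphism \<phi> \<longrightarrow> distr \<mu> borel (\<lambda>x. x \<circ> \<phi>) = \<mu>)"
      using M tree_markov_chain_unique[OF tree_markov_chain_reindex[OF M] M] by blast
  qed (use M tree_markov_chain_unique in blast)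
qed

lemma ising_chain_markov: "tree_markov_chain (ising_marginal J t) (ising_transition J t) (ising_chain J t :: 'a::finite config measure)"
  and ising_chain_automorphism: "tree_automorphism \<phi> \<Longrightarrow> distr (ising_chain J t :: 'a::finite config measure) borel (\<lambda>x. x \<circ> \<phi>) = ising_chain J t"
  using theI'[OF ising_chain_ex1[of J t, where 'a = 'a]] unfolding ising_chain_def by blast+

lemma ising_chain_borel_prob: "(ising_chain J t :: 'a::finite config measure) \<in> borel_prob"
  using ising_chain_markov by (auto simp: tree_markov_chain_def)

text \<open>Edges are left multiplications by generators, and these commute with right
  multiplications. The shifts are therefore among the automorphisms.\<close>

lemma right_mult_automorphism: "tree_automorphism (\<lambda>h. h \<otimes>\<^bsub>FG\<^esub> g)"
proof -
  interpret group FG by (rule group_FG)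
  have c: "x \<in> carrier FG" for x :: "'a fgroup" by (simp add: FG_def)
  have "bij (\<lambda>h. h \<otimes>\<^bsub>FG\<^esub> g)"
    by (rule bij_betw_byWitness[where f' = "\<lambda>h. h \<otimes>\<^bsub>FG\<^esub> inv\<^bsub>FG\<^esub> g"]) (auto simp: m_assoc c)
  moreover have "cayley_edge (x \<otimes>\<^bsub>FG\<^esub> g) (y \<otimes>\<^bsub>FG\<^esub> g) \<longleftrightarrow> cayley_edge x y" for x y
    by (simp add: cayley_edge_def m_assoc[symmetric] c)
  ultimately show ?thesis by (simp add: tree_automorphism_def)
qed

lemma ising_chain_shift_invariant: "shift_invariant (ising_chain J t :: 'a::finite config measure)"
  unfolding shift_invariant_def
proof
  fix g :: "'a fgroup"
  have "shift g = (\<lambda>x. x \<circ> (\<lambda>h. h \<otimes>\<^bsub>FG\<^esub> g))" by (auto simp: shift_def fun_eq_iff)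
  then show "distr (ising_chain J t) borel (shift g) = ising_chain J t"
    using ising_chain_automorphism[OF right_mult_automorphism, of J t g] by simp
qed

lemma ising_chain_cylinder:
  "word_tree T \<Longrightarrow> measure (ising_chain J t :: 'a::finite config measure) {x. \<forall>w\<in>T. x (Abs_fgroup w) = \<eta> w}
    = tree_weight (ising_transition J t) (ising_marginal J t) T \<eta>"
  by (rule tree_markov_chain_cylinder[OF ising_chain_markov])

lemma ising_chain_edge:
  "measure (ising_chain J t :: 'a::finite config measure) {x. x (Abs_fgroup []) = s \<and> x (letter_elt a) = s'} = ising_edge J t s s'"
proof -
  have "word_tree {[], [a]}" by (auto simp: word_tree_def reduced_Cons)
  from ising_chain_cylinder[OF this, of J t "\<lambda>w. if w = [] then s else s'"]
  show ?thesis by (simp add: tree_weight_def letter_elt_def ising_transition_edge del: ising_marginal.simps)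
qed

lemma expectation_edge:
  fixes \<mu> :: "'a::finite config measure"
  assumes \<mu>: "\<mu> \<in> borel_prob"
  shows "integrable \<mu> (\<lambda>x. val (x g) * val (x h))"
    "(\<integral>x. val (x g) * val (x h) \<partial>\<mu>) = (\<Sum>s\<in>UNIV. \<Sum>s'\<in>UNIV. val s * val s' * measure \<mu> {x. x g = s \<and> x h = s'})"
proof -
  interpret prob_space \<mu> using \<mu> by (simp add: borel_prob_def)
  have sets: "sets \<mu> = sets borel" using \<mu> by (simp add: borel_prob_def)
  let ?A = "\<lambda>s s'. {x :: 'a config. x g = s \<and> x h = s'}"
  have A: "?A s s' \<in> sets \<mu>" for s s'
    using sets.Int[OF config_set_borel[of "{g}" "\<lambda>_. s"] config_set_borel[of "{h}" "\<lambda>_. s'"]]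
    unfolding sets by (simp add: Collect_conj_eq)
  have eq: "(\<lambda>x. val (x g) * val (x h)) = (\<lambda>x. \<Sum>s\<in>UNIV. \<Sum>s'\<in>UNIV. val s * val s' * indicator (?A s s') x)"
  proof
    fix x :: "'a config"
    show "val (x g) * val (x h) = (\<Sum>s\<in>UNIV. \<Sum>s'\<in>UNIV. val s * val s' * indicator (?A s s') x)"
      by (cases "x g"; cases "x h") (simp_all add: sum_spin indicator_def)
  qed
  have int: "integrable \<mu> (\<lambda>x. val s * val s' * indicator (?A s s') x)" for s s'
    using A by (intro integrable_mult_right integrable_real_indicator) (auto simp: emeasure_eq_measure)
  show "integrable \<mu> (\<lambda>x. val (x g) * val (x h))"
    unfolding eq by (intro Bochner_Integration.integrable_sum int)
  show "(\<integral>x. val (x g) * val (x h) \<partial>\<mu>) = (\<Sum>s\<in>UNIV. \<Sum>s'\<in>UNIV. val s * val s' * measure \<mu> (?A s s'))"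
  proof -
    have one: "(\<integral>x. val s * val s' * indicator (?A s s') x \<partial>\<mu>) = val s * val s' * measure \<mu> (?A s s')" for s s'
      using A by simp
    show ?thesis
      unfolding eq by (simp only: Bochner_Integration.integral_sum[OF Bochner_Integration.integrable_sum[OF int]]
        Bochner_Integration.integral_sum[OF int] one)
  qed
qed

definition ising_corr :: "real \<Rightarrow> real \<Rightarrow> real" where
  "ising_corr J t = (\<Sum>s\<in>UNIV. \<Sum>s'\<in>UNIV. val s * val s' * ising_edge J t s s')"

lemma energy_ising_chain: "energy J (ising_chain J t :: 'a::finite config measure) = - J * real CARD('a) * ising_corr J t"
proof -
  let ?\<mu> = "ising_chain J t :: 'a config measure"
  have e: "\<one>\<^bsub>FG\<^esub> = Abs_fgroup []" by (simp add: FG_def fg_one_def)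
  have i: "integrable ?\<mu> (\<lambda>x. val (x \<one>\<^bsub>FG\<^esub>) * val (x g))" for g
    by (rule expectation_edge(1)[OF ising_chain_borel_prob])
  have c: "(\<integral>x. val (x \<one>\<^bsub>FG\<^esub>) * val (x (letter_elt a)) \<partial>?\<mu>) = ising_corr J t" for a
    unfolding e expectation_edge(2)[OF ising_chain_borel_prob] by (simp add: ising_chain_edge ising_corr_def)
  have "energy J ?\<mu> = - (J / 2) * (\<Sum>i\<in>(UNIV :: 'a set). (\<integral>x. val (x \<one>\<^bsub>FG\<^esub>) * val (x (letter_elt (i, True))) \<partial>?\<mu>)
      + (\<integral>x. val (x \<one>\<^bsub>FG\<^esub>) * val (x (letter_elt (i, False))) \<partial>?\<mu>))"
    unfolding energy_def site_energy_def fg_gen_letter letter_elt_False[symmetric, unfolded fg_gen_letter]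
    using i by (simp add: Bochner_Integration.integral_sum)
  also have "\<dots> = - J * real CARD('a) * ising_corr J t" by (simp add: c)
  finally show ?thesis .
qed

section \<open>Neighbourhoods in the weak* topology\<close>

lemma compact_UNIV_config: "compact (UNIV :: ('a fgroup \<Rightarrow> spin) set)"
proof -
  have "compact_space (euclidean :: spin topology)"
    by (simp add: compact_space_def finite_imp_compact)
  then have "compact_space (product_topology (\<lambda>_ :: 'a fgroup. (euclidean :: spin topology)) UNIV)"
    by (simp add: compact_space_product_topology)
  then show ?thesis by (simp add: euclidean_product_topology compact_space_def)
qed

lemma open_config_cylinder: "finite F \<Longrightarrow> open {y :: 'a fgroup \<Rightarrow> spin. \<forall>k\<in>F. y k = x k}"
proof -
  assume F: "finite F"
  have "open (Pi\<^sub>E UNIV (\<lambda>k. if k \<in> F then {x k} else UNIV) :: ('a fgroup \<Rightarrow> spin) set)"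
    by (rule open_PiE) (use F in \<open>auto simp: open_spin_def intro: finite_subset[of _ F]\<close>)
  also have "(Pi\<^sub>E UNIV (\<lambda>k. if k \<in> F then {x k} else UNIV)) = {y. \<forall>k\<in>F. y k = x k}"
    by (auto simp: PiE_def Pi_def split: if_splits)
  finally show ?thesis .
qed

text \<open>Around each point some cylinder keeps \<open>f\<close> within
  \<open>\<delta> / 2\<close>. By compactness finitely many such cylinders cover, and the
  coordinates they involve suffice.\<close>

lemma continuous_config_finite:
  fixes f :: "'a config \<Rightarrow> real"
  assumes f: "continuous_on UNIV f" and \<delta>: "\<delta> > 0"
  shows "\<exists>F. finite F \<and> (\<forall>x y. (\<forall>k\<in>F. x k = y k) \<longrightarrow> \<bar>f x - f y\<bar> < \<delta>)"
proof -
  have "\<forall>x. \<exists>F. finite F \<and> {y. \<forall>k\<in>F. y k = x k} \<subseteq> f -` ball (f x) (\<delta> / 2)"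
  proof
    fix x :: "'a config"
    have "open (f -` ball (f x) (\<delta> / 2))"
      by (rule open_vimage[OF open_ball f])
    then have "openin (product_topology (\<lambda>_. euclidean) UNIV) (f -` ball (f x) (\<delta> / 2))"
      by (simp add: euclidean_product_topology)
    from product_topology_open_contains_basis[OF this, of x] \<delta>
    obtain X where X: "x \<in> Pi\<^sub>E UNIV X" "finite {i. X i \<noteq> UNIV}"
      "Pi\<^sub>E UNIV X \<subseteq> f -` ball (f x) (\<delta> / 2)" by auto
    have "{y. \<forall>k\<in>{i. X i \<noteq> UNIV}. y k = x k} \<subseteq> Pi\<^sub>E UNIV X"
    proof (intro subsetI PiE_I)
      fix y k assume "y \<in> {y. \<forall>k\<in>{i. X i \<noteq> UNIV}. y k = x k}"
      then show "y k \<in> X k" using X(1) by (cases "X k = UNIV") (auto simp: PiE_def Pi_def)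
    qed auto
    then show "\<exists>F. finite F \<and> {y. \<forall>k\<in>F. y k = x k} \<subseteq> f -` ball (f x) (\<delta> / 2)"
      using X by (intro exI[of _ "{i. X i \<noteq> UNIV}"] conjI) (auto intro: order_trans)
  qed
  from choice[OF this] obtain F where F: "\<And>x. finite (F x)" "\<And>x. {y. \<forall>k\<in>F x. y k = x k} \<subseteq> f -` ball (f x) (\<delta> / 2)" by blast
  obtain Y where Y: "finite Y" "UNIV \<subseteq> (\<Union>x\<in>Y. {y. \<forall>k\<in>F x. y k = x k})"
  proof (rule compactE_image[OF compact_UNIV_config, of UNIV "\<lambda>x. {y. \<forall>k\<in>F x. y k = x k}"])
    show "open {y. \<forall>k\<in>F x. y k = x k}" for x using F(1) by (rule open_config_cylinder)
  qed auto
  show ?thesis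
  proof (intro exI[of _ "\<Union>x\<in>Y. F x"] conjI allI impI)
    fix y z :: "'a config" assume yz: "\<forall>k\<in>\<Union>x\<in>Y. F x. y k = z k"
    obtain x where x: "x \<in> Y" "\<forall>k\<in>F x. y k = x k" using Y(2) by blast
    have "y \<in> f -` ball (f x) (\<delta> / 2)" using F(2) x(2) by blast
    moreover have "\<forall>k\<in>F x. z k = x k" using x yz by auto
    then have "z \<in> f -` ball (f x) (\<delta> / 2)" using F(2) by blast
    ultimately have "\<bar>f x - f y\<bar> < \<delta> / 2" "\<bar>f x - f z\<bar> < \<delta> / 2" by (auto simp: dist_real_def)
    then show "\<bar>f y - f z\<bar> < \<delta>" by linarith
  qed (use Y(1) F(1) in auto)
qed

definition word_cyl :: "'a letter list set \<Rightarrow> ('a letter list \<Rightarrow> spin) \<Rightarrow> 'a config set" where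
  "word_cyl T \<eta> = {x. \<forall>w\<in>T. x (Abs_fgroup w) = \<eta> w}"

lemma word_cyl_borel: "word_tree T \<Longrightarrow> word_cyl T \<eta> \<in> sets (borel :: 'a::finite config measure)"
proof -
  assume T: "word_tree T"
  have "word_cyl T \<eta> = {x. \<forall>k\<in>Abs_fgroup ` T. x k = (\<eta> \<circ> Rep_fgroup) k}"
    using word_tree_reduced[OF T] by (auto simp: word_cyl_def)
  then show ?thesis using config_set_borel[of "Abs_fgroup ` T" "\<eta> \<circ> Rep_fgroup"] T by (simp add: word_tree_def)
qed

text \<open>The \<open>\<ell>\<close>-1 distance of the two marginals on \<open>T\<close>, twice
  their total variation distance.\<close>

definition cyl_dist :: "'a letter list set \<Rightarrow> 'a config measure \<Rightarrow> 'a config measure \<Rightarrow> real" where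
  "cyl_dist T \<nu> \<mu> = (\<Sum>\<eta>\<in>(T \<rightarrow>\<^sub>E UNIV). \<bar>measure \<nu> (word_cyl T \<eta>) - measure \<mu> (word_cyl T \<eta>)\<bar>)"

text \<open>\<open>f\<close> is compared with the step function that takes its value at one
  configuration in each cylinder over \<open>T\<close>.\<close>

lemma integral_near_cylinders:
  fixes \<nu> :: "'a::finite config measure" and f :: "'a config \<Rightarrow> real"
  assumes \<nu>: "\<nu> \<in> borel_prob" and f: "continuous_on UNIV f" and T: "word_tree T" "suffixes_of F \<subseteq> T"
    and \<delta>: "\<delta> > 0" "\<And>x y. (\<forall>k\<in>F. x k = y k) \<Longrightarrow> \<bar>f x - f y\<bar> < \<delta>"
  shows "\<bar>(\<integral>x. f x \<partial>\<nu>) - (\<Sum>\<eta>\<in>(T \<rightarrow>\<^sub>E UNIV). f (\<lambda>k. \<eta> (Rep_fgroup k)) * measure \<nu> (word_cyl T \<eta>))\<bar> \<le> \<delta>"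
proof -
  interpret prob_space \<nu> using \<nu> by (simp add: borel_prob_def)
  have sets: "sets \<nu> = sets borel" using \<nu> by (simp add: borel_prob_def)
  let ?E = "T \<rightarrow>\<^sub>E (UNIV :: spin set)"
  let ?g = "\<lambda>\<eta>. f (\<lambda>k. \<eta> (Rep_fgroup k))"
  let ?h = "\<lambda>x. \<Sum>\<eta>\<in>?E. ?g \<eta> * indicator (word_cyl T \<eta>) x"
  have finE: "finite ?E" using T by (intro finite_PiE) (auto simp: word_tree_def)
  have hx: "\<exists>\<eta>\<in>?E. x \<in> word_cyl T \<eta> \<and> ?h x = ?g \<eta>" for x
  proof -
    let ?\<eta> = "restrict (\<lambda>w. x (Abs_fgroup w)) T"
    have uniq: "x \<in> word_cyl T \<eta> \<longleftrightarrow> \<eta> = ?\<eta>" if "\<eta> \<in> ?E" for \<eta>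
    proof
      assume "x \<in> word_cyl T \<eta>"
      then show "\<eta> = ?\<eta>" using that by (intro PiE_ext[of _ T "\<lambda>_. UNIV"]) (auto simp: word_cyl_def)
    next
      assume "\<eta> = ?\<eta>"
      then show "x \<in> word_cyl T \<eta>" by (simp add: word_cyl_def)
    qed
    have "?h x = (\<Sum>\<eta>\<in>?E. if \<eta> = ?\<eta> then ?g \<eta> else 0)"
      by (intro sum.cong refl) (simp add: indicator_def uniq)
    also have "\<dots> = ?g ?\<eta>" using finE by (simp add: sum.delta)
    finally show ?thesis using uniq[of ?\<eta>] by (intro bexI[of _ ?\<eta>]) auto
  qed
  have near: "\<bar>f x - ?h x\<bar> \<le> \<delta>" for x
  proof -
    obtain \<eta> where \<eta>: "\<eta> \<in> ?E" "x \<in> word_cyl T \<eta>" "?h x = ?g \<eta>" using hx by blast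
    have "x k = \<eta> (Rep_fgroup k)" if "k \<in> F" for k
    proof -
      have "Rep_fgroup k \<in> T" using suffixes_of_superset[OF that] T(2) by blast
      then have "x (Abs_fgroup (Rep_fgroup k)) = \<eta> (Rep_fgroup k)" using \<eta>(2) by (simp add: word_cyl_def)
      then show ?thesis by (simp add: Rep_fgroup_inverse)
    qed
    then show ?thesis using \<delta>(2)[of x "\<lambda>k. \<eta> (Rep_fgroup k)"] unfolding \<eta>(3) by (simp add: less_imp_le)
  qed
  have near2: "f x - ?h x \<le> \<delta> \<and> - \<delta> \<le> f x - ?h x" for x using near[of x] by linarith
  have inth: "integrable \<nu> (\<lambda>x. ?g \<eta> * indicator (word_cyl T \<eta>) x)" for \<eta>
    using word_cyl_borel[OF T(1), of \<eta>] by (intro integrable_mult_right integrable_real_indicator) (auto simp: sets emeasure_eq_measure)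
  have int_h: "integrable \<nu> ?h" by (intro Bochner_Integration.integrable_sum inth)
  have fm: "f \<in> borel_measurable \<nu>"
    using borel_measurable_continuous_onI[OF f] sets by (simp cong: measurable_cong_sets)
  have int_d: "integrable \<nu> (\<lambda>x. f x - ?h x)"
    using near fm borel_measurable_integrable[OF int_h] by (intro integrable_const_bound[of _ \<delta>]) auto
  have int_f: "integrable \<nu> f" using Bochner_Integration.integrable_add[OF int_d int_h] by simp
  have one: "(\<integral>x. ?g \<eta> * indicator (word_cyl T \<eta>) x \<partial>\<nu>) = ?g \<eta> * measure \<nu> (word_cyl T \<eta>)" for \<eta>
    using word_cyl_borel[OF T(1), of \<eta>] by (simp add: sets)
  have H: "(\<integral>x. ?h x \<partial>\<nu>) = (\<Sum>\<eta>\<in>?E. ?g \<eta> * measure \<nu> (word_cyl T \<eta>))"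
    unfolding one[symmetric] by (rule Bochner_Integration.integral_sum) (rule inth)
  have "(\<integral>x. f x \<partial>\<nu>) - (\<integral>x. ?h x \<partial>\<nu>) = (\<integral>x. f x - ?h x \<partial>\<nu>)"
    by (rule Bochner_Integration.integral_diff[OF int_f int_h, symmetric])
  moreover have "(\<integral>x. f x - ?h x \<partial>\<nu>) \<le> \<delta>"
    using near2 by (intro integral_le_const int_d AE_I2) blast
  moreover have "- \<delta> \<le> (\<integral>x. f x - ?h x \<partial>\<nu>)"
    using near2 by (intro integral_ge_const int_d AE_I2) blast
  ultimately show ?thesis unfolding H by linarith
qed

text \<open>The claim is made for all trees beyond \<open>T0\<close>, not for one tree. In the
  induction this lets an intersection pass to the union of two trees without comparing
  \<open>cyl_dist\<close> for different trees.\<close>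

lemma weak_star_cylinders:
  fixes \<mu> :: "'a::finite config measure"
  assumes "openin weak_star \<O>" "\<mu> \<in> \<O>"
  shows "\<exists>T0. word_tree T0 \<and> (\<forall>T. word_tree T \<and> T0 \<subseteq> T \<longrightarrow> (\<exists>\<epsilon>>0. \<forall>\<nu>\<in>borel_prob. cyl_dist T \<nu> \<mu> < \<epsilon> \<longrightarrow> \<nu> \<in> \<O>))"
proof -
  have "generate_topology_on {{\<mu> \<in> borel_prob. (\<integral>x. f x \<partial>\<mu>) \<in> U} | (f :: 'a config \<Rightarrow> real) U. continuous_on UNIV f \<and> open U} \<O>"
    using assms(1) by (simp add: weak_star_def openin_topology_generated_by_iff)
  then show ?thesis using assms(2)
  proof (induction rule: generate_topology_on.induct)
    case (Int A B)
    then have "\<mu> \<in> A" "\<mu> \<in> B" by auto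
    from Int.IH(1)[OF this(1)] obtain T1 where T1: "word_tree T1" "\<And>T. word_tree T \<Longrightarrow> T1 \<subseteq> T \<Longrightarrow> (\<exists>\<epsilon>>0. \<forall>\<nu>\<in>borel_prob. cyl_dist T \<nu> \<mu> < \<epsilon> \<longrightarrow> \<nu> \<in> A)" by blast
    from Int.IH(2)[OF \<open>\<mu> \<in> B\<close>] obtain T2 where T2: "word_tree T2" "\<And>T. word_tree T \<Longrightarrow> T2 \<subseteq> T \<Longrightarrow> (\<exists>\<epsilon>>0. \<forall>\<nu>\<in>borel_prob. cyl_dist T \<nu> \<mu> < \<epsilon> \<longrightarrow> \<nu> \<in> B)" by blast
    show ?case
    proof (intro exI[of _ "T1 \<union> T2"] conjI allI impI)
      show "word_tree (T1 \<union> T2)" using T1(1) T2(1) unfolding word_tree_def by blast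
      fix T assume T: "word_tree T \<and> T1 \<union> T2 \<subseteq> T"
      obtain e1 where e1: "e1 > 0" "\<forall>\<nu>\<in>borel_prob. cyl_dist T \<nu> \<mu> < e1 \<longrightarrow> \<nu> \<in> A" using T1(2)[of T] T by auto
      obtain e2 where e2: "e2 > 0" "\<forall>\<nu>\<in>borel_prob. cyl_dist T \<nu> \<mu> < e2 \<longrightarrow> \<nu> \<in> B" using T2(2)[of T] T by auto
      show "\<exists>\<epsilon>>0. \<forall>\<nu>\<in>borel_prob. cyl_dist T \<nu> \<mu> < \<epsilon> \<longrightarrow> \<nu> \<in> A \<inter> B"
        using e1 e2 by (intro exI[of _ "min e1 e2"]) auto
    qed
  next
    case (UN K)
    then obtain A where A: "A \<in> K" "\<mu> \<in> A" by blast
    from UN.IH[OF A] show ?case using A(1) by (meson UnionI)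
  next
    case (Basis A)
    then obtain f :: "'a config \<Rightarrow> real" and U where A: "A = {\<nu> \<in> borel_prob. (\<integral>x. f x \<partial>\<nu>) \<in> U}" and f: "continuous_on UNIV f" and U: "open U"
      by blast
    have \<mu>: "\<mu> \<in> borel_prob" "(\<integral>x. f x \<partial>\<mu>) \<in> U" using Basis.prems A by auto
    obtain e where e: "e > 0" "ball (\<integral>x. f x \<partial>\<mu>) e \<subseteq> U" using U \<mu>(2) openE by blast
    then have e4: "e / 4 > 0" by simp
    obtain F where F: "finite F" "\<And>x y. (\<forall>k\<in>F. x k = y k) \<Longrightarrow> \<bar>f x - f y\<bar> < e / 4"
      using continuous_config_finite[OF f e4] by blast
    show ?case
    proof (intro exI[of _ "suffixes_of F"] conjI allI impI)
      show "word_tree (suffixes_of F)" by (rule word_tree_suffixes_of[OF F(1)])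
      fix T assume T: "word_tree T \<and> suffixes_of F \<subseteq> T"
      let ?E = "T \<rightarrow>\<^sub>E (UNIV :: spin set)"
      let ?g = "\<lambda>\<eta>. f (\<lambda>k. \<eta> (Rep_fgroup k))"
      have finE: "finite ?E" using T by (intro finite_PiE) (auto simp: word_tree_def)
      \<comment> \<open>\<open>B + 1\<close> bounds the step function and is positive. The tolerance
        \<open>e / (4 * (B + 1))\<close> leaves three errors of at most \<open>e / 4\<close>: one
        for each integral and one for the cylinder probabilities.\<close>
      define B where "B = (\<Sum>\<eta>\<in>?E. \<bar>?g \<eta>\<bar>)"
      have B0: "B \<ge> 0" by (simp add: B_def sum_nonneg)
      have gB: "\<bar>?g \<eta>\<bar> \<le> B" if "\<eta> \<in> ?E" for \<eta> unfolding B_def using finE that by (intro member_le_sum) auto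
      show "\<exists>\<epsilon>>0. \<forall>\<nu>\<in>borel_prob. cyl_dist T \<nu> \<mu> < \<epsilon> \<longrightarrow> \<nu> \<in> A"
      proof (intro exI[of _ "e / (4 * (B + 1))"] conjI ballI impI)
        show "e / (4 * (B + 1)) > 0" using e B0 by simp
        fix \<nu> :: "'a config measure" assume \<nu>: "\<nu> \<in> borel_prob" "cyl_dist T \<nu> \<mu> < e / (4 * (B + 1))"
        have n: "\<bar>(\<integral>x. f x \<partial>\<rho>) - (\<Sum>\<eta>\<in>?E. ?g \<eta> * measure \<rho> (word_cyl T \<eta>))\<bar> \<le> e / 4" if "\<rho> \<in> borel_prob" for \<rho>
          using integral_near_cylinders[OF that f _ _ e4 F(2)] T by blast
        have "\<bar>(\<Sum>\<eta>\<in>?E. ?g \<eta> * measure \<nu> (word_cyl T \<eta>)) - (\<Sum>\<eta>\<in>?E. ?g \<eta> * measure \<mu> (word_cyl T \<eta>))\<bar>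
            = \<bar>\<Sum>\<eta>\<in>?E. ?g \<eta> * (measure \<nu> (word_cyl T \<eta>) - measure \<mu> (word_cyl T \<eta>))\<bar>"
          by (simp add: sum_subtractf right_diff_distrib)
        also have "\<dots> \<le> (\<Sum>\<eta>\<in>?E. \<bar>?g \<eta>\<bar> * \<bar>measure \<nu> (word_cyl T \<eta>) - measure \<mu> (word_cyl T \<eta>)\<bar>)"
          by (rule order_trans[OF sum_abs]) (simp add: abs_mult)
        also have "\<dots> \<le> (\<Sum>\<eta>\<in>?E. B * \<bar>measure \<nu> (word_cyl T \<eta>) - measure \<mu> (word_cyl T \<eta>)\<bar>)"
          by (intro sum_mono mult_right_mono gB) auto
        also have "\<dots> = B * cyl_dist T \<nu> \<mu>" by (simp add: cyl_dist_def sum_distrib_left)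
        also have "\<dots> \<le> (B + 1) * (e / (4 * (B + 1)))"
          using \<nu>(2) B0 e by (intro mult_mono) (auto simp: cyl_dist_def sum_nonneg)
        also have "\<dots> = e / 4" using B0 by (simp add: field_simps)
        finally have m: "\<bar>(\<Sum>\<eta>\<in>?E. ?g \<eta> * measure \<nu> (word_cyl T \<eta>)) - (\<Sum>\<eta>\<in>?E. ?g \<eta> * measure \<mu> (word_cyl T \<eta>))\<bar> \<le> e / 4" .
        have "\<bar>(\<integral>x. f x \<partial>\<mu>) - (\<integral>x. f x \<partial>\<nu>)\<bar> < e"
          using n[OF \<nu>(1)] n[OF \<mu>(1)] m e(1) by linarith
        then show "\<nu> \<in> A" using e(2) \<nu>(1) by (auto simp: A dist_real_def)
      qed
    qed
  qed auto
qed

section \<open>Edge neighbourhoods\<close>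

lemma open_coordinate: "open {x :: 'a fgroup \<Rightarrow> spin. x k \<in> S}"
proof -
  have "open ((\<lambda>x :: 'a fgroup \<Rightarrow> spin. x k) -` S)"
    by (rule open_vimage) (auto simp: open_spin_def)
  then show ?thesis by (simp add: vimage_def)
qed

lemma continuous_indicator_pair: "continuous_on UNIV (\<lambda>x :: 'a fgroup \<Rightarrow> spin. indicator {x. x g = s \<and> x h = s'} x :: real)"
proof -
  let ?A = "{x :: 'a fgroup \<Rightarrow> spin. x g = s \<and> x h = s'}"
  have o1: "open ?A" using open_Int[OF open_coordinate[of g "{s}"] open_coordinate[of h "{s'}"]] by (simp add: Collect_conj_eq)
  have "- ?A = {x. x g \<in> - {s}} \<union> {x. x h \<in> - {s'}}" by auto
  then have o2: "open (- ?A)" using open_Un[OF open_coordinate[of g "- {s}"] open_coordinate[of h "- {s'}"]] by simp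
  have "open ((\<lambda>x. indicator ?A x :: real) -` B)" for B
  proof -
    have "(\<lambda>x. indicator ?A x :: real) -` B = (if 1 \<in> B then ?A else {}) \<union> (if 0 \<in> B then - ?A else {})"
      by (auto simp: indicator_def of_bool_def split: if_splits)
    then show ?thesis using o1 o2 by simp
  qed
  then show ?thesis by (auto simp: continuous_on_open_vimage)
qed

lemma openin_weak_star_basis:
  fixes f :: "'x::topological_space \<Rightarrow> real"
  assumes "continuous_on UNIV f" "open U"
  shows "openin weak_star {\<nu> \<in> borel_prob. (\<integral>x. f x \<partial>\<nu>) \<in> U}"
  unfolding weak_star_def openin_topology_generated_by_iff
  by (rule generate_topology_on.Basis) (use assms in blast)

text \<open>A neighbourhood that sees edge marginals only. Membership of an empirical measure is a
  condition on edge counts, for which the annealed average is explicit.\<close>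

definition edge_nbhd :: "real \<Rightarrow> real \<Rightarrow> real \<Rightarrow> 'a config measure set" where
  "edge_nbhd J t \<epsilon> = {\<nu> \<in> borel_prob. \<forall>i s s'.
     \<bar>measure \<nu> {x. x (Abs_fgroup []) = s \<and> x (letter_elt (i, True)) = s'} - ising_edge J t s s'\<bar> < \<epsilon>}"

lemma openin_edge_nbhd:
  fixes J t \<epsilon> :: real
  shows "openin weak_star (edge_nbhd J t \<epsilon> :: 'a::finite config measure set)"
proof -
  let ?A = "\<lambda>(i, s, s'). {x :: 'a config. x (Abs_fgroup []) = s \<and> x (letter_elt (i, True)) = s'}"
  let ?U = "\<lambda>(i, s, s'). {\<nu> \<in> borel_prob. (\<integral>x. indicator (?A (i, s, s')) x \<partial>\<nu>) \<in> ball (ising_edge J t s s') \<epsilon>} :: 'a config measure set"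
  have meas: "(\<integral>x. indicator (?A (i, s, s')) x \<partial>\<nu>) = measure \<nu> (?A (i, s, s'))" if "\<nu> \<in> borel_prob" for \<nu> and i :: 'a and s s'
  proof -
    have "?A (i, s, s') \<in> sets \<nu>"
      using sets.Int[OF config_set_borel[of "{Abs_fgroup []}" "\<lambda>_. s"] config_set_borel[of "{letter_elt (i, True)}" "\<lambda>_. s'"]] that
      by (simp add: Collect_conj_eq borel_prob_def)
    then show ?thesis by simp
  qed
  have op: "openin weak_star (?U z)" for z
  proof -
    obtain i s s' where z: "z = (i, s, s')" by (rule prod_cases3)
    have "openin weak_star {\<nu> \<in> borel_prob. (\<integral>x. indicator (?A (i, s, s')) x \<partial>\<nu>) \<in> ball (ising_edge J t s s') \<epsilon>}"
      using openin_weak_star_basis[OF continuous_indicator_pair[of "Abs_fgroup []" s "letter_elt (i, True)" s'] open_ball[of "ising_edge J t s s'" \<epsilon>]]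
      by (simp only: prod.case)
    then show ?thesis by (simp add: z)
  qed
  have "edge_nbhd J t \<epsilon> = (\<Inter>z\<in>UNIV. ?U z)"
    unfolding edge_nbhd_def using meas by (auto simp: dist_real_def abs_minus_commute)
  also have "openin weak_star \<dots>"
    by (rule openin_INT2[OF finite UNIV_not_empty op])
  finally show ?thesis .
qed

lemma ising_chain_in_edge_nbhd: "\<epsilon> > 0 \<Longrightarrow> (ising_chain J t :: 'a::finite config measure) \<in> edge_nbhd J t \<epsilon>"
  by (simp add: edge_nbhd_def ising_chain_borel_prob ising_chain_edge)

section \<open>Empirical distributions\<close>

lemma pullback_measurable: "pullback \<sigma> x \<in> uniform_count_measure V \<rightarrow>\<^sub>M (borel :: 'a::finite config measure)"
  by (rule measurableI) (auto simp: sets_uniform_count_measure space_uniform_count_measure)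

lemma empirical_borel_prob: "finite V \<Longrightarrow> V \<noteq> {} \<Longrightarrow> (empirical V \<sigma> x :: 'a::finite config measure) \<in> borel_prob"
  unfolding borel_prob_def empirical_def
  using prob_space.prob_space_distr[OF prob_space_uniform_count_measure pullback_measurable] by auto

lemma measure_empirical:
  assumes "finite V" "A \<in> sets borel"
  shows "measure (empirical V \<sigma> x :: 'a::finite config measure) A = real (card {v \<in> V. pullback \<sigma> x v \<in> A}) / real (card V)"
proof -
  have "pullback \<sigma> x -` A \<inter> space (uniform_count_measure V) = {v \<in> V. pullback \<sigma> x v \<in> A}"
    by (auto simp: space_uniform_count_measure)
  then show ?thesis unfolding empirical_def using assms
    by (subst measure_distr[OF pullback_measurable]) (auto simp: measure_uniform_count_measure)
qed

lemma pullback_tuple_hom: "reduced w \<Longrightarrow> pullback (tuple_hom p) x v (Abs_fgroup w) = x (word_perm p w v)"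
  by (simp add: pullback_def tuple_hom_def Abs_fgroup_inverse)

lemma empirical_word_cyl:
  assumes "word_tree T"
  shows "measure (empirical {1..n} (tuple_hom p) x :: 'a::finite config measure) (word_cyl T \<eta>) = real (hits n p x T \<eta>) / real n"
proof -
  have "{v \<in> {1..n}. pullback (tuple_hom p) x v \<in> word_cyl T \<eta>} = {v \<in> {1..n}. \<forall>w\<in>T. x (word_perm p w v) = \<eta> w}"
    using assms by (auto simp: word_cyl_def pullback_tuple_hom word_tree_def)
  then show ?thesis using assms by (simp add: measure_empirical word_cyl_borel hits_def)
qed

lemma empirical_edge:
  "measure (empirical {1..n} (tuple_hom p) x :: 'a::finite config measure) {y. y (Abs_fgroup []) = s \<and> y (letter_elt (i, True)) = s'}
    = real (ecount n x (x \<circ> p i) s s') / real n"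
proof -
  have r: "reduced [(i, True)]" by (simp add: reduced_Cons)
  have A: "{y :: 'a config. y (Abs_fgroup []) = s \<and> y (letter_elt (i, True)) = s'} \<in> sets borel"
    using sets.Int[OF config_set_borel[of "{Abs_fgroup []}" "\<lambda>_. s"] config_set_borel[of "{letter_elt (i, True)}" "\<lambda>_. s'"]]
    by (simp add: Collect_conj_eq)
  have "{v \<in> {1..n}. pullback (tuple_hom p) x v \<in> {y. y (Abs_fgroup []) = s \<and> y (letter_elt (i, True)) = s'}}
      = {v \<in> {1..n}. x v = s \<and> (x \<circ> p i) v = s'}"
    by (simp add: pullback_tuple_hom[OF r] pullback_tuple_hom[OF reduced_Nil] letter_elt_def)
  then show ?thesis by (simp add: measure_empirical[OF _ A] ecount_def)
qed

section \<open>The single-site optimization\<close>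

lemma tanh_gt_of_artanh:
  assumes "-1 < y" "y < 1" "artanh y < J"
  shows "y < tanh (J :: real)"
proof (rule ccontr)
  assume "\<not> y < tanh J"
  then have ty: "tanh J \<le> y" by simp
  let ?t = "tanh J"
  have t: "-1 < ?t" "?t < 1" by (rule tanh_real_gt_neg1, rule tanh_real_lt_1)
  have "(1 + ?t) / (1 - ?t) \<le> (1 + y) / (1 - y)"
    using t assms ty by (intro frac_le) auto
  then have "artanh ?t \<le> artanh y"
    using t assms by (simp add: artanh_def)
  then show False using assms by (simp add: artanh_tanh_real)
qed

lemma tanh_lt_of_artanh:
  assumes "-1 < y" "y < 1" "J < artanh y"
  shows "tanh (J :: real) < y"
  using tanh_gt_of_artanh[of "- y" "- J"] assms by simp

text \<open>For \<open>k = 2 r - 1\<close> its zeros are the solutions of the fixed point equation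
  for the boundary field.\<close>

definition t_gap :: "real \<Rightarrow> real \<Rightarrow> real \<Rightarrow> real" where
  "t_gap k J t = k / 2 * ln (cosh (t + J) / cosh (t - J)) - t"

lemma t_gap_deriv:
  "(t_gap k J has_real_derivative (k / 2 * (tanh (t + J) - tanh (t - J)) - 1)) (at t)"
proof -
  have eq: "t_gap k J = (\<lambda>t. k / 2 * (ln (cosh (t + J)) - ln (cosh (t - J))) - t)"
    by (auto simp: t_gap_def fun_eq_iff ln_div)
  show ?thesis
    unfolding eq
    by (auto intro!: derivative_eq_intros simp: tanh_def field_simps)
qed

lemma tanh_diff_shift:
  "tanh (t + J) - tanh (t - J) = 2 * sinh (2 * J) / (cosh (2 * t) + cosh (2 * J :: real))"
proof -
  have "2 * (cosh (t + J) * cosh (t - J)) = cosh (2 * t) + cosh (2 * J)"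
  proof -
    have "cosh (2 * t) + cosh (2 * J) = cosh ((t + J) + (t - J)) + cosh ((t + J) - (t - J))" by simp
    also have "\<dots> = 2 * (cosh (t + J) * cosh (t - J))"
      by (simp only: cosh_add[of "t + J" "t - J"] cosh_diff[of "t + J" "t - J"])
    finally show ?thesis by simp
  qed
  moreover have "sinh (t + J) * cosh (t - J) - sinh (t - J) * cosh (t + J) = sinh (2 * J)"
    using sinh_diff[of "t + J" "t - J"] by (simp add: algebra_simps)
  moreover have "tanh (t + J) - tanh (t - J) = (sinh (t + J) * cosh (t - J) - sinh (t - J) * cosh (t + J)) / (cosh (t + J) * cosh (t - J))"
    by (simp add: tanh_def field_simps)
  ultimately show ?thesis by (metis (no_types, opaque_lifting) mult_divide_mult_cancel_left zero_neq_numeral)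
qed

lemma t_gap_zero [simp]: "t_gap k J 0 = 0"
  by (simp add: t_gap_def)

text \<open>On the positive axis the derivative is strictly decreasing by
  \<open>tanh_diff_shift\<close>. It is positive at 0, while the function is negative for large
  arguments, so the function rises, falls and crosses 0 once.\<close>

lemma t_gap_sign:
  assumes k: "k > 0" and J: "J > 0" "k * tanh J > 1"
  shows "\<exists>a>0. t_gap k J a = 0 \<and> (\<forall>t. 0 < t \<and> t < a \<longrightarrow> t_gap k J t > 0) \<and> (\<forall>t. t > a \<longrightarrow> t_gap k J t < 0)"
proof -
  let ?h = "t_gap k J"
  let ?d = "\<lambda>t. k / 2 * (tanh (t + J) - tanh (t - J)) - 1"
  note der = t_gap_deriv[of k J]
  have dec: "?d s < ?d t" if "0 \<le> t" "t < s" for s t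
  proof -
    have s2: "sinh (2 * J) > 0" using J by simp
    have c: "cosh (2 * t) < cosh (2 * s)" using that by (intro cosh_real_strict_mono) auto
    then have "2 * sinh (2 * J) / (cosh (2 * s) + cosh (2 * J)) < 2 * sinh (2 * J) / (cosh (2 * t) + cosh (2 * J))"
      using s2 by (intro divide_strict_left_mono mult_pos_pos add_pos_pos) auto
    then have "k / 2 * (2 * sinh (2 * J) / (cosh (2 * s) + cosh (2 * J))) < k / 2 * (2 * sinh (2 * J) / (cosh (2 * t) + cosh (2 * J)))"
      using k by (intro mult_strict_left_mono) auto
    then show ?thesis unfolding tanh_diff_shift by linarith
  qed
  have d0: "?d 0 > 0" using J by simp
  from DERIV_pos_inc_right[OF der d0] obtain e where e: "e > 0" "\<And>x. x > 0 \<Longrightarrow> x < e \<Longrightarrow> ?h x > 0"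
    by auto
  \<comment> \<open>The logarithm is at most \<open>2 * J\<close>, so
    \<open>t_gap k J t \<le> k * J - t\<close>.\<close>
  have neg: "?h (k * J + 1) < 0"
  proof -
    let ?t = "k * J + 1"
    have "cosh (?t + J) \<le> exp (2 * J) * cosh (?t - J)"
    proof -
      have "exp (?t + J) = exp (2 * J) * exp (?t - J)" by (simp add: exp_add[symmetric])
      moreover have "exp (- (?t + J)) \<le> exp (2 * J) * exp (- (?t - J))"
        using J by (simp add: exp_add[symmetric])
      ultimately show ?thesis by (simp add: cosh_field_def algebra_simps)
    qed
    then have "cosh (?t + J) / cosh (?t - J) \<le> exp (2 * J)" by (simp add: divide_le_eq)
    then have "ln (cosh (?t + J) / cosh (?t - J)) \<le> 2 * J"
      by (metis cosh_real_pos divide_pos_pos exp_gt_zero ln_exp ln_le_cancel_iff)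
    then have "k / 2 * ln (cosh (?t + J) / cosh (?t - J)) \<le> k / 2 * (2 * J)"
      using k by (intro mult_left_mono) auto
    then show ?thesis by (simp add: t_gap_def)
  qed
  let ?b = "k * J + 1"
  have b: "?b > 0" using k J by (simp add: add_pos_pos)
  \<comment> \<open>A point close enough to 0 for the function to be positive there; the
    intermediate value theorem starts from it.\<close>
  define m where "m = min (e / 2) (?b / 2)"
  have "0 < m" using e(1) b by (simp add: m_def)
  moreover have half: "x / 2 < x" if "x > 0" for x :: real using that by simp
  have "m < e" unfolding m_def by (rule le_less_trans[OF min.cobounded1 half[OF e(1)]])
  moreover have "m < ?b" unfolding m_def by (rule le_less_trans[OF min.cobounded2 half[OF b]])
  ultimately have m: "0 < m" "m < e" "m < ?b" by blast+
  have cont: "continuous_on A ?h" for A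
    using der by (meson DERIV_isCont continuous_at_imp_continuous_on)
  have "\<exists>a. m \<le> a \<and> a \<le> ?b \<and> ?h a = 0"
    using m e(2)[of m] neg by (intro IVT2' cont) auto
  then obtain a where a: "m \<le> a" "?h a = 0" by blast
  have a0: "a > 0" using a(1) m(1) by simp
  have "\<exists>z>0. z < a \<and> ?h a - ?h 0 = (a - 0) * ?d z"
    using MVT2[OF a0, of ?h ?d] der by auto
  \<comment> \<open>The critical point between the zeros 0 and \<open>a\<close> separates the rising
    from the falling branch.\<close>
  then obtain z where z: "0 < z" "z < a" "?d z = 0" using a a0 by auto
  have up: "?h s < ?h t" if "0 \<le> s" "s < t" "t \<le> z" for s t
  proof (rule DERIV_pos_imp_increasing_open[OF that(2)])
    fix x assume "s < x" "x < t"
    then show "\<exists>y. DERIV ?h x :> y \<and> y > 0" using der[of x] dec[of x z] that z by (intro exI[of _ "?d x"]) auto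
  qed (rule cont)
  have down: "?h t < ?h s" if "z \<le> s" "s < t" for s t
  proof (rule DERIV_neg_imp_decreasing_open[OF that(2)])
    fix x assume "s < x" "x < t"
    then show "\<exists>y. DERIV ?h x :> y \<and> y < 0" using der[of x] dec[of z x] that z by (intro exI[of _ "?d x"]) auto
  qed (rule cont)
  show ?thesis
  proof (intro exI[of _ a] conjI allI impI)
    fix t assume t: "0 < t \<and> t < a"
    show "?h t > 0"
    proof (cases "t \<le> z")
      case True
      then show ?thesis using up[of 0 t] t by simp
    next
      case False
      then show ?thesis using down[of t a] t a by simp
    qed
  next
    fix t assume "t > a"
    then show "?h t < 0" using down[of a t] z a by simp
  qed (use a0 a in auto)
qed

text \<open>\<open>e\<^sup>J\<close> times the partition function of an edge with boundary field \<open>t\<close>.\<close>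

definition edge_norm :: "real \<Rightarrow> real \<Rightarrow> real" where
  "edge_norm J t = 2 * exp (- J) + 2 * exp J * cosh (2 * t)"

text \<open>With \<open>k = 2 r - 1\<close>: \<open>r\<close> times the logarithm of the edge
  partition function minus \<open>2 r - 1\<close> times that of a site. The site field is
  \<open>(k + 1) / k\<close> times the edge field because \<open>2 r\<close> edge ends are balanced
  against \<open>2 r - 1\<close> copies of the site.\<close>

definition bethe :: "real \<Rightarrow> real \<Rightarrow> real \<Rightarrow> real" where
  "bethe k J t = (k + 1) / 2 * ln (edge_norm J t) - k * ln (2 * cosh ((k + 1) / k * t))"

lemma edge_norm_pos [simp]: "edge_norm J t > 0"
  by (simp add: edge_norm_def add_pos_pos)

text \<open>The derivative is \<open>k + 1\<close> times the magnetization of the edge law minus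
  that of the site law. Written as hyperbolic tangents of fields, the two differ by
  \<open>t_gap k J t / k\<close> in the argument.\<close>

lemma bethe_deriv_sign:
  assumes k: "k > 0"
  obtains d where "(bethe k J has_real_derivative d) (at t)" "t_gap k J t > 0 \<Longrightarrow> d > 0" "t_gap k J t < 0 \<Longrightarrow> d < 0"
proof -
  \<comment> \<open>Half the logarithm of the ratio of the two marginals of
    \<open>ising_edge J t\<close>, so that \<open>tanh u\<close> is its magnetization.\<close>
  define u where "u = t + ln (cosh (t + J) / cosh (t - J)) / 2"
  define X where "X = exp (- J) + exp J * cosh (2 * t)"
  define Y where "Y = exp J * sinh (2 * t)"
  have X: "X > 0" by (simp add: X_def add_pos_pos)
  have XY1: "X + Y = 2 * exp t * cosh (t + J)"
    by (simp add: X_def Y_def cosh_field_def sinh_field_def exp_add[symmetric] algebra_simps add_divide_distrib diff_divide_distrib)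
  have XY2: "X - Y = 2 * exp (- t) * cosh (t - J)"
    by (simp add: X_def Y_def cosh_field_def sinh_field_def exp_add[symmetric] algebra_simps add_divide_distrib diff_divide_distrib)
  have e2u: "exp (2 * u) = exp (2 * t) * (cosh (t + J) / cosh (t - J))"
    by (simp add: u_def distrib_left exp_add)
  have E: "exp (2 * u) = (X + Y) / (X - Y)"
    unfolding e2u XY1 XY2 by (simp add: exp_minus field_simps exp_double power2_eq_square flip: exp_add)
  have XmY: "X - Y > 0" unfolding XY2 by simp
  have tE: "tanh u = (exp (2 * u) - 1) / (exp (2 * u) + 1)"
  proof -
    have "(1 - inverse E) / (1 + inverse E) = (E - 1) / (E + 1)" if "E > 0" for E :: real
    proof -
      have "1 - inverse E = (E - 1) / E" "1 + inverse E = (E + 1) / E" using that by (simp_all add: field_simps)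
      then show ?thesis using that by simp
    qed
    then show ?thesis unfolding tanh_real_altdef by (simp add: exp_minus)
  qed
  have "exp (2 * u) - 1 = 2 * Y / (X - Y)" "exp (2 * u) + 1 = 2 * X / (X - Y)"
    unfolding E using XmY by (simp_all add: field_simps)
  then have tu: "tanh u = Y / X"
    unfolding tE using X XmY by simp
  define d where "d = (k + 1) * (tanh u - tanh ((k + 1) / k * t))"
  have D: "(bethe k J has_real_derivative d) (at t)"
  proof -
    have en: "edge_norm J t = 2 * X" by (simp add: edge_norm_def X_def algebra_simps)
    have D_en: "(edge_norm J has_real_derivative 4 * Y) (at t)"
      unfolding edge_norm_def[abs_def] by (auto intro!: derivative_eq_intros simp: Y_def)
    have "((\<lambda>t. (k + 1) / 2 * ln (edge_norm J t)) has_real_derivative ((k + 1) / 2 * (1 / edge_norm J t * (4 * Y)))) (at t)"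
      by (intro DERIV_cmult DERIV_chain2[OF DERIV_ln_divide D_en]) simp
    moreover have "(k + 1) / 2 * (1 / edge_norm J t * (4 * Y)) = (k + 1) * (Y / X)" unfolding en by simp
    ultimately have D1: "((\<lambda>t. (k + 1) / 2 * ln (edge_norm J t)) has_real_derivative ((k + 1) * (Y / X))) (at t)" by simp
    have D2: "((\<lambda>t. k * ln (2 * cosh ((k + 1) / k * t))) has_real_derivative (k * ((k + 1) / k * tanh ((k + 1) / k * t)))) (at t)"
      by (auto intro!: derivative_eq_intros simp: tanh_def)
    have "(bethe k J has_real_derivative ((k + 1) * (Y / X) - k * ((k + 1) / k * tanh ((k + 1) / k * t)))) (at t)"
      unfolding bethe_def[abs_def] by (rule DERIV_diff[OF D1 D2])
    also have "(k + 1) * (Y / X) - k * ((k + 1) / k * tanh ((k + 1) / k * t)) = d"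
      using k by (simp add: d_def tu right_diff_distrib)
    finally show ?thesis .
  qed
  have gap: "u - (k + 1) / k * t = t_gap k J t / k"
    using k by (simp add: u_def t_gap_def field_simps)
  show thesis
  proof (rule that[OF D])
    assume "t_gap k J t > 0"
    then have "u > (k + 1) / k * t" using gap k by (metis diff_gt_0_iff_gt divide_pos_pos)
    then show "d > 0" using k by (simp add: d_def)
  next
    assume "t_gap k J t < 0"
    then have "u < (k + 1) / k * t" using gap k by (metis diff_less_0_iff_less divide_neg_pos)
    then have "tanh u - tanh ((k + 1) / k * t) < 0" by simp
    then show "d < 0" using k unfolding d_def by (simp add: mult_pos_neg)
  qed
qed

lemma bethe_minus [simp]: "bethe k J (- t) = bethe k J t"
  by (simp add: bethe_def edge_norm_def)

text \<open>\<open>bethe\<close> increases from 0 to the zero of \<open>t_gap\<close> and decreases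
  beyond it, and it is even in \<open>t\<close>.\<close>

lemma bethe_maximum:
  assumes k: "k > 0" and J: "J > 0" "k * tanh J > 1"
    and a: "a > 0" "t_gap k J a = 0"
  shows "bethe k J 0 < bethe k J a" "bethe k J t \<le> bethe k J a"
proof -
  obtain a' where a': "a' > 0" "t_gap k J a' = 0" "\<And>t. 0 < t \<Longrightarrow> t < a' \<Longrightarrow> t_gap k J t > 0" "\<And>t. t > a' \<Longrightarrow> t_gap k J t < 0"
    using t_gap_sign[OF k J] by blast
  have aa: "a = a'" using a a'(3)[of a] a'(4)[of a] by (cases a a' rule: linorder_cases) auto
  have cont: "continuous_on A (bethe k J)" for A
    using bethe_deriv_sign[OF k] by (metis DERIV_isCont continuous_at_imp_continuous_on)
  have up: "bethe k J s < bethe k J t" if "0 \<le> s" "s < t" "t \<le> a" for s t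
  proof (rule DERIV_pos_imp_increasing_open[OF that(2)])
    fix x assume x: "s < x" "x < t"
    obtain d where "(bethe k J has_real_derivative d) (at x)" "t_gap k J x > 0 \<Longrightarrow> d > 0"
      using bethe_deriv_sign[OF k, of J x] by blast
    then show "\<exists>y. DERIV (bethe k J) x :> y \<and> y > 0" using a'(3)[of x] x that aa by auto
  qed (rule cont)
  have down: "bethe k J t < bethe k J s" if "a \<le> s" "s < t" for s t
  proof (rule DERIV_neg_imp_decreasing_open[OF that(2)])
    fix x assume x: "s < x" "x < t"
    obtain d where "(bethe k J has_real_derivative d) (at x)" "t_gap k J x < 0 \<Longrightarrow> d < 0"
      using bethe_deriv_sign[OF k, of J x] by blast
    then show "\<exists>y. DERIV (bethe k J) x :> y \<and> y < 0" using a'(4)[of x] x that aa by auto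
  qed (rule cont)
  show "bethe k J 0 < bethe k J a" using up[of 0 a] a by simp
  have pos: "bethe k J t \<le> bethe k J a" if "t \<ge> 0" for t
    using up[of t a] down[of a t] that by (cases t a rule: linorder_cases) (auto intro: less_imp_le)
  show "bethe k J t \<le> bethe k J a"
    using pos[of t] pos[of "- t"] by (cases "t \<ge> 0") auto
qed

section \<open>Two inequalities behind the second moment bounds\<close>

lemma minkowski_pair:
  fixes a1 a2 b1 b2 q :: real
  assumes q: "q \<ge> 1" and pos: "a1 > 0" "a2 > 0" "b1 > 0" "b2 > 0"
  shows "(a1 + b1) powr q + (a2 + b2) powr q \<le> ((a1 powr q + a2 powr q) powr (1 / q) + (b1 powr q + b2 powr q) powr (1 / q)) powr q"
proof -
  define A where "A = (a1 powr q + a2 powr q) powr (1 / q)"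
  define B where "B = (b1 powr q + b2 powr q) powr (1 / q)"
  have AB0: "a1 powr q + a2 powr q > 0" "b1 powr q + b2 powr q > 0" using pos by (simp_all add: add_pos_pos)
  have A: "A > 0" "A powr q = a1 powr q + a2 powr q"
    using AB0 q by (auto simp: A_def powr_powr)
  have B: "B > 0" "B powr q = b1 powr q + b2 powr q"
    using AB0 q by (auto simp: B_def powr_powr)
  \<comment> \<open>Dividing both vectors by their norms reduces the claim to convexity of the power
    at the weights \<open>s\<close> and \<open>1 - s\<close>.\<close>
  define s where "s = A / (A + B)"
  have s: "0 \<le> s" "s \<le> 1" and s1: "1 - s = B / (A + B)" using A B by (auto simp: s_def field_simps)
  have cv: "convex_on {0<..} (\<lambda>x :: real. x powr q)" by (rule powr_convex[OF q])
  have one: "(a + b) powr q \<le> (A + B) powr q * (s * (a powr q / A powr q) + (1 - s) * (b powr q / B powr q))"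
    if "a > 0" "b > 0" for a b
  proof -
    have "s * (a / A) + (1 - s) * (b / B) = (a + b) / (A + B)"
      unfolding s1 unfolding s_def using A(1) B(1) by (simp add: add_divide_distrib)
    moreover have "(s * (a / A) + (1 - s) * (b / B)) powr q \<le> s * (a / A) powr q + (1 - s) * (b / B) powr q"
      using convex_onD[OF cv, of "1 - s" "a / A" "b / B"] s that A B by simp
    ultimately have "((a + b) / (A + B)) powr q \<le> s * (a powr q / A powr q) + (1 - s) * (b powr q / B powr q)"
      using that A B by (simp add: powr_divide)
    then show ?thesis using that A B by (simp add: powr_divide divide_le_eq mult.commute)
  qed
  have "(a1 + b1) powr q + (a2 + b2) powr q
      \<le> (A + B) powr q * (s * ((a1 powr q + a2 powr q) / A powr q) + (1 - s) * ((b1 powr q + b2 powr q) / B powr q))"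
    using one[of a1 b1] one[of a2 b2] pos by (simp add: algebra_simps add_divide_distrib)
  also have "\<dots> = (A + B) powr q"
    using A(1) B(1) unfolding A(2)[symmetric] B(2)[symmetric] by simp
  finally show ?thesis by (simp add: A_def B_def)
qed

lemma tanh_scale_ge:
  fixes L c :: real
  assumes "0 \<le> c" "c \<le> 1" "L \<ge> 0"
  shows "c * tanh L \<le> tanh (c * L)"
proof -
  have "(\<lambda>x. tanh (c * x) - c * tanh x) 0 \<le> (\<lambda>x. tanh (c * x) - c * tanh x) L"
  proof (rule DERIV_nonneg_imp_nondecreasing[OF assms(3)])
    fix x :: real assume x: "0 \<le> x" "x \<le> L"
    have "((\<lambda>x. tanh (c * x) - c * tanh x) has_real_derivative ((1 - (tanh (c * x))\<^sup>2) * c - c * (1 - (tanh x)\<^sup>2))) (at x)"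
      by (auto intro!: derivative_eq_intros)
    moreover have "tanh (c * x) \<le> tanh x" using x assms by (simp add: mult_left_le_one_le)
    then have "(tanh (c * x))\<^sup>2 \<le> (tanh x)\<^sup>2" using x assms by (intro power_mono) auto
    then have "(1 - (tanh (c * x))\<^sup>2) * c - c * (1 - (tanh x)\<^sup>2) \<ge> 0"
      using assms by (simp add: algebra_simps mult_left_mono)
    ultimately show "\<exists>y. DERIV (\<lambda>x. tanh (c * x) - c * tanh x) x :> y \<and> y \<ge> 0" by blast
  qed
  then show ?thesis by simp
qed

text \<open>Both sides are even and vanish at 0, so derivatives are compared. With
  \<open>b = tanh x\<close>, half the derivative on the left is
  \<open>(b + c * b) / (1 + b * (c * b))\<close>, an addition formula with
  \<open>c * b \<le> tanh (c * x)\<close>, hence at most \<open>tanh ((1 + c) * x)\<close>. It is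
  applied with \<open>c = (tanh J)\<^sup>2\<close> and \<open>\<kappa> = 1 + 1 / k\<close>, so
  \<open>\<kappa> \<ge> 1 + c\<close> is the reconstruction bound.\<close>

lemma overlap_inequality:
  fixes L c \<kappa> :: real
  assumes c: "0 \<le> c" "c \<le> 1" and \<kappa>: "\<kappa> \<ge> 1 + c"
  shows "ln ((cosh L)\<^sup>2 + c * (sinh L)\<^sup>2) \<le> 2 / \<kappa> * ln (cosh (\<kappa> * L))"
proof -
  define f where "f x = 2 / \<kappa> * ln (cosh (\<kappa> * x)) - ln ((cosh x)\<^sup>2 + c * (sinh x)\<^sup>2)" for x
  have \<kappa>0: "\<kappa> > 0" using c \<kappa> by linarith
  have pos: "(cosh x)\<^sup>2 + c * (sinh x)\<^sup>2 > 0" for x :: real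
    using c by (simp add: add_pos_nonneg)
  have main: "f L \<ge> 0" if L: "L \<ge> 0" for L
  proof -
    have "f 0 \<le> f L"
    proof (rule DERIV_nonneg_imp_nondecreasing[OF L])
      fix x :: real assume x: "0 \<le> x" "x \<le> L"
      let ?b = "tanh x"
      have D: "(f has_real_derivative (2 * tanh (\<kappa> * x) - 2 * ((1 + c) * (sinh x * cosh x) / ((cosh x)\<^sup>2 + c * (sinh x)\<^sup>2)))) (at x)"
        unfolding f_def[abs_def]
      proof (rule DERIV_diff)
        show "((\<lambda>x. 2 / \<kappa> * ln (cosh (\<kappa> * x))) has_real_derivative 2 * tanh (\<kappa> * x)) (at x)"
          using \<kappa>0 by (auto intro!: derivative_eq_intros simp: tanh_def)
        show "((\<lambda>x. ln ((cosh x)\<^sup>2 + c * (sinh x)\<^sup>2)) has_real_derivative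
            2 * ((1 + c) * (sinh x * cosh x) / ((cosh x)\<^sup>2 + c * (sinh x)\<^sup>2))) (at x)"
          using pos[of x] by (auto intro!: derivative_eq_intros simp: divide_inverse algebra_simps)
      qed
      have b: "0 \<le> ?b" "?b < 1" using x tanh_real_lt_1 by auto
      have eq: "(1 + c) * (sinh x * cosh x) / ((cosh x)\<^sup>2 + c * (sinh x)\<^sup>2) = (?b + c * ?b) / (1 + ?b * (c * ?b))"
      proof -
        have ch: "cosh x \<noteq> 0" using cosh_real_pos[of x] by linarith
        have s: "sinh x = ?b * cosh x" using ch by (simp add: tanh_def)
        have "(cosh x)\<^sup>2 + c * (sinh x)\<^sup>2 = (cosh x)\<^sup>2 * (1 + ?b * (c * ?b))"
          unfolding s by (simp add: power2_eq_square algebra_simps)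
        moreover have "(1 + c) * (sinh x * cosh x) = (cosh x)\<^sup>2 * (?b + c * ?b)"
          unfolding s by (simp add: power2_eq_square algebra_simps)
        ultimately show ?thesis using ch by simp
      qed
      have cb: "c * ?b \<le> tanh (c * x)" by (rule tanh_scale_ge) (use c x in auto)
      have mono: "(?b + y) / (1 + ?b * y) \<le> (?b + z) / (1 + ?b * z)" if "0 \<le> y" "y \<le> z" for y z
      proof -
        have 1: "1 + ?b * y > 0" "1 + ?b * z > 0" using that b by (auto intro: add_pos_nonneg)
        have b2: "?b * ?b \<le> 1" using b by (intro mult_le_one) auto
        have "(?b + z) * (1 + ?b * y) - (?b + y) * (1 + ?b * z) = (z - y) * (1 - ?b * ?b)"
          by (simp add: algebra_simps)
        moreover have "(z - y) * (1 - ?b * ?b) \<ge> 0" using that b2 by simp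
        ultimately have "(?b + y) * (1 + ?b * z) \<le> (?b + z) * (1 + ?b * y)" by linarith
        then show ?thesis using 1 by (simp add: frac_le_eq divide_le_eq pos_le_divide_eq mult.commute divide_le_0_iff)
      qed
      have "(?b + c * ?b) / (1 + ?b * (c * ?b)) \<le> (?b + tanh (c * x)) / (1 + ?b * tanh (c * x))"
        using cb b c by (intro mono) auto
      also have "\<dots> = tanh (x + c * x)" by (subst tanh_add) auto
      also have "\<dots> \<le> tanh (\<kappa> * x)"
        using \<kappa> x mult_right_mono[of "1 + c" \<kappa> x] by (simp add: algebra_simps)
      finally have "(1 + c) * (sinh x * cosh x) / ((cosh x)\<^sup>2 + c * (sinh x)\<^sup>2) \<le> tanh (\<kappa> * x)" unfolding eq .
      then have "2 * tanh (\<kappa> * x) - 2 * ((1 + c) * (sinh x * cosh x) / ((cosh x)\<^sup>2 + c * (sinh x)\<^sup>2)) \<ge> 0" by linarith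
      then show "\<exists>y. DERIV f x :> y \<and> y \<ge> 0" using D by blast
    qed
    then show ?thesis by (simp add: f_def)
  qed
  show ?thesis
  proof (cases "L \<ge> 0")
    case True
    then show ?thesis using main[of L] by (simp add: f_def)
  next
    case False
    then show ?thesis using main[of "- L"] by (simp add: f_def)
  qed
qed

lemma sum_pair_spin: "(\<Sum>a\<in>UNIV. f a) = (\<Sum>s\<in>UNIV. \<Sum>s'\<in>UNIV. f (s, s'))" for f :: "spin \<times> spin \<Rightarrow> 'b::comm_monoid_add"
  by (simp add: sum.cartesian_product UNIV_Times_UNIV[symmetric] del: UNIV_Times_UNIV)

context
  fixes k J M :: real
  assumes k: "k \<ge> 1" and J: "J > 0" and M: "M > 0" and bethe_le: "\<And>t. bethe k J t \<le> (k + 1) / 2 * ln M"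
begin

text \<open>Two positive numbers can be written as \<open>\<rho> * exp t\<close> and
  \<open>\<rho> * exp (- t)\<close>. Both sides are homogeneous of degree 2 in
  \<open>\<rho>\<close>, and what remains is the exponentiated bound on
  \<open>bethe k J t\<close>.\<close>

lemma edge_form_le:
  fixes R :: "spin \<Rightarrow> real"
  assumes R: "\<And>s. R s > 0"
  shows "(\<Sum>s\<in>UNIV. \<Sum>s'\<in>UNIV. R s * exp (J * val s * val s') * R s') \<le> M * (\<Sum>s\<in>UNIV. R s powr ((k + 1) / k)) powr (2 * k / (k + 1))"
proof -
  define \<rho> where "\<rho> = sqrt (R Plus * R Minus)"
  define t where "t = ln (R Plus / R Minus) / 2"
  have \<rho>: "\<rho> > 0" using R by (simp add: \<rho>_def)
  have e2t: "exp t = sqrt (R Plus / R Minus)"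
  proof -
    have "exp t * exp t = R Plus / R Minus" using R by (simp add: t_def exp_add[symmetric])
    then show ?thesis by (metis exp_ge_zero real_sqrt_abs2 abs_of_nonneg)
  qed
  have Rp: "R Plus = \<rho> * exp t"
  proof -
    have "\<rho> * exp t = sqrt ((R Plus * R Minus) * (R Plus / R Minus))" by (simp only: \<rho>_def e2t real_sqrt_mult)
    also have "(R Plus * R Minus) * (R Plus / R Minus) = R Plus * R Plus" using R[of Minus] by simp
    finally show ?thesis using R[of Plus] by simp
  qed
  have Rm: "R Minus = \<rho> * exp (- t)"
  proof -
    have "R Minus * exp t = \<rho>"
    proof -
      have "R Minus * exp t = sqrt (R Minus * R Minus) * sqrt (R Plus / R Minus)" using R[of Minus] by (simp add: e2t)
      also have "\<dots> = sqrt ((R Minus * R Minus) * (R Plus / R Minus))" by (simp only: real_sqrt_mult)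
      also have "(R Minus * R Minus) * (R Plus / R Minus) = R Plus * R Minus" using R[of Minus] by simp
      finally show ?thesis by (simp add: \<rho>_def)
    qed
    then show ?thesis by (simp add: exp_minus field_simps)
  qed
  let ?\<kappa> = "(k + 1) / k"
  have lhs: "(\<Sum>s\<in>UNIV. \<Sum>s'\<in>UNIV. R s * exp (J * val s * val s') * R s') = \<rho>\<^sup>2 * edge_norm J t"
  proof -
    have EF: "exp t * exp (- t) = 1" by (simp add: exp_minus)
    have ch: "2 * cosh (2 * t) = exp t * exp t + exp (- t) * exp (- t)" by (simp add: cosh_field_def exp_add[symmetric])
    have "(\<Sum>s\<in>UNIV. \<Sum>s'\<in>UNIV. R s * exp (J * val s * val s') * R s')
        = \<rho>\<^sup>2 * (exp J * (exp t * exp t + exp (- t) * exp (- t)) + 2 * exp (- J) * (exp t * exp (- t)))"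
      by (simp add: sum_spin Rp Rm power2_eq_square algebra_simps)
    then show ?thesis unfolding EF ch[symmetric] by (simp add: edge_norm_def algebra_simps)
  qed
  have pw: "(\<rho> * exp u) powr ?\<kappa> = \<rho> powr ?\<kappa> * exp (?\<kappa> * u)" for u
  proof -
    have "(\<rho> * exp u) powr ?\<kappa> = \<rho> powr ?\<kappa> * exp u powr ?\<kappa>" by (rule powr_mult)
    then show ?thesis by (simp add: powr_def)
  qed
  have "(\<Sum>s\<in>UNIV. R s powr ?\<kappa>) = \<rho> powr ?\<kappa> * (2 * cosh (?\<kappa> * t))"
    unfolding sum_spin Rp Rm pw mult_minus_right by (simp add: cosh_field_def distrib_left add.commute)
  note sumR = this
  have rhs: "(\<Sum>s\<in>UNIV. R s powr ?\<kappa>) powr (2 * k / (k + 1)) = \<rho>\<^sup>2 * (2 * cosh (?\<kappa> * t)) powr (2 * k / (k + 1))"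
  proof -
    have "a / b * (2 * b / a) = 2" if "a \<noteq> 0" "b \<noteq> 0" for a b :: real using that by simp
    from this[of "k + 1" k] have "?\<kappa> * (2 * k / (k + 1)) = 2" using k by linarith
    then have "(\<rho> powr ?\<kappa>) powr (2 * k / (k + 1)) = \<rho>\<^sup>2" using \<rho> by (simp only: powr_powr) simp
    then show ?thesis by (simp only: sumR powr_mult)
  qed
  have "(k + 1) / 2 * ln (edge_norm J t) \<le> (k + 1) / 2 * ln M + k * ln (2 * cosh (?\<kappa> * t))"
    using bethe_le[of t] by (simp add: bethe_def)
  then have "ln (edge_norm J t) \<le> ln M + 2 * k / (k + 1) * ln (2 * cosh (?\<kappa> * t))"
    using k by (simp add: field_simps)
  also have "\<dots> = ln (M * (2 * cosh (?\<kappa> * t)) powr (2 * k / (k + 1)))"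
    using M by (simp add: ln_mult ln_powr)
  finally have "edge_norm J t \<le> M * (2 * cosh (?\<kappa> * t)) powr (2 * k / (k + 1))"
    using M by (subst (asm) ln_le_cancel_iff) auto
  then show ?thesis unfolding lhs rhs using \<rho> by (simp add: mult.left_commute mult_left_mono)
qed

text \<open>
  The form is positive definite, so this says that a norm \<open>\<ell>\<^sup>p \<rightarrow> \<ell>\<^sup>2\<close>, \<open>p \<le> 2\<close>, is multiplicative under
  tensor products: split off a square root and apply Minkowski's inequality.
\<close>

lemma pair_form_le:
  fixes R :: "spin \<times> spin \<Rightarrow> real"
  assumes R: "\<And>a. R a > 0"
  shows "(\<Sum>a\<in>UNIV. \<Sum>b\<in>UNIV. R a * exp (J * (val (fst a) * val (fst b) + val (snd a) * val (snd b))) * R b)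
    \<le> M\<^sup>2 * (\<Sum>a\<in>UNIV. R a powr ((k + 1) / k)) powr (2 * k / (k + 1))"
proof -
  let ?\<kappa> = "(k + 1) / k" and ?q = "2 * k / (k + 1)"
  have "a / b * (2 * b / a) = 2" if "a \<noteq> 0" "b \<noteq> 0" for a b :: real using that by simp
  from this[of "k + 1" k] have \<kappa>q: "?\<kappa> * ?q = 2" using k by linarith
  have q1: "?q \<ge> 1" using k by (simp add: le_divide_eq)
  have iq: "1 / ?q = ?\<kappa> / 2" by simp
  \<comment> \<open>\<open>u\<close> and \<open>v\<close> are the square roots of the eigenvalues of
    the edge matrix; \<open>c\<close> and \<open>d\<close> below are the entries of its positive
    square root. Since \<open>J > 0\<close> they are positive, so \<open>S\<close> is a positive
    vector to which \<open>edge_form_le\<close> applies.\<close>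
  define u where "u = sqrt (exp J + exp (- J))"
  define v where "v = sqrt (exp J - exp (- J))"
  define c where "c = (u + v) / 2"
  define d where "d = (u - v) / 2"
  have ej: "exp (- J) < exp J" using J by simp
  have u2: "u * u = exp J + exp (- J)" by (simp add: u_def add_nonneg_nonneg)
  have v2: "v * v = exp J - exp (- J)" using ej by (simp add: v_def)
  have vu: "v < u" "0 \<le> v" using ej by (simp_all add: u_def v_def)
  have c: "c > 0" and d: "d > 0" using vu by (simp_all add: c_def d_def)
  have cd: "c * c + d * d = exp J" "2 * (c * d) = exp (- J)"
    using u2 v2 by (simp_all add: c_def d_def field_simps)
  define S where "S x y = c * R (x, y) + d * R (case x of Plus \<Rightarrow> Minus | Minus \<Rightarrow> Plus, y)" for x y
  have S: "S x y > 0" for x y unfolding S_def using R c d by (intro add_pos_pos mult_pos_pos) auto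
  have S0: "S x y \<noteq> 0" for x y using S[of x y] by linarith
  have SS: "(\<Sum>x\<in>UNIV. S x y * S x y') = (\<Sum>x\<in>UNIV. \<Sum>x'\<in>UNIV. R (x, y) * exp (J * val x * val x') * R (x', y'))" for y y'
  proof -
    have "(\<Sum>x\<in>UNIV. S x y * S x y') = (c * c + d * d) * (R (Plus, y) * R (Plus, y') + R (Minus, y) * R (Minus, y'))
        + 2 * (c * d) * (R (Plus, y) * R (Minus, y') + R (Minus, y) * R (Plus, y'))"
      by (simp add: S_def sum_spin algebra_simps)
    then show ?thesis unfolding cd by (simp add: sum_spin algebra_simps)
  qed
  have "(\<Sum>a\<in>UNIV. \<Sum>b\<in>UNIV. R a * exp (J * (val (fst a) * val (fst b) + val (snd a) * val (snd b))) * R b)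
      = (\<Sum>y\<in>UNIV. \<Sum>y'\<in>UNIV. exp (J * val y * val y') * (\<Sum>x\<in>UNIV. \<Sum>x'\<in>UNIV. R (x, y) * exp (J * val x * val x') * R (x', y')))"
    by (simp add: sum_pair_spin sum_spin exp_add algebra_simps)
  also have "\<dots> = (\<Sum>x\<in>UNIV. \<Sum>y\<in>UNIV. \<Sum>y'\<in>UNIV. S x y * exp (J * val y * val y') * S x y')"
    unfolding SS[symmetric] by (simp add: sum_spin algebra_simps)
  also have "\<dots> \<le> (\<Sum>x\<in>UNIV. M * (\<Sum>y\<in>UNIV. S x y powr ?\<kappa>) powr ?q)"
    by (intro sum_mono edge_form_le S)
  also have "\<dots> = M * ((S Minus Minus powr ?\<kappa> + S Minus Plus powr ?\<kappa>) powr ?q + (S Plus Minus powr ?\<kappa> + S Plus Plus powr ?\<kappa>) powr ?q)"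
    by (simp add: sum_spin distrib_left)
  \<comment> \<open>Minkowski's inequality exchanges the order of the two norms, so that
    \<open>edge_form_le\<close> can be applied a second time, in the other component.\<close>
  also have "\<dots> \<le> M * ((((S Minus Minus powr ?\<kappa>) powr ?q + (S Plus Minus powr ?\<kappa>) powr ?q) powr (1 / ?q)
      + ((S Minus Plus powr ?\<kappa>) powr ?q + (S Plus Plus powr ?\<kappa>) powr ?q) powr (1 / ?q)) powr ?q)"
    using M S by (intro mult_left_mono minkowski_pair q1) (auto simp: S0 intro: less_imp_le)
  also have "\<dots> = M * ((\<Sum>y\<in>UNIV. (\<Sum>x\<in>UNIV. S x y * S x y) powr (?\<kappa> / 2)) powr ?q)"
  proof -
    have "(S x y powr ?\<kappa>) powr ?q = S x y * S x y" for x y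
      using S[of x y] unfolding powr_powr \<kappa>q by (simp add: power2_eq_square)
    then show ?thesis unfolding iq by (simp add: sum_spin)
  qed
  also have "\<dots> \<le> M * ((\<Sum>y\<in>UNIV. M powr (?\<kappa> / 2) * (\<Sum>x\<in>UNIV. R (x, y) powr ?\<kappa>)) powr ?q)"
  proof -
    have "(\<Sum>x\<in>UNIV. S x y * S x y) powr (?\<kappa> / 2) \<le> M powr (?\<kappa> / 2) * (\<Sum>x\<in>UNIV. R (x, y) powr ?\<kappa>)" for y
    proof -
      have s0: "(\<Sum>x\<in>UNIV. R (x, y) powr ?\<kappa>) > 0" using R by (simp add: sum_spin add_pos_pos less_imp_neq[symmetric])
      have "(\<Sum>x\<in>UNIV. S x y * S x y) \<le> M * (\<Sum>x\<in>UNIV. R (x, y) powr ?\<kappa>) powr ?q"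
        unfolding SS using edge_form_le[of "\<lambda>x. R (x, y)"] R by simp
      then have "(\<Sum>x\<in>UNIV. S x y * S x y) powr (?\<kappa> / 2) \<le> (M * (\<Sum>x\<in>UNIV. R (x, y) powr ?\<kappa>) powr ?q) powr (?\<kappa> / 2)"
        by (rule powr_mono2[rotated 2]) (use k in \<open>auto intro!: sum_nonneg mult_nonneg_nonneg less_imp_le[OF S]\<close>)
      also have "\<dots> = M powr (?\<kappa> / 2) * (\<Sum>x\<in>UNIV. R (x, y) powr ?\<kappa>) powr (?\<kappa> * ?q / 2)"
        using M s0 by (simp add: powr_mult powr_powr mult.commute)
      also have "\<dots> = M powr (?\<kappa> / 2) * (\<Sum>x\<in>UNIV. R (x, y) powr ?\<kappa>)" unfolding \<kappa>q using s0 by simp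
      finally show ?thesis .
    qed
    then show ?thesis using M q1 by (intro mult_left_mono powr_mono2 sum_mono) (auto intro!: sum_nonneg)
  qed
  also have "\<dots> = M\<^sup>2 * (\<Sum>a\<in>UNIV. R a powr ?\<kappa>) powr ?q"
  proof -
    have "(\<Sum>y\<in>UNIV. M powr (?\<kappa> / 2) * (\<Sum>x\<in>UNIV. R (x, y) powr ?\<kappa>)) = M powr (?\<kappa> / 2) * (\<Sum>a\<in>UNIV. R a powr ?\<kappa>)"
      by (simp add: sum_pair_spin sum_spin algebra_simps)
    moreover have "(M powr (?\<kappa> / 2)) powr ?q = M"
    proof -
      have "?\<kappa> / 2 * ?q = ?\<kappa> * ?q / 2" by simp
      then have "?\<kappa> / 2 * ?q = 1" unfolding \<kappa>q by simp
      then show ?thesis using M by (simp only: powr_powr) simp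
    qed
    ultimately show ?thesis using M by (simp add: powr_mult sum_nonneg power2_eq_square)
  qed
  finally show ?thesis .
qed

end

section \<open>Annealed counts\<close>

lemma tuple_avg_mono: "(\<And>p. p \<in> perm_tuples n \<Longrightarrow> f p \<le> g p) \<Longrightarrow> tuple_avg n f \<le> tuple_avg n g"
  unfolding tuple_avg_def by (intro divide_right_mono sum_mono) auto

text \<open>There are only polynomially many families of edge types, so up to that factor the worst
  one decides.\<close>

lemma tuple_avg_count_le:
  fixes Q :: "'a::finite perms \<Rightarrow> (nat \<Rightarrow> 'c::finite) \<Rightarrow> bool"
  assumes K: "K \<ge> 0" "\<And>p z. p \<in> perm_tuples n \<Longrightarrow> z \<in> confs n \<Longrightarrow> Q p z \<Longrightarrow>
    tuple_avg n (\<lambda>p'. real (card {z' \<in> confs n. typed n (\<lambda>i. ecount n z (z \<circ> p i)) p' z'})) \<le> K"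
  shows "tuple_avg n (\<lambda>p. real (card {z \<in> confs n. Q p z})) \<le> real (n + 1) ^ (CARD('c) * CARD('c) * CARD('a)) * K"
proof -
  define \<N> where "\<N> = {(\<lambda>i. ecount n z (z \<circ> p i)) | p z. p \<in> (perm_tuples n :: 'a perms set) \<and> z \<in> confs n \<and> Q p z}"
  have sub: "\<N> \<subseteq> (UNIV \<rightarrow>\<^sub>E (UNIV \<rightarrow>\<^sub>E (UNIV \<rightarrow>\<^sub>E {0..n})))"
  proof
    fix N assume "N \<in> \<N>"
    then obtain p z where N: "N = (\<lambda>i. ecount n z (z \<circ> p i))" by (auto simp: \<N>_def)
    have "ecount n z y a b \<le> n" for y a b
    proof -
      have "ecount n z y a b \<le> card {1..n}" unfolding ecount_def by (rule card_mono) auto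
      then show ?thesis by simp
    qed
    then show "N \<in> (UNIV \<rightarrow>\<^sub>E (UNIV \<rightarrow>\<^sub>E (UNIV \<rightarrow>\<^sub>E {0..n})))" by (auto simp: N)
  qed
  have finB: "finite (UNIV \<rightarrow>\<^sub>E (UNIV \<rightarrow>\<^sub>E (UNIV \<rightarrow>\<^sub>E {0..n})) :: ('a \<Rightarrow> 'c \<Rightarrow> 'c \<Rightarrow> nat) set)"
    by (intro finite_PiE) auto
  have fin: "finite \<N>" by (rule finite_subset[OF sub finB])
  have card: "card \<N> \<le> (n + 1) ^ (CARD('c) * CARD('c) * CARD('a))"
    using card_mono[OF finB sub] by (simp add: card_PiE power_mult Suc_eq_plus1)
  have pt: "real (card {z \<in> confs n. Q p z}) \<le> (\<Sum>N\<in>\<N>. real (card {z \<in> confs n. typed n N p z}))" if p: "p \<in> perm_tuples n" for p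
  proof -
    have "{z \<in> confs n. Q p z} \<subseteq> (\<Union>N\<in>\<N>. {z \<in> confs n. typed n N p z})"
    proof
      fix z assume z: "z \<in> {z \<in> confs n. Q p z}"
      then have "(\<lambda>i. ecount n z (z \<circ> p i)) \<in> \<N>" using p by (auto simp: \<N>_def)
      then show "z \<in> (\<Union>N\<in>\<N>. {z \<in> confs n. typed n N p z})" using z by (intro UN_I) (auto simp: typed_def)
    qed
    then have "card {z \<in> confs n. Q p z} \<le> card (\<Union>N\<in>\<N>. {z \<in> confs n. typed n N p z})"
      using fin by (intro card_mono) auto
    also have "\<dots> \<le> (\<Sum>N\<in>\<N>. card {z \<in> confs n. typed n N p z})" by (rule card_UN_le[OF fin])
    finally have "real (card {z \<in> confs n. Q p z}) \<le> real (\<Sum>N\<in>\<N>. card {z \<in> confs n. typed n N p z})" by (rule of_nat_mono)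
    then show ?thesis by (simp only: of_nat_sum)
  qed
  have "tuple_avg n (\<lambda>p. real (card {z \<in> confs n. Q p z})) \<le> tuple_avg n (\<lambda>p. \<Sum>N\<in>\<N>. real (card {z \<in> confs n. typed n N p z}))"
    by (rule tuple_avg_mono) (rule pt)
  also have "\<dots> = (\<Sum>N\<in>\<N>. tuple_avg n (\<lambda>p. real (card {z \<in> confs n. typed n N p z})))"
    unfolding tuple_avg_def sum_divide_distrib[symmetric] by (subst sum.swap) (rule refl)
  also have "\<dots> \<le> (\<Sum>N\<in>\<N>. K)" by (intro sum_mono) (auto simp: \<N>_def K(2))
  also have "\<dots> = real (card \<N>) * K" by simp
  also have "\<dots> \<le> real ((n + 1) ^ (CARD('c) * CARD('c) * CARD('a))) * K"
    by (intro mult_right_mono of_nat_mono card K(1))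
  finally show ?thesis by simp
qed

text \<open>
  The weights \<open>R a = ((c a + 1) / (n + m)) powr (k / (k + 1))\<close> make the vertex factors cancel the factor
  \<open>(\<Prod>a. c a ^ c a) ^ (2 r - 1)\<close> of the count up to a constant, while they stay positive on unused letters.
\<close>

lemma tuple_avg_typed_form_le:
  fixes N :: "'a::finite \<Rightarrow> 'c::finite \<Rightarrow> 'c \<Rightarrow> nat" and B :: "'c \<Rightarrow> 'c \<Rightarrow> real"
  defines "k \<equiv> 2 * real CARD('a) - 1"
  assumes row: "\<And>i a. (\<Sum>b\<in>UNIV. N i a b) = c a" and col: "\<And>i b. (\<Sum>a\<in>UNIV. N i a b) = c b"
    and cn: "(\<Sum>a\<in>UNIV. c a) = n" and n: "n > 0"
    and B: "\<And>a b. B a b > 0"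
    and form: "\<And>R. (\<And>a. R a > 0) \<Longrightarrow> (\<Sum>a\<in>UNIV. \<Sum>b\<in>UNIV. R a * B a b * R b) \<le> \<Lambda> * (\<Sum>a\<in>UNIV. R a powr ((k + 1) / k)) powr (2 * k / (k + 1))"
  shows "tuple_avg n (\<lambda>p. real (card {z \<in> confs n. typed n N p z})) * (\<Prod>i\<in>UNIV. \<Prod>a\<in>UNIV. \<Prod>b\<in>UNIV. B a b ^ N i a b)
    \<le> ((exp 1 * (real n + 1)) ^ CARD('c)) ^ (2 * CARD('a) - 1) * exp (real CARD('c)) ^ (2 * CARD('a) - 1) * \<Lambda> ^ (n * CARD('a))"
proof -
  define r where "r = CARD('a)"
  define m where "m = CARD('c)"
  define e where "e = 2 * r - 1"
  have r: "r \<ge> 1" by (simp add: r_def Suc_leI One_nat_def)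
  have k: "k = real e" using r by (simp add: k_def e_def r_def)
  have e2: "e + 1 = 2 * r" using r by (simp add: e_def)
  have e1: "e \<ge> 1" using r by (simp add: e_def)
  define y where "y a = (real (c a) + 1) / (real n + real m)" for a
  have y: "y a > 0" for a by (simp add: y_def add_nonneg_pos n add_pos_nonneg divide_pos_pos)
  define R where "R a = y a powr (k / (k + 1))" for a
  have R: "R a > 0" for a using y[of a] by (simp add: R_def)
  have sumy: "(\<Sum>a\<in>UNIV. y a) = 1"
  proof -
    have "(\<Sum>a\<in>UNIV. y a) = (\<Sum>a\<in>UNIV. real (c a) + 1) / (real n + real m)" by (simp add: y_def sum_divide_distrib)
    also have "(\<Sum>a\<in>UNIV. real (c a) + 1) = real n + real m" using cn by (simp add: sum.distrib m_def flip: of_nat_sum)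
    finally show ?thesis using n by simp
  qed
  have "R a powr ((k + 1) / k) = y a" for a
    using y[of a] e1 by (simp add: R_def powr_powr k)
  then have L: "(\<Sum>a\<in>UNIV. \<Sum>b\<in>UNIV. R a * B a b * R b) \<le> \<Lambda>"
    using form[of R] R sumy by simp
  \<comment> \<open>Each vertex is an end of \<open>2 r\<close> edges, and
    \<open>k / (k + 1) * (2 * r)\<close> equals \<open>2 * r - 1\<close>.\<close>
  have R2r: "R a ^ (2 * r) = y a ^ e" for a
  proof -
    have "R a ^ (2 * r) = R a powr (real (2 * r))" by (simp only: powr_realpow[OF R])
    also have "\<dots> = y a powr (k / (k + 1) * real (2 * r))" by (simp add: R_def powr_powr)
    also have "k / (k + 1) * real (2 * r) = real e" using e2 by (simp add: k flip: e2)
    finally show ?thesis using y[of a] by (simp add: powr_realpow)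
  qed
  let ?q = "\<lambda>(i :: 'a) a b. R a * B a b * R b"
  let ?A = "tuple_avg n (\<lambda>p. real (card {z \<in> confs n. typed n N p z}))"
  let ?B = "\<Prod>i\<in>UNIV. \<Prod>a\<in>UNIV. \<Prod>b\<in>UNIV. B a b ^ N i a b"
  let ?Y = "\<Prod>a\<in>UNIV. y a ^ c a"
  have Y: "?Y > 0" using y by (intro prod_pos) simp
  have A0: "?A \<ge> 0" by (simp add: tuple_avg_def sum_nonneg)
  have B0: "?B > 0" using B by (intro prod_pos) simp
  have qprod: "(\<Prod>i\<in>UNIV. \<Prod>a\<in>UNIV. \<Prod>b\<in>UNIV. ?q i a b ^ N i a b) = ?Y ^ e * ?B"
  proof -
    have "(\<Prod>a\<in>UNIV. \<Prod>b\<in>UNIV. ?q i a b ^ N i a b) = (\<Prod>a\<in>UNIV. R a ^ c a) * (\<Prod>b\<in>UNIV. R b ^ c b) * (\<Prod>a\<in>UNIV. \<Prod>b\<in>UNIV. B a b ^ N i a b)" for i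
    proof -
      have "(\<Prod>a\<in>UNIV. \<Prod>b\<in>UNIV. R a ^ N i a b) = (\<Prod>a\<in>UNIV. R a ^ c a)"
        by (simp add: power_sum[symmetric] row)
      moreover have "(\<Prod>a\<in>UNIV. \<Prod>b\<in>UNIV. R b ^ N i a b) = (\<Prod>b\<in>UNIV. R b ^ c b)"
        by (subst prod.swap) (simp add: power_sum[symmetric] col)
      ultimately show ?thesis by (simp add: power_mult_distrib prod.distrib mult_ac)
    qed
    then have "(\<Prod>i\<in>UNIV. \<Prod>a\<in>UNIV. \<Prod>b\<in>UNIV. ?q i a b ^ N i a b) = ((\<Prod>a\<in>UNIV. R a ^ c a) * (\<Prod>b\<in>UNIV. R b ^ c b)) ^ r * ?B"
      by (simp add: prod.distrib r_def)
    also have "((\<Prod>a\<in>UNIV. R a ^ c a) * (\<Prod>b\<in>UNIV. R b ^ c b)) ^ r = (\<Prod>a\<in>UNIV. (R a ^ (2 * r)) ^ c a)"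
    proof -
      have "(x ^ c * x ^ c) ^ r = (x ^ (2 * r)) ^ c" for x :: real and c :: nat
        by (simp only: power_add[symmetric] power_mult[symmetric] mult_2[symmetric]) (simp only: mult_ac)
      then show ?thesis by (simp add: prod.distrib[symmetric] prod_power_distrib)
    qed
    also have "\<dots> = ?Y ^ e" unfolding R2r by (simp add: prod_power_distrib mult.commute flip: power_mult)
    finally show ?thesis .
  qed
  have "?A * (real n ^ n) ^ e * (?Y ^ e * ?B) \<le> ((exp 1 * (real n + 1)) ^ m) ^ e * (\<Prod>a\<in>UNIV. real (c a) ^ c a) ^ e * (\<Prod>i\<in>(UNIV :: 'a set). (\<Sum>a\<in>UNIV. \<Sum>b\<in>UNIV. R a * B a b * R b) ^ n)"
    unfolding qprod[symmetric] unfolding e_def r_def m_def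
    using tuple_avg_typed_le[where N = N and c = c and n = n and q = ?q, OF row col cn] R B by (simp add: less_imp_le)
  also have "\<dots> \<le> ((exp 1 * (real n + 1)) ^ m) ^ e * ((real n + real m) ^ n * ?Y) ^ e * (\<Prod>i\<in>(UNIV :: 'a set). \<Lambda> ^ n)"
  proof (intro mult_mono power_mono prod_mono conjI)
    have "(\<Prod>a\<in>UNIV. real (c a) ^ c a) \<le> (\<Prod>a\<in>UNIV. ((real n + real m) * y a) ^ c a)"
      using n by (intro prod_mono conjI power_mono) (auto simp: y_def)
    also have "\<dots> = (real n + real m) ^ n * ?Y" by (simp add: power_mult_distrib prod.distrib power_sum[symmetric] cn)
    finally show "(\<Prod>a\<in>UNIV. real (c a) ^ c a) \<le> (real n + real m) ^ n * ?Y" .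
  qed (use L in \<open>auto intro!: sum_nonneg prod_nonneg mult_nonneg_nonneg zero_le_power add_nonneg_nonneg
        less_imp_le[OF R] less_imp_le[OF B] less_imp_le[OF Y]\<close>)
  also have "\<dots> = ((exp 1 * (real n + 1)) ^ m) ^ e * ((real n + real m) ^ n) ^ e * \<Lambda> ^ (n * r) * ?Y ^ e"
    by (simp add: power_mult_distrib r_def power_mult mult_ac)
  finally have "(?A * (real n ^ n) ^ e * ?B) * ?Y ^ e \<le> (((exp 1 * (real n + 1)) ^ m) ^ e * ((real n + real m) ^ n) ^ e * \<Lambda> ^ (n * r)) * ?Y ^ e"
    by (simp only: mult_ac)
  then have main: "?A * (real n ^ n) ^ e * ?B \<le> ((exp 1 * (real n + 1)) ^ m) ^ e * ((real n + real m) ^ n) ^ e * \<Lambda> ^ (n * r)"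
    using Y by (meson mult_le_cancel_right_pos zero_less_power)
  have L0: "\<Lambda> \<ge> 0"
    by (rule order_trans[OF _ L]) (auto intro!: sum_nonneg mult_nonneg_nonneg less_imp_le[OF R] less_imp_le[OF B])
  \<comment> \<open>Normalizing by \<open>n + m\<close> instead of \<open>n\<close> costs only the
    constant \<open>exp m\<close> for each power.\<close>
  have nm: "(real n + real m) ^ n \<le> real n ^ n * exp (real m)"
  proof -
    have "real n + real m \<le> real n * exp (real m / real n)"
      using n mult_left_mono[OF exp_ge_add_one_self[of "real m / real n"], of "real n"] by (simp add: distrib_left)
    then have "(real n + real m) ^ n \<le> (real n * exp (real m / real n)) ^ n" by (intro power_mono) auto
    also have "\<dots> = real n ^ n * exp (real m)" using n by (simp add: power_mult_distrib flip: exp_of_nat_mult)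
    finally show ?thesis .
  qed
  have "?A * (real n ^ n) ^ e * ?B \<le> ((exp 1 * (real n + 1)) ^ m) ^ e * (real n ^ n * exp (real m)) ^ e * \<Lambda> ^ (n * r)"
    by (rule order_trans[OF main]) (intro mult_right_mono mult_left_mono power_mono nm zero_le_power L0; simp)
  then have "(?A * ?B) * (real n ^ n) ^ e \<le> (((exp 1 * (real n + 1)) ^ m) ^ e * exp (real m) ^ e * \<Lambda> ^ (n * r)) * (real n ^ n) ^ e"
    by (simp only: power_mult_distrib mult_ac)
  then show ?thesis unfolding m_def e_def r_def
    using n by (subst (asm) mult_le_cancel_right_pos) auto
qed

section \<open>First and second moments\<close>

lemma poly_le_exp:
  fixes C \<epsilon> :: real
  assumes "\<epsilon> > 0"
  shows "\<forall>\<^sub>F n in sequentially. C * (real n + 1) ^ m \<le> exp (\<epsilon> * real n)"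
proof -
  have "((\<lambda>n. C * ((real n + 1) ^ m / exp (\<epsilon> * real n))) \<longlongrightarrow> C * 0) sequentially"
  proof (intro tendsto_intros)
    have "((\<lambda>x. (x + 1) ^ m / exp (\<epsilon> * x)) \<longlongrightarrow> 0) at_top"
      using assms by real_asymp
    then show "((\<lambda>n. (real n + 1) ^ m / exp (\<epsilon> * real n)) \<longlongrightarrow> 0) sequentially"
      by (rule filterlim_compose) (rule filterlim_real_sequentially)
  qed
  then have "\<forall>\<^sub>F n in sequentially. C * ((real n + 1) ^ m / exp (\<epsilon> * real n)) < 1"
    by (rule order_tendstoD(2)) simp
  then show ?thesis
    by eventually_elim (simp add: divide_less_eq)
qed

text \<open>A symmetric integral approximation of \<open>n * W\<close>. The rounding errors go into
  the pair \<open>(Minus, Minus)\<close>, which makes the total exactly \<open>n\<close>; symmetry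
  makes row and column sums agree.\<close>

definition types :: "(spin \<Rightarrow> spin \<Rightarrow> real) \<Rightarrow> nat \<Rightarrow> spin \<Rightarrow> spin \<Rightarrow> nat" where
  "types W n s s' = (if s = Plus \<and> s' = Plus then nat \<lfloor>real n * W Plus Plus\<rfloor>
     else if s = Minus \<and> s' = Minus then n - nat \<lfloor>real n * W Plus Plus\<rfloor> - 2 * nat \<lfloor>real n * W Plus Minus\<rfloor>
     else nat \<lfloor>real n * W Plus Minus\<rfloor>)"

definition vtypes :: "(spin \<Rightarrow> spin \<Rightarrow> real) \<Rightarrow> nat \<Rightarrow> spin \<Rightarrow> nat" where
  "vtypes W n s = (\<Sum>s'\<in>UNIV. types W n s s')"

lemma types_sym: "types W n s s' = types W n s' s"
  by (simp add: types_def)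

lemma vtypes_col: "(\<Sum>s\<in>UNIV. types W n s s') = vtypes W n s'"
  unfolding vtypes_def by (rule sum.cong) (auto simp: types_sym)

locale edge_law =
  fixes W :: "spin \<Rightarrow> spin \<Rightarrow> real"
  assumes W_pos: "\<And>s s'. W s s' > 0" and W_sym: "\<And>s s'. W s s' = W s' s"
    and W_sum: "(\<Sum>s\<in>UNIV. \<Sum>s'\<in>UNIV. W s s') = 1"
begin

lemma W_sum': "W Plus Plus + 2 * W Plus Minus + W Minus Minus = 1"
  using W_sum W_sym[of Minus Plus] by (simp add: sum_spin)

lemma types_floor: "real (nat \<lfloor>real n * W Plus s\<rfloor>) \<le> real n * W Plus s" "real n * W Plus s - 1 \<le> real (nat \<lfloor>real n * W Plus s\<rfloor>)"
  using W_pos[of Plus s] by (auto simp: of_nat_nat mult_nonneg_nonneg)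

text \<open>Hence the truncated subtraction in \<open>types\<close> is a true one.\<close>

lemma types_le: "nat \<lfloor>real n * W Plus Plus\<rfloor> + 2 * nat \<lfloor>real n * W Plus Minus\<rfloor> \<le> n"
proof -
  have "real (nat \<lfloor>real n * W Plus Plus\<rfloor> + 2 * nat \<lfloor>real n * W Plus Minus\<rfloor>) \<le> real n * (W Plus Plus + 2 * W Plus Minus)"
    using types_floor(1)[of n Plus] types_floor(1)[of n Minus] by (simp add: algebra_simps)
  also have "\<dots> \<le> real n * 1" using W_sum' W_pos[of Minus Minus] by (intro mult_left_mono) auto
  finally show ?thesis by (simp only: of_nat_le_iff mult_1_right)
qed

lemma types_sum: "(\<Sum>s\<in>UNIV. vtypes W n s) = n"
  using types_le[of n] by (simp add: vtypes_def sum_spin types_def)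

lemma types_limit: "(\<lambda>n. real (types W n s s') / real n) \<longlonglongrightarrow> W s s'"
proof -
  have P: "(\<lambda>n. real (nat \<lfloor>real n * W Plus u\<rfloor>) / real n) \<longlonglongrightarrow> W Plus u" for u
  proof (rule tendsto_sandwich)
    show "\<forall>\<^sub>F n in sequentially. W Plus u - 1 / real n \<le> real (nat \<lfloor>real n * W Plus u\<rfloor>) / real n"
      using eventually_gt_at_top[of 0]
    proof eventually_elim
      case (elim n)
      have "W Plus u - 1 / real n = (real n * W Plus u - 1) / real n" using elim by (simp add: field_simps)
      also have "\<dots> \<le> real (nat \<lfloor>real n * W Plus u\<rfloor>) / real n" by (intro divide_right_mono types_floor) auto
      finally show ?case .
    qed
    show "\<forall>\<^sub>F n in sequentially. real (nat \<lfloor>real n * W Plus u\<rfloor>) / real n \<le> W Plus u"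
      using eventually_gt_at_top[of 0] by eventually_elim (use types_floor(1)[of _ u] in \<open>simp add: divide_le_eq mult.commute\<close>)
    have "(\<lambda>n. W Plus u - 1 / real n) \<longlonglongrightarrow> W Plus u - 0" by (intro tendsto_intros lim_const_over_n)
    then show "(\<lambda>n. W Plus u - 1 / real n) \<longlonglongrightarrow> W Plus u" by simp
  qed simp
  have "(\<lambda>n. 1 - real (nat \<lfloor>real n * W Plus Plus\<rfloor>) / real n - 2 * (real (nat \<lfloor>real n * W Plus Minus\<rfloor>) / real n)) \<longlonglongrightarrow> 1 - W Plus Plus - 2 * W Plus Minus"
    by (intro tendsto_intros P)
  moreover have "\<forall>\<^sub>F n in sequentially. 1 - real (nat \<lfloor>real n * W Plus Plus\<rfloor>) / real n - 2 * (real (nat \<lfloor>real n * W Plus Minus\<rfloor>) / real n) = real (types W n Minus Minus) / real n"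
    using eventually_gt_at_top[of 0]
  proof eventually_elim
    case (elim n)
    have "real (types W n Minus Minus) = real n - real (nat \<lfloor>real n * W Plus Plus\<rfloor>) - 2 * real (nat \<lfloor>real n * W Plus Minus\<rfloor>)"
      using types_le[of n] by (simp add: types_def of_nat_diff)
    then show ?case using elim by (simp add: diff_divide_distrib)
  qed
  ultimately have "(\<lambda>n. real (types W n Minus Minus) / real n) \<longlonglongrightarrow> 1 - W Plus Plus - 2 * W Plus Minus"
    by (rule Lim_transform_eventually)
  then have MM: "(\<lambda>n. real (types W n Minus Minus) / real n) \<longlonglongrightarrow> W Minus Minus"
  proof -
    have "1 - W Plus Plus - 2 * W Plus Minus = W Minus Minus" using W_sum' by linarith
    then show ?thesis using \<open>(\<lambda>n. real (types W n Minus Minus) / real n) \<longlonglongrightarrow> _\<close> by simp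
  qed
  show ?thesis
    by (cases s; cases s') (use MM P[of Plus] P[of Minus] W_sym[of Minus Plus] in \<open>simp_all add: types_def\<close>)
qed

lemma vtypes_limit: "(\<lambda>n. real (vtypes W n s) / real n) \<longlonglongrightarrow> (\<Sum>s'\<in>UNIV. W s s')"
proof -
  have "(\<lambda>n. \<Sum>s'\<in>UNIV. real (types W n s s') / real n) \<longlonglongrightarrow> (\<Sum>s'\<in>UNIV. W s s')"
    by (intro tendsto_sum types_limit)
  then show ?thesis by (simp add: vtypes_def sum_divide_distrib)
qed

text \<open>The rate is \<open>r\<close> edge entropies minus \<open>2 r - 1\<close> site entropies,
  the value of \<open>tuple_avg_typed_ge\<close> at \<open>\<pi>\<close> equal to the marginal of
  \<open>W\<close>.\<close>

lemma first_moment: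
  assumes \<epsilon>: "\<epsilon> > 0"
  defines "\<pi> \<equiv> \<lambda>s. \<Sum>s'\<in>UNIV. W s s'"
  shows "\<forall>\<^sub>F n in sequentially. tuple_avg n (\<lambda>p :: 'a::finite \<Rightarrow> _. real (card {x \<in> confs n. typed n (\<lambda>_. types W n) p x}))
    \<ge> exp (real n * ((2 * real CARD('a) - 1) * (\<Sum>s\<in>UNIV. \<pi> s * ln (\<pi> s)) - real CARD('a) * (\<Sum>s\<in>UNIV. \<Sum>s'\<in>UNIV. W s s' * ln (W s s')) - \<epsilon>))"
proof -
  let ?r = "CARD('a)"
  have r: "?r \<ge> 1" by (simp add: Suc_leI One_nat_def)
  have \<pi>: "\<pi> s > 0" for s unfolding \<pi>_def sum_spin using W_pos by (simp add: add_pos_pos)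
  have \<pi>1: "(\<Sum>s\<in>UNIV. \<pi> s) = 1" using W_sum by (simp add: \<pi>_def)
  let ?L = "(2 * real ?r - 1) * (\<Sum>s\<in>UNIV. \<pi> s * ln (\<pi> s)) - real ?r * (\<Sum>s\<in>UNIV. \<Sum>s'\<in>UNIV. W s s' * ln (W s s'))"
  \<comment> \<open>The exponent at finite \<open>n\<close>. The 4 counts the ordered pairs of
    spins, each of which costs one Stirling factor \<open>exp 1 * (n + 1)\<close>.\<close>
  define a where "a n = (2 * real ?r - 1) * (\<Sum>s\<in>UNIV. real (vtypes W n s) / real n * ln (\<pi> s))
    - real ?r * (4 * ((1 + ln (real n + 1)) / real n) + (\<Sum>s\<in>UNIV. \<Sum>s'\<in>UNIV. real (types W n s s') / real n * ln (real (types W n s s') / real n)))" for n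
  have poly: "(\<lambda>n. (1 + ln (real n + 1)) / real n) \<longlonglongrightarrow> 0" by real_asymp
  have Wn: "(\<lambda>n. real (types W n s s') / real n * ln (real (types W n s s') / real n)) \<longlonglongrightarrow> W s s' * ln (W s s')" for s s'
    by (intro tendsto_mult tendsto_ln types_limit) (use W_pos[of s s'] in simp)
  have "a \<longlonglongrightarrow> (2 * real ?r - 1) * (\<Sum>s\<in>UNIV. \<pi> s * ln (\<pi> s)) - real ?r * (4 * 0 + (\<Sum>s\<in>UNIV. \<Sum>s'\<in>UNIV. W s s' * ln (W s s')))"
    unfolding a_def[abs_def] by (intro tendsto_intros poly Wn) (simp add: vtypes_limit \<pi>_def)
  then have "a \<longlonglongrightarrow> ?L" by simp
  then have "\<forall>\<^sub>F n in sequentially. a n > ?L - \<epsilon>" by (rule order_tendstoD(1)) (use \<epsilon> in simp)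
  then show ?thesis using eventually_gt_at_top[of 0]
  proof eventually_elim
    case (elim n)
    let ?A = "tuple_avg n (\<lambda>p :: 'a perms. real (card {x \<in> confs n. typed n (\<lambda>_. types W n) p x}))"
    have n: "real n > 0" using elim by simp
    \<comment> \<open>For \<open>N = 0\<close> both sides are 1.\<close>
    have pw: "real N ^ N = exp (real N * ln (real N))" for N :: nat
      by (cases "N = 0") (simp_all add: exp_of_nat_mult)
    have E1: "(\<Prod>s\<in>UNIV. \<pi> s ^ vtypes W n s) = exp (\<Sum>s\<in>UNIV. real (vtypes W n s) * ln (\<pi> s))"
      using \<pi> by (simp add: exp_sum exp_of_nat_mult)
    have E2: "(exp 1 * (real n + 1)) ^ (CARD(spin) * CARD(spin)) = exp (4 * (1 + ln (real n + 1)))"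
    proof -
      have "CARD(spin) * CARD(spin) = 4" by (simp add: UNIV_spin)
      moreover have "exp (4 * (1 + ln (real n + 1))) = (exp 1 * (real n + 1)) ^ 4"
        using exp_of_nat_mult[of 4 "1 + ln (real n + 1)"] by (simp add: exp_add)
      ultimately show ?thesis by simp
    qed
    have E3: "(\<Prod>s\<in>UNIV. \<Prod>s'\<in>UNIV. real (types W n s s') ^ types W n s s') = exp (\<Sum>s\<in>UNIV. \<Sum>s'\<in>UNIV. real (types W n s s') * ln (real (types W n s s')))"
      by (simp only: pw exp_sum finite)
    have sumN: "(\<Sum>s\<in>UNIV. \<Sum>s'\<in>UNIV. real (types W n s s') / real n) = 1"
    proof -
      have "(\<Sum>s\<in>UNIV. \<Sum>s'\<in>UNIV. real (types W n s s')) = real n"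
        using arg_cong[OF types_sum[of n], of real] by (simp add: vtypes_def)
      then show ?thesis using n by (simp add: sum_divide_distrib[symmetric])
    qed
    \<comment> \<open>The term \<open>n * ln n\<close> split off here cancels against
      \<open>(n ^ n) ^ r\<close>.\<close>
    have nln: "(\<Sum>s\<in>UNIV. \<Sum>s'\<in>UNIV. real (types W n s s') * ln (real (types W n s s')))
      = real n * (\<Sum>s\<in>UNIV. \<Sum>s'\<in>UNIV. real (types W n s s') / real n * ln (real (types W n s s') / real n)) + real n * ln (real n)"
    proof -
      have one: "real N * ln (real N) = real n * (real N / real n * ln (real N / real n)) + real n * ln (real n) * (real N / real n)" for N :: nat
        using n by (cases "N = 0") (simp_all add: ln_div algebra_simps)
      have "(\<Sum>s\<in>UNIV. \<Sum>s'\<in>UNIV. real (types W n s s') * ln (real (types W n s s')))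
        = real n * (\<Sum>s\<in>UNIV. \<Sum>s'\<in>UNIV. real (types W n s s') / real n * ln (real (types W n s s') / real n))
          + real n * ln (real n) * (\<Sum>s\<in>UNIV. \<Sum>s'\<in>UNIV. real (types W n s s') / real n)"
        by (subst one) (simp only: sum.distrib sum_distrib_left)
      then show ?thesis unfolding sumN by simp
    qed
    let ?X = "\<Sum>s\<in>UNIV. real (vtypes W n s) * ln (\<pi> s)"
    let ?Y = "4 * (1 + ln (real n + 1)) + (\<Sum>s\<in>UNIV. \<Sum>s'\<in>UNIV. real (types W n s s') * ln (real (types W n s s')))"
    have e: "real (2 * ?r - 1) = 2 * real ?r - 1" using r by (simp add: of_nat_diff)
    have "(\<Prod>s\<in>UNIV. \<pi> s ^ vtypes W n s) ^ (2 * ?r - 1) * (real n ^ n) ^ ?r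
      \<le> ?A * ((exp 1 * (real n + 1)) ^ (CARD(spin) * CARD(spin)) * (\<Prod>s\<in>UNIV. \<Prod>s'\<in>UNIV. real (types W n s s') ^ types W n s s')) ^ ?r"
      by (rule tuple_avg_typed_ge[where \<pi> = \<pi>, OF _ vtypes_col types_sum less_imp_le[OF \<pi>] \<pi>1]) (simp add: vtypes_def)
    then have "exp (real (2 * ?r - 1) * ?X + real ?r * (real n * ln (real n))) \<le> ?A * exp (real ?r * ?Y)"
      unfolding E1 E2 E3 unfolding pw by (simp only: exp_of_nat_mult[symmetric] exp_add[symmetric])
    then have "exp (real (2 * ?r - 1) * ?X + real ?r * (real n * ln (real n)) - real ?r * ?Y) \<le> ?A"
      by (simp add: exp_diff divide_le_eq)
    moreover have "real (2 * ?r - 1) * ?X + real ?r * (real n * ln (real n)) - real ?r * ?Y = real n * a n"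
    proof -
      have "real n * (\<Sum>s\<in>UNIV. real (vtypes W n s) / real n * ln (\<pi> s)) = ?X"
        using n by (simp add: sum_distrib_left)
      moreover have "real n * (4 * ((1 + ln (real n + 1)) / real n)) = 4 * (1 + ln (real n + 1))" using n by simp
      ultimately have "real n * a n = (2 * real ?r - 1) * ?X - real ?r * (4 * (1 + ln (real n + 1)) +
          real n * (\<Sum>s\<in>UNIV. \<Sum>s'\<in>UNIV. real (types W n s s') / real n * ln (real (types W n s s') / real n)))"
        unfolding a_def by (simp only: right_diff_distrib distrib_left mult.left_commute[of "real n"])
      then show ?thesis unfolding e nln by (simp add: algebra_simps)
    qed
    ultimately have "exp (real n * a n) \<le> ?A" by simp
    moreover have "exp (real n * (?L - \<epsilon>)) \<le> exp (real n * a n)" using elim n by (simp add: mult_left_mono)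
    ultimately show ?case by (rule order_trans[rotated])
  qed
qed

end

section \<open>Labellings with the edge law of an Ising chain\<close>

lemma edge_law_ising: "edge_law (ising_edge J t)"
proof
  show "(\<Sum>s\<in>UNIV. \<Sum>s'\<in>UNIV. ising_edge J t s s') = 1"
    using ising_marginal_sum[of J t] unfolding ising_marginal_edge by (simp add: sum_spin)
qed (auto simp: ising_edge_sym)

abbreviation typed_count :: "nat \<Rightarrow> (spin \<Rightarrow> spin \<Rightarrow> nat) \<Rightarrow> 'a perms \<Rightarrow> real" where
  "typed_count n N p \<equiv> real (card {x \<in> confs n. typed n (\<lambda>_. N) p x})"

abbreviation edge_close :: "real \<Rightarrow> real \<Rightarrow> real \<Rightarrow> nat \<Rightarrow> 'a perms \<Rightarrow> (nat \<Rightarrow> spin) \<Rightarrow> bool" where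
  "edge_close J t \<delta> n p x \<equiv> \<forall>i s s'. \<bar>real (ecount n x (x \<circ> p i) s s') / real n - ising_edge J t s s'\<bar> < \<delta>"

definition pair_conf :: "nat \<Rightarrow> (nat \<Rightarrow> spin) \<Rightarrow> (nat \<Rightarrow> spin) \<Rightarrow> nat \<Rightarrow> spin \<times> spin" where
  "pair_conf n x y = restrict (\<lambda>v. (x v, y v)) {1..n}"

definition pair_typed :: "nat \<Rightarrow> (spin \<Rightarrow> spin \<Rightarrow> nat) \<Rightarrow> 'a perms \<Rightarrow> (nat \<Rightarrow> spin \<times> spin) \<Rightarrow> bool" where
  "pair_typed n N p z \<longleftrightarrow> typed n (\<lambda>_. N) p (fst \<circ> z) \<and> typed n (\<lambda>_. N) p (snd \<circ> z)"

lemma typed_cong: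
  assumes p: "p \<in> perm_tuples n" and eq: "\<And>v. v \<in> {1..n} \<Longrightarrow> z v = z' v"
  shows "typed n N p z \<longleftrightarrow> typed n N p z'"
proof -
  have "p i v \<in> {1..n}" if "v \<in> {1..n}" for i v
    using p that permutes_in_image[of "p i" "{1..n}" v] by (simp add: perm_tuples_def)
  then have "ecount n z (z \<circ> p i) = ecount n z' (z' \<circ> p i)" for i
    using eq by (auto simp: ecount_def fun_eq_iff intro!: arg_cong[where f = card])
  then show ?thesis by (simp add: typed_def)
qed

text \<open>A pair of labellings becomes one labelling by pairs, so the second moment is a first
  moment over the alphabet \<open>spin \<times> spin\<close>.\<close>

lemma card_typed_square:
  assumes p: "p \<in> (perm_tuples n :: 'a perms set)"
  shows "real (card {x \<in> confs n. typed n (\<lambda>_. N) p x}) ^ 2 \<le> real (card {z \<in> confs n. pair_typed n N p z})"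
proof -
  let ?X = "{x \<in> confs n. typed n (\<lambda>_. N) p x}"
  have "inj_on (\<lambda>(x, y). pair_conf n x y) (?X \<times> ?X)"
  proof (rule inj_onI, clarify)
    fix x y x' y' assume c: "x \<in> confs n" "y \<in> confs n" "x' \<in> confs n" "y' \<in> confs n" and eq: "pair_conf n x y = pair_conf n x' y'"
    have "(x v, y v) = (x' v, y' v)" if "v \<in> {1..n}" for v
      using fun_cong[OF eq, of v] that by (simp add: pair_conf_def)
    then show "x = x' \<and> y = y'"
      using c by (auto simp: confs_def intro!: PiE_ext[of _ "{1..n}" "\<lambda>_. UNIV"])
  qed
  moreover have "(\<lambda>(x, y). pair_conf n x y) ` (?X \<times> ?X) \<subseteq> {z \<in> confs n. pair_typed n N p z}"
  proof (clarify, intro CollectI conjI)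
    fix x y assume xy: "x \<in> confs n" "typed n (\<lambda>_. N) p x" "y \<in> confs n" "typed n (\<lambda>_. N) p y"
    show "pair_conf n x y \<in> confs n" by (simp add: pair_conf_def confs_def)
    have "typed n (\<lambda>_. N) p (fst \<circ> pair_conf n x y) \<longleftrightarrow> typed n (\<lambda>_. N) p x"
      "typed n (\<lambda>_. N) p (snd \<circ> pair_conf n x y) \<longleftrightarrow> typed n (\<lambda>_. N) p y"
      by (rule typed_cong[OF p]; simp add: pair_conf_def)+
    then show "pair_typed n N p (pair_conf n x y)" using xy by (simp add: pair_typed_def)
  qed
  ultimately have "card (?X \<times> ?X) \<le> card {z \<in> confs n. pair_typed n N p z}"
    by (intro card_inj_on_le) auto
  then have "real (card ?X * card ?X) \<le> real (card {z \<in> confs n. pair_typed n N p z})"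
    by (simp only: card_cartesian_product of_nat_le_iff)
  then show ?thesis by (simp add: power2_eq_square)
qed

lemma prod_power_ecount:
  fixes q :: "'c::finite \<Rightarrow> 'c \<Rightarrow> real"
  shows "(\<Prod>a\<in>UNIV. \<Prod>b\<in>UNIV. q a b ^ ecount n z y a b) = (\<Prod>v\<in>{1..n}. q (z v) (y v))"
proof -
  have "(\<Prod>v\<in>{1..n}. q (z v) (y v)) = (\<Prod>ab\<in>UNIV. (\<lambda>(a, b). q a b) ab ^ vcount n (\<lambda>v. (z v, y v)) ab)"
    using prod_power_vcount[where q = "\<lambda>(a, b). q a b" and z = "\<lambda>v. (z v, y v)" and n = n] by simp
  also have "\<dots> = (\<Prod>a\<in>UNIV. \<Prod>b\<in>UNIV. q a b ^ ecount n z y a b)"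
    by (simp add: prod.cartesian_product UNIV_Times_UNIV[symmetric] case_prod_unfold vcount_def ecount_def prod_eq_iff del: UNIV_Times_UNIV)
  finally show ?thesis by simp
qed

definition ising_corr_count :: "(spin \<Rightarrow> spin \<Rightarrow> nat) \<Rightarrow> real" where
  "ising_corr_count N = (\<Sum>s\<in>UNIV. \<Sum>s'\<in>UNIV. val s * val s' * real (N s s'))"

lemma prod_exp_corr: "(\<Prod>s\<in>UNIV. \<Prod>s'\<in>UNIV. exp (J * val s * val s') ^ N s s') = exp (J * ising_corr_count N)"
  by (simp add: ising_corr_count_def sum_spin prod_spin exp_of_nat_mult[symmetric] exp_add[symmetric] algebra_simps)

lemma ising_corr_count_limit: "(\<lambda>n. ising_corr_count (types (ising_edge J t) n) / real n) \<longlonglongrightarrow> ising_corr J t"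
proof -
  interpret edge_law "ising_edge J t" by (rule edge_law_ising)
  have "(\<lambda>n. \<Sum>s\<in>UNIV. \<Sum>s'\<in>UNIV. val s * val s' * (real (types (ising_edge J t) n s s') / real n)) \<longlonglongrightarrow> ising_corr J t"
    unfolding ising_corr_def by (intro tendsto_intros types_limit)
  then show ?thesis by (simp add: ising_corr_count_def sum_divide_distrib)
qed

text \<open>Both components have an exact type, so the interaction weight is the same for all pairs,
  whatever their joint type.\<close>

lemma pair_typed_corr:
  fixes p :: "'a::finite perms"
  assumes "pair_typed n N p z"
  shows "(\<Prod>i\<in>UNIV. \<Prod>a\<in>UNIV. \<Prod>b\<in>UNIV. exp (J * (val (fst a) * val (fst b) + val (snd a) * val (snd b))) ^ ecount n z (z \<circ> p i) a b)
    = exp (J * ising_corr_count N) ^ (2 * CARD('a))"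
proof -
  have "(\<Prod>a\<in>UNIV. \<Prod>b\<in>UNIV. exp (J * (val (fst a) * val (fst b) + val (snd a) * val (snd b))) ^ ecount n z (z \<circ> p i) a b) = exp (J * ising_corr_count N) ^ 2" for i
  proof -
    have N: "ecount n (fst \<circ> z) ((fst \<circ> z) \<circ> p i) = N" "ecount n (snd \<circ> z) ((snd \<circ> z) \<circ> p i) = N"
      using assms by (simp_all add: pair_typed_def typed_def)
    have "(\<Prod>a\<in>UNIV. \<Prod>b\<in>UNIV. exp (J * (val (fst a) * val (fst b) + val (snd a) * val (snd b))) ^ ecount n z (z \<circ> p i) a b)
      = (\<Prod>v\<in>{1..n}. exp (J * val ((fst \<circ> z) v) * val (((fst \<circ> z) \<circ> p i) v)) * exp (J * val ((snd \<circ> z) v) * val (((snd \<circ> z) \<circ> p i) v)))"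
      unfolding prod_power_ecount by (simp add: exp_add[symmetric] algebra_simps)
    also have "\<dots> = exp (J * ising_corr_count N) * exp (J * ising_corr_count N)"
      unfolding prod.distrib prod_power_ecount[of "\<lambda>s s'. exp (J * val s * val s')", symmetric] N prod_exp_corr ..
    finally show ?thesis by (simp add: power2_eq_square)
  qed
  then show ?thesis by (simp add: power_mult)
qed

lemma ecount_marginals:
  assumes "p \<in> perm_tuples n"
  shows "(\<Sum>b\<in>UNIV. ecount n z (z \<circ> p i) a b) = vcount n (z :: nat \<Rightarrow> 'c::finite) a" "(\<Sum>a\<in>UNIV. ecount n z (z \<circ> p i) a b) = vcount n z b"
proof -
  have "p i permutes {1..n}" using assms by (simp add: perm_tuples_def)
  then show "(\<Sum>a\<in>UNIV. ecount n z (z \<circ> p i) a b) = vcount n z b"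
    by (simp add: sum_ecount_left vcount_permute)
qed (rule sum_ecount_right)

lemma tuple_avg_nonneg: "(\<And>p. p \<in> perm_tuples n \<Longrightarrow> f p \<ge> 0) \<Longrightarrow> tuple_avg n f \<ge> 0"
  unfolding tuple_avg_def by (intro divide_nonneg_nonneg sum_nonneg) auto

text \<open>Reduces the second moment to a weighted count for one joint type at a time. The common
  interaction weight is divided out, and the number of joint types is absorbed into
  \<open>exp (\<epsilon> / 2 * n)\<close>.\<close>

lemma second_moment_of_bound:
  fixes J t H C \<epsilon> :: real
  assumes J: "J > 0" and C: "C \<ge> 0" and \<epsilon>: "\<epsilon> > 0"
    and bound: "\<And>n (p :: 'a::finite \<Rightarrow> nat \<Rightarrow> nat) z. n > 0 \<Longrightarrow> p \<in> perm_tuples n \<Longrightarrow> z \<in> confs n \<Longrightarrow> pair_typed n (types (ising_edge J t) n) p z \<Longrightarrow>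
      tuple_avg n (\<lambda>p'. real (card {z' \<in> confs n. typed n (\<lambda>i. ecount n z (z \<circ> p i)) p' z'})) * exp (J * ising_corr_count (types (ising_edge J t) n)) ^ (2 * CARD('a))
        \<le> C * (real n + 1) ^ m * exp (real n * H)"
  shows "\<forall>\<^sub>F n in sequentially. tuple_avg n (\<lambda>p :: 'a perms. typed_count n (types (ising_edge J t) n) p ^ 2)
     \<le> exp (real n * (H - 2 * real CARD('a) * J * ising_corr J t + \<epsilon>))"
proof -
  let ?r = "real CARD('a)"
  let ?N = "\<lambda>n. types (ising_edge J t) n"
  have r: "?r > 0" by simp
  \<comment> \<open>An error \<open>\<epsilon>'\<close> in the correlation changes the exponent by
    \<open>2 * r * J * \<epsilon>' = \<epsilon> / 2\<close>.\<close>
  define \<epsilon>' where "\<epsilon>' = \<epsilon> / (4 * ?r * J)"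
  have \<epsilon>': "\<epsilon>' > 0" using \<epsilon> J r by (simp add: \<epsilon>'_def)
  have c: "\<forall>\<^sub>F n in sequentially. ising_corr_count (?N n) / real n > ising_corr J t - \<epsilon>'"
    by (rule order_tendstoD(1)[OF ising_corr_count_limit]) (use \<epsilon>' in simp)
  have p: "\<forall>\<^sub>F n in sequentially. C * (real n + 1) ^ (m + 16 * CARD('a)) \<le> exp (\<epsilon> / 2 * real n)"
    by (rule poly_le_exp) (use \<epsilon> in simp)
  show ?thesis using c p eventually_gt_at_top[of 0]
  proof eventually_elim
    case (elim n)
    let ?E = "exp (J * ising_corr_count (?N n)) ^ (2 * CARD('a))"
    have E: "?E = exp (2 * ?r * J * ising_corr_count (?N n))" by (simp add: exp_of_nat_mult[symmetric] mult_ac)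
    have "tuple_avg n (\<lambda>p :: 'a perms. real (card {x \<in> confs n. typed n (\<lambda>_. ?N n) p x}) ^ 2)
       \<le> tuple_avg n (\<lambda>p :: 'a perms. real (card {z \<in> confs n. pair_typed n (?N n) p z}))"
      by (intro tuple_avg_mono card_typed_square)
    also have "\<dots> \<le> real (n + 1) ^ (CARD(spin \<times> spin) * CARD(spin \<times> spin) * CARD('a)) * (C * (real n + 1) ^ m * exp (real n * H) / ?E)"
    proof (rule tuple_avg_count_le)
      show "C * (real n + 1) ^ m * exp (real n * H) / ?E \<ge> 0" using C by simp
    qed (use bound elim in \<open>simp add: pos_le_divide_eq\<close>)
    also have "CARD(spin \<times> spin) * CARD(spin \<times> spin) * CARD('a) = 16 * CARD('a)" by (simp add: UNIV_spin)
    also have "real (n + 1) ^ (16 * CARD('a)) * (C * (real n + 1) ^ m * exp (real n * H) / ?E)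
        = (C * (real n + 1) ^ (m + 16 * CARD('a))) * (exp (real n * H) / ?E)"
      by (simp add: power_add)
    also have "\<dots> \<le> exp (\<epsilon> / 2 * real n) * (exp (real n * H) / ?E)"
      using elim(2) by (intro mult_right_mono) auto
    also have "\<dots> = exp (\<epsilon> / 2 * real n + real n * H - 2 * ?r * J * ising_corr_count (?N n))"
      unfolding E by (simp add: exp_add exp_diff)
    also have "\<dots> \<le> exp (real n * (H - 2 * ?r * J * ising_corr J t + \<epsilon>))"
    proof -
      have "real n * (ising_corr J t - \<epsilon>') \<le> ising_corr_count (?N n)"
        using elim(1,3) by (simp add: less_divide_eq mult.commute)
      then have "2 * ?r * J * (real n * (ising_corr J t - \<epsilon>')) \<le> 2 * ?r * J * ising_corr_count (?N n)"
        using J r by (intro mult_left_mono) auto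
      moreover have "2 * ?r * J * (real n * (ising_corr J t - \<epsilon>')) = 2 * ?r * J * real n * ising_corr J t - \<epsilon> / 2 * real n"
        using J r by (simp add: \<epsilon>'_def field_simps)
      moreover have "real n * (H - 2 * ?r * J * ising_corr J t + \<epsilon>) = real n * H - 2 * ?r * J * real n * ising_corr J t + \<epsilon> * real n"
        by (simp add: algebra_simps)
      ultimately have "\<epsilon> / 2 * real n + real n * H - 2 * ?r * J * ising_corr_count (?N n) \<le> real n * (H - 2 * ?r * J * ising_corr J t + \<epsilon>)"
        by linarith
      then show ?thesis unfolding exp_le_cancel_iff .
    qed
    finally show ?case .
  qed
qed

lemma poly_shape: "((exp 1 * (real n + 1)) ^ a) ^ b = exp (real (a * b)) * (real n + 1) ^ (a * b)"
  by (simp add: power_mult[symmetric] power_mult_distrib exp_of_nat_mult[symmetric])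

text \<open>The quadratic form of pairs has the constant \<open>M\<^sup>2\<close>, so the exponent
  is twice that of a single labelling and no correlation of the pair can win.\<close>

lemma second_moment_form:
  fixes J t M \<epsilon> :: real
  defines "k \<equiv> 2 * real CARD('a::finite) - 1"
  assumes J: "J > 0" and M: "M > 0" and bethe_le: "\<And>u. bethe k J u \<le> (k + 1) / 2 * ln M" and \<epsilon>: "\<epsilon> > 0"
  shows "\<forall>\<^sub>F n in sequentially. tuple_avg n (\<lambda>p :: 'a perms. typed_count n (types (ising_edge J t) n) p ^ 2)
     \<le> exp (real n * (2 * real CARD('a) * ln M - 2 * real CARD('a) * J * ising_corr J t + \<epsilon>))"
proof -
  let ?r = "CARD('a)" and ?B = "\<lambda>a b :: spin \<times> spin. exp (J * (val (fst a) * val (fst b) + val (snd a) * val (snd b)))"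
  have k1: "k \<ge> 1" by (simp add: k_def Suc_leI One_nat_def)
  show ?thesis
  proof (rule second_moment_of_bound[OF J _ \<epsilon>, where C = "exp (real (4 * (2 * ?r - 1))) * exp 4 ^ (2 * ?r - 1)" and m = "4 * (2 * ?r - 1)"])
    fix n and p :: "'a perms" and z
    assume n: "n > 0" and p: "p \<in> perm_tuples n" and z: "z \<in> confs n" "pair_typed n (types (ising_edge J t) n) p z"
    let ?N = "\<lambda>i. ecount n z (z \<circ> p i)"
    have c4: "CARD(spin \<times> spin) = 4" by (simp add: UNIV_spin)
    have "tuple_avg n (\<lambda>p'. real (card {z' \<in> confs n. typed n ?N p' z'})) * (\<Prod>i\<in>UNIV. \<Prod>a\<in>UNIV. \<Prod>b\<in>UNIV. ?B a b ^ ?N i a b)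
      \<le> ((exp 1 * (real n + 1)) ^ CARD(spin \<times> spin)) ^ (2 * CARD('a) - 1) * exp (real CARD(spin \<times> spin)) ^ (2 * CARD('a) - 1) * (M\<^sup>2) ^ (n * CARD('a))"
    proof (rule tuple_avg_typed_form_le[where c = "vcount n z"])
      show "(\<Sum>a\<in>UNIV. \<Sum>b\<in>UNIV. R a * ?B a b * R b) \<le> M\<^sup>2 * (\<Sum>a\<in>UNIV. R a powr ((2 * real CARD('a) - 1 + 1) / (2 * real CARD('a) - 1))) powr (2 * (2 * real CARD('a) - 1) / (2 * real CARD('a) - 1 + 1))"
        if "\<And>a. R a > 0" for R
        using pair_form_le[OF k1 J M bethe_le that] unfolding k_def .
    qed (use n ecount_marginals[OF p] in \<open>auto simp: sum_vcount\<close>)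
    also have "(\<Prod>i\<in>UNIV. \<Prod>a\<in>UNIV. \<Prod>b\<in>UNIV. ?B a b ^ ?N i a b) = exp (J * ising_corr_count (types (ising_edge J t) n)) ^ (2 * ?r)"
      by (rule pair_typed_corr[OF z(2)])
    also have "(M\<^sup>2) ^ (n * ?r) = exp (real n * (2 * real ?r * ln M))"
    proof -
      have "(M\<^sup>2) ^ (n * ?r) = exp (ln M) ^ (2 * (n * ?r))" using M by (simp add: power_mult)
      then show ?thesis by (simp add: exp_of_nat_mult[symmetric] mult_ac)
    qed
    finally show "tuple_avg n (\<lambda>p'. real (card {z' \<in> confs n. typed n ?N p' z'})) * exp (J * ising_corr_count (types (ising_edge J t) n)) ^ (2 * ?r)
      \<le> exp (real (4 * (2 * ?r - 1))) * exp 4 ^ (2 * ?r - 1) * (real n + 1) ^ (4 * (2 * ?r - 1)) * exp (real n * (2 * real ?r * ln M))"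
      unfolding c4 poly_shape of_nat_numeral by (simp only: mult_ac)
  qed simp
qed

text \<open>The interaction weight now varies with the labelling. Four edge frequencies, each within
  \<open>\<delta>\<close>, move the correlation by at most \<open>4 * \<delta>\<close>, which bounds
  the weight from below.\<close>

lemma upper_bound_of_bound:
  fixes J t H C \<epsilon> \<delta> :: real
  assumes J: "J > 0" and C: "C \<ge> 0" and \<epsilon>: "\<epsilon> > 0" and \<delta>: "\<delta> > 0"
    and bound: "\<And>n (p :: 'a::finite \<Rightarrow> nat \<Rightarrow> nat) x. n > 0 \<Longrightarrow> p \<in> perm_tuples n \<Longrightarrow> x \<in> confs n \<Longrightarrow>
      (\<And>i s s'. \<bar>real (ecount n x (x \<circ> p i) s s') / real n - ising_edge J t s s'\<bar> < \<delta>) \<Longrightarrow>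
      tuple_avg n (\<lambda>p'. real (card {x' \<in> confs n. typed n (\<lambda>i. ecount n x (x \<circ> p i)) p' x'}))
          * (\<Prod>i\<in>UNIV. \<Prod>s\<in>UNIV. \<Prod>s'\<in>UNIV. exp (J * val s * val s') ^ ecount n x (x \<circ> p i) s s')
        \<le> C * (real n + 1) ^ m * exp (real n * H)"
  shows "\<forall>\<^sub>F n in sequentially. tuple_avg n (\<lambda>p :: 'a perms. real (card {x \<in> confs n. edge_close J t \<delta> n p x}))
     \<le> exp (real n * (H - real CARD('a) * J * (ising_corr J t - 4 * \<delta>) + \<epsilon>))"
proof -
  let ?r = "real CARD('a)"
  have p: "\<forall>\<^sub>F n in sequentially. C * (real n + 1) ^ (m + 4 * CARD('a)) \<le> exp (\<epsilon> * real n)"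
    by (rule poly_le_exp[OF \<epsilon>])
  show ?thesis using p eventually_gt_at_top[of 0]
  proof eventually_elim
    case (elim n)
    let ?E = "exp (real n * (?r * J * (ising_corr J t - 4 * \<delta>)))"
    have "tuple_avg n (\<lambda>p :: 'a perms. real (card {x \<in> confs n. edge_close J t \<delta> n p x}))
      \<le> real (n + 1) ^ (CARD(spin) * CARD(spin) * CARD('a)) * (C * (real n + 1) ^ m * exp (real n * H) / ?E)"
    proof (rule tuple_avg_count_le)
      show "C * (real n + 1) ^ m * exp (real n * H) / ?E \<ge> 0" using C by simp
      fix p :: "'a perms" and x
      assume px: "p \<in> perm_tuples n" "x \<in> confs n" and near: "edge_close J t \<delta> n p x"
      let ?A = "tuple_avg n (\<lambda>p'. real (card {x' \<in> confs n. typed n (\<lambda>i. ecount n x (x \<circ> p i)) p' x'}))"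
      have E1: "exp (real n * (J * (ising_corr J t - 4 * \<delta>))) \<le> (\<Prod>s\<in>UNIV. \<Prod>s'\<in>UNIV. exp (J * val s * val s') ^ ecount n x (x \<circ> p i) s s')" for i
      proof -
        let ?N = "\<lambda>s s'. real (ecount n x (x \<circ> p i) s s')"
        have nn: "real n * ising_edge J t s s' - real n * \<delta> \<le> ?N s s'" "?N s s' \<le> real n * ising_edge J t s s' + real n * \<delta>" for s s'
        proof -
          have "\<bar>?N s s' / real n - ising_edge J t s s'\<bar> < \<delta>" using near by blast
          then have "\<bar>?N s s' / real n - ising_edge J t s s'\<bar> * real n \<le> \<delta> * real n" by (intro mult_right_mono) auto
          moreover have "(?N s s' / real n - ising_edge J t s s') * real n = ?N s s' - real n * ising_edge J t s s'"
            using elim(2) by (simp add: left_diff_distrib)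
          ultimately have "\<bar>?N s s' - real n * ising_edge J t s s'\<bar> \<le> \<delta> * real n" by (metis abs_mult abs_of_nat)
          then show "real n * ising_edge J t s s' - real n * \<delta> \<le> ?N s s'" "?N s s' \<le> real n * ising_edge J t s s' + real n * \<delta>"
            by (simp_all add: abs_le_iff algebra_simps)
        qed
        have "real n * (ising_corr J t - 4 * \<delta>) \<le> ising_corr_count (ecount n x (x \<circ> p i))"
          using nn[of Plus Plus] nn[of Plus Minus] nn[of Minus Plus] nn[of Minus Minus]
          by (simp add: ising_corr_def ising_corr_count_def sum_spin algebra_simps)
        then show ?thesis unfolding prod_exp_corr using J by (simp add: mult.left_commute)
      qed
      have "?E = (\<Prod>i\<in>(UNIV :: 'a set). exp (real n * (J * (ising_corr J t - 4 * \<delta>))))"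
        by (simp add: exp_of_nat_mult[symmetric] mult_ac)
      also have "\<dots> \<le> (\<Prod>i\<in>UNIV. \<Prod>s\<in>UNIV. \<Prod>s'\<in>UNIV. exp (J * val s * val s') ^ ecount n x (x \<circ> p i) s s')"
        using E1 by (intro prod_mono) auto
      finally have "?A * ?E \<le> ?A * (\<Prod>i\<in>UNIV. \<Prod>s\<in>UNIV. \<Prod>s'\<in>UNIV. exp (J * val s * val s') ^ ecount n x (x \<circ> p i) s s')"
        by (intro mult_left_mono tuple_avg_nonneg) auto
      also have "\<dots> \<le> C * (real n + 1) ^ m * exp (real n * H)"
        using near by (intro bound elim(2) px) auto
      finally show "?A \<le> C * (real n + 1) ^ m * exp (real n * H) / ?E" by (simp add: pos_le_divide_eq)
    qed
    also have "CARD(spin) * CARD(spin) * CARD('a) = 4 * CARD('a)" by (simp add: UNIV_spin)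
    also have "real (n + 1) ^ (4 * CARD('a)) * (C * (real n + 1) ^ m * exp (real n * H) / ?E)
        = (C * (real n + 1) ^ (m + 4 * CARD('a))) * (exp (real n * H) / ?E)"
      by (simp add: power_add)
    also have "\<dots> \<le> exp (\<epsilon> * real n) * (exp (real n * H) / ?E)"
      using elim(1) by (intro mult_right_mono) auto
    also have "\<dots> = exp (real n * (H - ?r * J * (ising_corr J t - 4 * \<delta>) + \<epsilon>))"
      by (simp add: exp_add[symmetric] exp_diff[symmetric] algebra_simps)
    finally show ?case .
  qed
qed

lemma upper_bound_form:
  fixes J t M \<epsilon> \<delta> :: real
  defines "k \<equiv> 2 * real CARD('a::finite) - 1"
  assumes J: "J > 0" and M: "M > 0" and bethe_le: "\<And>u. bethe k J u \<le> (k + 1) / 2 * ln M" and \<epsilon>: "\<epsilon> > 0" and \<delta>: "\<delta> > 0"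
  shows "\<forall>\<^sub>F n in sequentially. tuple_avg n (\<lambda>p :: 'a perms. real (card {x \<in> confs n. edge_close J t \<delta> n p x}))
     \<le> exp (real n * (real CARD('a) * ln M - real CARD('a) * J * (ising_corr J t - 4 * \<delta>) + \<epsilon>))"
proof -
  let ?r = "CARD('a)" and ?B = "\<lambda>s s'. exp (J * val s * val s')"
  have k1: "k \<ge> 1" by (simp add: k_def Suc_leI One_nat_def)
  show ?thesis
  proof (rule upper_bound_of_bound[OF J _ \<epsilon> \<delta>, where C = "exp (real (2 * (2 * ?r - 1))) * exp 2 ^ (2 * ?r - 1)" and m = "2 * (2 * ?r - 1)"])
    fix n and p :: "'a perms" and x :: "nat \<Rightarrow> spin"
    assume n: "n > 0" and p: "p \<in> perm_tuples n" and x: "x \<in> confs n"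
    let ?N = "\<lambda>i. ecount n x (x \<circ> p i)"
    have c2: "CARD(spin) = 2" by (simp add: UNIV_spin)
    have "tuple_avg n (\<lambda>p'. real (card {x' \<in> confs n. typed n ?N p' x'})) * (\<Prod>i\<in>UNIV. \<Prod>a\<in>UNIV. \<Prod>b\<in>UNIV. ?B a b ^ ?N i a b)
      \<le> ((exp 1 * (real n + 1)) ^ CARD(spin)) ^ (2 * CARD('a) - 1) * exp (real CARD(spin)) ^ (2 * CARD('a) - 1) * M ^ (n * CARD('a))"
    proof (rule tuple_avg_typed_form_le[where c = "vcount n x"])
      show "(\<Sum>a\<in>UNIV. \<Sum>b\<in>UNIV. R a * ?B a b * R b) \<le> M * (\<Sum>a\<in>UNIV. R a powr ((2 * real CARD('a) - 1 + 1) / (2 * real CARD('a) - 1))) powr (2 * (2 * real CARD('a) - 1) / (2 * real CARD('a) - 1 + 1))"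
        if "\<And>a. R a > 0" for R
        using edge_form_le[OF k1 J M bethe_le that] unfolding k_def .
    qed (use n ecount_marginals[OF p] in \<open>auto simp: sum_vcount\<close>)
    also have "M ^ (n * ?r) = exp (real n * (real ?r * ln M))"
    proof -
      have "M ^ (n * ?r) = exp (ln M) ^ (n * ?r)" using M by simp
      then show ?thesis by (simp add: exp_of_nat_mult[symmetric] mult_ac)
    qed
    finally show "tuple_avg n (\<lambda>p'. real (card {x' \<in> confs n. typed n ?N p' x'})) * (\<Prod>i\<in>UNIV. \<Prod>a\<in>UNIV. \<Prod>b\<in>UNIV. ?B a b ^ ?N i a b)
      \<le> exp (real (2 * (2 * ?r - 1))) * exp 2 ^ (2 * ?r - 1) * (real n + 1) ^ (2 * (2 * ?r - 1)) * exp (real n * (real ?r * ln M))"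
      unfolding c2 poly_shape of_nat_numeral by (simp only: mult_ac)
  qed simp
qed

section \<open>The second moment at the free boundary state\<close>

text \<open>Each generator uses every vertex once as a source and once as a target, hence the power
  \<open>2 r\<close> of the vertex weights.\<close>

lemma prod_form:
  fixes N :: "'a::finite \<Rightarrow> 'c::finite \<Rightarrow> 'c \<Rightarrow> nat" and R :: "'c \<Rightarrow> real"
  assumes row: "\<And>i a. (\<Sum>b\<in>UNIV. N i a b) = c a" and col: "\<And>i b. (\<Sum>a\<in>UNIV. N i a b) = c b"
  shows "(\<Prod>i\<in>UNIV. \<Prod>a\<in>UNIV. \<Prod>b\<in>UNIV. (R a * B a b * R b) ^ N i a b)
    = (\<Prod>a\<in>UNIV. R a ^ c a) ^ (2 * CARD('a)) * (\<Prod>i\<in>UNIV. \<Prod>a\<in>UNIV. \<Prod>b\<in>UNIV. B a b ^ N i a b)"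
proof -
  have "(\<Prod>a\<in>UNIV. \<Prod>b\<in>UNIV. (R a * B a b * R b) ^ N i a b) = (\<Prod>a\<in>UNIV. R a ^ c a) ^ 2 * (\<Prod>a\<in>UNIV. \<Prod>b\<in>UNIV. B a b ^ N i a b)" for i
  proof -
    have "(\<Prod>a\<in>UNIV. \<Prod>b\<in>UNIV. R a ^ N i a b) = (\<Prod>a\<in>UNIV. R a ^ c a)"
      by (simp add: power_sum[symmetric] row)
    moreover have "(\<Prod>a\<in>UNIV. \<Prod>b\<in>UNIV. R b ^ N i a b) = (\<Prod>b\<in>UNIV. R b ^ c b)"
      by (subst prod.swap) (simp add: power_sum[symmetric] col)
    ultimately show ?thesis by (simp add: power_mult_distrib prod.distrib power2_eq_square mult_ac)
  qed
  then show ?thesis by (simp add: prod.distrib power_mult)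
qed

text \<open>The partition function of the Ising model on a 4-cycle whose couplings alternate between
  \<open>J\<close> along the edges of the two copies and \<open>L\<close> between the
  copies.\<close>

lemma cycle_partition:
  "(\<Sum>a\<in>UNIV. \<Sum>b\<in>UNIV. exp (L * (val (fst a) * val (snd a))) * exp (J * (val (fst a) * val (fst b) + val (snd a) * val (snd b))) * exp (L * (val (fst b) * val (snd b))))
    = 16 * (cosh J)\<^sup>2 * ((cosh L)\<^sup>2 + (tanh J)\<^sup>2 * (sinh L)\<^sup>2)"
proof -
  define a where "a = exp J"
  define b where "b = exp L"
  have ab: "a > 0" "b > 0" by (simp_all add: a_def b_def)
  have e: "exp (- J) = 1 / a" "exp (- L) = 1 / b" by (simp_all add: a_def b_def exp_minus field_simps)
  have j: "exp (J + J) = a * a" "exp (- J - J) = 1 / (a * a)"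
    using exp_add[of J J] exp_add[of "- J" "- J"] e by (simp_all add: a_def)
  have e2: "exp (2 * J) = a * a" "exp (- (2 * J)) = 1 / (a * a)" "exp (J * 2) = a * a" "exp (- (J * 2)) = 1 / (a * a)"
  proof -
    have "2 * J = J + J" "- (2 * J) = - J - J" "J * 2 = J + J" "- (J * 2) = - J - J" by simp_all
    then show "exp (2 * J) = a * a" "exp (- (2 * J)) = 1 / (a * a)" "exp (J * 2) = a * a" "exp (- (J * 2)) = 1 / (a * a)" using j by (simp_all only:)
  qed
  have "16 * (cosh J)\<^sup>2 * ((cosh L)\<^sup>2 + (tanh J)\<^sup>2 * (sinh L)\<^sup>2) = 16 * ((cosh J)\<^sup>2 * (cosh L)\<^sup>2 + (sinh J)\<^sup>2 * (sinh L)\<^sup>2)"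
    using cosh_real_pos[of J] by (simp add: tanh_def power_divide field_simps)
  also have "\<dots> = (a + 1 / a)\<^sup>2 * (b + 1 / b)\<^sup>2 + (a - 1 / a)\<^sup>2 * (b - 1 / b)\<^sup>2"
    unfolding cosh_field_def sinh_field_def e a_def[symmetric] b_def[symmetric] by (simp add: power2_eq_square field_simps)
  also have "\<dots> = 2 * (a * a) * (b * b) + 2 * (a * a) / (b * b) + 2 * (b * b) / (a * a) + 2 / (a * a * (b * b)) + 8"
    using ab by (simp add: power2_eq_square field_simps)
  finally have rhs: "16 * (cosh J)\<^sup>2 * ((cosh L)\<^sup>2 + (tanh J)\<^sup>2 * (sinh L)\<^sup>2)
    = 2 * (a * a) * (b * b) + 2 * (a * a) / (b * b) + 2 * (b * b) / (a * a) + 2 / (a * a * (b * b)) + 8" .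
  show ?thesis unfolding rhs
    using ab by (simp add: sum_pair_spin sum_spin e e2 j a_def[symmetric] b_def[symmetric])
qed

text \<open>
  For balanced pairs the vertex entropy depends only on the overlap. The tilt \<open>L\<close> is chosen so that the
  edge and the vertex factors become conjugate to the same overlap.
\<close>

lemma free_pair_bound:
  fixes N :: "'a::finite \<Rightarrow> spin \<times> spin \<Rightarrow> spin \<times> spin \<Rightarrow> nat" and J :: real
  defines "k \<equiv> 2 * real CARD('a) - 1"
  assumes J: "k * (tanh J)\<^sup>2 \<le> 1" "J > 0"
    and row: "\<And>i a. (\<Sum>b\<in>UNIV. N i a b) = c a" and col: "\<And>i b. (\<Sum>a\<in>UNIV. N i a b) = c b"
    and cn: "(\<Sum>a\<in>UNIV. c a) = n" and n: "n > 0"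
    and bal: "c (Plus, Minus) = c (Minus, Plus)" "\<bar>real (c (Plus, Plus)) - real (c (Minus, Minus))\<bar> \<le> 4"
  shows "tuple_avg n (\<lambda>p. real (card {z \<in> confs n. typed n N p z}))
      * (\<Prod>i\<in>UNIV. \<Prod>a\<in>UNIV. \<Prod>b\<in>UNIV. exp (J * (val (fst a) * val (fst b) + val (snd a) * val (snd b))) ^ N i a b)
    \<le> ((exp 1 * (real n + 1)) ^ 4) ^ (2 * CARD('a) - 1) * exp (5 * k) * exp (real n * (2 * real CARD('a) * ln (4 * cosh J) - 2 * k * ln 2))"
proof -
  define r where "r = CARD('a)"
  define e where "e = 2 * r - 1"
  have r: "r \<ge> 1" by (simp add: r_def Suc_leI One_nat_def)
  have ke: "k = real e" using r by (simp add: k_def e_def r_def)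
  have k1: "k \<ge> 1" using r by (simp add: ke e_def)
  have kr: "k + 1 = 2 * real r" by (simp add: k_def r_def)
  define cp where "cp = c (Plus, Plus) + c (Minus, Minus)"
  define cm where "cm = c (Plus, Minus) + c (Minus, Plus)"
  have cpm: "cp + cm = n" using cn by (simp add: cp_def cm_def sum_pair_spin sum_spin)
  have cpm': "real cp + real cm = real n" using arg_cong[OF cpm, of real] by simp
  \<comment> \<open>Adding 1 keeps the logarithms finite when one of the overlap classes is
    empty.\<close>
  define A where "A = real cp + 1"
  define B where "B = real cm + 1"
  have AB: "A \<ge> 1" "B \<ge> 1" by (simp_all add: A_def B_def)
  define m where "m = (ln A - ln B) / 2"
  \<comment> \<open>Then \<open>(k + 1) / k * L = m\<close>, which \<open>overlap_inequality\<close>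
    asks for, and \<open>2 * r * L = k * m\<close>, which matches the \<open>k\<close> vertex
    factors.\<close>
  define L where "L = m * k / (k + 1)"
  define \<Lambda> where "\<Lambda> = 16 * (cosh J)\<^sup>2 * ((cosh L)\<^sup>2 + (tanh J)\<^sup>2 * (sinh L)\<^sup>2)"
  let ?B = "\<lambda>a b :: spin \<times> spin. exp (J * (val (fst a) * val (fst b) + val (snd a) * val (snd b)))"
  let ?R = "\<lambda>a :: spin \<times> spin. exp (L * (val (fst a) * val (snd a)))"
  let ?A = "tuple_avg n (\<lambda>p. real (card {z \<in> confs n. typed n N p z}))"
  let ?P = "((exp 1 * (real n + 1)) ^ 4) ^ e"
  let ?E = "\<Prod>i\<in>UNIV. \<Prod>a\<in>UNIV. \<Prod>b\<in>UNIV. ?B a b ^ N i a b"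
  have cosh_pos: "(cosh L)\<^sup>2 + (tanh J)\<^sup>2 * (sinh L)\<^sup>2 > 0" by (simp add: add_pos_nonneg)
  have \<Lambda>0: "\<Lambda> > 0" unfolding \<Lambda>_def using cosh_pos by simp
  have pw: "real N ^ N = exp (real N * ln (real N))" for N :: nat
    by (cases "N = 0") (simp_all add: exp_of_nat_mult)
  have c4: "CARD(spin \<times> spin) = 4" by (simp add: UNIV_spin)
  have F0: "?A * (real n ^ n) ^ e * (\<Prod>i\<in>UNIV. \<Prod>a\<in>UNIV. \<Prod>b\<in>UNIV. (?R a * ?B a b * ?R b) ^ N i a b)
    \<le> ((exp 1 * (real n + 1)) ^ CARD(spin \<times> spin)) ^ e * (\<Prod>a\<in>UNIV. real (c a) ^ c a) ^ e * (\<Prod>i\<in>(UNIV :: 'a set). (\<Sum>a\<in>UNIV. \<Sum>b\<in>UNIV. ?R a * ?B a b * ?R b) ^ n)"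
    unfolding e_def r_def
    by (rule tuple_avg_typed_le[where N = N and c = c and n = n and q = "\<lambda>_ a b. ?R a * ?B a b * ?R b", OF row col cn]) simp
  have F1: "(\<Prod>i\<in>(UNIV :: 'a set). (\<Sum>a\<in>UNIV. \<Sum>b\<in>UNIV. ?R a * ?B a b * ?R b) ^ n) = \<Lambda> ^ (n * r)"
    unfolding cycle_partition \<Lambda>_def[symmetric] by (simp add: r_def power_mult)
  have F2: "\<Lambda> ^ (n * r) \<le> exp (real n * (2 * real r * ln (4 * cosh J)) + real n * (k * ln (cosh m)))"
  proof -
    have c0: "cosh J > 0" by simp
    have "ln \<Lambda> = ln ((4 * cosh J)\<^sup>2) + ln ((cosh L)\<^sup>2 + (tanh J)\<^sup>2 * (sinh L)\<^sup>2)"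
    proof -
      have "\<Lambda> = (4 * cosh J)\<^sup>2 * ((cosh L)\<^sup>2 + (tanh J)\<^sup>2 * (sinh L)\<^sup>2)" unfolding \<Lambda>_def by (simp add: power_mult_distrib)
      moreover have "(4 * cosh J)\<^sup>2 > 0" using c0 by simp
      ultimately show ?thesis using cosh_pos by (simp only: ln_mult_pos)
    qed
    also have "ln ((4 * cosh J)\<^sup>2) = 2 * ln (4 * cosh J)" by (subst ln_realpow) auto
    also have "ln ((cosh L)\<^sup>2 + (tanh J)\<^sup>2 * (sinh L)\<^sup>2) \<le> 2 / ((k + 1) / k) * ln (cosh ((k + 1) / k * L))"
    proof (rule overlap_inequality)
      have "(tanh J)\<^sup>2 \<le> 1 / k" using J(1) k1 by (simp add: le_divide_eq mult.commute)
      then show "1 + (tanh J)\<^sup>2 \<le> (k + 1) / k" using k1 by (simp add: add_divide_distrib)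
      have "(tanh J)\<^sup>2 \<le> 1 / k" by fact
      also have "\<dots> \<le> 1" using k1 by simp
      finally show "(tanh J)\<^sup>2 \<le> 1" .
    qed simp
    also have "(k + 1) / k * L = m" using k1 by (simp add: L_def)
    finally have "real (n * r) * ln \<Lambda> \<le> real (n * r) * (2 * ln (4 * cosh J) + 2 / ((k + 1) / k) * ln (cosh m))"
      by (intro mult_left_mono) auto
    also have "\<dots> = real n * (2 * real r * ln (4 * cosh J)) + real n * (k * ln (cosh m))"
    proof -
      have "real r * (2 / ((k + 1) / k)) = k" using k1 unfolding kr by (simp add: r_def)
      then have "real n * (real r * (2 / ((k + 1) / k)) * ln (cosh m)) = real n * (k * ln (cosh m))" by simp
      then show ?thesis by (simp add: algebra_simps)
    qed
    finally have "exp (real (n * r) * ln \<Lambda>) \<le> exp (real n * (2 * real r * ln (4 * cosh J)) + real n * (k * ln (cosh m)))" by simp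
    then show ?thesis using \<Lambda>0 by (simp only: exp_of_nat_mult exp_ln)
  qed
  have F3: "(\<Prod>i\<in>UNIV. \<Prod>a\<in>UNIV. \<Prod>b\<in>UNIV. (?R a * ?B a b * ?R b) ^ N i a b) = exp (k * (m * (real cp - real cm))) * ?E"
  proof -
    have "(\<Prod>a\<in>UNIV. ?R a ^ c a) = exp (L * (real cp - real cm))"
    proof -
      have "(\<Prod>a\<in>UNIV. ?R a ^ c a) = (\<Prod>s\<in>UNIV. \<Prod>s'\<in>UNIV. ?R (s, s') ^ c (s, s'))"
        by (simp add: prod.cartesian_product UNIV_Times_UNIV[symmetric] case_prod_beta del: UNIV_Times_UNIV)
      also have "\<dots> = exp (L * (real cp - real cm))"
        by (simp add: prod_spin exp_of_nat_mult[symmetric] exp_add[symmetric] cp_def cm_def algebra_simps)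
      finally show ?thesis .
    qed
    moreover have "exp (L * (real cp - real cm)) ^ (2 * r) = exp (k * (m * (real cp - real cm)))"
    proof -
      have "2 * real r * L = k * m" unfolding kr[symmetric] L_def using k1 by simp
      then have "2 * real r * L * (real cp - real cm) = k * m * (real cp - real cm)" by simp
      then show ?thesis by (simp add: exp_of_nat_mult[symmetric] mult.assoc)
    qed
    ultimately show ?thesis using prod_form[where N = N and c = c and R = ?R and B = ?B, OF row col] unfolding r_def by (simp only:)
  qed
  have F4: "(\<Prod>a\<in>UNIV. real (c a) ^ c a) \<le> exp (real cp * ln A + real cm * ln B - real n * ln 2 + 3)"
  proof -
    have h: "real x ^ x \<le> exp (real x * ln y)" if "real x \<le> y" "y > 0" for x y
    proof (cases "x = 0")
      case False
      then have "ln (real x) \<le> ln y" using that by simp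
      then show ?thesis unfolding pw by (simp add: mult_left_mono)
    qed simp
    have p1: "real (c (Plus, Plus)) ^ c (Plus, Plus) * real (c (Minus, Minus)) ^ c (Minus, Minus) \<le> exp (real cp * (ln A - ln 2) + 3)"
    proof -
      \<comment> \<open>The two counts sum to \<open>A - 1\<close> and differ by at most 4, so each
        is at most half of \<open>A + 3\<close>.\<close>
      let ?y = "(A + 3) / 2"
      have y: "real (c (Plus, Plus)) \<le> ?y" "real (c (Minus, Minus)) \<le> ?y" "?y > 0"
        using bal(2) by (auto simp: A_def cp_def)
      have "real (c (Plus, Plus)) ^ c (Plus, Plus) * real (c (Minus, Minus)) ^ c (Minus, Minus)
         \<le> exp (real (c (Plus, Plus)) * ln ?y) * exp (real (c (Minus, Minus)) * ln ?y)"
        using y by (intro mult_mono h) auto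
      also have "\<dots> = exp (real cp * ln ?y)" by (simp add: cp_def exp_add[symmetric] algebra_simps)
      also have "real cp * ln ?y \<le> real cp * (ln A - ln 2 + 3 / A)"
      proof -
        have "ln ?y = ln A + ln (1 + 3 / A) - ln 2"
        proof -
          have "A * (1 + 3 / A) = A + 3" using AB by (simp add: distrib_left)
          moreover have "1 + 3 / A > 0" using AB by (simp add: add_pos_nonneg)
          ultimately have "ln (A + 3) = ln A + ln (1 + 3 / A)" using AB ln_mult_pos[of A "1 + 3 / A"] by (simp only:)
          then show ?thesis using AB by (simp add: ln_div)
        qed
        moreover have "ln (1 + 3 / A) \<le> 3 / A" using AB by (intro ln_add_one_self_le_self) auto
        ultimately show ?thesis by (intro mult_left_mono) auto
      qed
      also have "\<dots> \<le> real cp * (ln A - ln 2) + 3"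
      proof -
        have "real cp * (3 / A) \<le> 3" using AB by (simp add: A_def divide_le_eq)
        then show ?thesis by (simp add: distrib_left)
      qed
      finally show ?thesis by simp
    qed
    have p2: "real (c (Plus, Minus)) ^ c (Plus, Minus) * real (c (Minus, Plus)) ^ c (Minus, Plus) \<le> exp (real cm * (ln B - ln 2))"
    proof -
      have y: "real (c (Minus, Plus)) \<le> B / 2" "B / 2 > 0" using bal(1) AB by (auto simp: B_def cm_def)
      have "real (c (Plus, Minus)) ^ c (Plus, Minus) * real (c (Minus, Plus)) ^ c (Minus, Plus)
         \<le> exp (real (c (Minus, Plus)) * ln (B / 2)) * exp (real (c (Minus, Plus)) * ln (B / 2))"
        unfolding bal(1) using y by (intro mult_mono h) auto
      also have "\<dots> = exp (real cm * ln (B / 2))" by (simp add: cm_def bal(1) exp_add[symmetric] algebra_simps)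
      finally show ?thesis using AB by (simp add: ln_div)
    qed
    have "(\<Prod>a\<in>UNIV. real (c a) ^ c a) = (\<Prod>s\<in>UNIV. \<Prod>s'\<in>UNIV. real (c (s, s')) ^ c (s, s'))"
      by (simp add: prod.cartesian_product UNIV_Times_UNIV[symmetric] case_prod_beta del: UNIV_Times_UNIV)
    also have "\<dots> = (real (c (Plus, Plus)) ^ c (Plus, Plus) * real (c (Minus, Minus)) ^ c (Minus, Minus))
        * (real (c (Plus, Minus)) ^ c (Plus, Minus) * real (c (Minus, Plus)) ^ c (Minus, Plus))"
      by (simp add: prod_spin mult_ac)
    also have "\<dots> \<le> exp (real cp * (ln A - ln 2) + 3) * exp (real cm * (ln B - ln 2))"
      by (intro mult_mono p1 p2) auto
    also have "\<dots> = exp (real cp * ln A + real cm * ln B - real n * ln 2 + 3)"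
      unfolding cpm'[symmetric] by (simp add: exp_add[symmetric] algebra_simps)
    finally show ?thesis .
  qed
  let ?Q = "exp (real cp * ln A + real cm * ln B - real n * ln 2 + 3)"
  let ?S = "exp (real n * (2 * real r * ln (4 * cosh J)) + real n * (k * ln (cosh m)))"
  have "?A * (real n ^ n) ^ e * (exp (k * (m * (real cp - real cm))) * ?E) \<le> ?P * (\<Prod>a\<in>UNIV. real (c a) ^ c a) ^ e * \<Lambda> ^ (n * r)"
    using F0 unfolding F1 F3 c4 .
  also have "\<dots> \<le> ?P * ?Q ^ e * ?S"
    using F2 F4 \<Lambda>0 by (intro mult_mono power_mono order.refl mult_nonneg_nonneg zero_le_power prod_nonneg) auto
  finally have main: "?A * (real n ^ n) ^ e * (exp (k * (m * (real cp - real cm))) * ?E) \<le> ?P * ?Q ^ e * ?S" .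
  define U where "U = exp (k * (real n * ln (real n)) + k * (m * (real cp - real cm)))"
  have e1: "(real n ^ n) ^ e = exp (k * (real n * ln (real n)))"
    unfolding pw ke by (simp add: exp_of_nat_mult[symmetric])
  have e2: "?Q ^ e = exp (k * (real cp * ln A + real cm * ln B - real n * ln 2 + 3))"
    unfolding ke by (simp add: exp_of_nat_mult[symmetric])
  have lc: "ln (cosh m) = ln (real n + 2) - ln 2 - (ln A + ln B) / 2"
  proof -
    have "cosh m = (A + B) / 2 * exp (- ((ln A + ln B) / 2))"
    proof -
      have "exp m = A * exp (- ((ln A + ln B) / 2))"
      proof -
        have "exp m = exp (ln A + - ((ln A + ln B) / 2))" by (simp add: m_def field_simps)
        also have "\<dots> = A * exp (- ((ln A + ln B) / 2))" unfolding exp_add using AB by simp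
        finally show ?thesis .
      qed
      moreover have "exp (- m) = B * exp (- ((ln A + ln B) / 2))"
      proof -
        have "exp (- m) = exp (ln B + - ((ln A + ln B) / 2))" by (simp add: m_def field_simps)
        also have "\<dots> = B * exp (- ((ln A + ln B) / 2))" unfolding exp_add using AB by simp
        finally show ?thesis .
      qed
      ultimately show ?thesis unfolding cosh_field_def by (simp only:) (simp add: field_simps)
    qed
    moreover have "A + B = real n + 2" using cpm' by (simp add: A_def B_def)
    ultimately have "ln (cosh m) = ln ((real n + 2) / 2 * exp (- ((ln A + ln B) / 2)))" by simp
    also have "\<dots> = ln ((real n + 2) / 2) - (ln A + ln B) / 2" by (subst ln_mult) auto
    also have "ln ((real n + 2) / 2) = ln (real n + 2) - ln 2" by (subst ln_div) auto
    finally show ?thesis .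
  qed
  have ln2: "real n * ln (real n + 2) \<le> real n * ln (real n) + 2"
  proof -
    have "real n + 2 = real n * (1 + 2 / real n)" using n by (simp add: field_simps)
    then have "ln (real n + 2) = ln (real n * (1 + 2 / real n))" by simp
    also have "\<dots> = ln (real n) + ln (1 + 2 / real n)" using n by (intro ln_mult_pos) (auto simp: add_pos_nonneg)
    also have "\<dots> \<le> ln (real n) + 2 / real n" using n by (intro add_left_mono ln_add_one_self_le_self) auto
    finally have "real n * ln (real n + 2) \<le> real n * (ln (real n) + 2 / real n)" by (rule mult_left_mono) simp
    then show ?thesis using n by (simp add: distrib_left)
  qed
  \<comment> \<open>The logarithms of \<open>A\<close> and \<open>B\<close> cancel by the choice of
    \<open>m\<close>. The constant 5 is the 3 from \<open>F4\<close> plus the 2 from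
    \<open>ln2\<close>.\<close>
  have key: "(real cp * ln A + real cm * ln B - real n * ln 2 + 3) + real n * ln (cosh m) \<le> real n * ln (real n) + m * (real cp - real cm) + (5 - 2 * real n * ln 2)"
  proof -
    have "m * (real cp - real cm) = (real cp * ln A - real cm * ln A - real cp * ln B + real cm * ln B) / 2"
      unfolding m_def by (simp add: field_simps)
    moreover have "real n * ((ln A + ln B) / 2) = (real cp * ln A + real cp * ln B + real cm * ln A + real cm * ln B) / 2"
      unfolding cpm'[symmetric] by (simp add: field_simps)
    moreover have "real n * ln (cosh m) = real n * ln (real n + 2) - real n * ln 2 - real n * ((ln A + ln B) / 2)"
      unfolding lc by (simp add: algebra_simps)
    ultimately show ?thesis using ln2 by (simp add: field_simps)
  qed
  have "?A * ?E * U = ?A * (real n ^ n) ^ e * (exp (k * (m * (real cp - real cm))) * ?E)"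
    unfolding e1 U_def exp_add by (simp only: mult_ac)
  also note main
  also have "?P * ?Q ^ e * ?S = ?P * exp (real n * (2 * real r * ln (4 * cosh J)) + k * ((real cp * ln A + real cm * ln B - real n * ln 2 + 3) + real n * ln (cosh m)))"
    unfolding e2 mult.assoc exp_add[symmetric] by (simp add: algebra_simps)
  also have "\<dots> \<le> ?P * exp (real n * (2 * real r * ln (4 * cosh J)) + k * (real n * ln (real n) + m * (real cp - real cm) + (5 - 2 * real n * ln 2)))"
    using mult_left_mono[OF key, of k] k1 by (intro mult_left_mono) auto
  also have "\<dots> = ?P * exp (5 * k) * exp (real n * (2 * real r * ln (4 * cosh J) - 2 * k * ln 2)) * U"
    unfolding U_def mult.assoc exp_add[symmetric] by (simp add: algebra_simps)
  finally have "?A * ?E * U \<le> ?P * exp (5 * k) * exp (real n * (2 * real r * ln (4 * cosh J) - 2 * k * ln 2)) * U" .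
  then have "?A * ?E \<le> ?P * exp (5 * k) * exp (real n * (2 * real r * ln (4 * cosh J) - 2 * k * ln 2))"
    by (rule mult_right_le_imp_le) (simp add: U_def)
  then show ?thesis unfolding r_def e_def .
qed

lemma vcount_fst_snd:
  fixes z :: "nat \<Rightarrow> spin \<times> spin"
  shows "vcount n (fst \<circ> z) s = vcount n z (s, Plus) + vcount n z (s, Minus)"
    and "vcount n (snd \<circ> z) s = vcount n z (Plus, s) + vcount n z (Minus, s)"
proof -
  have "{v \<in> {1..n}. (fst \<circ> z) v = s} = {v \<in> {1..n}. z v = (s, Plus)} \<union> {v \<in> {1..n}. z v = (s, Minus)}"
    using spin.exhaust by (auto simp: prod_eq_iff)
  then show "vcount n (fst \<circ> z) s = vcount n z (s, Plus) + vcount n z (s, Minus)"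
    unfolding vcount_def by (simp only:) (rule card_Un_disjoint; auto)
  have "{v \<in> {1..n}. (snd \<circ> z) v = s} = {v \<in> {1..n}. z v = (Plus, s)} \<union> {v \<in> {1..n}. z v = (Minus, s)}"
    using spin.exhaust by (auto simp: prod_eq_iff)
  then show "vcount n (snd \<circ> z) s = vcount n z (Plus, s) + vcount n z (Minus, s)"
    unfolding vcount_def by (simp only:) (rule card_Un_disjoint; auto)
qed

lemma free_edge_half: "ising_edge J 0 Plus Plus + ising_edge J 0 Plus Minus = 1 / 2"
proof -
  have "ising_norm J 0 > 0" by (simp add: ising_norm_def add_pos_pos)
  then show ?thesis by (simp add: ising_edge_simps ising_norm_def add_divide_distrib[symmetric])
qed

lemma second_moment_free:
  fixes J \<epsilon> :: real
  defines "k \<equiv> 2 * real CARD('a::finite) - 1"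
  assumes J: "J > 0" "k * (tanh J)\<^sup>2 \<le> 1" and \<epsilon>: "\<epsilon> > 0"
  shows "\<forall>\<^sub>F n in sequentially. tuple_avg n (\<lambda>p :: 'a perms. typed_count n (types (ising_edge J 0) n) p ^ 2)
     \<le> exp (real n * (2 * real CARD('a) * ln (4 * cosh J) - 2 * k * ln 2 - 2 * real CARD('a) * J * ising_corr J 0 + \<epsilon>))"
proof -
  let ?r = "CARD('a)" and ?B = "\<lambda>a b :: spin \<times> spin. exp (J * (val (fst a) * val (fst b) + val (snd a) * val (snd b)))"
  show ?thesis
  proof (rule second_moment_of_bound[OF J(1) _ \<epsilon>, where C = "exp (real (4 * (2 * ?r - 1))) * exp (5 * k)" and m = "4 * (2 * ?r - 1)"])
    fix n and p :: "'a perms" and z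
    assume n: "n > 0" and p: "p \<in> perm_tuples n" and z: "z \<in> confs n" "pair_typed n (types (ising_edge J 0) n) p z"
    let ?N = "\<lambda>i. ecount n z (z \<circ> p i)"
    have vf: "vcount n (fst \<circ> z) s = vtypes (ising_edge J 0) n s" and vs: "vcount n (snd \<circ> z) s = vtypes (ising_edge J 0) n s" for s
    proof -
      fix i :: 'a
      have "ecount n (fst \<circ> z) ((fst \<circ> z) \<circ> p i) = types (ising_edge J 0) n" "ecount n (snd \<circ> z) ((snd \<circ> z) \<circ> p i) = types (ising_edge J 0) n"
        using z(2) unfolding pair_typed_def typed_def by blast+
      then show "vcount n (fst \<circ> z) s = vtypes (ising_edge J 0) n s" "vcount n (snd \<circ> z) s = vtypes (ising_edge J 0) n s"
        unfolding vtypes_def ecount_marginals(1)[OF p, where i = i, symmetric] by simp_all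
    qed
    have tot: "vcount n z (Plus, Plus) + vcount n z (Plus, Minus) + (vcount n z (Minus, Plus) + vcount n z (Minus, Minus)) = n"
      using sum_vcount[of n z] by (simp add: sum_pair_spin sum_spin)
    \<comment> \<open>Both components have the same number of plus spins.\<close>
    have bal1: "vcount n z (Plus, Minus) = vcount n z (Minus, Plus)"
      using vf[of Plus] vs[of Plus] unfolding vcount_fst_snd by linarith
    \<comment> \<open>Each of the two floors loses at most 1, so the number of plus spins is within
      2 of \<open>n / 2\<close>; the difference doubles this.\<close>
    have bal2: "\<bar>real (vcount n z (Plus, Plus)) - real (vcount n z (Minus, Minus))\<bar> \<le> 4"
    proof -
      interpret W: edge_law "ising_edge J 0" by (rule edge_law_ising)
      let ?x = "nat \<lfloor>real n * ising_edge J 0 Plus Plus\<rfloor>" and ?y = "nat \<lfloor>real n * ising_edge J 0 Plus Minus\<rfloor>"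
      have "vtypes (ising_edge J 0) n Plus = ?x + ?y" by (simp add: vtypes_def types_def sum_spin)
      then have v: "vcount n z (Plus, Plus) + vcount n z (Plus, Minus) = ?x + ?y" using vf[of Plus] unfolding vcount_fst_snd by simp
      have "real n * ising_edge J 0 Plus Plus + real n * ising_edge J 0 Plus Minus = real n / 2"
        unfolding distrib_left[symmetric] free_edge_half by simp
      then have b: "real (?x + ?y) \<le> real n / 2" "real n / 2 - 2 \<le> real (?x + ?y)"
        unfolding of_nat_add using W.types_floor[of n Plus] W.types_floor[of n Minus] by linarith+
      have "real (vcount n z (Plus, Plus)) - real (vcount n z (Minus, Minus)) = 2 * real (?x + ?y) - real n"
        unfolding v[symmetric] using arg_cong[OF tot, of real] bal1 by simp
      moreover have "\<bar>2 * X - real n\<bar> \<le> 4" if "X \<le> real n / 2" "real n / 2 - 2 \<le> X" for X :: real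
        using that by (simp only: abs_le_iff) auto
      ultimately show ?thesis using b by (simp only:)
    qed
    have "tuple_avg n (\<lambda>p'. real (card {z' \<in> confs n. typed n ?N p' z'})) * (\<Prod>i\<in>UNIV. \<Prod>a\<in>UNIV. \<Prod>b\<in>UNIV. ?B a b ^ ?N i a b)
      \<le> ((exp 1 * (real n + 1)) ^ 4) ^ (2 * CARD('a) - 1) * exp (5 * k) * exp (real n * (2 * real CARD('a) * ln (4 * cosh J) - 2 * k * ln 2))"
      unfolding k_def
    proof (rule free_pair_bound[where c = "vcount n z"])
      show "(2 * real CARD('a) - 1) * (tanh J)\<^sup>2 \<le> 1" using J(2) by (simp add: k_def)
    qed (use n J bal1 bal2 ecount_marginals[OF p] in \<open>auto simp: sum_vcount\<close>)
    also have "(\<Prod>i\<in>UNIV. \<Prod>a\<in>UNIV. \<Prod>b\<in>UNIV. ?B a b ^ ?N i a b) = exp (J * ising_corr_count (types (ising_edge J 0) n)) ^ (2 * ?r)"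
      by (rule pair_typed_corr[OF z(2)])
    finally show "tuple_avg n (\<lambda>p'. real (card {z' \<in> confs n. typed n ?N p' z'})) * exp (J * ising_corr_count (types (ising_edge J 0) n)) ^ (2 * ?r)
      \<le> exp (real (4 * (2 * ?r - 1))) * exp (5 * k) * (real n + 1) ^ (4 * (2 * ?r - 1)) * exp (real n * (2 * real CARD('a) * ln (4 * cosh J) - 2 * k * ln 2))"
      unfolding poly_shape by (simp only: mult_ac)
  qed simp
qed

text \<open>\<open>upper_bound_form\<close> would give the maximum of \<open>bethe\<close>, which is
  too large here. Instead the vertex counts are at most \<open>n * (1 / 2 + 2 * \<delta>)\<close>,
  as each site frequency is a sum of two edge frequencies, and the untilted interaction weights are
  used.\<close>

lemma upper_bound_free:
  fixes J \<epsilon> \<delta> :: real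
  defines "k \<equiv> 2 * real CARD('a::finite) - 1"
  assumes J: "J > 0" and \<epsilon>: "\<epsilon> > 0" and \<delta>: "\<delta> > 0"
  shows "\<forall>\<^sub>F n in sequentially. tuple_avg n (\<lambda>p :: 'a perms. real (card {x \<in> confs n. edge_close J 0 \<delta> n p x}))
     \<le> exp (real n * (real CARD('a) * ln (4 * cosh J) + k * ln (1 / 2 + 2 * \<delta>) - real CARD('a) * J * (ising_corr J 0 - 4 * \<delta>) + \<epsilon>))"
proof -
  define e where "e = 2 * CARD('a) - 1"
  have r: "CARD('a) \<ge> 1" by (simp add: Suc_leI One_nat_def)
  have ke: "k = real e" using r by (simp add: k_def e_def)
  let ?r = "CARD('a)" and ?B = "\<lambda>s s'. exp (J * val s * val s')"
  let ?h = "1 / 2 + 2 * \<delta>"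
  have h: "?h > 0" using \<delta> by simp
  show ?thesis
  proof (rule upper_bound_of_bound[OF J _ \<epsilon> \<delta>, where C = "exp (real (2 * e))" and m = "2 * e"])
    fix n and p :: "'a perms" and x :: "nat \<Rightarrow> spin"
    assume n: "n > 0" and p: "p \<in> perm_tuples n" and x: "x \<in> confs n"
      and near: "\<And>i s s'. \<bar>real (ecount n x (x \<circ> p i) s s') / real n - ising_edge J 0 s s'\<bar> < \<delta>"
    let ?N = "\<lambda>i. ecount n x (x \<circ> p i)"
    let ?A = "tuple_avg n (\<lambda>p'. real (card {x' \<in> confs n. typed n ?N p' x'}))"
    have c2: "CARD(spin) = 2" by (simp add: UNIV_spin)
    have c_le: "real (vcount n x s) \<le> real n * ?h" for s
    proof -
      fix i :: 'a
      have "real (?N i s s') \<le> real n * (ising_edge J 0 s s' + \<delta>)" for s'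
      proof -
        have "real (?N i s s') / real n \<le> ising_edge J 0 s s' + \<delta>" using near[of i s s'] by linarith
        then show ?thesis using n by (simp add: divide_le_eq mult.commute)
      qed
      then have "real (?N i s Plus) + real (?N i s Minus) \<le> real n * (ising_edge J 0 s Plus + \<delta>) + real n * (ising_edge J 0 s Minus + \<delta>)"
        by (intro add_mono)
      also have "\<dots> = real n * (ising_edge J 0 s Plus + ising_edge J 0 s Minus + 2 * \<delta>)" by (simp add: algebra_simps)
      also have "ising_edge J 0 s Plus + ising_edge J 0 s Minus = 1 / 2"
        using free_edge_half[of J] by (cases s) (simp_all add: ising_edge_simps add.commute)
      finally show ?thesis
        unfolding ecount_marginals(1)[OF p, where i = i, symmetric] by (simp only: sum_spin add.commute)
    qed
    have V: "(\<Prod>s\<in>UNIV. real (vcount n x s) ^ vcount n x s) \<le> real n ^ n * ?h ^ n"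
    proof -
      have "(\<Prod>s\<in>UNIV. real (vcount n x s) ^ vcount n x s) \<le> (\<Prod>s\<in>UNIV. (real n * ?h) ^ vcount n x s)"
        using c_le by (intro prod_mono) (auto intro: power_mono)
      also have "\<dots> = real n ^ n * ?h ^ n" by (simp only: power_mult_distrib prod.distrib power_sum[symmetric] sum_vcount)
      finally show ?thesis .
    qed
    have Z: "(\<Sum>a\<in>UNIV. \<Sum>b\<in>UNIV. ?B a b) = 4 * cosh J" by (simp add: sum_spin cosh_field_def)
    let ?E = "\<Prod>i\<in>UNIV. \<Prod>a\<in>UNIV. \<Prod>b\<in>UNIV. ?B a b ^ ?N i a b"
    have "?A * ?E * (real n ^ n) ^ e = ?A * (real n ^ n) ^ e * ?E" by (simp only: mult_ac)
    also have "\<dots> \<le> ((exp 1 * (real n + 1)) ^ CARD(spin)) ^ e * (\<Prod>a\<in>UNIV. real (vcount n x a) ^ vcount n x a) ^ e * (\<Prod>i\<in>(UNIV :: 'a set). (\<Sum>a\<in>UNIV. \<Sum>b\<in>UNIV. ?B a b) ^ n)"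
      unfolding e_def
      by (rule tuple_avg_typed_le[where N = ?N and c = "vcount n x" and n = n and q = "\<lambda>_ a b. ?B a b", OF ecount_marginals(1)[OF p] ecount_marginals(2)[OF p] sum_vcount]) simp
    also have "\<dots> \<le> ((exp 1 * (real n + 1)) ^ CARD(spin)) ^ e * (real n ^ n * ?h ^ n) ^ e * (\<Prod>i\<in>(UNIV :: 'a set). (4 * cosh J) ^ n)"
      unfolding Z using V \<delta> by (intro mult_mono power_mono order.refl mult_nonneg_nonneg zero_le_power prod_nonneg) auto
    also have "\<dots> = exp (real (2 * e)) * (real n + 1) ^ (2 * e) * ((?h ^ n) ^ e * (\<Prod>i\<in>(UNIV :: 'a set). (4 * cosh J) ^ n)) * (real n ^ n) ^ e"
      unfolding c2 poly_shape power_mult_distrib[of "real n ^ n"] by (simp only: mult_ac)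
    also have "(?h ^ n) ^ e * (\<Prod>i\<in>(UNIV :: 'a set). (4 * cosh J) ^ n) = exp (real n * (real ?r * ln (4 * cosh J) + k * ln ?h))"
    proof -
      have "?h ^ n = exp (real n * ln ?h)" using h by (simp add: exp_of_nat_mult)
      then have "(?h ^ n) ^ e = exp (k * (real n * ln ?h))" unfolding ke by (simp only: exp_of_nat_mult)
      moreover have "(4 * cosh J) ^ n = exp (real n * ln (4 * cosh J))" by (simp add: exp_of_nat_mult)
      then have "(\<Prod>i\<in>(UNIV :: 'a set). (4 * cosh J) ^ n) = exp (real ?r * (real n * ln (4 * cosh J)))" by (simp only: exp_of_nat_mult prod_constant)
      ultimately show ?thesis by (simp add: exp_add[symmetric] algebra_simps)
    qed
    finally show "?A * ?E \<le> exp (real (2 * e)) * (real n + 1) ^ (2 * e) * exp (real n * (real ?r * ln (4 * cosh J) + k * ln ?h))"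
      by (rule mult_right_le_imp_le) (use n in simp)
  qed simp
qed

lemma ln_ising_edge: "ln (ising_edge J t s s') = J * (val s * val s') + t * (val s + val s') - ln (edge_norm J t)"
proof -
  have n: "ising_norm J t > 0" by (simp add: ising_norm_def add_pos_pos)
  have e: "edge_norm J t = exp J * ising_norm J t"
    by (simp add: edge_norm_def ising_norm_def distrib_left exp_add[symmetric] algebra_simps)
  have "ln (edge_norm J t) = J + ln (ising_norm J t)" unfolding e using n by (simp add: ln_mult_pos)
  moreover have "ln (ising_edge J t s s') = J * (val s * val s' - 1) + t * (val s + val s') - ln (ising_norm J t)"
    unfolding ising_edge_def using n by (simp add: ln_div less_imp_neq[symmetric])
  ultimately show ?thesis by (simp add: algebra_simps)
qed

text \<open>
  At a root of \<open>t_gap\<close> the magnetization of a site matches its edge field, which makes the site marginals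
  proportional to \<^term>\<open>exp ((k + 1) / k * t * val s)\<close>.
\<close>

lemma entropy_value:
  fixes J t k r :: real
  assumes k: "k > 0" and kr: "k + 1 = 2 * r" and gap: "t_gap k J t = 0"
  defines "\<pi> \<equiv> \<lambda>s. \<Sum>s'\<in>UNIV. ising_edge J t s s'"
  shows "k * (\<Sum>s\<in>UNIV. \<pi> s * ln (\<pi> s)) - r * (\<Sum>s\<in>UNIV. \<Sum>s'\<in>UNIV. ising_edge J t s s' * ln (ising_edge J t s s'))
    = bethe k J t - r * J * ising_corr J t"
proof -
  let ?W = "ising_edge J t" and ?\<kappa> = "(k + 1) / k"
  have n: "ising_norm J t > 0" by (simp add: ising_norm_def add_pos_pos)
  interpret W: edge_law ?W by (rule edge_law_ising)
  have tot: "(\<Sum>s\<in>UNIV. \<pi> s) = 1" unfolding \<pi>_def by (rule W.W_sum)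
  have \<pi>0: "\<pi> s > 0" for s unfolding \<pi>_def by (intro sum_pos W.W_pos) auto
  have ratio: "ln (\<pi> Plus) - ln (\<pi> Minus) = 2 * ?\<kappa> * t"
  proof -
    have pm: "\<pi> Plus = 2 * exp (t - J) * cosh (t + J) / ising_norm J t" "\<pi> Minus = 2 * exp (- t - J) * cosh (t - J) / ising_norm J t"
    proof -
      have "2 * exp (t - J) * cosh (t + J) = exp (t - J + (t + J)) + exp (t - J + - (t + J))"
        unfolding exp_add cosh_field_def by (simp add: distrib_left)
      also have "\<dots> = exp (2 * t) + exp (- 2 * J)" by (simp add: algebra_simps)
      finally show "\<pi> Plus = 2 * exp (t - J) * cosh (t + J) / ising_norm J t"
        by (simp add: \<pi>_def sum_spin ising_edge_simps add_divide_distrib add.commute)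
      have "2 * exp (- t - J) * cosh (t - J) = exp (- t - J + (t - J)) + exp (- t - J + - (t - J))"
        unfolding exp_add cosh_field_def by (simp add: distrib_left)
      also have "\<dots> = exp (- 2 * J) + exp (- 2 * t)" by (simp add: algebra_simps)
      finally show "\<pi> Minus = 2 * exp (- t - J) * cosh (t - J) / ising_norm J t"
        by (simp add: \<pi>_def sum_spin ising_edge_simps add_divide_distrib add.commute)
    qed
    have "ln (\<pi> Plus) = ln 2 + (t - J) + ln (cosh (t + J)) - ln (ising_norm J t)"
      unfolding pm using n by (simp add: ln_div ln_mult less_imp_neq[symmetric])
    moreover have "ln (\<pi> Minus) = ln 2 + (- t - J) + ln (cosh (t - J)) - ln (ising_norm J t)"
      unfolding pm using n by (simp add: ln_div ln_mult less_imp_neq[symmetric])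
    ultimately have "ln (\<pi> Plus) - ln (\<pi> Minus) = 2 * t + ln (cosh (t + J) / cosh (t - J))" by (simp add: ln_div)
    moreover have "k * ln (cosh (t + J) / cosh (t - J)) = 2 * t" using gap by (simp add: t_gap_def)
    then have "ln (cosh (t + J) / cosh (t - J)) = 2 * t / k" using k by (simp add: eq_divide_eq mult.commute)
    ultimately show ?thesis using k by (simp add: field_simps)
  qed
  have ln_pi: "ln (\<pi> s) = ?\<kappa> * t * val s - ln (2 * cosh (?\<kappa> * t))" for s
  proof -
    define u where "u = ?\<kappa> * t"
    have "\<pi> Plus = exp (ln (\<pi> Plus) - ln (\<pi> Minus)) * \<pi> Minus" using \<pi>0 by (simp add: exp_diff less_imp_neq[symmetric])
    then have P: "\<pi> Plus = exp (2 * u) * \<pi> Minus" unfolding ratio by (simp add: u_def)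
    have "(1 + exp (2 * u)) * \<pi> Minus = 1" using tot P by (simp add: sum_spin distrib_right)
    moreover have "1 + exp (2 * u) = exp u * (2 * cosh u)"
    proof -
      have "2 * cosh u = exp u + exp (- u)" by (simp add: cosh_field_def)
      then have "exp u * (2 * cosh u) = exp (u + u) + exp (u + - u)" by (simp only: distrib_left exp_add)
      then show ?thesis by simp
    qed
    ultimately have m: "exp u * (2 * cosh u) * \<pi> Minus = 1" by simp
    have "ln (exp u * (2 * cosh u) * \<pi> Minus) = u + ln (2 * cosh u) + ln (\<pi> Minus)"
      using \<pi>0[of Minus] by (simp add: ln_mult)
    then have M: "ln (\<pi> Minus) = - u - ln (2 * cosh u)" unfolding m by simp
    have "ln (\<pi> Plus) = 2 * u + ln (\<pi> Minus)" using ratio unfolding u_def mult.assoc by linarith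
    then show ?thesis unfolding u_def[symmetric] using M by (cases s) simp_all
  qed
  let ?m = "\<Sum>s\<in>UNIV. \<pi> s * val s"
  have S1: "(\<Sum>s\<in>UNIV. \<pi> s * ln (\<pi> s)) = ?\<kappa> * t * ?m - ln (2 * cosh (?\<kappa> * t))"
  proof -
    have "(\<Sum>s\<in>UNIV. \<pi> s * (a * val s - b)) = a * ?m - (\<Sum>s\<in>UNIV. \<pi> s) * b" for a b
      by (simp add: sum_spin algebra_simps)
    from this[of "?\<kappa> * t" "ln (2 * cosh (?\<kappa> * t))"] show ?thesis unfolding ln_pi tot by simp
  qed
  have S2: "(\<Sum>s\<in>UNIV. \<Sum>s'\<in>UNIV. ?W s s' * ln (?W s s')) = J * ising_corr J t + 2 * t * ?m - ln (edge_norm J t)"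
  proof -
    have "(\<Sum>s\<in>UNIV. \<Sum>s'\<in>UNIV. ?W s s' * ln (?W s s')) = J * (\<Sum>s\<in>UNIV. \<Sum>s'\<in>UNIV. val s * val s' * ?W s s')
       + t * (\<Sum>s\<in>UNIV. (\<Sum>s'\<in>UNIV. ?W s s') * val s) + t * (\<Sum>s\<in>UNIV. \<Sum>s'\<in>UNIV. ?W s s' * val s') - (\<Sum>s\<in>UNIV. \<Sum>s'\<in>UNIV. ?W s s') * ln (edge_norm J t)"
      unfolding ln_ising_edge by (simp add: sum_spin algebra_simps)
    also have "(\<Sum>s\<in>UNIV. \<Sum>s'\<in>UNIV. ?W s s' * val s') = ?m"
      unfolding \<pi>_def by (simp add: sum_spin W.W_sym[of Minus Plus] algebra_simps)
    finally show ?thesis unfolding W.W_sum ising_corr_def \<pi>_def by (simp add: algebra_simps)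
  qed
  have r: "r = (k + 1) / 2" using kr by simp
  show ?thesis unfolding S1 S2 bethe_def r using k by (simp add: field_simps)
qed

section \<open>From second moments to high probability\<close>

lemma letter_perm_switch:
  fixes p :: "'a perms"
  assumes p: "p \<in> perm_tuples n" and xy: "x \<in> {1..n}" "y \<in> {1..n}"
  shows "\<exists>S. finite S \<and> card S \<le> 2 \<and> {u. letter_perm (p(i := Transposition.transpose x y \<circ> p i)) a u \<noteq> letter_perm p a u} \<subseteq> S"
proof -
  let ?t = "Transposition.transpose x y"
  have per: "p i permutes {1..n}" using p by (simp add: perm_tuples_def)
  have c2: "card {x, y} \<le> 2" by (cases "x = y") simp_all
  obtain j b where a: "a = (j, b)" by (cases a)
  consider "j \<noteq> i" | "j = i" "b" | "j = i" "\<not> b" by blast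
  then show ?thesis
  proof cases
    case 1
    then show ?thesis using a by (intro exI[of _ "{}"]) (cases b; auto)
  next
    case 2
    have "{u. letter_perm (p(i := ?t \<circ> p i)) a u \<noteq> letter_perm p a u} \<subseteq> inv_into UNIV (p i) ` {x, y}"
    proof
      fix u assume "u \<in> {u. letter_perm (p(i := ?t \<circ> p i)) a u \<noteq> letter_perm p a u}"
      then have "?t (p i u) \<noteq> p i u" using a 2 by simp
      then have "p i u \<in> {x, y}" by (metis insertCI transpose_apply_other)
      moreover have "u = inv_into UNIV (p i) (p i u)" by (simp add: permutes_inverses(2)[OF per])
      ultimately show "u \<in> inv_into UNIV (p i) ` {x, y}" by blast
    qed
    then show ?thesis using le_trans[OF card_image_le c2] by (intro exI[of _ "inv_into UNIV (p i) ` {x, y}"]) auto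
  next
    case 3
    have "{u. letter_perm (p(i := ?t \<circ> p i)) a u \<noteq> letter_perm p a u} \<subseteq> {x, y}"
    proof
      fix u assume u: "u \<in> {u. letter_perm (p(i := ?t \<circ> p i)) a u \<noteq> letter_perm p a u}"
      have "inv_into UNIV (?t \<circ> p i) = inv_into UNIV (p i) \<circ> inv_into UNIV ?t"
        by (rule o_inv_distrib) (auto simp: permutes_bij[OF per])
      then have "inv_into UNIV (p i) (?t u) \<noteq> inv_into UNIV (p i) u" using a 3 u by simp
      then have "?t u \<noteq> u" by auto
      then show "u \<in> {x, y}" by (metis insertCI transpose_apply_other)
    qed
    then show ?thesis using c2 by (intro exI[of _ "{x, y}"]) auto
  qed
qed

text \<open>The transposition alters the action of a letter at no more than two points, and each of
  these is reached from one starting vertex because the letters read before it act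
  injectively.\<close>

lemma word_perm_switch:
  fixes p :: "'a perms"
  assumes p: "p \<in> perm_tuples n" and xy: "x \<in> {1..n}" "y \<in> {1..n}"
  shows "card {v \<in> {1..n}. word_perm (p(i := Transposition.transpose x y \<circ> p i)) w v \<noteq> word_perm p w v} \<le> 2 * length w"
proof (induction w)
  case (Cons a w)
  let ?q = "p(i := Transposition.transpose x y \<circ> p i)"
  obtain S where S: "finite S" "card S \<le> 2" "{u. letter_perm ?q a u \<noteq> letter_perm p a u} \<subseteq> S"
    using letter_perm_switch[OF p xy] by blast
  have inj: "inj_on (word_perm p w) A" for A
    using permutes_inj[OF word_perm_permutes[OF p]] by (rule inj_on_subset) simp
  have "{v \<in> {1..n}. word_perm ?q (a # w) v \<noteq> word_perm p (a # w) v}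
    \<subseteq> {v \<in> {1..n}. word_perm ?q w v \<noteq> word_perm p w v} \<union> {v \<in> {1..n}. word_perm p w v \<in> S}"
  proof
    fix v assume v: "v \<in> {v \<in> {1..n}. word_perm ?q (a # w) v \<noteq> word_perm p (a # w) v}"
    show "v \<in> {v \<in> {1..n}. word_perm ?q w v \<noteq> word_perm p w v} \<union> {v \<in> {1..n}. word_perm p w v \<in> S}"
    proof (cases "word_perm ?q w v = word_perm p w v")
      case True
      then have "letter_perm ?q a (word_perm p w v) \<noteq> letter_perm p a (word_perm p w v)" using v by simp
      then show ?thesis using S(3) v by blast
    qed (use v in simp)
  qed
  then have "card {v \<in> {1..n}. word_perm ?q (a # w) v \<noteq> word_perm p (a # w) v}
    \<le> card ({v \<in> {1..n}. word_perm ?q w v \<noteq> word_perm p w v} \<union> {v \<in> {1..n}. word_perm p w v \<in> S})"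
    by (intro card_mono) auto
  also have "\<dots> \<le> card {v \<in> {1..n}. word_perm ?q w v \<noteq> word_perm p w v} + card {v \<in> {1..n}. word_perm p w v \<in> S}"
    by (rule card_Un_le)
  finally have "card {v \<in> {1..n}. word_perm ?q (a # w) v \<noteq> word_perm p (a # w) v}
    \<le> card {v \<in> {1..n}. word_perm ?q w v \<noteq> word_perm p w v} + card {v \<in> {1..n}. word_perm p w v \<in> S}" .
  moreover have "card {v \<in> {1..n}. word_perm p w v \<in> S} \<le> card S"
    by (rule card_inj_on_le[OF inj]) (use S in auto)
  moreover have "x \<le> 2 * Suc l" if "x \<le> a + b" "b \<le> c" "a \<le> 2 * l" "c \<le> 2" for x a b c l :: nat
    using that by simp
  ultimately show ?case unfolding length_Cons using Cons S(2) by blast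
qed simp

definition tree_dev :: "nat \<Rightarrow> 'a perms \<Rightarrow> (nat \<Rightarrow> spin) \<Rightarrow> 'a letter list set \<Rightarrow> (('a letter list \<Rightarrow> spin) \<Rightarrow> real) \<Rightarrow> real" where
  "tree_dev n p x T w = (\<Sum>\<eta>\<in>(T \<rightarrow>\<^sub>E UNIV). \<bar>real (hits n p x T \<eta>) - real n * w \<eta>\<bar>)"

lemma tree_dev_nonneg [simp]: "tree_dev n p x T w \<ge> 0"
  unfolding tree_dev_def by (intro sum_nonneg) auto

text \<open>Only vertices at which some word acts differently can change their pattern. Each of them
  leaves at most one pattern and enters at most one, hence the factor 2.\<close>

lemma hits_switch:
  fixes p q :: "'a perms" and x :: "nat \<Rightarrow> spin"
  assumes T: "finite T"
  shows "(\<Sum>\<eta>\<in>(T \<rightarrow>\<^sub>E UNIV). \<bar>real (hits n q x T \<eta>) - real (hits n p x T \<eta>)\<bar>)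
    \<le> 2 * (\<Sum>w\<in>T. real (card {v \<in> {1..n}. word_perm q w v \<noteq> word_perm p w v}))"
proof -
  define B where "B = {v \<in> {1..n}. \<exists>w\<in>T. word_perm q w v \<noteq> word_perm p w v}"
  let ?E = "T \<rightarrow>\<^sub>E (UNIV :: spin set)"
  define h where "h f \<eta> = card {v \<in> B. \<forall>w\<in>T. x (word_perm f w v) = \<eta> w}" for f \<eta>
  have fE: "finite ?E" using T by (intro finite_PiE) auto
  have fB: "finite B" by (simp add: B_def)
  have sum_h: "(\<Sum>\<eta>\<in>?E. h f \<eta>) \<le> card B" for f
  proof -
    have "(\<Sum>\<eta>\<in>?E. h f \<eta>) = card (\<Union>\<eta>\<in>?E. {v \<in> B. \<forall>w\<in>T. x (word_perm f w v) = \<eta> w})"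
      unfolding h_def
    proof (subst card_UN_disjoint)
      show "\<forall>\<eta>\<in>?E. \<forall>\<eta>'\<in>?E. \<eta> \<noteq> \<eta>' \<longrightarrow>
        {v \<in> B. \<forall>w\<in>T. x (word_perm f w v) = \<eta> w} \<inter> {v \<in> B. \<forall>w\<in>T. x (word_perm f w v) = \<eta>' w} = {}"
      proof (intro ballI impI)
        fix \<eta> \<eta>' :: "'a letter list \<Rightarrow> spin" assume "\<eta> \<in> ?E" "\<eta>' \<in> ?E" "\<eta> \<noteq> \<eta>'"
        then obtain w where "w \<in> T" "\<eta> w \<noteq> \<eta>' w" by (meson PiE_ext)
        then show "{v \<in> B. \<forall>w\<in>T. x (word_perm f w v) = \<eta> w} \<inter> {v \<in> B. \<forall>w\<in>T. x (word_perm f w v) = \<eta>' w} = {}"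
          by auto
      qed
    qed (use fE fB in auto)
    also have "\<dots> \<le> card B" by (intro card_mono fB) auto
    finally show ?thesis .
  qed
  have diff: "\<bar>real (hits n q x T \<eta>) - real (hits n p x T \<eta>)\<bar> \<le> real (h q \<eta>) + real (h p \<eta>)" for \<eta>
  proof -
    have le: "hits n f x T \<eta> \<le> hits n g x T \<eta> + h f \<eta>" if fg: "\<And>v w. v \<in> {1..n} - B \<Longrightarrow> w \<in> T \<Longrightarrow> word_perm f w v = word_perm g w v" for f g
    proof -
      have "{v \<in> {1..n}. \<forall>w\<in>T. x (word_perm f w v) = \<eta> w} \<subseteq> {v \<in> {1..n}. \<forall>w\<in>T. x (word_perm g w v) = \<eta> w} \<union> {v \<in> B. \<forall>w\<in>T. x (word_perm f w v) = \<eta> w}"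
        using fg by auto
      then have "hits n f x T \<eta> \<le> card ({v \<in> {1..n}. \<forall>w\<in>T. x (word_perm g w v) = \<eta> w} \<union> {v \<in> B. \<forall>w\<in>T. x (word_perm f w v) = \<eta> w})"
        unfolding hits_def using fB by (intro card_mono) auto
      also have "\<dots> \<le> hits n g x T \<eta> + h f \<eta>" unfolding hits_def h_def by (rule card_Un_le)
      finally show ?thesis .
    qed
    have "hits n q x T \<eta> \<le> hits n p x T \<eta> + h q \<eta>" "hits n p x T \<eta> \<le> hits n q x T \<eta> + h p \<eta>"
      by (rule le; simp add: B_def; fastforce)+
    then show ?thesis by linarith
  qed
  have "(\<Sum>\<eta>\<in>?E. \<bar>real (hits n q x T \<eta>) - real (hits n p x T \<eta>)\<bar>) \<le> (\<Sum>\<eta>\<in>?E. real (h q \<eta>) + real (h p \<eta>))"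
    by (intro sum_mono diff)
  also have "\<dots> = real ((\<Sum>\<eta>\<in>?E. h q \<eta>) + (\<Sum>\<eta>\<in>?E. h p \<eta>))" by (simp add: sum.distrib)
  also have "\<dots> \<le> real (2 * card B)" using sum_h[of q] sum_h[of p] by (intro of_nat_mono) simp
  also have "card B \<le> (\<Sum>w\<in>T. card {v \<in> {1..n}. word_perm q w v \<noteq> word_perm p w v})"
  proof -
    have "B = (\<Union>w\<in>T. {v \<in> {1..n}. word_perm q w v \<noteq> word_perm p w v})" by (auto simp: B_def)
    then show ?thesis using card_UN_le[OF T] by simp
  qed
  finally show ?thesis by simp
qed

lemma tree_dev_switch:
  fixes p :: "'a perms"
  assumes T: "finite T" and p: "p \<in> perm_tuples n" and xy: "u \<in> {1..n}" "v \<in> {1..n}"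
  shows "\<bar>tree_dev n (p(i := Transposition.transpose u v \<circ> p i)) x T w - tree_dev n p x T w\<bar> \<le> 4 * (\<Sum>w\<in>T. real (length w))"
proof -
  let ?q = "p(i := Transposition.transpose u v \<circ> p i)"
  have "\<bar>tree_dev n ?q x T w - tree_dev n p x T w\<bar>
    = \<bar>\<Sum>\<eta>\<in>(T \<rightarrow>\<^sub>E UNIV). \<bar>real (hits n ?q x T \<eta>) - real n * w \<eta>\<bar> - \<bar>real (hits n p x T \<eta>) - real n * w \<eta>\<bar>\<bar>"
    by (simp add: tree_dev_def sum_subtractf)
  also have "\<dots> \<le> (\<Sum>\<eta>\<in>(T \<rightarrow>\<^sub>E UNIV). \<bar>real (hits n ?q x T \<eta>) - real (hits n p x T \<eta>)\<bar>)"
    by (rule order_trans[OF sum_abs sum_mono]) linarith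
  also have "\<dots> \<le> 2 * (\<Sum>w\<in>T. real (card {v' \<in> {1..n}. word_perm ?q w v' \<noteq> word_perm p w v'}))"
    by (rule hits_switch[OF T])
  also have "\<dots> \<le> 2 * (\<Sum>w\<in>T. real (2 * length w))"
    using word_perm_switch[OF p xy] by (intro mult_left_mono sum_mono of_nat_mono) auto
  also have "\<dots> = 4 * (\<Sum>w\<in>T. real (length w))" by (simp add: sum_distrib_left[symmetric])
  finally show ?thesis .
qed

text \<open>
  A soft version of the number of good labellings: unlike that number it is never zero, and its logarithm
  changes by a bounded amount when a permutation is composed with a transposition.
\<close>

definition soft_count :: "real \<Rightarrow> nat \<Rightarrow> 'a letter list set \<Rightarrow> (('a letter list \<Rightarrow> spin) \<Rightarrow> real) \<Rightarrow> 'a perms \<Rightarrow> real" where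
  "soft_count \<beta> n T w p = (\<Sum>x\<in>confs n. exp (- \<beta> * tree_dev n p x T w))"

lemma confs_nonempty: "(confs n :: (nat \<Rightarrow> spin) set) \<noteq> {}"
  unfolding confs_def by (auto simp: PiE_eq_empty_iff)

lemma soft_count_pos: "soft_count \<beta> n T w p > 0"
  unfolding soft_count_def by (intro sum_pos confs_nonempty) auto

lemma soft_count_switch:
  fixes p :: "'a perms"
  assumes T: "finite T" and \<beta>: "\<beta> \<ge> 0" and p: "p \<in> perm_tuples n" and xy: "u \<in> {1..n}" "v \<in> {1..n}"
  shows "\<bar>ln (soft_count \<beta> n T w (p(i := Transposition.transpose u v \<circ> p i))) - ln (soft_count \<beta> n T w p)\<bar>
    \<le> \<beta> * (4 * (\<Sum>w\<in>T. real (length w)))"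
proof -
  let ?q = "p(i := Transposition.transpose u v \<circ> p i)"
  let ?L = "4 * (\<Sum>w\<in>T. real (length w))"
  have le: "ln (soft_count \<beta> n T w f) \<le> ln (soft_count \<beta> n T w g) + \<beta> * ?L"
    if "\<And>x. tree_dev n g x T w \<le> tree_dev n f x T w + ?L" for f g
  proof -
    have "soft_count \<beta> n T w f \<le> (\<Sum>x\<in>confs n. exp (- \<beta> * tree_dev n g x T w) * exp (\<beta> * ?L))"
      unfolding soft_count_def
    proof (rule sum_mono)
      fix x
      have "\<beta> * tree_dev n g x T w \<le> \<beta> * (tree_dev n f x T w + ?L)" using that \<beta> by (rule mult_left_mono)
      then show "exp (- \<beta> * tree_dev n f x T w) \<le> exp (- \<beta> * tree_dev n g x T w) * exp (\<beta> * ?L)"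
        unfolding exp_add[symmetric] exp_le_cancel_iff by (simp only: distrib_left)
    qed
    also have "\<dots> = soft_count \<beta> n T w g * exp (\<beta> * ?L)" by (simp add: soft_count_def sum_distrib_right)
    finally have "ln (soft_count \<beta> n T w f) \<le> ln (soft_count \<beta> n T w g * exp (\<beta> * ?L))"
      using soft_count_pos[of \<beta> n T w f] by simp
    also have "\<dots> = ln (soft_count \<beta> n T w g) + \<beta> * ?L"
      using soft_count_pos[of \<beta> n T w g] by (subst ln_mult_pos) auto
    finally show ?thesis .
  qed
  have d: "\<bar>tree_dev n ?q x T w - tree_dev n p x T w\<bar> \<le> ?L" for x by (rule tree_dev_switch[OF T p xy])
  have "ln (soft_count \<beta> n T w ?q) \<le> ln (soft_count \<beta> n T w p) + \<beta> * ?L" by (rule le) (use d in \<open>smt (verit)\<close>)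
  moreover have "ln (soft_count \<beta> n T w p) \<le> ln (soft_count \<beta> n T w ?q) + \<beta> * ?L" by (rule le) (use d in \<open>smt (verit)\<close>)
  ultimately show ?thesis by (simp add: abs_le_iff)
qed

text \<open>Each labelling with deviation at least \<open>R\<close> weighs at most
  \<open>exp (- \<beta> * R)\<close>, and there are at most \<open>2 ^ n\<close> of them. A large
  \<open>\<beta>\<close> makes their share negligible.\<close>

lemma soft_count_upper:
  assumes \<beta>: "\<beta> \<ge> 0"
  shows "soft_count \<beta> n T w p \<le> real (card {x \<in> confs n. tree_dev n p x T w < R}) + 2 ^ n * exp (- \<beta> * R)"
proof -
  have "soft_count \<beta> n T w p \<le> (\<Sum>x\<in>confs n. (if tree_dev n p x T w < R then 1 else 0) + exp (- \<beta> * R))"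
    unfolding soft_count_def
  proof (rule sum_mono)
    fix x
    show "exp (- \<beta> * tree_dev n p x T w) \<le> (if tree_dev n p x T w < R then 1 else 0) + exp (- \<beta> * R)"
    proof (cases "tree_dev n p x T w < R")
      case True
      have "- \<beta> * tree_dev n p x T w \<le> 0" using \<beta> by simp
      then have "exp (- \<beta> * tree_dev n p x T w) \<le> 1" by (simp only: exp_le_one_iff)
      then show ?thesis using True by (simp add: add_increasing2)
    qed (use \<beta> in \<open>simp add: mult_left_mono\<close>)
  qed
  also have "\<dots> = real (card {x \<in> confs n. tree_dev n p x T w < R}) + 2 ^ n * exp (- \<beta> * R)"
    by (simp add: sum.distrib sum.If_cases card_confs Int_def UNIV_spin)
  finally show ?thesis .
qed

lemma soft_count_lower:
  assumes \<beta>: "\<beta> \<ge> 0"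
  shows "real (card {x \<in> confs n. Q x \<and> tree_dev n p x T w \<le> R}) * exp (- \<beta> * R) \<le> soft_count \<beta> n T w p"
proof -
  have "real (card {x \<in> confs n. Q x \<and> tree_dev n p x T w \<le> R}) * exp (- \<beta> * R) = (\<Sum>x\<in>{x \<in> confs n. Q x \<and> tree_dev n p x T w \<le> R}. exp (- \<beta> * R))"
    by simp
  also have "\<dots> \<le> (\<Sum>x\<in>{x \<in> confs n. Q x \<and> tree_dev n p x T w \<le> R}. exp (- \<beta> * tree_dev n p x T w))"
    using \<beta> by (intro sum_mono) (auto intro: mult_left_mono)
  also have "\<dots> \<le> soft_count \<beta> n T w p"
    unfolding soft_count_def by (intro sum_mono2) auto
  finally show ?thesis .
qed

section \<open>Tail bounds for fractions of tuples\<close>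

definition tuple_frac :: "nat \<Rightarrow> ('a::finite perms \<Rightarrow> bool) \<Rightarrow> real" where
  "tuple_frac n Q = real (card {p \<in> perm_tuples n. Q p}) / real (card (perm_tuples n :: 'a perms set))"

lemma tuple_frac_nonneg [simp]: "tuple_frac n Q \<ge> 0"
  by (simp add: tuple_frac_def)

lemma tuple_frac_mono:
  assumes "\<And>p. p \<in> perm_tuples n \<Longrightarrow> Q p \<Longrightarrow> Q' p"
  shows "tuple_frac n Q \<le> tuple_frac n Q'"
  unfolding tuple_frac_def using assms by (intro divide_right_mono of_nat_mono card_mono) auto

lemma tuple_frac_not: "tuple_frac n (\<lambda>p :: 'a::finite \<Rightarrow> _. \<not> Q p) = 1 - tuple_frac n Q"
proof -
  let ?P = "perm_tuples n :: 'a perms set"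
  have "{p \<in> ?P. Q p} \<union> {p \<in> ?P. \<not> Q p} = ?P" by blast
  moreover have "card ({p \<in> ?P. Q p} \<union> {p \<in> ?P. \<not> Q p}) = card {p \<in> ?P. Q p} + card {p \<in> ?P. \<not> Q p}"
    by (rule card_Un_disjoint) auto
  ultimately have "real (card {p \<in> ?P. \<not> Q p}) = real (card ?P) - real (card {p \<in> ?P. Q p})" by simp
  then show ?thesis by (simp add: tuple_frac_def diff_divide_distrib card_perm_tuples_pos[THEN less_imp_neq, symmetric])
qed

lemma tuple_frac_disj: "tuple_frac n (\<lambda>p. Q p \<or> Q' p) \<le> tuple_frac n Q + tuple_frac n Q'"
proof -
  have "{p \<in> perm_tuples n. Q p \<or> Q' p} = {p \<in> perm_tuples n. Q p} \<union> {p \<in> perm_tuples n. Q' p}" by blast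
  then show ?thesis unfolding tuple_frac_def add_divide_distrib[symmetric] of_nat_add[symmetric]
    by (simp only:) (intro divide_right_mono of_nat_mono card_Un_le, simp)
qed

lemma tuple_frac_markov:
  assumes "\<And>p. p \<in> perm_tuples n \<Longrightarrow> f p \<ge> 0" and "a > 0"
  shows "tuple_frac n (\<lambda>p. f p \<ge> a) \<le> tuple_avg n f / a"
proof -
  have "real (card {p \<in> perm_tuples n. f p \<ge> a}) * a = (\<Sum>p\<in>{p \<in> perm_tuples n. f p \<ge> a}. a)" by simp
  also have "\<dots> \<le> (\<Sum>p\<in>{p \<in> perm_tuples n. f p \<ge> a}. f p)" by (intro sum_mono) auto
  also have "\<dots> \<le> (\<Sum>p\<in>perm_tuples n. f p)" using assms by (intro sum_mono2) auto
  finally show ?thesis using assms(2) unfolding tuple_frac_def tuple_avg_def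
    by (simp add: pos_le_divide_eq divide_right_mono)
qed

text \<open>The part of \<open>f\<close> below half its mean carries at most half the mean. The
  Cauchy-Schwarz inequality bounds the rest by the size of the event and the second moment.\<close>

lemma paley_zygmund_half:
  fixes f :: "'a::finite perms \<Rightarrow> real"
  assumes "\<And>p. p \<in> perm_tuples n \<Longrightarrow> f p \<ge> 0"
  shows "(tuple_avg n f)\<^sup>2 / 4 \<le> tuple_frac n (\<lambda>p. f p \<ge> tuple_avg n f / 2) * tuple_avg n (\<lambda>p. (f p)\<^sup>2)"
proof -
  let ?P = "perm_tuples n :: 'a perms set" and ?a = "tuple_avg n f"
  let ?c = "real (card ?P)"
  have c: "?c > 0" by simp
  let ?A = "{p \<in> ?P. f p \<ge> ?a / 2}"
  have a0: "?a \<ge> 0" using assms by (rule tuple_avg_nonneg)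
  have "?a * ?c = (\<Sum>p\<in>?P. f p)" using c by (simp add: tuple_avg_def)
  also have "\<dots> \<le> (\<Sum>p\<in>?P. (if f p \<ge> ?a / 2 then 1 else 0) * f p + ?a / 2)"
    using assms a0 by (intro sum_mono) auto
  also have "\<dots> = (\<Sum>p\<in>?P. (if f p \<ge> ?a / 2 then 1 else 0) * f p) + ?a * ?c / 2"
    by (simp add: sum.distrib)
  finally have "?a * ?c / 2 \<le> (\<Sum>p\<in>?P. (if f p \<ge> ?a / 2 then 1 else 0) * f p)" by simp
  then have "(?a * ?c / 2)\<^sup>2 \<le> (\<Sum>p\<in>?P. (if f p \<ge> ?a / 2 then 1 else 0) * f p)\<^sup>2"
    using a0 by (intro power_mono) auto
  also have "\<dots> \<le> (\<Sum>p\<in>?P. (if f p \<ge> ?a / 2 then 1 else 0)\<^sup>2) * (\<Sum>p\<in>?P. (f p)\<^sup>2)"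
    by (rule Cauchy_Schwarz_ineq_sum)
  also have "(\<Sum>p\<in>?P. (if f p \<ge> ?a / 2 then 1 else 0)\<^sup>2) = real (card ?A)"
    by (simp add: if_distrib[of "\<lambda>x. x\<^sup>2"] sum.If_cases Int_def cong: if_cong)
  finally have "(?a)\<^sup>2 / 4 * (?c * ?c) \<le> real (card ?A) * (\<Sum>p\<in>?P. (f p)\<^sup>2)"
    by (simp add: power2_eq_square mult_ac)
  then have "(?a)\<^sup>2 / 4 \<le> real (card ?A) * (\<Sum>p\<in>?P. (f p)\<^sup>2) / (?c * ?c)"
    using c by (simp add: pos_le_divide_eq)
  also have "\<dots> = tuple_frac n (\<lambda>p. f p \<ge> ?a / 2) * tuple_avg n (\<lambda>p. (f p)\<^sup>2)"
    by (simp add: tuple_frac_def tuple_avg_def)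
  finally show ?thesis .
qed

lemma tuple_frac_concentration:
  fixes f :: "'a::finite perms \<Rightarrow> real"
  assumes "c > 0" "s > 0"
    and lip: "\<And>p i x y. p \<in> perm_tuples n \<Longrightarrow> x \<in> {1..n} \<Longrightarrow> y \<in> {1..n} \<Longrightarrow>
      \<bar>f (p(i := Transposition.transpose x y \<circ> p i)) - f p\<bar> \<le> c"
  shows "tuple_frac n (\<lambda>p. f p \<ge> tuple_avg n f + s * real n) \<le> exp (- (s\<^sup>2 / (16 * c\<^sup>2 * real CARD('a))) * real n)"
    and "tuple_frac n (\<lambda>p. f p \<le> tuple_avg n f - s * real n) \<le> exp (- (s\<^sup>2 / (16 * c\<^sup>2 * real CARD('a))) * real n)"
proof -
  have c: "real (card (perm_tuples n :: 'a perms set)) > 0" by simp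
  show "tuple_frac n (\<lambda>p. f p \<ge> tuple_avg n f + s * real n) \<le> exp (- (s\<^sup>2 / (16 * c\<^sup>2 * real CARD('a))) * real n)"
    using tuple_concentration[where f = f and n = n, OF assms(1,2) lip] c
    unfolding tuple_frac_def by (simp add: divide_le_eq mult.commute)
  have m: "tuple_avg n (\<lambda>p. - f p) = - tuple_avg n f" by (simp add: tuple_avg_def sum_negf)
  have e: "- f p \<ge> - tuple_avg n f + s * real n \<longleftrightarrow> f p \<le> tuple_avg n f - s * real n" for p by linarith
  have "real (card {p \<in> perm_tuples n. - f p \<ge> tuple_avg n (\<lambda>p. - f p) + s * real n})
     \<le> real (card (perm_tuples n :: 'a perms set)) * exp (- (s\<^sup>2 / (16 * c\<^sup>2 * real CARD('a))) * real n)"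
    by (rule tuple_concentration[OF assms(1,2)]) (use lip in \<open>simp add: abs_minus_commute\<close>)
  then show "tuple_frac n (\<lambda>p. f p \<le> tuple_avg n f - s * real n) \<le> exp (- (s\<^sup>2 / (16 * c\<^sup>2 * real CARD('a))) * real n)"
    unfolding m e using c unfolding tuple_frac_def by (simp add: divide_le_eq mult.commute)
qed

text \<open>
  The second moment method only gives an exponentially small lower bound on the probability of having many
  good labellings. Concentration of the logarithm of the soft count turns it into a bound of probability close to 1.
\<close>

lemma good_labellings_many:
  fixes w :: "('a::finite letter list \<Rightarrow> spin) \<Rightarrow> real" and N :: "nat \<Rightarrow> spin \<Rightarrow> spin \<Rightarrow> nat" and F :: real
  defines "Z \<equiv> \<lambda>n (p :: 'a \<Rightarrow> nat \<Rightarrow> nat). real (card {x \<in> confs n. typed n (\<lambda>_. N n) p x})"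
  assumes T: "word_tree T" and \<epsilon>0: "\<epsilon>0 > 0" and \<epsilon>1: "\<epsilon>1 > 0"
    and first: "\<And>\<epsilon>. \<epsilon> > 0 \<Longrightarrow> \<forall>\<^sub>F n in sequentially. tuple_avg n (Z n) \<ge> exp (real n * (F - \<epsilon>))"
    and second: "\<And>\<epsilon>. \<epsilon> > 0 \<Longrightarrow> \<forall>\<^sub>F n in sequentially. tuple_avg n (\<lambda>p. (Z n p)\<^sup>2) \<le> exp (real n * (2 * F + \<epsilon>))"
    and near: "\<And>\<delta>. \<delta> > 0 \<Longrightarrow> \<forall>\<^sub>F n in sequentially.
      tuple_avg n (\<lambda>p. real (card {x \<in> confs n. typed n (\<lambda>_. N n) p x \<and> tree_dev n p x T w \<le> \<delta> * real n})) \<ge> tuple_avg n (Z n) / 2"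
  shows "(\<lambda>n. tuple_frac n (\<lambda>p. \<not> real (card {x \<in> confs n. tree_dev n p x T w < \<epsilon>0 * real n}) \<ge> exp (real n * (F - \<epsilon>1)))) \<longlonglongrightarrow> 0"
proof -
  let ?r = "real CARD('a)"
  define L where "L = 4 * (\<Sum>w\<in>T. real (length w)) + 1"
  \<comment> \<open>Large enough that all labellings with deviation at least
    \<open>\<epsilon>0 * n\<close> together weigh at most
    \<open>exp (n * (F - \<epsilon>1))\<close>.\<close>
  define \<beta> where "\<beta> = max 1 ((ln 2 - F + \<epsilon>1) / \<epsilon>0)"
  define s where "s = \<epsilon>1 / 16"
  define \<gamma> where "\<gamma> = s\<^sup>2 / (16 * (\<beta> * L)\<^sup>2 * ?r)"
  \<comment> \<open>The second moment loses \<open>3 * \<epsilon>\<close> in the exponent, which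
    must stay below the rate \<open>\<gamma>\<close> of concentration.\<close>
  define \<epsilon> where "\<epsilon> = min s (\<gamma> / 4)"
  \<comment> \<open>A deviation of \<open>\<delta> * n\<close> lowers the logarithm of the soft
    count by only \<open>s * n\<close>.\<close>
  define \<delta> where "\<delta> = s / \<beta>"
  have fT: "finite T" using T by (simp add: word_tree_def)
  have L: "L \<ge> 1" by (simp add: L_def sum_nonneg)
  have \<beta>: "\<beta> \<ge> 1" "\<beta> > 0" by (simp_all add: \<beta>_def)
  have \<beta>\<epsilon>: "ln 2 - \<beta> * \<epsilon>0 \<le> F - \<epsilon>1"
  proof -
    have "(ln 2 - F + \<epsilon>1) / \<epsilon>0 \<le> \<beta>" by (simp add: \<beta>_def)
    then have "ln 2 - F + \<epsilon>1 \<le> \<beta> * \<epsilon>0" using \<epsilon>0 by (simp only: pos_divide_le_eq)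
    then show ?thesis by linarith
  qed
  have s: "s > 0" using \<epsilon>1 by (simp add: s_def)
  have \<gamma>: "\<gamma> > 0" using s \<beta> L by (simp add: \<gamma>_def)
  have \<epsilon>: "\<epsilon> > 0" "\<epsilon> \<le> s" "\<epsilon> \<le> \<gamma> / 4" using s \<gamma> by (simp_all add: \<epsilon>_def)
  have \<delta>: "\<delta> > 0" "\<beta> * \<delta> = s" using s \<beta> by (simp_all add: \<delta>_def)
  define Y where "Y n p = soft_count \<beta> n T w p" for n and p :: "'a perms"
  have lip: "\<bar>ln (Y n (p(i := Transposition.transpose x y \<circ> p i))) - ln (Y n p)\<bar> \<le> \<beta> * L"
    if "p \<in> perm_tuples n" "x \<in> {1..n}" "y \<in> {1..n}" for n p i x y
  proof -
    have "\<beta> * (4 * (\<Sum>w\<in>T. real (length w))) \<le> \<beta> * L" unfolding L_def using \<beta> by (intro mult_left_mono) auto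
    then show ?thesis using soft_count_switch[OF fT less_imp_le[OF \<beta>(2)] that] unfolding Y_def by (rule order_trans[rotated])
  qed
  have bL: "\<beta> * L > 0" using \<beta> L by simp
  note conc = tuple_frac_concentration[where f = "\<lambda>p. ln (Y _ p)" and c = "\<beta> * L" and s = s, OF bL s lip]
  have ev1: "\<forall>\<^sub>F n in sequentially. exp (- \<gamma> * real n) < exp (- 3 * (\<gamma> / 4) * real n) / 16"
    using \<gamma> by real_asymp
  have ev2: "\<forall>\<^sub>F n in sequentially. ln 4 < s * real n"
    using s by real_asymp
  have ev3: "\<forall>\<^sub>F n in sequentially. ln 8 < \<epsilon>1 / 2 * real n"
    using \<epsilon>1 by real_asymp
  have "\<forall>\<^sub>F n in sequentially. tuple_frac n (\<lambda>p. \<not> real (card {x \<in> confs n. tree_dev n p x T w < \<epsilon>0 * real n}) \<ge> exp (real n * (F - \<epsilon>1)))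
      \<le> exp (- \<gamma> * real n)"
    using first[OF \<epsilon>(1)] second[OF \<epsilon>(1)] near[OF \<delta>(1)] ev1 ev2 ev3
  proof eventually_elim
    case (elim n)
    let ?n = "real n"
    define Q where "Q p = real (card {x \<in> confs n. typed n (\<lambda>_. N n) p x \<and> tree_dev n p x T w \<le> \<delta> * ?n})" for p :: "'a perms"
    let ?A = "tuple_avg n Q"
    have Q0: "Q p \<ge> 0" for p by (simp add: Q_def)
    have A1: "?A \<ge> exp (?n * (F - \<epsilon>)) / 2" using elim(1,3) unfolding Q_def by linarith
    have Q2: "tuple_avg n (\<lambda>p. (Q p)\<^sup>2) \<le> exp (?n * (2 * F + \<epsilon>))"
    proof -
      have "tuple_avg n (\<lambda>p. (Q p)\<^sup>2) \<le> tuple_avg n (\<lambda>p. (Z n p)\<^sup>2)"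
      proof (rule tuple_avg_mono)
        fix p :: "'a perms"
        have "Q p \<le> Z n p" unfolding Q_def Z_def by (intro of_nat_mono card_mono) auto
        then show "(Q p)\<^sup>2 \<le> (Z n p)\<^sup>2" using Q0 by (intro power_mono) auto
      qed
      then show ?thesis using elim(2) by linarith
    qed
    let ?G = "tuple_frac n (\<lambda>p. Q p \<ge> ?A / 2)"
    \<comment> \<open>The exponent is \<open>2 * (F - \<epsilon>) - (2 * F + \<epsilon>)\<close>.
      The 16 combines the half in \<open>A1\<close>, squared, with the 4 of
      \<open>paley_zygmund_half\<close>.\<close>
    have "exp (- 3 * \<epsilon> * ?n) / 16 \<le> ?G"
    proof -
      have "exp (?n * (F - \<epsilon>)) ^ 2 / 16 \<le> ?A\<^sup>2 / 4"
      proof -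
        have "(exp (?n * (F - \<epsilon>)) / 2)\<^sup>2 \<le> ?A\<^sup>2" using A1 by (intro power_mono) auto
        then show ?thesis by (simp add: power_divide)
      qed
      also have "\<dots> \<le> ?G * tuple_avg n (\<lambda>p. (Q p)\<^sup>2)" by (rule paley_zygmund_half) (rule Q0)
      also have "\<dots> \<le> ?G * exp (?n * (2 * F + \<epsilon>))" using Q2 by (intro mult_left_mono) auto
      finally have "exp (?n * (F - \<epsilon>)) ^ 2 / 16 \<le> ?G * exp (?n * (2 * F + \<epsilon>))" .
      moreover have "exp (?n * (F - \<epsilon>)) ^ 2 = exp (- 3 * \<epsilon> * ?n) * exp (?n * (2 * F + \<epsilon>))"
        unfolding exp_add[symmetric] power2_eq_square by (simp add: algebra_simps)
      ultimately have "exp (- 3 * \<epsilon> * ?n) / 16 * exp (?n * (2 * F + \<epsilon>)) \<le> ?G * exp (?n * (2 * F + \<epsilon>))" by simp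
      then show ?thesis by (rule mult_right_le_imp_le) simp
    qed
    moreover have "exp (- 3 * (\<gamma> / 4) * ?n) \<le> exp (- 3 * \<epsilon> * ?n)"
      using mult_right_mono[OF \<epsilon>(3), of ?n] by simp
    ultimately have G: "exp (- \<gamma> * ?n) < ?G" using elim(4) by linarith
    have lnY: "ln (Y n p) \<ge> ?n * (F - \<epsilon> - s) - ln 4" if "Q p \<ge> ?A / 2" for p
    proof -
      have "exp (?n * (F - \<epsilon> - s) - ln 4) = exp (?n * (F - \<epsilon>)) / 4 * exp (- \<beta> * (\<delta> * ?n))"
      proof -
        have "?n * (F - \<epsilon> - s) - ln 4 = ?n * (F - \<epsilon>) + - ln 4 + - \<beta> * (\<delta> * ?n)"
          unfolding mult_minus_left mult.assoc[symmetric, of \<beta> \<delta>] \<delta>(2) by (simp add: algebra_simps)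
        moreover have "exp (- ln (4 :: real)) = 1 / 4" by (simp add: exp_minus)
        ultimately show ?thesis by (simp only: exp_add)
      qed
      also have "\<dots> \<le> Q p * exp (- \<beta> * (\<delta> * ?n))" using that A1 by (intro mult_right_mono) auto
      also have "\<dots> \<le> Y n p" unfolding Q_def Y_def by (rule soft_count_lower) (use \<beta> in simp)
      finally have "exp (?n * (F - \<epsilon> - s) - ln 4) \<le> Y n p" .
      then have "ln (exp (?n * (F - \<epsilon> - s) - ln 4)) \<le> ln (Y n p)" by (intro ln_mono) auto
      then show ?thesis by simp
    qed
    define m where "m = tuple_avg n (\<lambda>p. ln (Y n p))"
    \<comment> \<open>Were the mean lower, the event of probability \<open>?G\<close> would lie in
      the upper tail, whose probability is at most \<open>exp (- \<gamma> * n)\<close> and thus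
      smaller than \<open>?G\<close>.\<close>
    have m: "m + s * ?n > ?n * (F - \<epsilon> - s) - ln 4"
    proof (rule ccontr)
      assume "\<not> m + s * ?n > ?n * (F - \<epsilon> - s) - ln 4"
      then have "?G \<le> tuple_frac n (\<lambda>p. ln (Y n p) \<ge> m + s * ?n)"
        using lnY by (intro tuple_frac_mono) force
      also have "\<dots> \<le> exp (- \<gamma> * ?n)"
        unfolding m_def \<gamma>_def using conc(1)[of n] by simp
      finally show False using G by linarith
    qed
    have "tuple_frac n (\<lambda>p. \<not> real (card {x \<in> confs n. tree_dev n p x T w < \<epsilon>0 * ?n}) \<ge> exp (?n * (F - \<epsilon>1)))
      \<le> tuple_frac n (\<lambda>p. ln (Y n p) \<le> m - s * ?n)"
    proof (rule tuple_frac_mono, rule ccontr)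
      fix p :: "'a perms"
      let ?C = "real (card {x \<in> confs n. tree_dev n p x T w < \<epsilon>0 * ?n})"
      assume small: "\<not> ?C \<ge> exp (?n * (F - \<epsilon>1))" and big: "\<not> ln (Y n p) \<le> m - s * ?n"
      have Y0: "Y n p > 0" unfolding Y_def by (rule soft_count_pos)
      have "Y n p \<le> ?C + 2 ^ n * exp (- \<beta> * (\<epsilon>0 * ?n))"
        unfolding Y_def by (rule soft_count_upper) (use \<beta> in simp)
      also have "2 ^ n * exp (- \<beta> * (\<epsilon>0 * ?n)) = exp (?n * (ln 2 - \<beta> * \<epsilon>0))"
      proof -
        have "(2 :: real) ^ n = exp (?n * ln 2)" by (simp add: exp_of_nat_mult)
        then show ?thesis unfolding right_diff_distrib by (simp add: exp_diff exp_minus field_simps)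
      qed
      also have "\<dots> \<le> exp (?n * (F - \<epsilon>1))" using \<beta>\<epsilon> by (simp add: mult_left_mono)
      finally have "Y n p \<le> 2 * exp (?n * (F - \<epsilon>1))" using small by simp
      then have "ln (Y n p) \<le> ln (2 * exp (?n * (F - \<epsilon>1)))" using Y0 by simp
      also have "\<dots> = ln 2 + ?n * (F - \<epsilon>1)" by (subst ln_mult_pos) auto
      finally have up: "ln (Y n p) \<le> ln 2 + ?n * (F - \<epsilon>1)" .
      have "ln (8 :: real) = ln 2 + ln 4" using ln_mult_pos[of 2 "4 :: real"] by simp
      moreover have "?n * (F - \<epsilon> - s) \<ge> ?n * F - 2 * (s * ?n)"
      proof -
        have "\<epsilon> * ?n \<le> s * ?n" using \<epsilon>(2) by (intro mult_right_mono) auto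
        moreover have "?n * (F - \<epsilon> - s) = ?n * F - \<epsilon> * ?n - s * ?n" by (simp add: algebra_simps)
        ultimately show ?thesis by linarith
      qed
      moreover have "ln (8 :: real) > 0" by simp
      moreover have "s * ?n = \<epsilon>1 * ?n / 16" by (simp add: s_def)
      moreover have "?n * (F - \<epsilon>1) = ?n * F - \<epsilon>1 * ?n" by (simp add: algebra_simps)
      ultimately show False using big m up elim(6) by linarith
    qed
    also have "\<dots> \<le> exp (- \<gamma> * ?n)"
      unfolding m_def \<gamma>_def using conc(2)[of n] by simp
    finally show ?case .
  qed
  moreover have "(\<lambda>n. exp (- \<gamma> * real n)) \<longlonglongrightarrow> 0" using \<gamma> by real_asymp
  ultimately show ?thesis by (rule tendsto_sandwich[OF _ _ tendsto_const, rotated]) simp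
qed

section \<open>Entropies along good homomorphisms\<close>

definition whp :: "(nat \<Rightarrow> 'a::finite perms \<Rightarrow> bool) \<Rightarrow> bool" where
  "whp E \<longleftrightarrow> (\<lambda>n. tuple_frac n (\<lambda>p. \<not> E n p)) \<longlonglongrightarrow> 0"

lemma whp_conj: "whp E \<Longrightarrow> whp E' \<Longrightarrow> whp (\<lambda>n p. E n p \<and> E' n p)"
proof -
  assume E: "whp E" "whp E'"
  have "(\<lambda>n. tuple_frac n (\<lambda>p. \<not> E n p) + tuple_frac n (\<lambda>p. \<not> E' n p)) \<longlonglongrightarrow> 0 + 0"
    using E unfolding whp_def by (intro tendsto_add)
  then have lim: "(\<lambda>n. tuple_frac n (\<lambda>p. \<not> E n p) + tuple_frac n (\<lambda>p. \<not> E' n p)) \<longlonglongrightarrow> 0" by simp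
  show ?thesis unfolding whp_def
  proof (rule tendsto_sandwich[OF _ _ tendsto_const lim])
    have "tuple_frac n (\<lambda>p. \<not> (E n p \<and> E' n p)) \<le> tuple_frac n (\<lambda>p. \<not> E n p \<or> \<not> E' n p)" for n
      by (rule tuple_frac_mono) blast
    then show "\<forall>\<^sub>F n in sequentially. tuple_frac n (\<lambda>p. \<not> (E n p \<and> E' n p)) \<le> tuple_frac n (\<lambda>p. \<not> E n p) + tuple_frac n (\<lambda>p. \<not> E' n p)"
      by (intro always_eventually allI order_trans[OF _ tuple_frac_disj])
  qed simp
qed

lemma tuple_frac_union:
  fixes Q :: "nat \<Rightarrow> 'a::finite perms \<Rightarrow> bool"
  shows "tuple_frac n (\<lambda>p. \<exists>j\<le>k. Q j p) \<le> (\<Sum>j\<le>k. tuple_frac n (Q j))"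
proof (induction k)
  case (Suc k)
  have "tuple_frac n (\<lambda>p. \<exists>j\<le>Suc k. Q j p) \<le> tuple_frac n (\<lambda>p. (\<exists>j\<le>k. Q j p) \<or> Q (Suc k) p)"
    by (rule tuple_frac_mono) (auto simp: le_Suc_eq)
  also have "\<dots> \<le> tuple_frac n (\<lambda>p. \<exists>j\<le>k. Q j p) + tuple_frac n (Q (Suc k))" by (rule tuple_frac_disj)
  finally show ?case using Suc by simp
qed simp

text \<open>At stage \<open>n\<close> the first few conditions are imposed, with their number
  growing so slowly that the union bound still tends to 0. One sequence of sets then serves
  countably many conditions.\<close>

lemma whp_diagonal:
  fixes E :: "nat \<Rightarrow> nat \<Rightarrow> 'a::finite perms \<Rightarrow> bool"
  assumes "\<And>j. whp (E j)"
  shows "\<exists>G. whp G \<and> (\<forall>j. \<forall>\<^sub>F n in sequentially. \<forall>p. G n p \<longrightarrow> E j n p)"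
proof -
  define bad where "bad k n = (\<Sum>j\<le>k. tuple_frac n (\<lambda>p. \<not> E j n p))" for k n
  have "(\<lambda>n. bad k n) \<longlonglongrightarrow> (\<Sum>j\<le>k. 0)" for k
    unfolding bad_def using assms unfolding whp_def by (intro tendsto_sum)
  then have "\<forall>\<^sub>F n in sequentially. bad k n < 1 / real (Suc k)" for k
    by (rule order_tendstoD(2)) simp
  then have "\<forall>k. \<exists>M. \<forall>n\<ge>M. bad k n < 1 / real (Suc k)" by (simp add: eventually_sequentially)
  then obtain M where M: "\<And>k n. n \<ge> M k \<Longrightarrow> bad k n < 1 / real (Suc k)" by metis
  \<comment> \<open>The stages whose threshold has been passed. The bound \<open>k \<le> n\<close>
    makes the set finite, and its maximum tells how many conditions are imposed.\<close>
  define K where "K n = {k. k \<le> n \<and> M k \<le> n}" for n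
  define G where "G n p \<longleftrightarrow> (\<forall>k\<in>K n. \<forall>j\<le>k. E j n p)" for n p
  have fK: "finite (K n)" for n by (rule finite_subset[of _ "{..n}"]) (auto simp: K_def)
  have small: "tuple_frac n (\<lambda>p. \<not> G n p) < 1 / real (Suc k)" if "n \<ge> k" "n \<ge> M k" for n k
  proof -
    have k: "k \<in> K n" using that by (simp add: K_def)
    define m where "m = Max (K n)"
    have m: "m \<in> K n" "k \<le> m" using Max_in[OF fK] Max_ge[OF fK k] k unfolding m_def by auto
    have "\<not> G n p \<Longrightarrow> \<exists>j\<le>m. \<not> E j n p" for p
      unfolding G_def m_def using Max_ge[OF fK] by (meson le_trans)
    then have "tuple_frac n (\<lambda>p. \<not> G n p) \<le> tuple_frac n (\<lambda>p. \<exists>j\<le>m. \<not> E j n p)" by (intro tuple_frac_mono)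
    also have "\<dots> \<le> bad m n" unfolding bad_def by (rule tuple_frac_union)
    also have "\<dots> < 1 / real (Suc m)" using m(1) by (intro M) (simp add: K_def)
    also have "\<dots> \<le> 1 / real (Suc k)" using m(2) by (simp add: divide_simps)
    finally show ?thesis .
  qed
  have "whp G" unfolding whp_def
  proof (rule order_tendstoI)
    fix a :: real assume "0 < a"
    then obtain k where k: "1 / real (Suc k) < a" using reals_Archimedean[of a] by (auto simp: inverse_eq_divide)
    show "\<forall>\<^sub>F n in sequentially. tuple_frac n (\<lambda>p. \<not> G n p) < a"
      using eventually_ge_at_top[of "max k (M k)"]
    proof eventually_elim
      case (elim n)
      then have "tuple_frac n (\<lambda>p. \<not> G n p) < 1 / real (Suc k)" by (intro small) auto
      then show ?case using k by linarith
    qed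
  next
    fix a :: real assume "a < 0"
    then show "\<forall>\<^sub>F n in sequentially. a < tuple_frac n (\<lambda>p. \<not> G n p)"
      by (intro always_eventually allI less_le_trans[OF _ tuple_frac_nonneg])
  qed
  moreover have "\<forall>\<^sub>F n in sequentially. \<forall>p. G n p \<longrightarrow> E j n p" for j
    using eventually_ge_at_top[of "max j (M j)"] by eventually_elim (auto simp: G_def K_def)
  ultimately show ?thesis by blast
qed

lemma whp_markov:
  fixes f :: "nat \<Rightarrow> 'a::finite perms \<Rightarrow> real"
  assumes nonneg: "\<And>n p. f n p \<ge> 0" and avg: "\<forall>\<^sub>F n in sequentially. tuple_avg n (f n) \<le> exp (real n * H)" and \<epsilon>: "\<epsilon> > 0"
  shows "whp (\<lambda>n p. f n p \<le> exp (real n * (H + \<epsilon>)))"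
  unfolding whp_def
proof (rule tendsto_sandwich[OF _ _ tendsto_const])
  show "(\<lambda>n. exp (- \<epsilon> * real n)) \<longlonglongrightarrow> 0" using \<epsilon> by real_asymp
  show "\<forall>\<^sub>F n in sequentially. tuple_frac n (\<lambda>p. \<not> f n p \<le> exp (real n * (H + \<epsilon>))) \<le> exp (- \<epsilon> * real n)"
    using avg
  proof eventually_elim
    case (elim n)
    have "tuple_frac n (\<lambda>p. \<not> f n p \<le> exp (real n * (H + \<epsilon>))) \<le> tuple_frac n (\<lambda>p. f n p \<ge> exp (real n * (H + \<epsilon>)))"
      by (rule tuple_frac_mono) simp
    also have "\<dots> \<le> tuple_avg n (f n) / exp (real n * (H + \<epsilon>))" by (rule tuple_frac_markov[OF nonneg]) simp
    also have "\<dots> \<le> exp (real n * H) / exp (real n * (H + \<epsilon>))" using elim by (intro divide_right_mono) auto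
    also have "\<dots> = exp (- \<epsilon> * real n)" by (simp add: exp_diff[symmetric] algebra_simps)
    finally show ?case .
  qed
qed simp

text \<open>Markov's inequality for the number of vertices at which the exploration is not
  injective.\<close>

lemma whp_free:
  fixes T :: "'a::finite letter list set"
  assumes T: "word_tree T" and \<delta>: "\<delta> > 0"
  shows "whp (\<lambda>n p. real (card {v \<in> {1..n}. inj_on (\<lambda>w. word_perm p w v) T}) > real n * (1 - \<delta>))"
  unfolding whp_def
proof (rule order_tendstoI)
  fix a :: real assume "a < 0"
  then show "\<forall>\<^sub>F n in sequentially. a < tuple_frac n (\<lambda>p :: 'a perms. \<not> real (card {v \<in> {1..n}. inj_on (\<lambda>w. word_perm p w v) T}) > real n * (1 - \<delta>))"
    by (intro always_eventually allI less_le_trans[OF _ tuple_frac_nonneg])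
next
  fix a :: real assume a: "0 < a"
  let ?f = "\<lambda>n (p :: 'a \<Rightarrow> nat \<Rightarrow> nat). real (card {v \<in> {1..n}. inj_on (\<lambda>w. word_perm p w v) T})"
  \<comment> \<open>The mean number of such vertices is then at most
    \<open>n * a * \<delta> / 2\<close>, and division by the allowed \<open>n * \<delta>\<close>
    leaves \<open>a / 2\<close>.\<close>
  have "a * \<delta> / 2 > 0" using a \<delta> by simp
  from free_limit[OF T this] eventually_gt_at_top[of 0]
  show "\<forall>\<^sub>F n in sequentially. tuple_frac n (\<lambda>p. \<not> ?f n p > real n * (1 - \<delta>)) < a"
  proof eventually_elim
    case (elim n)
    let ?c = "real (card (perm_tuples n :: 'a perms set))"
    have c: "?c > 0" by simp
    have le: "?f n p \<le> real n" for p
    proof -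
      have "card {v \<in> {1..n}. inj_on (\<lambda>w. word_perm p w v) T} \<le> card {1..n}" by (intro card_mono) auto
      then show ?thesis by simp
    qed
    have "tuple_frac n (\<lambda>p. \<not> ?f n p > real n * (1 - \<delta>)) \<le> tuple_frac n (\<lambda>p. real n - ?f n p \<ge> real n * \<delta>)"
      by (rule tuple_frac_mono) (simp add: right_diff_distrib)
    also have "\<dots> \<le> tuple_avg n (\<lambda>p. real n - ?f n p) / (real n * \<delta>)"
      using le elim(2) \<delta> by (intro tuple_frac_markov) auto
    also have "tuple_avg n (\<lambda>p. real n - ?f n p) \<le> real n * (a * \<delta> / 2)"
    proof -
      have "(\<Sum>p\<in>perm_tuples n. real n - ?f n p) \<le> ?c * (real n * (a * \<delta> / 2))"
        using elim(1) by (simp add: sum_subtractf algebra_simps)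
      then show ?thesis unfolding tuple_avg_def using c by (simp only: pos_divide_le_eq mult.commute)
    qed
    also have "real n * (a * \<delta> / 2) / (real n * \<delta>) = a / 2" using elim(2) \<delta> by simp
    finally show ?case using a elim(2) \<delta> by (simp add: divide_right_mono)
  qed
qed

text \<open>The balls form a sequence that exhausts all finite trees, so countably many conditions
  decide every neighbourhood.\<close>

definition word_ball :: "nat \<Rightarrow> 'a::finite letter list set" where
  "word_ball j = {w. reduced w \<and> length w \<le> j}"

lemma finite_word_ball: "finite (word_ball j :: 'a::finite letter list set)"
  by (rule finite_subset[OF _ finite_lists_length_le[of UNIV j]]) (auto simp: word_ball_def)

lemma word_tree_word_ball: "word_tree (word_ball j)"
  unfolding word_tree_def using finite_word_ball by (auto simp: word_ball_def reduced_Cons)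

lemma word_ball_exhausts:
  assumes "finite T" "\<forall>w\<in>T. reduced w"
  shows "\<exists>j. T \<subseteq> word_ball j"
proof -
  have "T \<subseteq> word_ball (Max (insert 0 (length ` T)))" using assms by (auto simp: word_ball_def)
  then show ?thesis by blast
qed

abbreviation ising_weight :: "real \<Rightarrow> real \<Rightarrow> 'a letter list set \<Rightarrow> ('a letter list \<Rightarrow> spin) \<Rightarrow> real" where
  "ising_weight J t T \<equiv> tree_weight (ising_transition J t) (ising_marginal J t) T"

lemma word_cyl_ising: "word_tree T \<Longrightarrow> measure (ising_chain J t :: 'a::finite config measure) (word_cyl T \<eta>) = ising_weight J t T \<eta>"
  unfolding word_cyl_def by (rule ising_chain_cylinder)

lemma sum_ising_weight:
  fixes T :: "'a::finite letter list set"
  assumes T: "word_tree T"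
  shows "(\<Sum>\<eta>\<in>(T \<rightarrow>\<^sub>E UNIV). ising_weight J t T \<eta>) = 1"
proof -
  let ?\<mu> = "ising_chain J t :: 'a config measure" and ?E = "T \<rightarrow>\<^sub>E (UNIV :: spin set)"
  have b: "?\<mu> \<in> borel_prob" by (rule ising_chain_borel_prob)
  then interpret prob_space ?\<mu> by (simp add: borel_prob_def)
  have fT: "finite T" using T by (simp add: word_tree_def)
  have "(\<Sum>\<eta>\<in>?E. measure ?\<mu> (word_cyl T \<eta>)) = measure ?\<mu> (\<Union>\<eta>\<in>?E. word_cyl T \<eta>)"
  proof (rule finite_measure_finite_Union[symmetric])
    show "finite ?E" using fT by (intro finite_PiE) auto
    show "word_cyl T ` ?E \<subseteq> sets ?\<mu>" using b word_cyl_borel[OF T] by (auto simp: borel_prob_def)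
    show "disjoint_family_on (word_cyl T) ?E" unfolding disjoint_family_on_def
    proof (intro ballI impI)
      fix \<eta> \<eta>' assume "\<eta> \<in> ?E" "\<eta>' \<in> ?E" "\<eta> \<noteq> \<eta>'"
      then obtain w where "w \<in> T" "\<eta> w \<noteq> \<eta>' w" by (meson PiE_ext)
      then show "word_cyl T \<eta> \<inter> word_cyl T \<eta>' = {}" by (auto simp: word_cyl_def)
    qed
  qed
  also have "(\<Union>\<eta>\<in>?E. word_cyl T \<eta>) = UNIV"
  proof (intro equalityI subsetI)
    fix x :: "'a config"
    show "x \<in> (\<Union>\<eta>\<in>?E. word_cyl T \<eta>)"
      by (rule UN_I[of "restrict (\<lambda>w. x (Abs_fgroup w)) T"]) (auto simp: word_cyl_def)
  qed simp
  also have "UNIV = space ?\<mu>" using space_borel_prob[OF b] by simp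
  finally show ?thesis unfolding prob_space using word_cyl_ising[OF T] by simp
qed

lemma microstates_confs: "microstates {1..n} \<sigma> \<O> = {x \<in> confs n. empirical {1..n} \<sigma> x \<in> \<O>}"
  by (simp add: microstates_def confs_def)

lemma tree_dev_cyl_dist:
  assumes T: "word_tree T" and n: "n > 0"
  shows "tree_dev n p x T (ising_weight J t T) = real n * cyl_dist T (empirical {1..n} (tuple_hom p) x) (ising_chain J t :: 'a::finite config measure)"
proof -
  have "\<bar>real (hits n p x T \<eta>) - real n * ising_weight J t T \<eta>\<bar>
    = real n * \<bar>real (hits n p x T \<eta>) / real n - ising_weight J t T \<eta>\<bar>" for \<eta>
  proof -
    have "real (hits n p x T \<eta>) - real n * ising_weight J t T \<eta> = real n * (real (hits n p x T \<eta>) / real n - ising_weight J t T \<eta>)"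
      using n by (simp add: right_diff_distrib)
    then show ?thesis by (simp add: abs_mult)
  qed
  then show ?thesis
    unfolding tree_dev_def cyl_dist_def empirical_word_cyl[OF T] word_cyl_ising[OF T] sum_distrib_left by simp
qed

lemma microstates_lower:
  assumes T: "word_tree T" and n: "n > 0"
    and O: "\<And>\<nu>. \<nu> \<in> borel_prob \<Longrightarrow> cyl_dist T \<nu> (ising_chain J t :: 'a::finite config measure) < \<epsilon> \<Longrightarrow> \<nu> \<in> \<O>"
  shows "{x \<in> confs n. tree_dev n p x T (ising_weight J t T) < \<epsilon> * real n} \<subseteq> microstates {1..n} (tuple_hom p) \<O>"
proof
  fix x assume x: "x \<in> {x \<in> confs n. tree_dev n p x T (ising_weight J t T) < \<epsilon> * real n}"
  let ?\<nu> = "empirical {1..n} (tuple_hom p) x :: 'a config measure"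
  have "real n * cyl_dist T ?\<nu> (ising_chain J t) < real n * \<epsilon>"
    using x unfolding tree_dev_cyl_dist[OF T n] by (simp add: mult.commute)
  then have "cyl_dist T ?\<nu> (ising_chain J t) < \<epsilon>" using n by simp
  then show "x \<in> microstates {1..n} (tuple_hom p) \<O>"
    unfolding microstates_confs using x n by (auto intro!: O empirical_borel_prob)
qed

lemma microstates_edge_nbhd:
  assumes n: "n > 0"
  shows "microstates {1..n} (tuple_hom p) (edge_nbhd J t \<delta> :: 'a::finite config measure set)
    = {x \<in> confs n. edge_close J t \<delta> n p x}"
  unfolding microstates_confs edge_nbhd_def using n by (auto simp: empirical_borel_prob empirical_edge)

lemma elog_le:
  assumes "X \<ge> 0" "a > 0" "X \<le> exp (real a * c)"
  shows "ereal (1 / real a) * elog X \<le> ereal c"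
proof (cases "X = 0")
  case True
  then show ?thesis using assms(2) by (simp add: elog_def)
next
  case False
  then have "ln X \<le> real a * c" using assms by (metis ln_exp ln_le_cancel_iff exp_gt_zero order_le_less)
  then show ?thesis using False assms(2) by (simp add: elog_def divide_le_eq mult.commute)
qed

lemma elog_ge:
  assumes "a > 0" "X \<ge> exp (real a * c)"
  shows "ereal (1 / real a) * elog X \<ge> ereal c"
proof -
  have X: "X > 0" using assms(2) by (rule less_le_trans[OF exp_gt_zero])
  then have "real a * c \<le> ln X" using assms(2) by (simp add: ln_ge_iff)
  then show ?thesis using X assms(1) by (simp add: elog_def le_divide_eq mult.commute)
qed

text \<open>The common frame for both entropies: every neighbourhood must contain enough
  microstates, while the upper bound is needed for just one neighbourhood at each tolerance.\<close>

lemma entropy_eqI: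
  fixes X :: "'x::topological_space measure set \<Rightarrow> nat \<Rightarrow> real"
  assumes a: "filterlim a at_top sequentially" and X: "\<And>\<O> n. X \<O> n \<ge> 0"
    and lower: "\<And>\<O> \<epsilon>. openin weak_star \<O> \<Longrightarrow> \<mu> \<in> \<O> \<Longrightarrow> \<epsilon> > 0 \<Longrightarrow> \<forall>\<^sub>F n in sequentially. X \<O> n \<ge> exp (real (a n) * (F - \<epsilon>))"
    and upper: "\<And>\<epsilon>. \<epsilon> > 0 \<Longrightarrow> \<exists>\<O>. openin weak_star \<O> \<and> \<mu> \<in> \<O> \<and> (\<forall>\<^sub>F n in sequentially. X \<O> n \<le> exp (real (a n) * (F + \<epsilon>)))"
  shows "(INF \<O>\<in>{\<O>. openin weak_star \<O> \<and> \<mu> \<in> \<O>}. limsup (\<lambda>n. ereal (1 / real (a n)) * elog (X \<O> n))) = ereal F"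
    (is "?I = _")
proof (rule antisym)
  have a0: "\<forall>\<^sub>F n in sequentially. a n > 0" by (rule eventually_compose_filterlim[OF eventually_gt_at_top a])
  show "?I \<le> ereal F"
  proof (rule ereal_le_epsilon2)
    fix \<epsilon> :: real assume "0 < \<epsilon>"
    from upper[OF this] obtain \<O> where \<O>: "openin weak_star \<O>" "\<mu> \<in> \<O>" "\<forall>\<^sub>F n in sequentially. X \<O> n \<le> exp (real (a n) * (F + \<epsilon>))" by blast
    have "?I \<le> limsup (\<lambda>n. ereal (1 / real (a n)) * elog (X \<O> n))" using \<O> by (intro INF_lower) auto
    also have "\<dots> \<le> ereal (F + \<epsilon>)"
    proof (rule Limsup_bounded)
      show "\<forall>\<^sub>F n in sequentially. ereal (1 / real (a n)) * elog (X \<O> n) \<le> ereal (F + \<epsilon>)"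
        using \<O>(3) a0 by eventually_elim (rule elog_le[OF X])
    qed
    finally show "?I \<le> ereal F + ereal \<epsilon>" by simp
  qed
  show "ereal F \<le> ?I"
  proof (rule INF_greatest)
    fix \<O> assume \<O>: "\<O> \<in> {\<O>. openin weak_star \<O> \<and> \<mu> \<in> \<O>}"
    let ?l = "limsup (\<lambda>n. ereal (1 / real (a n)) * elog (X \<O> n))"
    show "ereal F \<le> ?l"
    proof (rule ereal_le_epsilon2)
      fix \<epsilon> :: real assume \<epsilon>: "0 < \<epsilon>"
      have "ereal (F - \<epsilon>) \<le> ?l"
      proof (rule le_Limsup)
        show "\<forall>\<^sub>F n in sequentially. ereal (F - \<epsilon>) \<le> ereal (1 / real (a n)) * elog (X \<O> n)"
        proof -
          have "\<forall>\<^sub>F n in sequentially. X \<O> n \<ge> exp (real (a n) * (F - \<epsilon>))" using \<O> by (intro lower \<epsilon>) auto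
          then show ?thesis using a0 by eventually_elim (rule elog_ge)
        qed
      qed simp
      then have "ereal (F - \<epsilon>) + ereal \<epsilon> \<le> ?l + ereal \<epsilon>" by (intro add_right_mono)
      then show "ereal F \<le> ?l + ereal \<epsilon>" by simp
    qed
  qed
qed

lemma small_tol:
  assumes "\<epsilon> > (0 :: real)"
  obtains k where "1 / real (Suc k) < \<epsilon>"
  using reals_Archimedean[OF assms] by (auto simp: inverse_eq_divide)

lemma card_microstates_mono:
  fixes \<sigma> :: "'b fgroup \<Rightarrow> nat \<Rightarrow> nat"
  assumes "A \<subseteq> microstates {1..n} \<sigma> \<O>"
  shows "real (card A) \<le> real (card (microstates {1..n} \<sigma> \<O>))"
  using assms by (intro of_nat_mono card_mono) (simp_all add: microstates_confs)

text \<open>What the two states share: the first moment has rate \<open>F\<close>, the second moment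
  has rate at most \<open>2 * F\<close>, and the labellings with nearby edge statistics are no more
  numerous. All entropy statements follow from these.\<close>

locale sharp_state =
  fixes J t F :: real and R :: "'a::finite itself"
  assumes first: "\<And>\<epsilon>. \<epsilon> > 0 \<Longrightarrow> \<forall>\<^sub>F n in sequentially.
      tuple_avg n (\<lambda>p :: 'a perms. typed_count n (types (ising_edge J t) n) p) \<ge> exp (real n * (F - \<epsilon>))"
    and second: "\<And>\<epsilon>. \<epsilon> > 0 \<Longrightarrow> \<forall>\<^sub>F n in sequentially.
      tuple_avg n (\<lambda>p :: 'a perms. (typed_count n (types (ising_edge J t) n) p)\<^sup>2) \<le> exp (real n * (2 * F + \<epsilon>))"
    and upper: "\<And>\<epsilon>. \<epsilon> > 0 \<Longrightarrow> \<exists>\<delta>>0. \<forall>\<^sub>F n in sequentially.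
      tuple_avg n (\<lambda>p :: 'a perms. real (card {x \<in> confs n. edge_close J t \<delta> n p x}))
        \<le> exp (real n * (F + \<epsilon>))"
begin

text \<open>Order of summation is exchanged: for each typed labelling \<open>x\<close>, at least
  half of the tuples planted for \<open>x\<close> give it the local statistics of the chain.\<close>

lemma near_half:
  fixes T :: "'a letter list set"
  assumes T: "word_tree T" and \<delta>: "\<delta> > 0"
  shows "\<forall>\<^sub>F n in sequentially.
    tuple_avg n (\<lambda>p :: 'a perms. real (card {x \<in> confs n. typed n (\<lambda>_. types (ising_edge J t) n) p x \<and> tree_dev n p x T (ising_weight J t T) \<le> \<delta> * real n}))
      \<ge> tuple_avg n (\<lambda>p :: 'a perms. typed_count n (types (ising_edge J t) n) p) / 2"
proof -
  let ?W = "ising_edge J t" and ?w = "ising_weight J t T"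
  interpret W: edge_law ?W by (rule edge_law_ising)
  have "\<forall>\<^sub>F n in sequentially. \<forall>x\<in>vclass n (vtypes ?W n).
    real (card {p \<in> planted n (types ?W n) x. (\<Sum>\<eta>\<in>(T \<rightarrow>\<^sub>E UNIV). \<bar>real (hits n p x T \<eta>) / real n - ?w \<eta>\<bar>) > \<delta>})
      \<le> real (card (planted n (types ?W n) x :: 'a perms set)) / 2"
  proof (rule planted_limit[OF types_sym _ _ _ _ T sum_ising_weight[OF T] \<delta>])
    show "(\<lambda>n. real (types ?W n s s') / real n) \<longlonglongrightarrow> ising_marginal J t s * ising_transition J t s s'" for s s'
      unfolding ising_transition_edge by (rule W.types_limit)
    have "(\<Sum>s'\<in>UNIV. ?W s s') = ising_marginal J t s" for s by (simp only: ising_marginal_edge sum_spin add.commute)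
    then show "(\<lambda>n. real (vtypes ?W n s) / real n) \<longlonglongrightarrow> ising_marginal J t s" for s
      using W.vtypes_limit[of s] by simp
  qed (use less_imp_le[OF ising_transition_pos] ising_marginal_pos in blast)+
  then show ?thesis using eventually_gt_at_top[of 0]
  proof eventually_elim
    case (elim n)
    let ?N = "types ?W n"
    let ?D = "\<lambda>(p :: 'a \<Rightarrow> _) x. tree_dev n p x T ?w \<le> \<delta> * real n"
    have dev: "(\<Sum>\<eta>\<in>(T \<rightarrow>\<^sub>E UNIV). \<bar>real (hits n p x T \<eta>) / real n - ?w \<eta>\<bar>) > \<delta> \<longleftrightarrow> \<not> ?D p x" for p x
    proof -
      have "tree_dev n p x T ?w = real n * (\<Sum>\<eta>\<in>(T \<rightarrow>\<^sub>E UNIV). \<bar>real (hits n p x T \<eta>) / real n - ?w \<eta>\<bar>)"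
        unfolding tree_dev_cyl_dist[OF T elim(2)] cyl_dist_def empirical_word_cyl[OF T] word_cyl_ising[OF T] ..
      then show ?thesis using elim(2) by (simp add: not_le mult.commute)
    qed
    have half: "real (card {p \<in> perm_tuples n. typed n (\<lambda>_ :: 'a. ?N) p x \<and> ?D p x}) \<ge> real (card {p \<in> perm_tuples n. typed n (\<lambda>_ :: 'a. ?N) p x \<and> True}) / 2"
      if x: "x \<in> vclass n (vtypes ?W n)" for x
    proof -
      let ?P = "planted n ?N x :: 'a perms set"
      have pl: "?P = {p \<in> perm_tuples n. typed n (\<lambda>_ :: 'a. ?N) p x}" by (simp add: planted_def typed_def)
      have "card ?P = card ({p \<in> ?P. ?D p x} \<union> {p \<in> ?P. \<not> ?D p x})" by (rule arg_cong[where f = card]) blast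
      also have "\<dots> = card {p \<in> ?P. ?D p x} + card {p \<in> ?P. \<not> ?D p x}" by (rule card_Un_disjoint) auto
      finally have "real (card ?P) = real (card {p \<in> ?P. ?D p x}) + real (card {p \<in> ?P. \<not> ?D p x})" by simp
      moreover have "real (card {p \<in> ?P. \<not> ?D p x}) \<le> real (card ?P) / 2" using elim(1) x unfolding dev by blast
      ultimately have "real (card {p \<in> ?P. ?D p x}) \<ge> real (card ?P) / 2" by linarith
      then show ?thesis unfolding pl by (simp add: conj_assoc)
    qed
    have row: "(\<Sum>b\<in>UNIV. ?N a b) = vtypes ?W n a" for a by (simp add: vtypes_def)
    have st: "(\<Sum>p\<in>perm_tuples n. real (card {x \<in> confs n. typed n (\<lambda>_ :: 'a. ?N) p x \<and> Q p x}))
      = (\<Sum>x\<in>vclass n (vtypes ?W n). real (card {p \<in> perm_tuples n. typed n (\<lambda>_ :: 'a. ?N) p x \<and> Q p x}))" for Q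
      using arg_cong[OF sum_typed[where N = "\<lambda>_ :: 'a. ?N" and c = "vtypes ?W n" and n = n and Q = Q, OF row], of real] by simp
    have "(\<Sum>p\<in>perm_tuples n. real (card {x \<in> confs n. typed n (\<lambda>_ :: 'a. ?N) p x \<and> True})) / 2
      \<le> (\<Sum>p\<in>perm_tuples n. real (card {x \<in> confs n. typed n (\<lambda>_ :: 'a. ?N) p x \<and> ?D p x}))"
      unfolding st sum_divide_distrib by (intro sum_mono half)
    from divide_right_mono[OF this, of "real (card (perm_tuples n :: 'a perms set))"]
    show ?case unfolding tuple_avg_def by (simp add: mult.commute)
  qed
qed

lemma many_good:
  assumes "word_tree T" "\<epsilon>0 > 0" "\<epsilon>1 > 0"
  shows "whp (\<lambda>n (p :: 'a \<Rightarrow> _). real (card {x \<in> confs n. tree_dev n p x T (ising_weight J t T) < \<epsilon>0 * real n}) \<ge> exp (real n * (F - \<epsilon>1)))"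
  unfolding whp_def by (rule good_labellings_many[OF assms first second near_half[OF assms(1)]])

text \<open>One tolerance is selected for each \<open>k\<close>, so that the conditions collected in
  \<open>good\<close> form a countable family.\<close>

definition edge_tol :: "nat \<Rightarrow> real" where
  "edge_tol k = (SOME \<delta>. \<delta> > 0 \<and> (\<forall>\<^sub>F n in sequentially.
      tuple_avg n (\<lambda>p :: 'a perms. real (card (microstates {1..n} (tuple_hom p) (edge_nbhd J t \<delta> :: 'a config measure set))))
        \<le> exp (real n * (F + 1 / real (Suc k)))))"

lemma edge_tol: "edge_tol k > 0"
  "\<forall>\<^sub>F n in sequentially. tuple_avg n (\<lambda>p :: 'a perms. real (card (microstates {1..n} (tuple_hom p) (edge_nbhd J t (edge_tol k) :: 'a config measure set))))
     \<le> exp (real n * (F + 1 / real (Suc k)))"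
proof -
  have "\<exists>\<delta>. \<delta> > 0 \<and> (\<forall>\<^sub>F n in sequentially.
      tuple_avg n (\<lambda>p :: 'a perms. real (card (microstates {1..n} (tuple_hom p) (edge_nbhd J t \<delta> :: 'a config measure set))))
        \<le> exp (real n * (F + 1 / real (Suc k))))"
  proof -
    obtain \<delta> where \<delta>: "\<delta> > 0" "\<forall>\<^sub>F n in sequentially.
      tuple_avg n (\<lambda>p :: 'a perms. real (card {x \<in> confs n. edge_close J t \<delta> n p x}))
        \<le> exp (real n * (F + 1 / real (Suc k)))"
      using upper[of "1 / real (Suc k)"] by auto
    from \<delta>(2) eventually_gt_at_top[of 0] have "\<forall>\<^sub>F n in sequentially.
      tuple_avg n (\<lambda>p :: 'a perms. real (card (microstates {1..n} (tuple_hom p) (edge_nbhd J t \<delta> :: 'a config measure set))))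
        \<le> exp (real n * (F + 1 / real (Suc k)))"
      by eventually_elim (simp only: microstates_edge_nbhd)
    then show ?thesis using \<delta>(1) by blast
  qed
  from someI_ex[OF this, folded edge_tol_def]
  show "edge_tol k > 0" "\<forall>\<^sub>F n in sequentially. tuple_avg n (\<lambda>p :: 'a perms. real (card (microstates {1..n} (tuple_hom p) (edge_nbhd J t (edge_tol k) :: 'a config measure set))))
     \<le> exp (real n * (F + 1 / real (Suc k)))" by blast+
qed

text \<open>\<open>j\<close> is the radius of the inspected balls and \<open>k\<close> the
  precision. The second \<open>1 / real (Suc k)\<close> in the upper bound is what Markov's
  inequality costs.\<close>

definition good :: "nat \<Rightarrow> nat \<Rightarrow> nat \<Rightarrow> 'a perms \<Rightarrow> bool" where
  "good j k n p \<longleftrightarrow>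
     real (card {x \<in> confs n. tree_dev n p x (word_ball j) (ising_weight J t (word_ball j)) < 1 / real (Suc k) * real n})
       \<ge> exp (real n * (F - 1 / real (Suc k))) \<and>
     real (card (microstates {1..n} (tuple_hom p) (edge_nbhd J t (edge_tol k) :: 'a config measure set)))
       \<le> exp (real n * (F + 1 / real (Suc k) + 1 / real (Suc k)))"

lemma whp_good: "whp (good j k)"
  unfolding good_def
  by (intro whp_conj many_good word_tree_word_ball whp_markov edge_tol) auto

text \<open>A neighbourhood of the chain contains all measures with nearly correct statistics on
  some ball; \<open>j\<close> is its radius, and \<open>k\<close> is taken fine enough for both the
  neighbourhood and \<open>\<epsilon>\<close>.\<close>

lemma good_lower:
  assumes "openin weak_star \<O>" "(ising_chain J t :: 'a config measure) \<in> \<O>" "\<epsilon> > 0"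
  shows "\<exists>j k. \<forall>n p. n > 0 \<and> good j k n p \<longrightarrow> real (card (microstates {1..n} (tuple_hom p) \<O>)) \<ge> exp (real n * (F - \<epsilon>))"
proof -
  from weak_star_cylinders[OF assms(1,2)] obtain T0 where T0: "word_tree T0"
    "\<And>T. word_tree T \<Longrightarrow> T0 \<subseteq> T \<Longrightarrow> \<exists>\<epsilon>>0. \<forall>\<nu>\<in>borel_prob. cyl_dist T \<nu> (ising_chain J t) < \<epsilon> \<longrightarrow> \<nu> \<in> \<O>" by blast
  obtain j where "T0 \<subseteq> word_ball j" using word_ball_exhausts[of T0] T0(1) by (auto simp: word_tree_def)
  from T0(2)[OF word_tree_word_ball this] obtain e where e: "e > 0"
    "\<And>\<nu>. \<nu> \<in> borel_prob \<Longrightarrow> cyl_dist (word_ball j) \<nu> (ising_chain J t) < e \<Longrightarrow> \<nu> \<in> \<O>" by blast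
  obtain k where k: "1 / real (Suc k) < min e \<epsilon>" using small_tol[of "min e \<epsilon>"] e(1) assms(3) by auto
  have "real (card (microstates {1..n} (tuple_hom p) \<O>)) \<ge> exp (real n * (F - \<epsilon>))" if "n > 0" "good j k n p" for n p
  proof -
    have "exp (real n * (F - \<epsilon>)) \<le> exp (real n * (F - 1 / real (Suc k)))"
      unfolding exp_le_cancel_iff using k by (intro mult_left_mono) auto
    also have "\<dots> \<le> real (card {x \<in> confs n. tree_dev n p x (word_ball j) (ising_weight J t (word_ball j)) < 1 / real (Suc k) * real n})"
      using that(2) unfolding good_def by (rule conjunct1)
    also have "\<dots> \<le> real (card (microstates {1..n} (tuple_hom p) \<O>))"
    proof (rule card_microstates_mono)
      show "{x \<in> confs n. tree_dev n p x (word_ball j) (ising_weight J t (word_ball j)) < 1 / real (Suc k) * real n} \<subseteq> microstates {1..n} (tuple_hom p) \<O>"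
        by (rule microstates_lower[OF word_tree_word_ball that(1)]) (use e(2) k in force)
    qed
    finally show ?thesis .
  qed
  then show ?thesis by blast
qed

lemma sofic_entropy_eq:
  assumes m: "filterlim m at_top sequentially" and good: "\<And>j k. \<forall>\<^sub>F n in sequentially. good j k (m n) (p n)"
  shows "sofic_entropy (\<lambda>n. {1..m n}) (\<lambda>n. tuple_hom (p n)) (ising_chain J t :: 'a config measure) = ereal F"
  unfolding sofic_entropy_def card_atLeastAtMost diff_Suc_1
proof (rule entropy_eqI[OF m])
  have m0: "\<forall>\<^sub>F n in sequentially. m n > 0" by (rule eventually_compose_filterlim[OF eventually_gt_at_top m])
  fix \<epsilon> :: real assume \<epsilon>: "\<epsilon> > 0"
  show "\<forall>\<^sub>F n in sequentially. real (card (microstates {1..m n} (tuple_hom (p n)) \<O>)) \<ge> exp (real (m n) * (F - \<epsilon>))"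
    if \<O>: "openin weak_star \<O>" "(ising_chain J t :: 'a config measure) \<in> \<O>" for \<O>
  proof -
    from good_lower[OF \<O> \<epsilon>] obtain j k where jk: "\<And>n p. n > 0 \<Longrightarrow> good j k n p \<Longrightarrow> real (card (microstates {1..n} (tuple_hom p) \<O>)) \<ge> exp (real n * (F - \<epsilon>))"
      by blast
    show ?thesis using m0 good[of j k] by eventually_elim (rule jk)
  qed
  obtain k where k: "1 / real (Suc k) < \<epsilon> / 2" using small_tol[of "\<epsilon> / 2"] \<epsilon> by auto
  have "\<forall>\<^sub>F n in sequentially. real (card (microstates {1..m n} (tuple_hom (p n)) (edge_nbhd J t (edge_tol k) :: 'a config measure set))) \<le> exp (real (m n) * (F + \<epsilon>))"
    using good[of 0 k]
  proof eventually_elim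
    case (elim n)
    have "real (card (microstates {1..m n} (tuple_hom (p n)) (edge_nbhd J t (edge_tol k) :: 'a config measure set))) \<le> exp (real (m n) * (F + 1 / real (Suc k) + 1 / real (Suc k)))"
      using elim unfolding good_def by (rule conjunct2)
    also have "\<dots> \<le> exp (real (m n) * (F + \<epsilon>))" unfolding exp_le_cancel_iff using k by (intro mult_left_mono) auto
    finally show ?case .
  qed
  then show "\<exists>\<O>. openin weak_star \<O> \<and> (ising_chain J t :: 'a config measure) \<in> \<O> \<and>
      (\<forall>\<^sub>F n in sequentially. real (card (microstates {1..m n} (tuple_hom (p n)) \<O>)) \<le> exp (real (m n) * (F + \<epsilon>)))"
    by (intro exI[of _ "edge_nbhd J t (edge_tol k)"] conjI openin_edge_nbhd ising_chain_in_edge_nbhd edge_tol(1))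
qed simp

text \<open>For large \<open>n\<close> at least half of the tuples are good, so the annealed average
  is at least half of the typical lower bound. The upper bound is the defining property of
  \<open>edge_tol\<close>.\<close>

lemma f_entropy_eq: "f_entropy (ising_chain J t :: 'a config measure) = ereal F"
  unfolding f_entropy_def expectation_uniform_hom
proof (rule entropy_eqI[where a = "\<lambda>n. n", OF filterlim_ident])
  show "tuple_avg n (\<lambda>p :: 'a perms. real (card (microstates {1..n} (tuple_hom p) \<O>))) \<ge> 0" for \<O> n
    by (rule tuple_avg_nonneg) simp
  fix \<epsilon> :: real assume \<epsilon>: "\<epsilon> > 0"
  show "\<forall>\<^sub>F n in sequentially. tuple_avg n (\<lambda>p :: 'a perms. real (card (microstates {1..n} (tuple_hom p) \<O>))) \<ge> exp (real n * (F - \<epsilon>))"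
    if \<O>: "openin weak_star \<O>" "(ising_chain J t :: 'a config measure) \<in> \<O>" for \<O>
  proof -
    have "\<epsilon> / 2 > 0" using \<epsilon> by simp
    from good_lower[OF \<O> this] obtain j k where jk: "\<And>n p. n > 0 \<Longrightarrow> good j k n p \<Longrightarrow> real (card (microstates {1..n} (tuple_hom p) \<O>)) \<ge> exp (real n * (F - \<epsilon> / 2))" by blast
    have "\<forall>\<^sub>F n in sequentially. tuple_frac n (\<lambda>p. \<not> good j k n p) < 1 / 2"
      using whp_good[of j k] unfolding whp_def by (rule order_tendstoD(2)) simp
    moreover have "\<forall>\<^sub>F n in sequentially. 2 \<le> exp (\<epsilon> / 2 * real n)" using \<epsilon> by real_asymp
    ultimately show ?thesis using eventually_gt_at_top[of 0]
    proof eventually_elim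
      case (elim n)
      let ?f = "\<lambda>p :: 'a perms. real (card (microstates {1..n} (tuple_hom p) \<O>))"
      have "exp (real n * (F - \<epsilon>)) * 2 \<le> exp (real n * (F - \<epsilon>)) * exp (\<epsilon> / 2 * real n)"
        using elim(2) by (intro mult_left_mono) auto
      also have "\<dots> = exp (real n * (F - \<epsilon> / 2))" by (simp add: exp_add[symmetric] algebra_simps)
      finally have a: "exp (real n * (F - \<epsilon>)) * 2 \<le> exp (real n * (F - \<epsilon> / 2))" .
      have "1 / 2 \<le> tuple_frac n (good j k n)" using elim(1) by (simp add: tuple_frac_not)
      also have "\<dots> \<le> tuple_frac n (\<lambda>p. ?f p \<ge> exp (real n * (F - \<epsilon> / 2)))"
        using jk[OF elim(3)] by (intro tuple_frac_mono)
      also have "\<dots> \<le> tuple_avg n ?f / exp (real n * (F - \<epsilon> / 2))" by (rule tuple_frac_markov) auto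
      finally have "exp (real n * (F - \<epsilon> / 2)) \<le> 2 * tuple_avg n ?f" by (simp add: pos_le_divide_eq)
      then show ?case using a by linarith
    qed
  qed
  obtain k where k: "1 / real (Suc k) < \<epsilon>" using small_tol[OF \<epsilon>] by auto
  have "\<forall>\<^sub>F n in sequentially. tuple_avg n (\<lambda>p :: 'a perms. real (card (microstates {1..n} (tuple_hom p) (edge_nbhd J t (edge_tol k) :: 'a config measure set)))) \<le> exp (real n * (F + \<epsilon>))"
    using edge_tol(2)[of k]
  proof eventually_elim
    case (elim n)
    have "exp (real n * (F + 1 / real (Suc k))) \<le> exp (real n * (F + \<epsilon>))"
      unfolding exp_le_cancel_iff using k by (intro mult_left_mono) auto
    then show ?case using elim by linarith
  qed
  then show "\<exists>\<O>. openin weak_star \<O> \<and> (ising_chain J t :: 'a config measure) \<in> \<O> \<and>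
      (\<forall>\<^sub>F n in sequentially. tuple_avg n (\<lambda>p :: 'a perms. real (card (microstates {1..n} (tuple_hom p) \<O>))) \<le> exp (real n * (F + \<epsilon>)))"
    by (intro exI[of _ "edge_nbhd J t (edge_tol k)"] conjI openin_edge_nbhd ising_chain_in_edge_nbhd edge_tol(1))
qed

end

text \<open>Injectivity on a ball that contains \<open>F\<close> excludes fixed points of nontrivial
  elements of \<open>F\<close>. The multiplicative condition holds at every vertex because the map
  is a homomorphism.\<close>

lemma free_sofic_map:
  assumes p: "p \<in> perm_tuples n" and n: "n \<ge> 1" and F: "Rep_fgroup ` F \<subseteq> word_ball j"
    and free: "real (card {v \<in> {1..n}. inj_on (\<lambda>w. word_perm p w v) (word_ball j)}) > real n * (1 - \<delta>)" and \<delta>: "\<delta> > 0"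
  shows "sofic_map {1..n} (tuple_hom p) F \<delta>"
  unfolding sofic_map_def
proof
  let ?A = "{v \<in> {1..n}. \<forall>\<gamma>\<in>F - {\<one>\<^bsub>FG\<^esub>}. tuple_hom p \<gamma> v \<noteq> v}"
  have "{v \<in> {1..n}. inj_on (\<lambda>w. word_perm p w v) (word_ball j)} \<subseteq> ?A"
  proof
    fix v assume v: "v \<in> {v \<in> {1..n}. inj_on (\<lambda>w. word_perm p w v) (word_ball j)}"
    have "tuple_hom p \<gamma> v \<noteq> v" if \<gamma>: "\<gamma> \<in> F - {\<one>\<^bsub>FG\<^esub>}" for \<gamma>
    proof
      assume "tuple_hom p \<gamma> v = v"
      then have "word_perm p (Rep_fgroup \<gamma>) v = word_perm p [] v" by (simp add: tuple_hom_def)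
      moreover have "Rep_fgroup \<gamma> \<in> word_ball j" "[] \<in> word_ball j" using F \<gamma> by (auto simp: word_ball_def)
      ultimately have "Rep_fgroup \<gamma> = []" using v unfolding inj_on_def by blast
      then have "\<gamma> = \<one>\<^bsub>FG\<^esub>" by (simp add: FG_def Rep_fgroup_inject[symmetric] fg_one.rep_eq)
      then show False using \<gamma> by simp
    qed
    then show "v \<in> ?A" using v by blast
  qed
  then have "real (card {v \<in> {1..n}. inj_on (\<lambda>w. word_perm p w v) (word_ball j)}) \<le> real (card ?A)"
    by (intro of_nat_mono card_mono) auto
  then have "real n * (1 - \<delta>) < real (card ?A)" using free by linarith
  then show "real (card ?A) / real (card {1..n}) > 1 - \<delta>" using n by (simp add: pos_less_divide_eq mult.commute)
  have "tuple_hom p (\<gamma>1 \<otimes>\<^bsub>FG\<^esub> \<gamma>2) v = tuple_hom p \<gamma>1 (tuple_hom p \<gamma>2 v)" for \<gamma>1 \<gamma>2 v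
    using hom_mult[OF tuple_hom_in_hom[OF p], of \<gamma>1 \<gamma>2] by (simp add: FG_def sym_group_def)
  then have "{v \<in> {1..n}. \<forall>\<gamma>1\<in>F. \<forall>\<gamma>2\<in>F. tuple_hom p (\<gamma>1 \<otimes>\<^bsub>FG\<^esub> \<gamma>2) v = tuple_hom p \<gamma>1 (tuple_hom p \<gamma>2 v)} = {1..n}" by auto
  then show "1 - \<delta> < real (card {v \<in> {1..n}. \<forall>\<gamma>1\<in>F. \<forall>\<gamma>2\<in>F. tuple_hom p (\<gamma>1 \<otimes>\<^bsub>FG\<^esub> \<gamma>2) v = tuple_hom p \<gamma>1 (tuple_hom p \<gamma>2 v)}) / real (card {1..n})"
    using n \<delta> by simp
qed

section \<open>Sharpness of the free boundary state and of the plus state\<close>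

lemma bethe_zero: "bethe k J 0 = (k + 1) / 2 * ln (4 * cosh J) - k * ln 2"
proof -
  have "edge_norm J 0 = 4 * cosh J" by (simp add: edge_norm_def cosh_field_def)
  then show ?thesis by (simp add: bethe_def)
qed

lemma first_moment_ising:
  fixes J t \<epsilon> :: real
  defines "k \<equiv> 2 * real CARD('a::finite) - 1"
  assumes gap: "t_gap k J t = 0" and \<epsilon>: "\<epsilon> > 0"
  shows "\<forall>\<^sub>F n in sequentially. tuple_avg n (\<lambda>p :: 'a perms. typed_count n (types (ising_edge J t) n) p)
    \<ge> exp (real n * (bethe k J t - real CARD('a) * J * ising_corr J t - \<epsilon>))"
proof -
  have r: "real CARD('a) \<ge> 1" by (simp add: Suc_leI One_nat_def)
  have k: "k > 0" "k + 1 = 2 * real CARD('a)" using r by (simp_all add: k_def)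
  show ?thesis
    using edge_law.first_moment[OF edge_law_ising \<epsilon>, of J t, where 'a = 'a]
    unfolding entropy_value[OF k gap, unfolded k_def] k_def .
qed

lemma sharp_free:
  fixes J :: real
  defines "k \<equiv> 2 * real CARD('a::finite) - 1"
  assumes J: "J > 0" "k * (tanh J)\<^sup>2 \<le> 1"
  shows "sharp_state TYPE('a) J 0 (bethe k J 0 - real CARD('a) * J * ising_corr J 0)"
proof
  let ?r = "real CARD('a)" and ?F = "bethe k J 0 - real CARD('a) * J * ising_corr J 0"
  have r: "?r \<ge> 1" by (simp add: Suc_leI One_nat_def)
  have k: "k > 0" "(k + 1) / 2 = ?r" using r by (simp_all add: k_def)
  have F: "?F = ?r * ln (4 * cosh J) - k * ln 2 - ?r * J * ising_corr J 0"
    unfolding bethe_zero k(2) ..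
  fix \<epsilon> :: real assume \<epsilon>: "\<epsilon> > 0"
  show "\<forall>\<^sub>F n in sequentially. tuple_avg n (\<lambda>p :: 'a perms. typed_count n (types (ising_edge J 0) n) p) \<ge> exp (real n * (?F - \<epsilon>))"
    unfolding k_def by (rule first_moment_ising[OF t_gap_zero \<epsilon>])
  have e: "2 * ?r * ln (4 * cosh J) - 2 * k * ln 2 - 2 * ?r * J * ising_corr J 0 + \<epsilon> = 2 * ?F + \<epsilon>"
    unfolding F by simp
  show "\<forall>\<^sub>F n in sequentially. tuple_avg n (\<lambda>p :: 'a perms. (typed_count n (types (ising_edge J 0) n) p)\<^sup>2) \<le> exp (real n * (2 * ?F + \<epsilon>))"
    unfolding e[symmetric] unfolding k_def by (rule second_moment_free[OF J(1) J(2)[unfolded k_def] \<epsilon>])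
  \<comment> \<open>The edge tolerance changes the exponent by at most
    \<open>4 * (k + r * J) * \<delta> = \<epsilon> / 2\<close>, from the vertex entropy and the
    interaction together.\<close>
  define \<delta> where "\<delta> = \<epsilon> / (8 * (k + ?r * J))"
  have c: "k + ?r * J > 0" using k J by (simp add: add_pos_nonneg)
  have \<delta>: "\<delta> > 0" using \<epsilon> c by (simp add: \<delta>_def)
  have "\<epsilon> / 2 > 0" using \<epsilon> by simp
  from upper_bound_free[OF J(1) this \<delta>, where 'a = 'a]
  have "\<forall>\<^sub>F n in sequentially. tuple_avg n (\<lambda>p :: 'a perms. real (card {x \<in> confs n. edge_close J 0 \<delta> n p x})) \<le> exp (real n * (?F + \<epsilon>))"
  proof eventually_elim
    case (elim n)
    have "?r * ln (4 * cosh J) + (2 * ?r - 1) * ln (1 / 2 + 2 * \<delta>) - ?r * J * (ising_corr J 0 - 4 * \<delta>) + \<epsilon> / 2 \<le> ?F + \<epsilon>"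
    proof -
      have "1 / 2 + 2 * \<delta> = (1 + 4 * \<delta>) / 2" by simp
      then have "ln (1 / 2 + 2 * \<delta>) = ln (1 + 4 * \<delta>) - ln 2" using \<delta> by (simp only: ln_div) simp
      also have "\<dots> \<le> 4 * \<delta> - ln 2" using ln_add_one_self_le_self[of "4 * \<delta>"] \<delta> by simp
      finally have "k * ln (1 / 2 + 2 * \<delta>) \<le> k * (4 * \<delta> - ln 2)" using k by (intro mult_left_mono) auto
      moreover have "k * (4 * \<delta> - ln 2) + ?r * J * (4 * \<delta>) = 4 * ((k + ?r * J) * \<delta>) - k * ln 2" by (simp add: algebra_simps)
      moreover have "(k + ?r * J) * \<delta> = \<epsilon> / 8"
      proof -
        have "x * (\<epsilon> / (8 * x)) = \<epsilon> / 8" if "x > 0" for x using that by simp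
        from this[OF c] show ?thesis unfolding \<delta>_def .
      qed
      moreover have "?r * J * (ising_corr J 0 - 4 * \<delta>) = ?r * J * ising_corr J 0 - ?r * J * (4 * \<delta>)" by (simp add: right_diff_distrib)
      ultimately show ?thesis unfolding F unfolding k_def[symmetric] by linarith
    qed
    then have "exp (real n * (?r * ln (4 * cosh J) + (2 * ?r - 1) * ln (1 / 2 + 2 * \<delta>) - ?r * J * (ising_corr J 0 - 4 * \<delta>) + \<epsilon> / 2)) \<le> exp (real n * (?F + \<epsilon>))"
      unfolding exp_le_cancel_iff by (rule mult_left_mono) simp
    then show ?case using elim by (rule order_trans[rotated])
  qed
  then show "\<exists>\<delta>>0. \<forall>\<^sub>F n in sequentially. tuple_avg n (\<lambda>p :: 'a perms. real (card {x \<in> confs n. edge_close J 0 \<delta> n p x})) \<le> exp (real n * (?F + \<epsilon>))"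
    using \<delta> by (intro exI[of _ \<delta>] conjI)
qed

lemma sharp_plus:
  fixes J a :: real
  defines "k \<equiv> 2 * real CARD('a::finite) - 1"
  assumes J: "J > 0" and gap: "t_gap k J a = 0" and le: "\<And>t. bethe k J t \<le> bethe k J a"
  shows "sharp_state TYPE('a) J a (bethe k J a - real CARD('a) * J * ising_corr J a)"
proof
  let ?r = "real CARD('a)" and ?F = "bethe k J a - real CARD('a) * J * ising_corr J a"
  have r: "?r \<ge> 1" by (simp add: Suc_leI One_nat_def)
  have k: "k > 0" "(k + 1) / 2 = ?r" using r by (simp_all add: k_def)
  \<comment> \<open>Chosen so that \<open>r * ln M\<close> is the maximum of \<open>bethe\<close>;
    the form bounds are then tight at \<open>a\<close>.\<close>
  define M where "M = exp (bethe k J a / ?r)"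
  have M: "M > 0" by (simp add: M_def)
  have lM: "?r * ln M = bethe k J a" using r by (simp add: M_def)
  have bl: "bethe (2 * ?r - 1) J t \<le> (2 * ?r - 1 + 1) / 2 * ln M" for t
    using le[of t] unfolding k_def[symmetric] k(2) lM .
  fix \<epsilon> :: real assume \<epsilon>: "\<epsilon> > 0"
  show "\<forall>\<^sub>F n in sequentially. tuple_avg n (\<lambda>p :: 'a perms. typed_count n (types (ising_edge J a) n) p) \<ge> exp (real n * (?F - \<epsilon>))"
    unfolding k_def by (rule first_moment_ising[OF gap[unfolded k_def] \<epsilon>])
  have e: "2 * ?r * ln M - 2 * ?r * J * ising_corr J a + \<epsilon> = 2 * ?F + \<epsilon>"
    unfolding lM[symmetric] by simp
  show "\<forall>\<^sub>F n in sequentially. tuple_avg n (\<lambda>p :: 'a perms. (typed_count n (types (ising_edge J a) n) p)\<^sup>2) \<le> exp (real n * (2 * ?F + \<epsilon>))"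
    unfolding e[symmetric] by (rule second_moment_form[OF J M bl \<epsilon>])
  define \<delta> where "\<delta> = \<epsilon> / (8 * (?r * J))"
  have c: "?r * J > 0" using r J by simp
  have \<delta>: "\<delta> > 0" using \<epsilon> c unfolding \<delta>_def by (intro divide_pos_pos) auto
  have "\<epsilon> / 2 > 0" using \<epsilon> by simp
  from upper_bound_form[OF J M bl this \<delta>, of a]
  have "\<forall>\<^sub>F n in sequentially. tuple_avg n (\<lambda>p :: 'a perms. real (card {x \<in> confs n. edge_close J a \<delta> n p x})) \<le> exp (real n * (?F + \<epsilon>))"
  proof eventually_elim
    case (elim n)
    have "?r * ln M - ?r * J * (ising_corr J a - 4 * \<delta>) + \<epsilon> / 2 = ?F + \<epsilon>"
    proof -
      have "?r * J * \<delta> = \<epsilon> / 8" using c J by (simp add: \<delta>_def)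
      then show ?thesis unfolding lM by (simp add: right_diff_distrib)
    qed
    then show ?case using elim by simp
  qed
  then show "\<exists>\<delta>>0. \<forall>\<^sub>F n in sequentially. tuple_avg n (\<lambda>p :: 'a perms. real (card {x \<in> confs n. edge_close J a \<delta> n p x})) \<le> exp (real n * (?F + \<epsilon>))"
    using \<delta> by (intro exI[of _ \<delta>] conjI)
qed

text \<open>The lower threshold makes the derivative of \<open>t_gap\<close> at 0 positive, which
  produces the plus state. The upper one is what the second moment at the free state needs.\<close>

lemma interaction_range:
  fixes r :: nat
  assumes r: "r \<ge> 2" and J: "J_uniq r < J" "J < J_rec r"
  defines "k \<equiv> 2 * real r - 1"
  shows "J > 0" "k * tanh J > 1" "k * (tanh J)\<^sup>2 \<le> 1"
proof -
  have k: "k > 1" using r by (simp add: k_def)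
  have u: "1 / k < tanh J"
    by (rule tanh_gt_of_artanh) (use k J(1) in \<open>simp_all add: J_uniq_def k_def divide_simps\<close>)
  then have "0 < tanh J" using k by (meson divide_pos_pos less_trans zero_less_one)
  then show J0: "J > 0" by simp
  show "k * tanh J > 1" using u k by (simp add: divide_less_eq mult.commute)
  have s: "sqrt k > 1" using k by simp
  have "tanh J < 1 / sqrt k"
  proof (rule tanh_lt_of_artanh)
    have "0 < 1 / sqrt k" using s by simp
    then show "-1 < 1 / sqrt k" by linarith
    show "1 / sqrt k < 1" using s by simp
    show "J < artanh (1 / sqrt k)" using J(2) by (simp add: J_rec_def k_def)
  qed
  then have "(tanh J)\<^sup>2 \<le> (1 / sqrt k)\<^sup>2" using \<open>0 < tanh J\<close> by (intro power_mono) auto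
  also have "\<dots> = 1 / k" using k by (simp add: power_divide)
  finally show "k * (tanh J)\<^sup>2 \<le> 1" using k by (simp add: le_divide_eq mult.commute)
qed

lemma t_plus_root:
  fixes r :: nat
  assumes r: "r \<ge> 2" and J: "J > 0" "(2 * real r - 1) * tanh J > 1"
  shows "t_plus r J > 0" "t_gap (2 * real r - 1) J (t_plus r J) = 0"
proof -
  let ?k = "2 * real r - 1"
  have k: "?k > 0" using r by simp
  obtain a where a: "a > 0" "t_gap ?k J a = 0" "\<And>t. 0 < t \<Longrightarrow> t < a \<Longrightarrow> t_gap ?k J t > 0" "\<And>t. t > a \<Longrightarrow> t_gap ?k J t < 0"
    using t_gap_sign[OF k J] by blast
  have root: "t = ?k / 2 * ln (cosh (t + J) / cosh (t - J)) \<longleftrightarrow> t_gap ?k J t = 0" for t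
    unfolding t_gap_def by linarith
  have "t_plus r J = a"
    unfolding t_plus_def root
  proof (rule the_equality)
    show "a > 0 \<and> t_gap ?k J a = 0" using a by simp
    fix t assume t: "t > 0 \<and> t_gap ?k J t = 0"
    then show "t = a" using a(3)[of t] a(4)[of t] by (cases t a rule: linorder_cases) auto
  qed
  then show "t_plus r J > 0" "t_gap ?k J (t_plus r J) = 0" using a by simp_all
qed

theorem theorem1:
  fixes r :: nat and J :: real
  assumes "r \<ge> 2" and "r = CARD('r::finite)"
    and "J_uniq r < J" and "J < J_rec r"
  shows "\<exists>S :: nat \<Rightarrow> ('r fgroup \<Rightarrow> nat \<Rightarrow> nat) set.
    (\<forall>n\<ge>1. S n \<subseteq> hom FG (sym_group n)) \<and>
    (\<lambda>n. measure_pmf.prob (uniform_hom n) (S n)) \<longlonglongrightarrow> 1 \<and>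
    (\<forall>m \<sigma>. filterlim m at_top sequentially \<and> (\<forall>n. m n \<ge> 1 \<and> \<sigma> n \<in> S (m n)) \<longrightarrow>
      (let V = (\<lambda>n. {1..m n});
           \<mu>_FB = free_boundary_state J :: 'r config measure;
           \<mu>_plus = plus_state J :: 'r config measure
       in sofic_approximation V \<sigma> \<and>
          sofic_pressure V \<sigma> J \<mu>_FB = f_pressure J \<mu>_FB \<and>
          f_pressure J \<mu>_FB < f_pressure J \<mu>_plus \<and>
          f_pressure J \<mu>_plus = sofic_pressure V \<sigma> J \<mu>_plus \<and>
          -\<infinity> < sofic_entropy V \<sigma> \<mu>_FB \<and> sofic_entropy V \<sigma> \<mu>_FB < \<infinity> \<and>
          \<not> sofic_equilibrium V \<sigma> J \<mu>_FB))"
proof -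
  define k where "k = 2 * real CARD('r) - 1"
  define a where "a = t_plus CARD('r) J"
  have r: "CARD('r) \<ge> 2" using assms(1,2) by simp
  have k: "k > 0" using r by (simp add: k_def)
  note J = interaction_range[OF assms(1,3,4), unfolded assms(2), folded k_def]
  have a: "a > 0" "t_gap k J a = 0"
    unfolding a_def k_def by (rule t_plus_root[OF r J(1) J(2)[unfolded k_def]])+
  note max = bethe_maximum[OF k J(1,2) a]
  interpret FB: sharp_state J 0 "bethe k J 0 - real CARD('r) * J * ising_corr J 0" "TYPE('r)"
    unfolding k_def by (rule sharp_free[OF J(1) J(3)[unfolded k_def]])
  interpret PL: sharp_state J a "bethe k J a - real CARD('r) * J * ising_corr J a" "TYPE('r)"
    unfolding k_def by (rule sharp_plus[OF J(1) a(2)[unfolded k_def] max(2)[unfolded k_def]])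
  \<comment> \<open>Radius and precision are packed into one index. The requirements for both states
    and for soficity are imposed together, so the same sets serve all claims.\<close>
  define E where "E i n p \<longleftrightarrow> FB.good (fst (prod_decode i)) (snd (prod_decode i)) n p \<and>
      PL.good (fst (prod_decode i)) (snd (prod_decode i)) n p \<and>
      real (card {v \<in> {1..n}. inj_on (\<lambda>w. word_perm p w v) (word_ball (fst (prod_decode i)))}) > real n * (1 - 1 / real (Suc (snd (prod_decode i))))"
    for i n and p :: "'r \<Rightarrow> nat \<Rightarrow> nat"
  have "whp (E i)" for i
    unfolding E_def by (intro whp_conj FB.whp_good PL.whp_good whp_free word_tree_word_ball) simp
  from whp_diagonal[of E, OF this] obtain G where G: "whp G" "\<And>i. \<forall>\<^sub>F n in sequentially. \<forall>p. G n p \<longrightarrow> E i n p" by blast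
  define S where "S n = tuple_hom ` {p \<in> perm_tuples n. G n p}" for n
  have 1: "S n \<subseteq> hom FG (sym_group n)" for n
    unfolding S_def using tuple_hom_in_hom by blast
  have 2: "(\<lambda>n. measure_pmf.prob (uniform_hom n) (S n)) \<longlonglongrightarrow> 1"
  proof -
    have "measure_pmf.prob (uniform_hom n) (S n) = 1 - tuple_frac n (\<lambda>p. \<not> G n p)" for n
      unfolding S_def tuple_frac_not by (subst prob_uniform_hom) (auto simp: tuple_frac_def)
    moreover have "(\<lambda>n. 1 - tuple_frac n (\<lambda>p. \<not> G n p)) \<longlonglongrightarrow> 1 - 0"
      using G(1) unfolding whp_def by (intro tendsto_diff tendsto_const)
    ultimately show ?thesis by simp
  qed
  have 3: "sofic_approximation (\<lambda>n. {1..m n}) \<sigma> \<and>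
      sofic_pressure (\<lambda>n. {1..m n}) \<sigma> J (ising_chain J 0 :: 'r config measure) = f_pressure J (ising_chain J 0 :: 'r config measure) \<and>
      f_pressure J (ising_chain J 0 :: 'r config measure) < f_pressure J (ising_chain J a :: 'r config measure) \<and>
      f_pressure J (ising_chain J a :: 'r config measure) = sofic_pressure (\<lambda>n. {1..m n}) \<sigma> J (ising_chain J a :: 'r config measure) \<and>
      -\<infinity> < sofic_entropy (\<lambda>n. {1..m n}) \<sigma> (ising_chain J 0 :: 'r config measure) \<and>
      sofic_entropy (\<lambda>n. {1..m n}) \<sigma> (ising_chain J 0 :: 'r config measure) < \<infinity> \<and>
      \<not> sofic_equilibrium (\<lambda>n. {1..m n}) \<sigma> J (ising_chain J 0 :: 'r config measure)"
    if m: "filterlim m at_top sequentially" and \<sigma>: "\<And>n. m n \<ge> 1 \<and> \<sigma> n \<in> S (m n)" for m \<sigma>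
  proof -
    have "\<forall>n. \<exists>p. p \<in> perm_tuples (m n) \<and> G (m n) p \<and> \<sigma> n = tuple_hom p" using \<sigma> by (auto simp: S_def)
    then obtain p where p: "\<And>n. p n \<in> perm_tuples (m n)" "\<And>n. G (m n) (p n)" "\<And>n. \<sigma> n = tuple_hom (p n)" by metis
    have \<sigma>_eq: "\<sigma> = (\<lambda>n. tuple_hom (p n))" using p(3) by blast
    have "\<forall>\<^sub>F n in sequentially. E i (m n) (p n)" for i
      using eventually_compose_filterlim[OF G(2) m, of i] by eventually_elim (use p(2) in blast)
    \<comment> \<open>The index decodes to radius \<open>j\<close> and precision
      \<open>l\<close>.\<close>
    then have Ev: "\<forall>\<^sub>F n in sequentially. E (prod_encode (j, l)) (m n) (p n)" for j l .
    have goodFB: "\<forall>\<^sub>F n in sequentially. FB.good j l (m n) (p n)" for j l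
      using Ev[of j l] by eventually_elim (simp add: E_def)
    have goodPL: "\<forall>\<^sub>F n in sequentially. PL.good j l (m n) (p n)" for j l
      using Ev[of j l] by eventually_elim (simp add: E_def)
    have free: "\<forall>\<^sub>F n in sequentially. real (card {v \<in> {1..m n}. inj_on (\<lambda>w. word_perm (p n) w v) (word_ball j)}) > real (m n) * (1 - 1 / real (Suc l))" for j l
      using Ev[of j l] by eventually_elim (simp add: E_def)
    have approx: "sofic_approximation (\<lambda>n. {1..m n}) \<sigma>"
      unfolding sofic_approximation_def
    proof (intro conjI allI impI)
      fix n \<gamma>
      show "\<sigma> n \<gamma> permutes {1..m n}" unfolding \<sigma>_eq tuple_hom_def by (rule word_perm_permutes[OF p(1)])
    next
      show "filterlim (\<lambda>n. card {1..m n}) at_top sequentially" using m by simp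
    next
      fix F :: "'r fgroup set" and \<delta> :: real assume F: "finite F \<and> \<delta> > 0"
      obtain j where j: "Rep_fgroup ` F \<subseteq> word_ball j"
        using word_ball_exhausts[of "Rep_fgroup ` F"] F Rep_fgroup by blast
      obtain l where l: "1 / real (Suc l) < \<delta>" using small_tol F by blast
      show "\<forall>\<^sub>F n in sequentially. sofic_map {1..m n} (\<sigma> n) F \<delta>"
        using free[where j = j and l = l]
      proof eventually_elim
        case (elim n)
        have "real (m n) * (1 - \<delta>) \<le> real (m n) * (1 - 1 / real (Suc l))" using l by (intro mult_left_mono) auto
        then have "real (m n) * (1 - \<delta>) < real (card {v \<in> {1..m n}. inj_on (\<lambda>w. word_perm (p n) w v) (word_ball j)})" using elim by linarith
        then show ?case unfolding \<sigma>_eq using \<sigma>[of n] F by (intro free_sofic_map[OF p(1) _ j]) auto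
      qed
    qed simp
    have eFB: "energy J (ising_chain J 0 :: 'r config measure) = - (real CARD('r) * J * ising_corr J 0)"
      and ePL: "energy J (ising_chain J a :: 'r config measure) = - (real CARD('r) * J * ising_corr J a)"
      unfolding energy_ising_chain by simp_all
    note hFB = FB.sofic_entropy_eq[OF m goodFB, folded \<sigma>_eq] and hPL = PL.sofic_entropy_eq[OF m goodPL, folded \<sigma>_eq]
    have pFB: "sofic_pressure (\<lambda>n. {1..m n}) \<sigma> J (ising_chain J 0 :: 'r config measure) = ereal (bethe k J 0)"
      "f_pressure J (ising_chain J 0 :: 'r config measure) = ereal (bethe k J 0)"
      unfolding sofic_pressure_def f_pressure_def hFB FB.f_entropy_eq eFB by simp_all
    have pPL: "sofic_pressure (\<lambda>n. {1..m n}) \<sigma> J (ising_chain J a :: 'r config measure) = ereal (bethe k J a)"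
      "f_pressure J (ising_chain J a :: 'r config measure) = ereal (bethe k J a)"
      unfolding sofic_pressure_def f_pressure_def hPL PL.f_entropy_eq ePL by simp_all
    \<comment> \<open>The plus state is shift-invariant and has strictly larger sofic
      pressure.\<close>
    have "\<not> sofic_equilibrium (\<lambda>n. {1..m n}) \<sigma> J (ising_chain J 0 :: 'r config measure)"
    proof
      assume "sofic_equilibrium (\<lambda>n. {1..m n}) \<sigma> J (ising_chain J 0 :: 'r config measure)"
      then have "sofic_pressure (\<lambda>n. {1..m n}) \<sigma> J (ising_chain J a :: 'r config measure) \<le> sofic_pressure (\<lambda>n. {1..m n}) \<sigma> J (ising_chain J 0 :: 'r config measure)"
        unfolding sofic_equilibrium_def using ising_chain_borel_prob ising_chain_shift_invariant by blast
      then show False unfolding pFB pPL using max(1) by simp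
    qed
    then show ?thesis using approx max(1) unfolding pFB pPL hFB by simp
  qed
  show ?thesis
    unfolding Let_def free_boundary_state_def plus_state_def a_def[symmetric]
    using 1 2 3 by (intro exI[of _ S] conjI allI impI) auto
qed

end
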